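(* Let $\mathbb G$ be the 5-dimensional Cartan group. For each $h=0,\dots,5$, the Laplace-type operator $\Delta_{A,h}$ acting on the Rumin $h$-forms $E_0^h$, defined by $$\Delta_{A,h}=\begin{cases}(d_c\delta_c)^3+\delta_cd_c & h=0,1,\\ d_c\delta_c+\delta_cA_\Delta d_c & h=2,\\ d_cA_\Delta\delta_c+\delta_cd_c & h=3,\\ d_c\delta_c+(\delta_cd_c)^3 & h=4,5,\end{cases}$$ where $A_\Delta=-(X_1^2+X_2^2)\,I_3$ with $I_3$ the $3\times3$ identity matrix, is hypoelliptic.
   Context: **Cartan group.** $\mathbb G$ is the free Carnot group of step 3 with 2 generators: the connected, simply connected Lie group whose Lie algebra $\mathfrak g$ has basis $X_1,\dots,X_5$ with only nonzero brackets $[X_1,X_2]=X_3$, $[X_1,X_3]=X_4$, $[X_2,X_3]=X_5$. In suitable coordinates $\mathbb G\cong\mathbb R^5$ and the left-invariant vector fields are $X_1=\partial_1$, $X_2=\partial_2+x_1\partial_3+\frac{x_1^2}{2}\partial_4+x_1x_2\partial_5$, $X_3=\partial_3+x_1\partial_4+x_2\partial_5$, $X_4=\partial_4$, $X_5=\partial_5$. Haar measure is Lebesgue measure on $\mathbb R^5$. **Rumin forms.** Let $\theta_1,\dots,\theta_5$ be the left-invariant coframe dual to $X_1,\dots,X_5$; write $\theta_{ij\cdots}=\theta_i\wedge\theta_j\wedge\cdots$. The space $E_0^h$ of Rumin (intrinsic) $h$-forms is the set of smooth-coefficient combinations of the following ordered orthonormal left-invariant basis $\Xi_0^h$: - $\Xi_0^0=\{1\}$;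 $\Xi_0^1=\{\theta_1,\theta_2\}$; - $\Xi_0^2=\{\theta_{14},\tfrac1{\sqrt2}(\theta_{24}+\theta_{15}),\theta_{25}\}$; - $\Xi_0^3=\{\theta_{134},\tfrac1{\sqrt2}(\theta_{135}+\theta_{234}),\theta_{235}\}$; - $\Xi_0^4=\{\theta_{1345},\theta_{2345}\}$; $\Xi_0^5=\{\theta_{12345}\}$. **Rumin differential.** In these bases $d_c:E_0^h\to E_0^{h+1}$ acts on the column vector of coefficients by the following matrices of differential operators (and $d_c=0$ on $E_0^5$). - $h=0$: $\begin{pmatrix}X_1\\ X_2\end{pmatrix}$. - $h=1$: $\begin{pmatrix}-X_1^2X_2-X_1X_3-X_4 & X_1^3\\ -\sqrt2(X_1X_2^2+X_5)&\sqrt2(X_2X_1^2-X_4)\\ -X_2^3& X_2^2X_1-X_2X_3-X_5\end{pmatrix}$. - $h=2$: $\begin{pmatrix}-X_1X_2-X_3&\frac1{\sqrt2}X_1^2&0\\ -\frac1{\sqrt2}X_2^2&-\frac32X_3&\frac1{\sqrt2}X_1^2\\ 0&-\frac1{\sqrt2}X_2^2&X_2X_1-X_3\end{pmatrix}$. - $h=3$: $\begin{pmatrix}(X_1X_2+X_3)X_2-X_5&\sqrt2(-X_1^2X_2+X_4)&X_1^3\\ X_2^3&-\sqrt2(X_2^2X_1+X_5)&X_2X_1^2-X_3X_1+X_4\end{pmatrix}$. - $h=4$: $\begin{pmatrix}-X_2&X_1\end{pmatrix}$. The codifferential $\delta_c:E_0^{h}\to E_0^{h-1}$ is the formal $L^2$-adjoint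 of $d_c:E_0^{h-1}\to E_0^{h}$ with respect to these orthonormal bases (so one transposes the matrix and takes formal adjoints of the entries, with $X_i^*=-X_i$), and $\delta_c=0$ on $E_0^0$. **Conventions.** In $\Delta_{A,2}$ the matrix $A_\Delta$ acts on the three components of an element of $E_0^3$; in $\Delta_{A,3}$ it acts on the three components of an element of $E_0^2$. Using the bases $\Xi_0^h$, $\Delta_{A,h}$ is a matrix-valued left-invariant differential operator acting on vector-valued distributions $\mathcal D'(\mathbb G,\mathbb R^{N_h})$, $N_h=\dim E_0^h$ (the rank, i.e. the number of elements of $\Xi_0^h$). Hypoelliptic means: for every open set $\Omega\subset\mathbb G$ and every vector-valued distribution $u$ on $\Omega$, if $\Delta_{A,h}u$ is smooth on $\Omega$, then $u$ is smooth on $\Omega$. *)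

theory Defs
  imports "HOL-Analysis.Analysis"
begin

section \<open>Smooth functions and distributions\<close>

primrec iter_deriv :: "'a list \<Rightarrow> ('a::euclidean_space \<Rightarrow> real) \<Rightarrow> 'a \<Rightarrow> real" where
  "iter_deriv [] f = f"
| "iter_deriv (v # vs) f = (\<lambda>x. frechet_derivative (iter_deriv vs f) (at x) v)"

text \<open>Meant for open \<open>S\<close>: differentiability of all iterated partial derivatives at the points
  of \<open>S\<close> makes them continuous as well, so this is the class of C-infinity functions on \<open>S\<close>.\<close>

definition smooth_on :: "'a::euclidean_space set \<Rightarrow> ('a \<Rightarrow> real) \<Rightarrow> bool" where
  "smooth_on S f \<longleftrightarrow> (\<forall>vs\<in>lists Basis. \<forall>x\<in>S. iter_deriv vs f differentiable (at x))"

definition supp :: "('a::topological_space \<Rightarrow> real) \<Rightarrow> 'a set" where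
  "supp \<phi> = closure {x. \<phi> x \<noteq> 0}"

definition test_functions :: "'a::euclidean_space set \<Rightarrow> ('a \<Rightarrow> real) set" where
  "test_functions \<Omega> = {\<phi>. smooth_on UNIV \<phi> \<and> compact (supp \<phi>) \<and> supp \<phi> \<subseteq> \<Omega>}"

definition C_norm :: "nat \<Rightarrow> ('a::euclidean_space \<Rightarrow> real) \<Rightarrow> real" where
  "C_norm N \<phi> = (\<Sum>vs | vs \<in> lists Basis \<and> length vs \<le> N. SUP x. \<bar>iter_deriv vs \<phi> x\<bar>)"

text \<open>Distributions are functionals whose values are relevant on test functions only; outside
  \<^term>\<open>test_functions \<Omega>\<close> they are arbitrary.\<close>

type_synonym 'a functional = "('a \<Rightarrow> real) \<Rightarrow> real"

definition distribution_on :: "'a::euclidean_space set \<Rightarrow> 'a functional \<Rightarrow> bool" where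
  "distribution_on \<Omega> T \<longleftrightarrow>
     (\<forall>\<phi>\<in>test_functions \<Omega>. \<forall>\<psi>\<in>test_functions \<Omega>. T (\<lambda>x. \<phi> x + \<psi> x) = T \<phi> + T \<psi>) \<and>
     (\<forall>\<phi>\<in>test_functions \<Omega>. \<forall>c. T (\<lambda>x. c * \<phi> x) = c * T \<phi>) \<and>
     (\<forall>K. compact K \<and> K \<subseteq> \<Omega> \<longrightarrow>
        (\<exists>C N. \<forall>\<phi>\<in>test_functions \<Omega>. supp \<phi> \<subseteq> K \<longrightarrow> \<bar>T \<phi>\<bar> \<le> C * C_norm N \<phi>))"

definition smooth_distribution_on :: "'a::euclidean_space set \<Rightarrow> 'a functional \<Rightarrow> bool" where
  "smooth_distribution_on \<Omega> T \<longleftrightarrow>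
     (\<exists>f. smooth_on \<Omega> f \<and> (\<forall>\<phi>\<in>test_functions \<Omega>. T \<phi> = (LINT x:\<Omega>|lborel. f x * \<phi> x)))"

text \<open>A vector-valued distribution of rank \<open>N\<close> is a sequence of functionals of which only the
  components below \<open>N\<close> matter.\<close>

type_synonym 'a vec_functional = "nat \<Rightarrow> 'a functional"

definition hypoelliptic ::
    "nat \<Rightarrow> ('a::euclidean_space vec_functional \<Rightarrow> 'a vec_functional) \<Rightarrow> bool" where
  "hypoelliptic N P \<longleftrightarrow>
     (\<forall>\<Omega> u. open \<Omega> \<and> (\<forall>j<N. distribution_on \<Omega> (u j)) \<and>
        (\<forall>i<N. smooth_distribution_on \<Omega> (P u i)) \<longrightarrow>
        (\<forall>j<N. smooth_distribution_on \<Omega> (u j)))"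


section \<open>Left-invariant differential operators on the Cartan group\<close>

text \<open>In the type \<^typ>\<open>5\<close> the numeral 5 denotes 0; the five indices 1, ..., 5 are still distinct.\<close>

definition vfield :: "5 \<Rightarrow> real^5 \<Rightarrow> real^5" where
  "vfield i x =
    (if i = 1 then axis 1 1
     else if i = 2 then
       axis 2 1 + x $ 1 *\<^sub>R axis 3 1 + ((x $ 1)\<^sup>2 / 2) *\<^sub>R axis 4 1 + (x $ 1 * x $ 2) *\<^sub>R axis 5 1
     else if i = 3 then axis 3 1 + x $ 1 *\<^sub>R axis 4 1 + x $ 2 *\<^sub>R axis 5 1
     else if i = 4 then axis 4 1
     else axis 5 1)"

text \<open>Noncommutative polynomial expressions in the vector fields. The arithmetic operations below
  are purely notational (the type satisfies no ring laws); the meaning is given by \<open>apply_op\<close>.\<close>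

datatype diffop =
  X 5 | Null | Ident | Add diffop diffop | Neg diffop | Comp diffop diffop | Scale real diffop

instantiation diffop :: "{zero, one, plus, uminus, minus, times}"
begin
definition "0 = Null"
definition "1 = Ident"
definition "P + Q = Add P Q"
definition "- P = Neg P"
definition "P - Q = Add P (Neg Q)"
definition "P * Q = Comp P Q"
instance ..
end

instance diffop :: power ..

primrec apply_op :: "diffop \<Rightarrow> (real^5 \<Rightarrow> real) \<Rightarrow> real^5 \<Rightarrow> real" where
  "apply_op (X i) f = (\<lambda>x. frechet_derivative f (at x) (vfield i x))"
| "apply_op Null f = (\<lambda>x. 0)"
| "apply_op Ident f = f"
| "apply_op (Add P Q) f = (\<lambda>x. apply_op P f x + apply_op Q f x)"
| "apply_op (Neg P) f = (\<lambda>x. - apply_op P f x)"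
| "apply_op (Comp P Q) f = apply_op P (apply_op Q f)"
| "apply_op (Scale c P) f = (\<lambda>x. c * apply_op P f x)"

text \<open>Formal adjoint with respect to Lebesgue (= Haar) measure; the vector fields are
  divergence free, hence skew-adjoint.\<close>

primrec adj :: "diffop \<Rightarrow> diffop" where
  "adj (X i) = Neg (X i)"
| "adj Null = Null"
| "adj Ident = Ident"
| "adj (Add P Q) = Add (adj P) (adj Q)"
| "adj (Neg P) = Neg (adj P)"
| "adj (Comp P Q) = Comp (adj Q) (adj P)"
| "adj (Scale c P) = Scale c (adj P)"

definition apply_distr :: "diffop \<Rightarrow> (real^5) functional \<Rightarrow> (real^5) functional" where
  "apply_distr P T = (\<lambda>\<phi>. T (apply_op (adj P) \<phi>))"

text \<open>Matrices of operators are lists of rows.\<close>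

definition apply_matrix ::
    "diffop list list \<Rightarrow> (real^5) vec_functional \<Rightarrow> (real^5) vec_functional" where
  "apply_matrix M u = (\<lambda>i \<phi>. if i < length M
     then \<Sum>j<length (M ! i). apply_distr (M ! i ! j) (u j) \<phi> else 0)"


section \<open>The Rumin complex\<close>

text \<open>Left-invariant forms are given by their coefficients with respect to the forms
  \<open>\<theta>\<^sub>I\<close>, where \<open>I\<close> is an increasing list of indices from 1 to 5.\<close>

definition theta :: "nat list \<Rightarrow> nat list \<Rightarrow> real" where
  "theta I = (\<lambda>J. if J = I then 1 else 0)"

definition rumin_basis :: "nat \<Rightarrow> (nat list \<Rightarrow> real) list" where
  "rumin_basis h =
    (if h = 0 then [theta []]
     else if h = 1 then [theta [1], theta [2]]
     else if h = 2 then
       [theta [1,4], \<lambda>J. 1 / sqrt 2 * (theta [2,4] J + theta [1,5] J), theta [2,5]]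
     else if h = 3 then
       [theta [1,3,4], \<lambda>J. 1 / sqrt 2 * (theta [1,3,5] J + theta [2,3,4] J), theta [2,3,5]]
     else if h = 4 then [theta [1,3,4,5], theta [2,3,4,5]]
     else if h = 5 then [theta [1,2,3,4,5]]
     else [])"

definition rumin_rank :: "nat \<Rightarrow> nat" where
  "rumin_rank h = length (rumin_basis h)"

text \<open>From here on a Rumin form of degree \<open>h\<close> is the vector of its coefficients with respect to
  \<^term>\<open>rumin_basis h\<close>.\<close>

definition dc_matrix :: "nat \<Rightarrow> diffop list list" where
  "dc_matrix h =
    (if h = 0 then
       [[X 1],
        [X 2]]
     else if h = 1 then
       [[- ((X 1)^2 * X 2) - X 1 * X 3 - X 4, (X 1)^3],
        [- Scale (sqrt 2) (X 1 * (X 2)^2 + X 5), Scale (sqrt 2) (X 2 * (X 1)^2 - X 4)],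
        [- ((X 2)^3), (X 2)^2 * X 1 - X 2 * X 3 - X 5]]
     else if h = 2 then
       [[- (X 1 * X 2) - X 3, Scale (1 / sqrt 2) ((X 1)^2), 0],
        [- Scale (1 / sqrt 2) ((X 2)^2), - Scale (3 / 2) (X 3), Scale (1 / sqrt 2) ((X 1)^2)],
        [0, - Scale (1 / sqrt 2) ((X 2)^2), X 2 * X 1 - X 3]]
     else if h = 3 then
       [[(X 1 * X 2 + X 3) * X 2 - X 5, Scale (sqrt 2) (- ((X 1)^2 * X 2) + X 4), (X 1)^3],
        [(X 2)^3, - Scale (sqrt 2) ((X 2)^2 * X 1 + X 5), X 2 * (X 1)^2 - X 3 * X 1 + X 4]]
     else if h = 4 then
       [[- X 2, X 1]]
     else [])"

definition deltac_matrix :: "nat \<Rightarrow> diffop list list" where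
  "deltac_matrix h = (if h = 0 then [] else map (map adj) (List.transpose (dc_matrix (h - 1))))"

text \<open>\<open>d\<^sub>c\<close> and \<open>\<delta>\<^sub>c\<close> on forms of degree \<open>h\<close>; the empty matrix acts as the zero operator.\<close>

definition dc :: "nat \<Rightarrow> (real^5) vec_functional \<Rightarrow> (real^5) vec_functional" where
  "dc h = apply_matrix (dc_matrix h)"

definition deltac :: "nat \<Rightarrow> (real^5) vec_functional \<Rightarrow> (real^5) vec_functional" where
  "deltac h = apply_matrix (deltac_matrix h)"

definition A_Delta :: "(real^5) vec_functional \<Rightarrow> (real^5) vec_functional" where
  "A_Delta = (let L = - ((X 1)^2 + (X 2)^2)
     in apply_matrix [[L, 0, 0], [0, L, 0], [0, 0, L]])"

text \<open>For \<open>h = 0\<close> the truncated degree \<open>h - 1\<close> is harmless, as \<^term>\<open>deltac 0\<close> is zero.\<close>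

definition rumin_laplacian :: "nat \<Rightarrow> (real^5) vec_functional \<Rightarrow> (real^5) vec_functional" where
  "rumin_laplacian h u = (\<lambda>i \<phi>.
     if h = 0 \<or> h = 1 then
       ((dc (h - 1) \<circ> deltac h) ^^ 3) u i \<phi> + (deltac (h + 1) \<circ> dc h) u i \<phi>
     else if h = 2 then
       (dc (h - 1) \<circ> deltac h) u i \<phi> + (deltac (h + 1) \<circ> A_Delta \<circ> dc h) u i \<phi>
     else if h = 3 then
       (dc (h - 1) \<circ> A_Delta \<circ> deltac h) u i \<phi> + (deltac (h + 1) \<circ> dc h) u i \<phi>
     else
       (dc (h - 1) \<circ> deltac h) u i \<phi> + ((deltac (h + 1) \<circ> dc h) ^^ 3) u i \<phi>)"

end

theory Submission
 imports Defs
begin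

text \<open>Each Laplacian reduces, by \<open>d\<^sub>c\<^sup>2 = 0\<close>, to the system formed by \<open>\<delta>\<^sub>c\<close> and \<open>d\<^sub>c\<close> (in degree 3 by \<open>A \<delta>\<^sub>c\<close>
  and \<open>d\<^sub>c\<close>), applied successively to the powers of the two summands; degrees 3, 4, 5 follow from 2, 1, 0 by
  Hodge duality. For such a system the fields \<open>X\<^sub>4\<close>, \<open>X\<^sub>5\<close>, \<open>X\<^sub>3\<^sup>2\<close>, \<open>X\<^sub>1\<^sup>3\<close>, \<open>X\<^sub>2\<^sup>3\<close> are, each modulo the ideal
  of the earlier ones, of the form \<open>d K + L d\<close> with explicit matrices \<open>K\<close>, \<open>L\<close>. Pairing these identities with the
  form itself gives the maximal estimate in \<open>L\<^sup>2\<close>, without any representation theory.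

  The right-invariant fields commute with the system, so the localized estimate can be iterated in these directions, and
  by a Sobolev inequality it bounds right-invariant derivatives in the supremum norm. A distribution \<open>T\<close> solving
  the system with smooth right-hand side is mollified by group convolution at scale \<open>s\<^sup>2\<close>. The mollification \<open>T\<^sub>s\<close>
  is at first only bounded by a power of \<open>1 / s\<close>; as \<open>\<partial>T\<^sub>s / \<partial>s\<close> is \<open>s\<close> times a combination of right-invariant
  derivatives of such mollifications, the estimates improve the exponent step by step, until all right-invariant
  derivatives of \<open>T\<^sub>s\<close> are Lipschitz in \<open>s\<close>. Hence \<open>T\<^sub>s\<close> converges to a smooth function as \<open>s \<rightarrow> 0\<close>.\<close>

section \<open>Calculus of smooth functions\<close>

text \<open>The maximal estimate is an absorption argument. A quantity is \<open>small\<close> if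
  for every e > 0 it is at most e times the full norm of order k plus a constant times the rows;
  once all squares of derivatives of order k are small, e = 1/2 finishes. Noncommutativity is met by
  adjoining the fields one at a time: when the degree 2k part of an ideal is negligible in pairings,
  computations may go on modulo that ideal. The order 4, 5, 3, 1, 2 follows the brackets: central
  fields first, then X3, whose brackets with X1 and X2 are central, and then X1 and X2, which
  commute modulo X3. The order k is 6, or 7 in degree 3, because 6 is divisible by the weights 1, 2,
  3 of the fields, so that each field has a pure power of degree 6. The operator A stands between
  codifferential and differential in degrees 2 and 3, which makes the degree 3 system one for the
  weighted codifferential. Being a sum of products X* X, the weight survives the pairing as a sum of
  squares, at the price of one more derivative.\<close>

notation scaleR (infixr "*R" 75)

abbreviation fder :: "('a::real_normed_vector => 'b::real_normed_vector) => 'a => 'a => 'b" where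
 "fder f x \<equiv> frechet_derivative f (at x)"

abbreviation smooth :: "('a::euclidean_space => real) => bool" where
 "smooth \<equiv> smooth_on UNIV"

text \<open>\<open>iter_deriv\<close> applies the head of the list last, so induction on the list
  leaves the function fixed. Splitting off the innermost derivative instead makes sums, products and
  composites accessible to an induction with the function arbitrary.\<close>

primrec diffn :: "nat => 'a::euclidean_space set => ('a => real) => bool" where
 "diffn 0 S f \<longleftrightarrow> (ALL x:S. f differentiable at x)"
| "diffn (Suc n) S f \<longleftrightarrow> (ALL x:S. f differentiable at x) &
  (ALL b:Basis. diffn n S (%x. fder f x b))"

lemma iter_deriv_snoc: "iter_deriv (vs @ [b]) f = iter_deriv vs (%x. fder f x b)"
 by (induction vs) auto

lemma diffn_iff: "diffn n S f \<longleftrightarrow> (ALL vs:lists Basis. length vs <= n --> (ALL x:S. iter_deriv vs f differentiable at x))"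
proof (induction n arbitrary: f)
 case 0
 then show ?case by auto
next
 case (Suc n)
 show ?case
 proof
  assume L: "diffn (Suc n) S f"
  show "ALL vs:lists Basis. length vs <= Suc n --> (ALL x:S. iter_deriv vs f differentiable at x)"
  proof (intro ballI impI)
   fix vs x assume vs: "vs : lists (Basis::'a set)" "length vs <= Suc n" and x: "x : S"
   show "iter_deriv vs f differentiable at x"
   proof (cases vs rule: rev_cases)
    case Nil
    then show ?thesis using L x by simp
   next
    case (snoc ws b)
    then show ?thesis using L x vs Suc[of "%x. fder f x b"]
     by (simp add: iter_deriv_snoc)
   qed
  qed
 next
  assume R: "ALL vs:lists Basis. length vs <= Suc n --> (ALL x:S. iter_deriv vs f differentiable at x)"
  have "f differentiable at x" if "x : S" for x
   using R[rule_format, of "[]"] that by simp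
  moreover have "diffn n S (%x. fder f x b)" if b: "b : Basis" for b
   unfolding Suc
  proof (intro ballI impI)
   fix vs x assume "vs : lists (Basis::'a set)" "length vs <= n" "x : S"
   then show "iter_deriv vs (%x. fder f x b) differentiable at x"
    using R[rule_format, of "vs @ [b]" x] b by (simp add: iter_deriv_snoc)
  qed
  ultimately show "diffn (Suc n) S f" by simp
 qed
qed

lemma smooth_on_iff_diffn: "smooth_on S f \<longleftrightarrow> (ALL n. diffn n S f)"
 unfolding smooth_on_def diffn_iff by blast

lemma diffn_imp_differentiable: "diffn n S f ==> x : S ==> f differentiable at x"
 by (cases n) auto

lemma diffn_SucD: "diffn (Suc n) S f ==> diffn n S f"
 unfolding diffn_iff by auto

lemma fder_cong:
 assumes "open S" "x : S" "!!y. y : S ==> f y = g y"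
 shows "fder f x = fder g x"
proof -
 have "(f has_derivative f') (at x) \<longleftrightarrow> (g has_derivative f') (at x)" for f'
  using assms has_derivative_transform_within_open[of f f' x UNIV S g]
   has_derivative_transform_within_open[of g f' x UNIV S f] by auto
 then show ?thesis unfolding frechet_derivative_def by simp
qed

lemma differentiable_cong:
 assumes "open S" "x : S" "!!y. y : S ==> f y = g y" "f differentiable at x"
 shows "g differentiable at x"
 using assms has_derivative_transform_within_open[of f _ x UNIV S g]
 unfolding differentiable_def by metis

lemma diffn_cong:
 assumes "open S" "!!y. y : S ==> f y = g y" "diffn n S f"
 shows "diffn n S g"
 using assms
proof (induction n arbitrary: f g)
 case 0
 then show ?case using differentiable_cong[of S _ f g] by auto
next
 case (Suc n)
 have "diffn n S (%x. fder g x b)" if "b : Basis" for b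
 proof (rule Suc.IH[OF Suc.prems(1), of "%x. fder f x b"])
  show "fder f y b = fder g y b" if "y : S" for y
   using fder_cong[OF Suc.prems(1) that, of f g] Suc.prems(2) by simp
  show "diffn n S (%x. fder f x b)"
   using Suc.prems(3) that by simp
 qed
 moreover have "g differentiable at x" if "x : S" for x
  using differentiable_cong[OF Suc.prems(1) that, of f g] Suc.prems(2,3) that by simp
 ultimately show ?case by simp
qed

lemma smooth_on_cong:
 assumes "open S" "!!y. y : S ==> f y = g y" "smooth_on S f"
 shows "smooth_on S g"
 using assms diffn_cong unfolding smooth_on_iff_diffn by metis

lemma smooth_on_subset: "smooth_on S f ==> T <= S ==> smooth_on T f"
 unfolding smooth_on_def by blast

lemma smooth_on_Un: "smooth_on S f ==> smooth_on T f ==> smooth_on (S \<union> T) f"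
 unfolding smooth_on_def by blast

lemma diffn_const: "diffn n S (%x. c)"
 by (induction n arbitrary: c) (auto simp: frechet_derivative_const)

lemma smooth_zero_extension:
 assumes "open U" "smooth_on U f" "closed K" "K <= U" "!!x. x ~: K ==> f x = 0"
 shows "smooth f"
proof -
 have "smooth_on (- K) f"
  by (rule smooth_on_cong[of _ "%_. 0"]) (use assms in "auto simp: smooth_on_iff_diffn diffn_const")
 moreover have "UNIV = U \<union> - K" using assms(4) by auto
 ultimately show ?thesis using assms(2) smooth_on_Un by metis
qed

lemma smooth_on_Union: "(!!x. x : S ==> EX T. x : T & smooth_on T f) ==> smooth_on S f"
 unfolding smooth_on_def by blast

lemma smooth_on_differentiable: "smooth_on S f ==> x : S ==> f differentiable at x"
 unfolding smooth_on_iff_diffn using diffn_imp_differentiable by blast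

lemma smooth_on_has_derivative:
 "smooth_on S f ==> x : S ==> (f has_derivative fder f x) (at x)"
 using smooth_on_differentiable frechet_derivative_works by blast

lemma smooth_on_isCont: "smooth_on S f ==> x : S ==> isCont f x"
 using smooth_on_differentiable differentiable_imp_continuous_within by blast

lemma smooth_on_continuous_on: "smooth_on S f ==> continuous_on S f"
 using smooth_on_isCont continuous_at_imp_continuous_on by blast

lemma smooth_on_deriv_Basis: "smooth_on S f ==> b : Basis ==> smooth_on S (%x. fder f x b)"
 unfolding smooth_on_iff_diffn by (metis diffn.simps(2))

lemma smooth_on_const [simp, intro]: "smooth_on S (%x. c)"
 unfolding smooth_on_iff_diffn using diffn_const by blast

lemma fder_eqI: "(f has_derivative f') (at x) ==> fder f x = f'"
 using frechet_derivative_at by metis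

lemma diffn_add:
 assumes "open S" "diffn n S f" "diffn n S g"
 shows "diffn n S (%x. f x + g x)"
 using assms(2,3)
proof (induction n arbitrary: f g)
 case 0
 then show ?case by auto
next
 case (Suc n)
 have "diffn n S (%x. fder (%x. f x + g x) x b)" if b: "b : Basis" for b
 proof (rule diffn_cong[OF assms(1)])
  show "diffn n S (%x. fder f x b + fder g x b)"
   using Suc b by auto
  fix y assume "y : S"
  then have "(f has_derivative fder f y) (at y)"
   "(g has_derivative fder g y) (at y)"
   using Suc.prems by (auto simp: frechet_derivative_works)
  from has_derivative_add[OF this]
  show "fder f y b + fder g y b =
    fder (%x. f x + g x) y b"
   by (simp add: fder_eqI)
 qed
 then show ?case using Suc.prems by auto
qed

lemma diffn_mult:
 assumes "open S" "diffn n S f" "diffn n S g"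
 shows "diffn n S (%x. f x * g x)"
 using assms(2,3)
proof (induction n arbitrary: f g)
 case 0
 then show ?case by auto
next
 case (Suc n)
 have "diffn n S (%x. fder (%x. f x * g x) x b)" if b: "b : Basis" for b
 proof (rule diffn_cong[OF assms(1)])
  show "diffn n S (%x. f x * fder g x b + fder f x b * g x)"
   using Suc.prems b diffn_SucD[OF Suc.prems(1)] diffn_SucD[OF Suc.prems(2)]
   by (intro diffn_add assms(1) Suc.IH) auto
  fix y assume "y : S"
  then have "(f has_derivative fder f y) (at y)"
   "(g has_derivative fder g y) (at y)"
   using Suc.prems by (auto simp: frechet_derivative_works)
  from has_derivative_mult[OF this]
  show "f y * fder g y b + fder f y b * g y =
    fder (%x. f x * g x) y b"
   by (simp add: fder_eqI)
 qed
 then show ?case using Suc.prems by auto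
qed

lemma diffn_sum:
 assumes "open S" "!!i. i : I ==> diffn n S (f i)"
 shows "diffn n S (%x. SUM i:I. f i x)"
 using assms(2) by (induction I rule: infinite_finite_induct) (auto intro: diffn_const diffn_add assms(1))

lemma smooth_on_add: "open S ==> smooth_on S f ==> smooth_on S g ==> smooth_on S (%x. f x + g x)"
 unfolding smooth_on_iff_diffn using diffn_add by blast

lemma smooth_on_mult: "open S ==> smooth_on S f ==> smooth_on S g ==> smooth_on S (%x. f x * g x)"
 unfolding smooth_on_iff_diffn using diffn_mult by blast

lemma smooth_on_cmult: "open S ==> smooth_on S f ==> smooth_on S (%x. c * f x)"
 by (intro smooth_on_mult smooth_on_const)

lemma smooth_on_minus: "open S ==> smooth_on S f ==> smooth_on S (%x. - f x)"
 using smooth_on_cmult[of S f "-1"] by simp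

lemma smooth_on_diff: "open S ==> smooth_on S f ==> smooth_on S g ==> smooth_on S (%x. f x - g x)"
 using smooth_on_add[of S f "%x. - g x"] smooth_on_minus[of S g] by simp

lemma smooth_on_sum: "open S ==> (!!i. i : I ==> smooth_on S (f i)) ==> smooth_on S (%x. SUM i:I. f i x)"
 unfolding smooth_on_iff_diffn by (intro allI diffn_sum) auto

lemma smooth_on_prod: "open S ==> (!!i. i : I ==> smooth_on S (f i)) ==> smooth_on S (%x. \<Prod>i\<in>I. f i x)"
 by (induction I rule: infinite_finite_induct) (auto intro: smooth_on_mult)

lemma smooth_on_power: "open S ==> smooth_on S f ==> smooth_on S (%x. f x ^ n)"
 by (induction n) (auto intro: smooth_on_mult)

lemma smooth_on_bounded_linear:
 assumes "bounded_linear f" shows "smooth_on S f"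
proof -
 have d: "(f has_derivative f) (at x)" for x
  using assms bounded_linear_imp_has_derivative by blast
 then have "fder f x = f" for x
  using fder_eqI by metis
 then have "diffn n S f" for n
  by (cases n) (use d in "auto simp: differentiable_def intro: diffn_const")
 then show ?thesis by (simp add: smooth_on_iff_diffn)
qed

lemma fder_Basis:
 assumes "f differentiable at x"
 shows "fder f x v = (SUM b:Basis. (v \<bullet> b) * fder f x b)"
proof -
 have l: "linear (fder f x)"
  using assms by (simp add: linear_frechet_derivative)
 have "fder f x (SUM b:Basis. (v \<bullet> b) *R b) = (SUM b:Basis. (v \<bullet> b) *R fder f x b)"
  using l by (simp add: linear_sum linear_scale)
 then show ?thesis by (simp add: euclidean_representation)
qed

lemma smooth_on_deriv:
 assumes "open S" "smooth_on S f"
 shows "smooth_on S (%x. fder f x v)"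
proof (rule smooth_on_cong[OF assms(1)])
 show "smooth_on S (%x. SUM b:Basis. (v \<bullet> b) * fder f x b)"
  using assms by (intro smooth_on_sum smooth_on_cmult smooth_on_deriv_Basis) auto
qed (simp add: fder_Basis[OF smooth_on_differentiable[OF assms(2)], of _ v])

lemma smooth_on_deriv_field:
 assumes "open S" "smooth_on S f" "!!b. b : Basis ==> smooth_on S (%x. v x \<bullet> b)"
 shows "smooth_on S (%x. fder f x (v x))"
proof (rule smooth_on_cong[OF assms(1)])
 show "smooth_on S (%x. SUM b:Basis. (v x \<bullet> b) * fder f x b)"
  using assms by (intro smooth_on_sum smooth_on_mult smooth_on_deriv_Basis) auto
 show "(SUM b:Basis. (v y \<bullet> b) * fder f y b) = fder f y (v y)"
  if "y : S" for y
  by (rule fder_Basis[OF smooth_on_differentiable[OF assms(2) that], symmetric])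
qed

text \<open>The chain rule writes a partial derivative of the composite through composites of
  derivatives of \<open>g\<close> with the same \<open>m\<close>, so the induction runs over
  \<open>g\<close>.\<close>

lemma diffn_compose:
 fixes m :: "'a::euclidean_space => 'b::euclidean_space"
 assumes "open S" "open T" "m ` S <= T" "!!c. c : Basis ==> smooth_on S (%x. m x \<bullet> c)"
  and "smooth_on T g"
 shows "diffn n S (%x. g (m x)) & (ALL x:S. m differentiable at x &
  ((%x. g (m x)) has_derivative (%v. fder g (m x) (fder m x v))) (at x))"
proof -
 have m: "(m has_derivative fder m x) (at x)" if "x : S" for x
 proof -
  have "m differentiable at x"
   using assms(4) that smooth_on_differentiable
   by (subst differentiable_componentwise_within) blast
  then show ?thesis by (simp add: frechet_derivative_works)
 qed
 have comp: "((%x. g (m x)) has_derivative (%v. fder g (m x) (fder m x v))) (at x)"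
  if "x : S" "smooth_on T g" for x g
  using diff_chain_at[OF m[OF that(1)], of g "fder g (m x)"] that assms(3)
   smooth_on_has_derivative by (fastforce simp: o_def)
 have mc: "fder m x b \<bullet> c = fder (%x. m x \<bullet> c) x b" if "x : S" for x b c
  using fder_eqI[OF has_derivative_inner_left[OF m[OF that]], of c] by simp
 have "diffn n S (%x. g (m x))"
  using assms(5)
 proof (induction n arbitrary: g)
  case 0
  then show ?case using comp by (auto simp: differentiable_def)
 next
  case (Suc n)
  have "diffn n S (%x. fder (%x. g (m x)) x b)" if b: "b : Basis" for b
  proof (rule diffn_cong[OF assms(1)])
   show "diffn n S (%x. SUM c:Basis. fder (%x. m x \<bullet> c) x b * fder g (m x) c)"
    using Suc.IH[OF smooth_on_deriv_Basis[OF Suc.prems]] smooth_on_deriv_Basis[OF assms(4) b]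
    by (intro diffn_sum diffn_mult assms(1)) (auto simp: smooth_on_iff_diffn)
   fix y assume y: "y : S"
   then have "m y : T" using assms(3) by auto
   then show "(SUM c:Basis. fder (%x. m x \<bullet> c) y b * fder g (m y) c) =
    fder (%x. g (m x)) y b"
    using Suc.prems y by (subst fder_eqI[OF comp])
    (auto simp: mc fder_Basis[of g "m y" "fder m y b"] smooth_on_differentiable)
  qed
  then show ?case using comp Suc.prems by (auto simp: differentiable_def)
 qed
 then show ?thesis using comp assms(5) m by (auto simp: differentiable_def)
qed

lemma smooth_on_compose:
 fixes m :: "'a::euclidean_space => 'b::euclidean_space"
 assumes "open S" "open T" "m ` S <= T" "!!c. c : Basis ==> smooth_on S (%x. m x \<bullet> c)"
  and "smooth_on T g"
 shows "smooth_on S (%x. g (m x))"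
 using diffn_compose[OF assms] by (auto simp: smooth_on_iff_diffn)

lemma smooth_on_inverse:
 assumes "open S" "smooth_on S f" "!!x. x : S ==> f x ~= 0"
 shows "smooth_on S (%x. inverse (f x))"
proof -
 have d: "((%x. inverse (f x)) has_derivative (%h. - (inverse (f x) * fder f x h * inverse (f x)))) (at x)"
  if "x : S" for x
  using Deriv.has_derivative_inverse[OF assms(3)[OF that] smooth_on_has_derivative[OF assms(2) that]] .
 have "diffn n S (%x. inverse (f x))" for n
 proof (induction n)
  case 0
  then show ?case using d by (auto simp: differentiable_def)
 next
  case (Suc n)
  have "diffn n S (%x. fder (%x. inverse (f x)) x b)" if "b : Basis" for b
  proof (rule diffn_cong[OF assms(1)])
   show "diffn n S (%x. (-1) * (inverse (f x) * fder f x b * inverse (f x)))"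
    using assms(1) smooth_on_deriv_Basis[OF assms(2) that]
    by (intro diffn_mult Suc diffn_const) (auto simp: smooth_on_iff_diffn)
  qed (use fder_eqI[OF d] in auto)
  then show ?case using d by (auto simp: differentiable_def)
 qed
 then show ?thesis by (simp add: smooth_on_iff_diffn)
qed

lemma smooth_on_inner [intro]: "smooth_on S (%x. x \<bullet> b)"
 by (rule smooth_on_bounded_linear) (rule bounded_linear_inner_left)

lemma continuous_on_deriv:
 "open S ==> smooth_on S f ==> continuous_on S (%x. fder f x v)"
 using smooth_on_continuous_on smooth_on_deriv by blast

lemmas smooth_add = smooth_on_add[OF open_UNIV]
 and smooth_mult = smooth_on_mult[OF open_UNIV]
 and smooth_cmult = smooth_on_cmult[OF open_UNIV]
 and smooth_diff = smooth_on_diff[OF open_UNIV]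
 and smooth_sum = smooth_on_sum[OF open_UNIV]
 and smooth_power = smooth_on_power[OF open_UNIV]
 and smooth_deriv = smooth_on_deriv[OF open_UNIV]
 and smooth_minus = smooth_on_minus[OF open_UNIV]

lemma has_real_derivative_line:
 fixes f :: "'a::euclidean_space => real"
 assumes "smooth_on S f" "p + t *R w : S"
 shows "((%t. f (p + t *R w)) has_real_derivative fder f (p + t *R w) w) (at t)"
proof -
 note d = smooth_on_has_derivative[OF assms]
 have "((%t. p + t *R w) has_derivative (%h. h *R w)) (at t)"
  by (auto intro!: derivative_eq_intros)
 from has_derivative_compose[OF this d] show ?thesis
  by (simp add: has_field_derivative_def linear_scale[OF has_derivative_linear[OF d]] mult.commute[of _ "fder f _ w"])
qed

text \<open>Schwarz's theorem. The second difference \<open>Q h\<close> is symmetric in the two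
  directions; the mean value theorem, applied twice in either order, identifies the limit of
  \<open>Q h / (h * h)\<close> with either mixed derivative.\<close>

lemma partial_derivatives_commute:
 fixes f :: "'a::euclidean_space => real"
 assumes S: "open S" and f: "smooth_on S f" and x: "x : S"
 shows "fder (%y. fder f y u) x v =
    fder (%y. fder f y v) x u"
proof -
 define D where "D = (%w g y. fder g y (w::'a) :: real)"
 have smD: "smooth_on S (D w g)" if "smooth_on S g" for w g
  unfolding D_def using smooth_on_deriv[OF S that] .
 have sDD: "smooth_on S (D v (D u f))" "smooth_on S (D u (D v f))" using f smD by auto
 obtain r where r: "r > 0" "ball x r <= S" using S x open_contains_ball by blast
 have line: "((%t. g (p + t *R w)) has_real_derivative D w g (p + t *R w)) (at t)"
  if "smooth_on S g" "p + t *R w : S" for g p w t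
  using has_real_derivative_line[OF that] by (simp add: D_def)
 have in_ball: "x + s *R u + t *R v : S" if "0 <= s" "s <= h" "0 <= t" "t <= h" "h * (norm u + norm v) < r" for s t h
 proof -
  have "norm (s *R u + t *R v) <= s * norm u + t * norm v"
   using that norm_triangle_ineq[of "s *R u" "t *R v"] by simp
  also have "... <= h * (norm u + norm v)"
   using that by (simp add: distrib_left add_mono mult_right_mono)
  finally have "norm (s *R u + t *R v) < r" using that by simp
  moreover have "dist (x + (s *R u + t *R v)) x = norm (s *R u + t *R v)"
   by (simp only: dist_norm add_diff_cancel_left')
  ultimately have "dist x (x + s *R u + t *R v) < r" by (simp add: dist_commute add.assoc)
  then show ?thesis using r by auto
 qed
 define Q where "Q h = f (x + h *R u + h *R v) - f (x + h *R u) - f (x + h *R v) + f x" for h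
 have key: "EX s t. 0 < s & s < h & 0 < t & t < h & Q h = h * h * D w2 (D w1 f) (x + s *R w1 + t *R w2)"
  if h: "h > 0" "h * (norm u + norm v) < r" and w: "(w1, w2) = (u, v) \<or> (w1, w2) = (v, u)" for h w1 w2
 proof -
  have inS: "x + s *R w1 + t *R w2 : S" if "0 <= s" "s <= h" "0 <= t" "t <= h" for s t
   using w in_ball[of s h t] in_ball[of t h s] that h by (auto simp: algebra_simps)
  have "((%s. f ((x + h *R w2) + s *R w1) - f (x + s *R w1)) has_real_derivative
    D w1 f ((x + h *R w2) + s *R w1) - D w1 f (x + s *R w1)) (at s)" if "0 <= s" "s <= h" for s
   using inS[of s h] inS[of s 0] that h
   by (intro DERIV_diff line f) (auto simp: algebra_simps)
  from MVT2[OF h(1), of "%s. f ((x + h *R w2) + s *R w1) - f (x + s *R w1)", OF this]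
  obtain s where s: "0 < s" "s < h" "(f (x + h *R w2 + h *R w1) - f (x + h *R w1)) - (f (x + h *R w2) - f x) =
   h * (D w1 f ((x + h *R w2) + s *R w1) - D w1 f (x + s *R w1))" by auto
  have "((%t. D w1 f ((x + s *R w1) + t *R w2)) has_real_derivative D w2 (D w1 f) ((x + s *R w1) + t *R w2)) (at t)"
   if "0 <= t" "t <= h" for t
   using inS[of s t] that s by (intro line smD f) auto
  from MVT2[OF h(1), of "%t. D w1 f ((x + s *R w1) + t *R w2)", OF this]
  obtain t where t: "0 < t" "t < h" "D w1 f ((x + s *R w1) + h *R w2) - D w1 f (x + s *R w1) =
   h * D w2 (D w1 f) (x + s *R w1 + t *R w2)" by auto
  have "Q h = (f (x + h *R w2 + h *R w1) - f (x + h *R w1)) - (f (x + h *R w2) - f x)"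
   using w by (auto simp: Q_def algebra_simps)
  also have "... = h * h * D w2 (D w1 f) (x + s *R w1 + t *R w2)"
   using s(3) t(3) by (simp add: algebra_simps)
  finally show ?thesis using s t by blast
 qed
 define h where "h n = r / (2 * (norm u + norm v + 1)) / real (Suc n)" for n
 have h0: "h n > 0" for n using r by (auto simp: h_def divide_simps add_nonneg_pos)
 have hr: "h n * (norm u + norm v) < r" for n
 proof -
  have "h n * (norm u + norm v) <= r / (2 * (norm u + norm v + 1)) * (norm u + norm v)"
   using r by (intro mult_right_mono) (auto simp: h_def divide_simps add_nonneg_pos mult_le_cancel_left1)
  also have "... <= r / 2 * 1"
   using r by (auto simp: divide_simps add_nonneg_pos)
  finally show ?thesis using r by simp
 qed
 have hlim: "h \<longlonglongrightarrow> 0"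
  unfolding h_def by (rule real_tendsto_divide_at_top[OF tendsto_const])
   (rule filterlim_compose[OF filterlim_real_sequentially filterlim_Suc])
 have lim: "(%n. Q (h n) / (h n * h n)) \<longlonglongrightarrow> D w2 (D w1 f) x" if w: "(w1, w2) = (u, v) \<or> (w1, w2) = (v, u)" for w1 w2
 proof -
  have "ALL n. EX s t. 0 < s & s < h n & 0 < t & t < h n & Q (h n) = h n * h n * D w2 (D w1 f) (x + s *R w1 + t *R w2)"
   using key[OF h0 hr w] by blast
  then obtain s t where st: "!!n. 0 < s n & s n < h n & 0 < t n & t n < h n &
    Q (h n) = h n * h n * D w2 (D w1 f) (x + s n *R w1 + t n *R w2)" by metis
  have sl: "s \<longlonglongrightarrow> 0" by (rule tendsto_sandwich[OF _ _ tendsto_const hlim])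
    (use st in "auto intro!: always_eventually less_imp_le")
  have tl: "t \<longlonglongrightarrow> 0" by (rule tendsto_sandwich[OF _ _ tendsto_const hlim])
    (use st in "auto intro!: always_eventually less_imp_le")
  have "(%n. x + s n *R w1 + t n *R w2) \<longlonglongrightarrow> x + 0 *R w1 + 0 *R w2"
   by (intro tendsto_intros sl tl)
  then have "(%n. x + s n *R w1 + t n *R w2) \<longlonglongrightarrow> x" by simp
  then have "(%n. D w2 (D w1 f) (x + s n *R w1 + t n *R w2)) \<longlonglongrightarrow> D w2 (D w1 f) x"
   by (rule isCont_tendsto_compose[OF smooth_on_isCont[OF smD[OF smD[OF f]] x]])
  moreover have "Q (h n) / (h n * h n) = D w2 (D w1 f) (x + s n *R w1 + t n *R w2)" for n
   using st[of n] h0[of n] by simp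
  ultimately show ?thesis by simp
 qed
 have "D v (D u f) x = D u (D v f) x"
  using LIMSEQ_unique[OF lim[of u v] lim[of v u]] by simp
 then show ?thesis by (simp add: D_def)
qed

section \<open>Smooth cutoff functions\<close>

definition cutoff_poly :: "real poly => real => real" where
 "cutoff_poly p t = (if t > 0 then poly p (1 / t) * exp (- (1 / t)) else 0)"

lemma cutoff_poly_limit: "((%t. poly p (1 / t) * exp (- (1 / t))) \<longlongrightarrow> 0) (at_right (0::real))"
proof -
 have "((%s. poly p s / exp s) \<longlongrightarrow> 0) at_top"
 proof (induction p)
  case (pCons a p)
  have "((%s. (a * s ^ 0) / exp s + s * (poly p s / exp s)) \<longlongrightarrow> 0) at_top" if "((%s. s * (poly p s / exp s)) \<longlongrightarrow> 0) at_top"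
   using tendsto_add[OF tendsto_mult[OF tendsto_const[of a] tendsto_power_div_exp_0[of 0]] that] by simp
  moreover have "((%s. s * (poly p s / exp s)) \<longlongrightarrow> 0) at_top"
  proof -
   have "((%s. SUM i<=degree p. coeff p i * (s ^ Suc i / exp s)) \<longlongrightarrow> (SUM i<=degree p. coeff p i * 0)) at_top"
    by (intro tendsto_sum tendsto_mult tendsto_const tendsto_power_div_exp_0)
   then show ?thesis
    by (simp add: poly_altdef sum_distrib_left sum_divide_distrib algebra_simps)
  qed
  ultimately show ?case by (simp add: add_divide_distrib)
 qed simp
 moreover have "filterlim (%t::real. 1 / t) at_top (at_right 0)"
  using filterlim_inverse_at_top_right by (simp add: inverse_eq_divide)
 ultimately have "((%t. poly p (1 / t) / exp (1 / t)) \<longlongrightarrow> 0) (at_right 0)"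
  by (rule filterlim_compose[of "%s. poly p s / exp s"])
 then show ?thesis by (simp add: exp_minus field_simps)
qed

text \<open>Keeping the polynomial in 1 / t general makes the family closed under differentiation,
  also at t = 0, so the smoothness of all its members is a single induction.\<close>

lemma cutoff_poly_deriv:
 "(cutoff_poly p has_real_derivative cutoff_poly (monom 1 2 * (p - pderiv p)) t) (at t)"
proof (cases t "0::real" rule: linorder_cases)
 case less
 have "(cutoff_poly p has_real_derivative 0) (at t)"
  by (rule has_field_derivative_transform_within_open[of "%_. 0" _ _ "{..<0}"]) (use less in "auto simp: cutoff_poly_def")
 then show ?thesis using less by (simp add: cutoff_poly_def)
next
 case greater
 have "((%t. poly p (1 / t) * exp (- (1 / t))) has_real_derivative cutoff_poly (monom 1 2 * (p - pderiv p)) t) (at t)"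
  using greater by (auto intro!: derivative_eq_intros simp: cutoff_poly_def poly_monom power2_eq_square field_simps)
 then show ?thesis
  by (rule has_field_derivative_transform_within_open[of _ _ _ "{0<..}"]) (use greater in "auto simp: cutoff_poly_def")
next
 case equal
 have "((%h. cutoff_poly p h / h) \<longlongrightarrow> 0) (at_right 0)"
 proof (rule Lim_transform_eventually[OF cutoff_poly_limit[of "monom 1 1 * p"]])
  show "\<forall>\<^sub>F x in at_right 0. poly (monom 1 1 * p) (1 / x) * exp (- (1 / x)) = cutoff_poly p x / x"
   unfolding eventually_at_right_field by (intro exI[of _ 1]) (auto simp: cutoff_poly_def poly_monom)
 qed
 moreover have "((%h. cutoff_poly p h / h) \<longlongrightarrow> 0) (at_left 0)"
  by (rule Lim_transform_eventually[OF tendsto_const])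
   (auto simp: eventually_at_left_field cutoff_poly_def intro!: exI[of _ "-1"])
 ultimately have "((%h. cutoff_poly p h / h) \<longlongrightarrow> 0) (at 0)"
  by (simp add: filterlim_split_at)
 then show ?thesis using equal by (simp add: DERIV_def cutoff_poly_def)
qed

lemma smooth_on_cutoff_poly: "smooth (cutoff_poly p)"
proof -
 have "diffn n UNIV (cutoff_poly p)" for n
 proof (induction n arbitrary: p)
  case 0
  then show ?case using cutoff_poly_deriv by (auto simp: differentiable_def has_field_derivative_def)
 next
  case (Suc n)
  have "fder (cutoff_poly p) x 1 = cutoff_poly (monom 1 2 * (p - pderiv p)) x" for x
   using fder_eqI[OF cutoff_poly_deriv[unfolded has_field_derivative_def]] by simp
  moreover have "cutoff_poly p differentiable at x" for x
   using cutoff_poly_deriv by (auto simp: differentiable_def has_field_derivative_def)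
  ultimately show ?case using Suc by simp
 qed
 then show ?thesis by (simp add: smooth_on_iff_diffn)
qed

definition smooth_step :: "real => real" where
 "smooth_step t = cutoff_poly 1 t * inverse (cutoff_poly 1 t + cutoff_poly 1 (1 - t))"

lemma smooth_step_props:
 "smooth smooth_step" "t <= 0 ==> smooth_step t = 0" "t > 0 ==> smooth_step t > 0"
 "t >= 1 ==> smooth_step t = 1" "0 <= smooth_step t" "smooth_step t <= 1"
proof -
 have p: "cutoff_poly 1 t + cutoff_poly 1 (1 - t) > 0" for t
  by (cases "t > 0"; cases "t < 1") (auto simp: cutoff_poly_def add_pos_pos)
 have n: "cutoff_poly 1 t >= 0" for t by (simp add: cutoff_poly_def)
 have "smooth (%t. cutoff_poly 1 (1 - t))"
  by (rule smooth_on_compose[OF _ _ _ _ smooth_on_cutoff_poly]) (auto intro!: smooth_on_diff[where f = "%_. 1"] smooth_on_bounded_linear[where f = "%x. x"] bounded_linear_ident)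
 then show "smooth smooth_step"
  unfolding smooth_step_def using p
  by (intro smooth_on_mult smooth_on_inverse smooth_on_add smooth_on_cutoff_poly) (auto simp: less_imp_neq[OF p, symmetric])
 show "t <= 0 ==> smooth_step t = 0" "t >= 1 ==> smooth_step t = 1" "t > 0 ==> smooth_step t > 0"
  using p[of t] by (auto simp: smooth_step_def cutoff_poly_def)
 show "0 <= smooth_step t" "smooth_step t <= 1"
  using p[of t] n[of t] n[of "1 - t"] by (auto simp: smooth_step_def field_simps)
qed

text \<open>For r > 0 the argument of \<open>smooth_step\<close> is positive exactly inside the ball
  of radius r, and at least 1 where the squared distance is at most r^2 / 2, in particular on the
  ball of radius r / 2. The squared distance keeps the function smooth at the centre.\<close>

definition bump :: "'a::euclidean_space => real => 'a => real" where
 "bump x0 r x = smooth_step (2 - 2 * ((x - x0) \<bullet> (x - x0)) / r^2)"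

lemma smooth_on_bump: "smooth (bump x0 r)"
proof -
 have c: "smooth (%x. (x - x0) \<bullet> b)" for b
  using smooth_diff[OF smooth_on_inner smooth_on_const, of b "x0 \<bullet> b"] by (simp add: inner_diff_left)
 have "smooth (%x. SUM b:Basis. ((x - x0) \<bullet> b) * ((x - x0) \<bullet> b))"
  by (intro smooth_on_sum smooth_on_mult c) auto
 then have "smooth (%x. (x - x0) \<bullet> (x - x0))" by (subst euclidean_inner)
 then have "smooth (%x. 2 - (2 / r^2) * ((x - x0) \<bullet> (x - x0)))"
  by (intro smooth_on_diff smooth_on_const smooth_on_cmult) auto
 then show ?thesis unfolding bump_def
  by (intro smooth_on_compose[OF _ _ _ _ smooth_step_props(1)]) auto
qed

lemma bump_props:
 assumes "r > 0"
 shows "0 <= bump x0 r x" "bump x0 r x <= 1" "x : ball x0 r ==> bump x0 r x > 0"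
  "x ~: ball x0 r ==> bump x0 r x = 0" "dist x0 x <= r / 2 ==> bump x0 r x = 1"
proof -
 have d: "(x - x0) \<bullet> (x - x0) = (dist x0 x)^2"
  by (simp add: dist_norm norm_minus_commute power2_norm_eq_inner)
 show "0 <= bump x0 r x" "bump x0 r x <= 1" by (simp_all add: bump_def smooth_step_props)
 show "bump x0 r x > 0" if "x : ball x0 r"
 proof -
  have "(dist x0 x)^2 < r^2" using that by (intro power_strict_mono) auto
  then show ?thesis unfolding bump_def d using assms by (intro smooth_step_props) (simp add: field_simps)
 qed
 show "bump x0 r x = 0" if "x ~: ball x0 r"
 proof -
  have "(dist x0 x)^2 >= r^2" using that assms by (intro power_mono) auto
  then show ?thesis unfolding bump_def d using assms by (intro smooth_step_props) (simp add: field_simps)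
 qed
 show "bump x0 r x = 1" if "dist x0 x <= r / 2"
 proof -
  have "(dist x0 x)^2 <= (r/2)^2" using that by (intro power_mono) auto
  then have "(dist x0 x)^2 * 4 <= r^2" by (simp add: power_divide)
  then have "2 * (dist x0 x)^2 <= r^2"
   using zero_le_power2[of "dist x0 x"] by linarith
  then show ?thesis unfolding bump_def d using assms by (intro smooth_step_props) (simp add: field_simps)
 qed
qed

section \<open>Functionals of compact support\<close>

abbreviation deriv_bound :: "nat => 'a::euclidean_space set => ('a => real) => real => bool" where
 "deriv_bound N K f B \<equiv> ALL vs:lists Basis. length vs <= N --> (ALL x:K. \<bar>iter_deriv vs f x\<bar> <= B)"

text \<open>Distributions of compact support, as functionals on all smooth functions. Continuity is
  expressed with an arbitrary bound \<open>B\<close> of the derivatives on \<open>K\<close>, so that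
  no supremum has to be shown finite.\<close>

definition cdistr :: "(('a::euclidean_space => real) => real) => bool" where
 "cdistr S \<longleftrightarrow>
  (ALL \<phi> \<psi>. smooth \<phi> --> smooth \<psi> --> S (%x. \<phi> x + \<psi> x) = S \<phi> + S \<psi>) &
  (ALL c \<phi>. smooth \<phi> --> S (%x. c * \<phi> x) = c * S \<phi>) &
  (EX K N C. compact K & 0 <= C & (ALL \<phi> B. smooth \<phi> -->
   deriv_bound N K \<phi> B --> \<bar>S \<phi>\<bar> <= C * B))"

lemma cdistrD:
 assumes "cdistr S"
 shows cdistr_add: "smooth \<phi> ==> smooth \<psi> ==> S (%x. \<phi> x + \<psi> x) = S \<phi> + S \<psi>"
  and cdistr_cmult: "smooth \<phi> ==> S (%x. c * \<phi> x) = c * S \<phi>"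
 using assms by (auto simp: cdistr_def)

lemma cdistr_zero: "cdistr S ==> S (%x. 0) = 0"
 using cdistr_cmult[of S "%_. 0" 0] by simp

lemma cdistr_diff:
 assumes "cdistr S" "smooth \<phi>" "smooth \<psi>"
 shows "S (%x. \<phi> x - \<psi> x) = S \<phi> - S \<psi>"
 using cdistr_add[OF assms(1,2) smooth_minus[OF assms(3)]]
  cdistr_cmult[OF assms(1,3), of "-1"] by simp

lemma cdistr_sum:
 assumes "cdistr S" "finite I" "!!i. i : I ==> smooth (\<phi> i)"
 shows "S (%x. SUM i:I. \<phi> i x) = (SUM i:I. S (\<phi> i))"
 using assms(2,3)
proof (induction I rule: finite_induct)
 case empty
 then show ?case by (simp add: cdistr_zero assms(1))
next
 case (insert i I)
 then show ?case
  using cdistr_add[OF assms(1), of "\<phi> i" "%x. SUM i:I. \<phi> i x"]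
  by (simp add: smooth_on_sum)
qed

lemma smooth_on_iter_deriv:
 "open S ==> smooth_on S f ==> smooth_on S (iter_deriv vs f)"
 by (induction vs) (auto intro: smooth_on_deriv)

lemmas smooth_iter_deriv = smooth_on_iter_deriv[OF open_UNIV]

lemma smooth_on_Pair_components:
 fixes f :: "'c::euclidean_space => 'a::euclidean_space" and g :: "'c => 'b::euclidean_space"
 assumes "!!b. b : Basis ==> smooth_on S (%x. f x \<bullet> b)" "!!b. b : Basis ==> smooth_on S (%x. g x \<bullet> b)"
  and "c : Basis"
 shows "smooth_on S (%x. (f x, g x) \<bullet> c)"
 using assms by (auto simp: Basis_prod_def)

lemma smooth_on_slice:
 fixes \<Phi> :: "'b::euclidean_space \<times> 'a::euclidean_space => real"
 assumes "open U" "smooth_on (U \<times> UNIV) \<Phi>" "s : U"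
 shows "smooth (%y. \<Phi> (s, y))"
 by (rule smooth_on_compose[OF open_UNIV open_Times[OF assms(1) open_UNIV] _ _ assms(2)])
  (use assms(3) in "auto intro!: smooth_on_Pair_components")

lemma fder_slice:
 fixes \<Phi> :: "'b::euclidean_space \<times> 'a::euclidean_space => real"
 assumes "open U" "smooth_on (U \<times> UNIV) \<Phi>" "s : U"
 shows "fder (%y. \<Phi> (s, y)) y v = fder \<Phi> (s, y) (0, v)"
proof -
 have "((%y. (s, y)) has_derivative (%v. (0, v))) (at y)"
  by (auto intro!: derivative_eq_intros)
 from diff_chain_at[OF this smooth_on_has_derivative[OF assms(2)]] assms(3)
 have "((%y. \<Phi> (s, y)) has_derivative (%v. fder \<Phi> (s, y) (0, v))) (at y)"
  by (simp add: o_def)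
 then show ?thesis by (simp add: fder_eqI)
qed

lemma iter_deriv_slice:
 fixes \<Phi> :: "'b::euclidean_space \<times> 'a::euclidean_space => real"
 assumes "open U" "smooth_on (U \<times> UNIV) \<Phi>" "s : U"
 shows "iter_deriv vs (%y. \<Phi> (s, y)) = (%y. iter_deriv (map (Pair 0) vs) \<Phi> (s, y))"
proof (induction vs)
 case (Cons v vs)
 have "smooth_on (U \<times> UNIV) (iter_deriv (map (Pair 0) vs) \<Phi>)"
  by (intro smooth_on_iter_deriv open_Times assms open_UNIV)
 from fder_slice[OF assms(1) this assms(3)] show ?case using Cons by simp
qed simp

lemma iter_deriv_frechet_commute:
 assumes "open W" "smooth_on W f" "x : W"
 shows "iter_deriv vs (%y. fder f y v) x = fder (iter_deriv vs f) x v"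
 using assms(3)
proof (induction vs arbitrary: x)
 case (Cons w vs)
 have "iter_deriv (w # vs) (%y. fder f y v) x =
  fder (%y. fder (iter_deriv vs f) y v) x w"
  using fder_cong[OF assms(1) Cons.prems Cons.IH] by simp
 also have "... = fder (%y. fder (iter_deriv vs f) y w) x v"
  using partial_derivatives_commute[OF assms(1) smooth_on_iter_deriv[OF assms(1,2)] Cons.prems] .
 finally show ?case by simp
qed simp

text \<open>A first order Taylor expansion in the parameter whose error is uniform over a compact
  set of the other variable: the mean value theorem along the segment, combined with uniform
  continuity of the partial derivatives.\<close>

lemma smooth_on_uniform_linearization:
 fixes G :: "'b::euclidean_space \<times> 'a::euclidean_space => real"
 assumes "open U" "smooth_on (U \<times> UNIV) G" "s : U" "compact K" "e > 0"
 shows "EX d>0. ALL v. norm v < d --> s + v : U & (ALL y:K. \<bar>G (s + v, y) - G (s, y) - fder G (s, y) (v, 0)\<bar> <= e * norm v)"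
proof -
 have oW: "open (U \<times> (UNIV::'a set))" by (intro open_Times assms open_UNIV)
 obtain r where r: "r > 0" "cball s r <= U" using assms(1,3) open_contains_cball by blast
 define e' where "e' = e / real (DIM('b))"
 have e': "e' > 0" using assms(5) by (simp add: e'_def)
 have uc: "uniformly_continuous_on (cball s r \<times> K) (%z. fder G z (b, 0))" for b :: 'b
  using continuous_on_deriv[OF oW assms(2)] r assms(4)
  by (intro compact_uniformly_continuous compact_Times compact_cball) (blast intro: continuous_on_subset)+
 have "ALL b. EX d>0. ALL z:cball s r \<times> K. ALL z':cball s r \<times> K. dist z' z < d -->
   \<bar>fder G z' (b, 0) - fder G z (b, 0)\<bar> < e'"
  using uc e' by (auto simp: uniformly_continuous_on_def dist_real_def)
 then obtain d where d: "!!b. d b > 0" "!!b z z'. z : cball s r \<times> K ==> z' : cball s r \<times> K ==> dist z' z < d b ==>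
   \<bar>fder G z' (b, 0) - fder G z (b, 0)\<bar> < e'" by metis
 define \<delta> where "\<delta> = Min (insert r (d ` (Basis::'b set)))"
 have \<delta>: "\<delta> > 0" "\<delta> <= r" using d r by (auto simp: \<delta>_def)
 have \<delta>_le: "\<delta> <= d b" if "b : (Basis::'b set)" for b
  unfolding \<delta>_def using that by (intro Min_le) auto
 show ?thesis
 proof (intro exI[of _ \<delta>] conjI allI impI ballI \<delta>(1))
  fix v :: 'b assume v: "norm v < \<delta>"
  have inU: "s + t *R v : cball s r" if "0 <= t" "t <= 1" for t
  proof -
   have "norm (t *R v) <= norm v" using that by (simp add: mult_left_le_one_le)
   then show ?thesis using v \<delta>(2) by (simp add: dist_norm)
  qed
  show "s + v : U" using inU[of 1] r by auto
  fix y assume y: "y : K"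
  have "((%t. G (s + t *R v, y)) has_real_derivative fder G (s + t *R v, y) (v, 0)) (at t)"
   if t: "0 <= t" "t <= 1" for t
   using has_real_derivative_line[OF assms(2), of "(s, y)" t "(v, 0)"] inU[OF t] r by auto
  from MVT2[of 0 1, OF _ this] obtain t where t: "0 < t" "t < 1"
   "G (s + v, y) - G (s, y) = fder G (s + t *R v, y) (v, 0)" by auto
  have sm: "(s + t *R v, y) : U \<times> UNIV" "(s, y) : U \<times> UNIV" using inU[of t] t r assms(3) by auto
  have exp: "fder G z (v, 0) = (SUM b:Basis. (v \<bullet> b) * fder G z (b, 0))" if "z : U \<times> UNIV" for z
  proof -
   have "linear (fder G z)"
    using linear_frechet_derivative smooth_on_differentiable[OF assms(2) that] by blast
   then have l: "linear (%v. fder G z (v, 0))"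
    by (auto simp: linear_iff) (metis add.right_neutral add_Pair, metis scaleR_Pair scaleR_zero_right)
   then have "fder G z (SUM b:Basis. (v \<bullet> b) *R b, 0) = (SUM b:Basis. (v \<bullet> b) *R fder G z (b, 0))"
    using linear_sum[OF l, of "%b. (v \<bullet> b) *R b" Basis] linear_scale[OF l] by simp
   then show ?thesis by (simp add: euclidean_representation)
  qed
  have "\<bar>G (s + v, y) - G (s, y) - fder G (s, y) (v, 0)\<bar> =
   \<bar>SUM b:Basis. (v \<bullet> b) * (fder G (s + t *R v, y) (b, 0) - fder G (s, y) (b, 0))\<bar>"
   unfolding t(3) exp[OF sm(1)] exp[OF sm(2)] by (simp add: sum_subtractf algebra_simps)
  also have "... <= (SUM b:(Basis::'b set). norm v * e')"
  proof (rule order_trans[OF sum_abs sum_mono])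
   fix b :: 'b assume b: "b : Basis"
   have "dist (s + t *R v, y) (s, y) < d b"
   proof -
    have "norm (t *R v) <= norm v" using t by (simp add: mult_left_le_one_le)
    then show ?thesis using v \<delta>_le[OF b] by (simp add: dist_Pair_Pair dist_norm)
   qed
   then have "\<bar>fder G (s + t *R v, y) (b, 0) - fder G (s, y) (b, 0)\<bar> <= e'"
    using d(2)[of "(s, y)" "(s + t *R v, y)" b] y inU[of t] t r by (auto simp: less_imp_le)
   moreover have "\<bar>v \<bullet> b\<bar> <= norm v" using b Basis_le_norm by blast
   ultimately show "\<bar>(v \<bullet> b) * (fder G (s + t *R v, y) (b, 0) - fder G (s, y) (b, 0))\<bar> <= norm v * e'"
    unfolding abs_mult by (intro mult_mono) auto
  qed
  also have "... = e * norm v" by (simp add: e'_def)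
  finally show "\<bar>G (s + v, y) - G (s, y) - fder G (s, y) (v, 0)\<bar> <= e * norm v" .
 qed
qed

text \<open>Differentiation under the functional. Its bound involves finitely many derivatives in
  \<open>y\<close> on a compact set, and for each of them the linearization error is uniformly small
  there.\<close>

lemma cdistr_has_derivative:
 fixes \<Phi> :: "'b::euclidean_space \<times> 'a::euclidean_space => real"
 assumes S: "cdistr S" and U: "open U" "smooth_on (U \<times> UNIV) \<Phi>" "s : U"
 shows "((%s. S (%y. \<Phi> (s, y))) has_derivative (%v. S (%y. fder \<Phi> (s, y) (v, 0)))) (at s)"
proof -
 let ?M = "%vs. iter_deriv (map (Pair 0) vs) \<Phi>"
 have oW: "open (U \<times> (UNIV::'a set))" by (intro open_Times U open_UNIV)
 obtain K N C where K: "compact K" "C >= 0" and bnd: "!!\<phi> B. smooth \<phi> ==>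
   deriv_bound N K \<phi> B ==> \<bar>S \<phi>\<bar> <= C * B"
  using S unfolding cdistr_def by blast
 have smD: "smooth_on (U \<times> UNIV) (%z. fder \<Phi> z (v, 0))" for v
  using smooth_on_deriv[OF oW U(2)] .
 have lin: "linear (fder \<Phi> (s, y))" for y
  using linear_frechet_derivative[OF smooth_on_differentiable[OF U(2), of "(s, y)"]] U(3) by simp
 define L where "L v = S (%y. fder \<Phi> (s, y) (v, 0))" for v
 have smDs: "smooth (%y. fder \<Phi> (s, y) (v, 0))" for v
  using smooth_on_slice[OF U(1) smD U(3)] .
 have "linear L"
 proof
  show "L (v + w) = L v + L w" for v w
   using cdistr_add[OF S smDs[of v] smDs[of w]] linear_add[OF lin, of _ "(v, 0)" "(w, 0)"]
   by (simp add: L_def)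
  show "L (c *R v) = c *R L v" for c v
   using cdistr_cmult[OF S smDs[of v], of c] linear_scale[OF lin, of _ c "(v, 0)"]
   by (simp add: L_def)
 qed
 then have bl: "bounded_linear L" by (simp add: linear_conv_bounded_linear)
 have "EX d>0. ALL x. norm (x - s) < d -->
  norm (S (%y. \<Phi> (x, y)) - S (%y. \<Phi> (s, y)) - L (x - s)) <= e * norm (x - s)" if e: "e > 0" for e
 proof -
  define e' where "e' = e / (C + 1)"
  have e': "e' > 0" "C * e' <= e" using e K(2) by (auto simp: e'_def field_simps)
  define I where "I = {vs : lists (Basis::'a set). length vs <= N}"
  have fin: "finite I"
   using finite_lists_length_le[of "Basis::'a set" N] by (simp add: I_def lists_eq_set)
  have "ALL vs. EX d>0. ALL v. norm v < d --> s + v : U & (ALL y:K. \<bar>?M vs (s + v, y) - ?M vs (s, y)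
   - fder (?M vs) (s, y) (v, 0)\<bar> <= e' * norm v)"
   by (intro allI smooth_on_uniform_linearization smooth_on_iter_deriv oW U K(1) e'(1))
  then obtain d where d: "!!vs. d vs > 0" "!!vs v. norm v < d vs ==> s + v : U"
   "!!vs v y. norm v < d vs ==> y : K ==> \<bar>?M vs (s + v, y) - ?M vs (s, y)
   - fder (?M vs) (s, y) (v, 0)\<bar> <= e' * norm v" by metis
  define \<delta> where "\<delta> = Min (insert (d []) (d ` I))"
  have \<delta>: "\<delta> > 0" using d(1) fin by (auto simp: \<delta>_def)
  have \<delta>_le: "\<delta> <= d vs" if "vs : insert [] I" for vs
   unfolding \<delta>_def using that fin by (intro Min_le) auto
  show ?thesis
  proof (intro exI[of _ \<delta>] conjI allI impI \<delta>)
   fix x assume x: "norm (x - s) < \<delta>"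
   define v where "v = x - s"
   have sv: "s + v = x" by (simp add: v_def)
   have xU: "x : U" using d(2)[of v "[]"] x \<delta>_le[of "[]"] sv by (simp add: v_def)
   define \<phi> where "\<phi> y = \<Phi> (x, y) - \<Phi> (s, y) - fder \<Phi> (s, y) (v, 0)" for y
   have sl: "smooth (%y. \<Phi> (x, y))" "smooth (%y. \<Phi> (s, y))"
    using smooth_on_slice[OF U(1,2)] xU U(3) by auto
   have sm\<phi>: "smooth \<phi>"
    unfolding \<phi>_def by (intro smooth_diff sl smDs)
   have it: "iter_deriv vs \<phi> = (%y. ?M vs (x, y) - ?M vs (s, y)
    - fder (?M vs) (s, y) (v, 0))" for vs
   proof -
    have idiff: "iter_deriv vs (%y. f y - g y) = (%y. iter_deriv vs f y - iter_deriv vs g y)"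
     if "smooth f" "smooth g" for f g :: "'a => real"
    proof (induction vs)
     case (Cons w vs)
     have "smooth (iter_deriv vs f)" "smooth (iter_deriv vs g)"
      using that smooth_on_iter_deriv by auto
     then have "((%y. iter_deriv vs f y - iter_deriv vs g y) has_derivative
      (%h. fder (iter_deriv vs f) z h - fder (iter_deriv vs g) z h)) (at z)" for z
      by (intro has_derivative_diff smooth_on_has_derivative[of UNIV]) auto
     from fder_eqI[OF this] show ?case using Cons by simp
    qed simp
    have "iter_deriv vs \<phi> = (%y. iter_deriv vs (%y. \<Phi> (x, y)) y - iter_deriv vs (%y. \<Phi> (s, y)) y
     - iter_deriv vs (%y. fder \<Phi> (s, y) (v, 0)) y)"
     unfolding \<phi>_def by (subst idiff, intro smooth_on_diff open_UNIV sl, rule smDs, subst idiff[OF sl]) simp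
    also have "... = (%y. ?M vs (x, y) - ?M vs (s, y)
     - iter_deriv (map (Pair 0) vs) (%z. fder \<Phi> z (v, 0)) (s, y))"
     using iter_deriv_slice[OF U(1,2)] iter_deriv_slice[OF U(1) smD U(3)] xU U(3) by simp
    also have "... = (%y. ?M vs (x, y) - ?M vs (s, y)
     - fder (?M vs) (s, y) (v, 0))"
     using iter_deriv_frechet_commute[OF oW U(2)] U(3) by simp
    finally show ?thesis .
   qed
   have "\<bar>S \<phi>\<bar> <= C * (e' * norm v)"
   proof (rule bnd[OF sm\<phi>], intro ballI impI)
    fix vs y assume "vs : lists (Basis::'a set)" "length vs <= N" "y : K"
    then show "\<bar>iter_deriv vs \<phi> y\<bar> <= e' * norm v"
     using d(3)[of v vs y] \<delta>_le[of vs] x by (simp add: it sv I_def v_def)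
   qed
   also have "... <= e * norm v" using e'(2) mult_right_mono[OF e'(2), of "norm v"] by (simp add: mult.assoc)
   finally have "\<bar>S \<phi>\<bar> <= e * norm v" .
   moreover have "S \<phi> = S (%y. \<Phi> (x, y)) - S (%y. \<Phi> (s, y)) - L v"
    unfolding \<phi>_def L_def
    using cdistr_diff[OF S smooth_diff[OF sl] smDs] cdistr_diff[OF S sl] by simp
   ultimately show "norm (S (%y. \<Phi> (x, y)) - S (%y. \<Phi> (s, y)) - L (x - s)) <= e * norm (x - s)"
    by (simp add: v_def)
  qed
 qed
 then show ?thesis unfolding has_derivative_within_alt L_def[symmetric, abs_def] using bl by simp
qed

lemma cdistr_smooth:
 fixes \<Phi> :: "'b::euclidean_space \<times> 'a::euclidean_space => real"
 assumes S: "cdistr S" and U: "open U" "smooth_on (U \<times> UNIV) \<Phi>"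
 shows "smooth_on U (%s. S (%y. \<Phi> (s, y)))"
  and "!!s v. s : U ==> fder (%s. S (%y. \<Phi> (s, y))) s v = S (%y. fder \<Phi> (s, y) (v, 0))"
proof -
 have oW: "open (U \<times> (UNIV::'a set))" by (intro open_Times U open_UNIV)
 have 1: "fder (%s. S (%y. \<Phi> (s, y))) s v = S (%y. fder \<Phi> (s, y) (v, 0))"
  if "smooth_on (U \<times> UNIV) \<Phi>" "s : U" for s v and \<Phi> :: "'b \<times> 'a => real"
  using fder_eqI[OF cdistr_has_derivative[OF S U(1) that]] by simp
 have "diffn n U (%s. S (%y. \<Phi> (s, y)))" for n
  using U(2)
 proof (induction n arbitrary: \<Phi>)
  case 0
  then show ?case using cdistr_has_derivative[OF S U(1)] by (force simp: differentiable_def)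
 next
  case (Suc n)
  have "diffn n U (%s. fder (%s. S (%y. \<Phi> (s, y))) s b)" for b
   by (rule diffn_cong[OF U(1) _ Suc.IH[OF smooth_on_deriv[OF oW Suc.prems, of "(b, 0)"]]]) (simp add: 1[OF Suc.prems])
  then show ?case using cdistr_has_derivative[OF S U(1) Suc.prems] by (force simp: differentiable_def)
 qed
 then show "smooth_on U (%s. S (%y. \<Phi> (s, y)))" by (simp add: smooth_on_iff_diffn)
 show "fder (%s. S (%y. \<Phi> (s, y))) s v = S (%y. fder \<Phi> (s, y) (v, 0))"
  if "s : U" for s v using 1[OF U(2) that] .
qed

section \<open>Integration by parts\<close>

text \<open>Bounded support without a closure, so that products, sums and derivatives inherit it
  directly.\<close>

definition bsupp :: "('a::real_normed_vector => real) => bool" where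
 "bsupp f \<longleftrightarrow> (EX r. ALL x. r < norm x --> f x = 0)"

lemma bsuppI: "(!!x. r < norm x ==> f x = 0) ==> bsupp f"
 by (auto simp: bsupp_def)

lemma bsupp_ball:
 fixes f :: "'a::real_normed_vector => real"
 assumes "!!y. y ~: ball x r ==> f y = 0" shows "bsupp f"
proof (rule bsuppI[of "norm x + r"])
 fix y :: 'a assume "norm x + r < norm y"
 then show "f y = 0" using norm_triangle_sub[of y x] by (intro assms) (auto simp: dist_norm norm_minus_commute)
qed

lemma bsupp_mult1: "bsupp f ==> bsupp (%x. f x * g x)"
 and bsupp_mult2: "bsupp g ==> bsupp (%x. f x * g x)"
 by (auto simp: bsupp_def)

lemma bsupp_add: "bsupp f ==> bsupp g ==> bsupp (%x. f x + g x)"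
 unfolding bsupp_def by (metis add.right_neutral max.strict_boundedE)

lemma integrable_bsupp:
 fixes f :: "'a::euclidean_space => real"
 assumes "continuous_on UNIV f" "bsupp f"
 shows "integrable lborel f"
proof -
 obtain r where r: "!!x. r < norm x ==> f x = 0" using assms(2) by (auto simp: bsupp_def)
 have "integrable lborel (%x. indicator (cball 0 r) x *R f x)"
  using assms(1) by (intro borel_integrable_compact compact_cball continuous_on_subset[OF assms(1)]) auto
 moreover have "(%x. indicator (cball 0 r) x *R f x) = f"
  using r by (force simp: indicator_def)
 ultimately show ?thesis by simp
qed

lemma cdistr_integral:
 fixes k :: "'a::euclidean_space => real"
 assumes "continuous_on UNIV k" "bsupp k"
 shows "cdistr (%\<phi>. LINT x|lborel. k x * \<phi> x)"
proof -
 have i: "integrable lborel (%x. k x * \<phi> x)" if "smooth \<phi>" for \<phi>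
  using assms that by (intro integrable_bsupp bsupp_mult1 continuous_on_mult smooth_on_continuous_on[of UNIV \<phi>])
 obtain r where r: "!!x. r < norm x ==> k x = 0" using assms(2) by (auto simp: bsupp_def)
 have ik: "integrable lborel k" using integrable_bsupp assms by blast
 show ?thesis unfolding cdistr_def
 proof (intro conjI allI impI exI[of _ "cball 0 r"] exI[of _ "0::nat"] exI[of _ "LINT x|lborel. \<bar>k x\<bar>"])
  fix \<phi> B assume sm: "smooth \<phi>" and B: "deriv_bound 0 (cball (0::'a) r) \<phi> B"
  have b: "\<bar>k x * \<phi> x\<bar> <= \<bar>k x\<bar> * B" for x
  proof (cases "norm x <= r")
   case True
   then have "\<bar>\<phi> x\<bar> <= B" using B[rule_format, of "[]" x] by simp
   then show ?thesis by (simp add: abs_mult mult_left_mono)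
  next
   case False
   then show ?thesis using r[of x] by simp
  qed
  have "\<bar>LINT x|lborel. k x * \<phi> x\<bar> <= (LINT x|lborel. \<bar>k x\<bar> * B)"
   by (rule order_trans[OF integral_abs_bound integral_mono])
    (use i[OF sm] ik b in "auto intro!: integrable_abs integrable_mult_left")
  then show "\<bar>LINT x|lborel. k x * \<phi> x\<bar> <= (LINT x|lborel. \<bar>k x\<bar>) * B" by simp
 next
  fix \<phi> \<psi> assume "smooth (\<phi>::'a => real)" "smooth (\<psi>::'a => real)"
  then show "(LINT x|lborel. k x * (\<phi> x + \<psi> x)) = (LINT x|lborel. k x * \<phi> x) + (LINT x|lborel. k x * \<psi> x)"
   using i by (simp add: distrib_left)
 next
  fix c \<phi> assume "smooth (\<phi>::'a => real)"
  then show "(LINT x|lborel. k x * (c * \<phi> x)) = c * (LINT x|lborel. k x * \<phi> x)"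
   by (simp add: mult.left_commute)
 qed auto
qed

lemma integral_translate:
 fixes f :: "'a::euclidean_space => real"
 assumes "f : borel_measurable borel"
 shows "(LINT x|lborel. f (x + a)) = (LINT x|lborel. f x)"
proof -
 have "(LINT x|lborel. f x) = (LINT x|distr lborel borel ((+) a). f x)" by (simp add: lborel_distr_plus)
 also have "... = (LINT x|lborel. f (a + x))" using assms by (subst integral_distr) auto
 finally show ?thesis by (simp add: add.commute)
qed

lemma fder_zero_outside:
 fixes f :: "'a::real_normed_vector => real"
 assumes "open U" "!!x. x : U ==> f x = 0" "x : U"
 shows "fder f x v = 0"
 using fder_cong[OF assms(1,3), of f "%_. 0"] assms(2) by (simp add: frechet_derivative_const)

lemma bsupp_deriv: "bsupp f ==> bsupp (%x. fder f x v)"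
proof -
 assume "bsupp f"
 then obtain r where "!!x. r < norm x ==> f x = 0" by (auto simp: bsupp_def)
 moreover have "open {x::'a. r < norm x}" by (intro open_Collect_less continuous_intros)
 ultimately show ?thesis using fder_zero_outside[of "{x. r < norm x}" f _ v] by (auto simp: bsupp_def)
qed

text \<open>Translation invariance: the integral of \<open>f (y + s *R v)\<close> is constant in
  \<open>s\<close>, and its derivative at 0 is the integral in question. The cutoff \<open>k\<close>
  is 1 wherever a translate with |s| < 1 is nonzero; inserting it turns the integral into a
  functional of compact support, under which differentiation is already justified.\<close>

lemma integral_deriv_zero:
 fixes f :: "'a::euclidean_space => real"
 assumes f: "smooth f" "bsupp f"
 shows "(LINT x|lborel. fder f x v) = 0"
proof -
 obtain r0 where r0: "!!x. r0 < norm x ==> f x = 0" using f(2) by (auto simp: bsupp_def)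
 define r where "r = \<bar>r0\<bar> + norm v + 1"
 have r: "r > 0" by (simp add: r_def add_nonneg_pos)
 define k where "k = bump (0::'a) (2 * r)"
 have k1: "k x = 1" if "norm x <= r" for x
  unfolding k_def using that r by (intro bump_props) auto
 have kc: "continuous_on UNIV k" unfolding k_def by (rule smooth_on_continuous_on[OF smooth_on_bump])
 have kb: "bsupp k" unfolding k_def using bump_props(4)[of "2 * r" _ "0::'a"] r by (intro bsuppI[of "2*r"]) auto
 let ?\<Phi> = "%z::real \<times> 'a. f (snd z + fst z *R v)"
 have sm: "smooth_on (UNIV \<times> UNIV) ?\<Phi>"
  unfolding UNIV_Times_UNIV
 proof (rule smooth_on_compose[OF _ _ _ _ f(1)])
  fix c :: 'a assume "c : Basis"
  have "(%x::real \<times> 'a. (snd x + fst x *R v) \<bullet> c) = (%x. snd x \<bullet> c + fst x * (v \<bullet> c))"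
   by (simp add: inner_add_left)
  moreover have "bounded_linear (%x::real \<times> 'a. snd x \<bullet> c + fst x * (v \<bullet> c))"
   by (intro bounded_linear_add bounded_linear_mult_const bounded_linear_fst bounded_linear_inner_left_comp bounded_linear_snd)
  ultimately show "smooth (%x::real \<times> 'a. (snd x + fst x *R v) \<bullet> c)"
   using smooth_on_bounded_linear by metis
 qed auto
 note cf = cdistr_integral[OF kc kb]
 have "((%s::real. LINT y|lborel. k y * f (y + s *R v)) has_derivative
  (%w. LINT y|lborel. k y * fder ?\<Phi> (0, y) (w, 0))) (at 0)"
  using cdistr_has_derivative[OF cf open_UNIV sm] by simp
 moreover have "((%s::real. LINT y|lborel. k y * f (y + s *R v)) has_derivative (%w. 0)) (at 0)"
 proof (rule has_derivative_transform_within_open[of "%_. LINT x|lborel. f x" _ _ _ "ball 0 1"])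
  fix s :: real assume s: "s : ball 0 1"
  have "k y * f (y + s *R v) = f (y + s *R v)" for y
  proof (cases "norm y <= r")
   case False
   have "norm y <= norm (y + s *R v) + norm (s *R v)" using norm_triangle_ineq4[of "y + s *R v" "s *R v"] by simp
   moreover have "norm (s *R v) <= norm v" using s by (simp add: mult_left_le_one_le)
   ultimately have "r0 < norm (y + s *R v)" using False by (simp add: r_def)
   then show ?thesis using r0 by simp
  qed (simp add: k1)
  moreover have "f : borel_measurable borel"
   using smooth_on_continuous_on[OF f(1)] borel_measurable_continuous_onI by blast
  ultimately show "(LINT x|lborel. f x) = (LINT y|lborel. k y * f (y + s *R v))"
   by (simp only: integral_translate)
 qed auto
 ultimately have "(%w. LINT y|lborel. k y * fder ?\<Phi> (0, y) (w, 0)) = (%w. 0)"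
  using has_derivative_unique by blast
 then have "(LINT y|lborel. k y * fder ?\<Phi> (0, y) (1, 0)) = 0" by metis
 moreover have "fder ?\<Phi> (0, y) (1, 0) = fder f y v" for y
 proof -
  have "((%z::real \<times> 'a. snd z + fst z *R v) has_derivative (%h. snd h + fst h *R v)) (at (0, y))"
   by (auto intro!: derivative_eq_intros)
  from diff_chain_at[OF this, of f "fder f y"]
  have "(?\<Phi> has_derivative (%h. fder f y (snd h + fst h *R v))) (at (0, y))"
   using smooth_on_has_derivative[OF f(1)] by (simp add: o_def)
  then show ?thesis by (simp add: fder_eqI)
 qed
 moreover have "k y * fder f y v = fder f y v" for y
 proof (cases "norm y <= r")
  case False
  then have "r0 < norm y" using norm_ge_zero[of v] abs_ge_self[of r0] unfolding r_def by linarith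
  moreover have "open {x::'a. r0 < norm x}" by (intro open_Collect_less continuous_intros)
  ultimately show ?thesis using fder_zero_outside[of "{x. r0 < norm x}" f y v] r0 by simp
 qed (simp add: k1)
 ultimately show ?thesis by simp
qed

section \<open>The ring of differential operators\<close>

text \<open>Bundling the smooth functions gives a commutative algebra on which differential
  operators form a ring, so that operator identities become ring computations.\<close>

typedef sm = "{f :: real^5 => real. smooth f}" morphisms Fn Sm
 by (intro exI[of _ "%_. 0"]) auto

setup_lifting type_definition_sm

lemma smooth_Fn [simp, intro]: "smooth (Fn f)"
 using Fn by simp

lemma cont_Fn [simp, intro]: "continuous_on UNIV (Fn f)"
 using smooth_on_continuous_on by blast

lemma Fn_Sm: "smooth f ==> Fn (Sm f) = f"
 by (simp add: Sm_inverse)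

instantiation sm :: "{comm_ring_1, real_algebra_1}"
begin
lift_definition zero_sm :: sm is "%x. 0" by simp
lift_definition one_sm :: sm is "%x. 1" by simp
lift_definition plus_sm :: "sm => sm => sm" is "%f g x. f x + g x" by (simp add: smooth_on_add)
lift_definition minus_sm :: "sm => sm => sm" is "%f g x. f x - g x" by (simp add: smooth_on_diff)
lift_definition uminus_sm :: "sm => sm" is "%f x. - f x" by (simp add: smooth_on_minus)
lift_definition times_sm :: "sm => sm => sm" is "%f g x. f x * g x" by (simp add: smooth_on_mult)
lift_definition scaleR_sm :: "real => sm => sm" is "%c f x. c * f x" by (simp add: smooth_on_cmult)
instance
 by standard (transfer; auto simp: algebra_simps fun_eq_iff)+
end

lifting_forget sm.lifting

lemmas Fn_simps [simp] = zero_sm.rep_eq one_sm.rep_eq plus_sm.rep_eq minus_sm.rep_eq uminus_sm.rep_eq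
 times_sm.rep_eq scaleR_sm.rep_eq

lemma Fn_sum [simp]: "Fn (SUM i:I. f i) x = (SUM i:I. Fn (f i) x)"
 by (induction I rule: infinite_finite_induct) auto

lemma Fn_power [simp]: "Fn (f ^ n) x = Fn f x ^ n"
 by (induction n) auto

lemma sm_eqI: "(!!x. Fn f x = Fn g x) ==> f = g"
 using Fn_inject by blast

definition bs :: "sm => bool" where "bs f \<longleftrightarrow> bsupp (Fn f)"

lemma bs_simps [simp]: "bs 0" "bs f ==> bs (f * g)" "bs g ==> bs (f * g)" "bs f ==> bs g ==> bs (f + g)"
  "bs f ==> bs (- f)" "bs f ==> bs (c *R f)" "bs f ==> bs g ==> bs (f - g)"
proof -
 show [simp]: "bs f ==> bs g ==> bs (f + g)" for f g
  by (simp add: bs_def bsupp_add plus_sm.rep_eq)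
 show [simp]: "bs f ==> bs (- f)" for f by (auto simp: bs_def bsupp_def)
 show "bs f ==> bs g ==> bs (f - g)" by (metis \<open>!!g f. bs f ==> bs g ==> bs (f + g)\<close> \<open>!!f. bs f ==> bs (- f)\<close> add_uminus_conv_diff)
qed (auto simp: bs_def bsupp_def)

lemma bs_sum [simp]: "(!!i. i : I ==> bs (f i)) ==> bs (SUM i:I. f i)"
 by (induction I rule: infinite_finite_induct) auto

definition ip :: "sm => sm => real" where
 "ip f g = (LINT x|lborel. Fn f x * Fn g x)"

lemma integrable_ip [simp, intro]: "bs f \<or> bs g ==> integrable lborel (%x. Fn f x * Fn g x)"
 unfolding bs_def by (intro integrable_bsupp continuous_on_mult cont_Fn) (auto intro: bsupp_mult1 bsupp_mult2)

lemma ip_commute: "ip f g = ip g f" by (simp add: ip_def mult.commute)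

lemma ip_add_left: "(bs f & bs f') \<or> bs g ==> ip (f + f') g = ip f g + ip f' g"
 unfolding ip_def by (subst Bochner_Integration.integral_add[symmetric]) (auto simp: distrib_right)

lemma ip_add_right: "(bs g & bs g') \<or> bs f ==> ip f (g + g') = ip f g + ip f g'"
 using ip_add_left[of g g' f] by (simp add: ip_commute)

lemma ip_scaleR_left [simp]: "ip (c *R f) g = c * ip f g"
 by (simp add: ip_def mult.assoc)

lemma ip_scaleR_right [simp]: "ip f (c *R g) = c * ip f g"
 by (simp add: ip_def mult.left_commute)

lemma ip_minus_left [simp]: "ip (- f) g = - ip f g"
 by (simp add: ip_def)

lemma ip_minus_right [simp]: "ip f (- g) = - ip f g"
 by (simp add: ip_def)

lemma ip_zero [simp]: "ip 0 g = 0" "ip f 0 = 0" by (simp_all add: ip_def)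

lemma ip_sum_left: "(ALL i:I. bs (f i)) \<or> bs g ==> ip (SUM i:I. f i) g = (SUM i:I. ip (f i) g)"
 by (induction I rule: infinite_finite_induct) (auto simp: ip_add_left)

lemma ip_sum_right: "(ALL i:I. bs (g i)) \<or> bs f ==> ip f (SUM i:I. g i) = (SUM i:I. ip f (g i))"
 using ip_sum_left[of I g f] by (simp add: ip_commute)

lemma ip_mult_move: "ip (h * f) g = ip f (h * g)"
 by (simp add: ip_def mult_ac)

lemma ip_nonneg [simp]: "ip f f >= 0"
 unfolding ip_def by (rule integral_nonneg_AE) auto

lemma ip_Cauchy_Schwarz:
 assumes "bs f" "bs g"
 shows "\<bar>ip f g\<bar> <= sqrt (ip f f) * sqrt (ip g g)"
proof -
 have q: "0 <= ip f f * t^2 + 2 * ip f g * t + ip g g" for t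
 proof -
  have "0 <= ip (t *R f + g) (t *R f + g)" by simp
  also have "... = ip f f * t^2 + 2 * ip f g * t + ip g g"
   using assms by (simp add: ip_add_left ip_add_right ip_commute[of g f] power2_eq_square algebra_simps)
  finally show ?thesis .
 qed
 have "(ip f g)^2 <= ip f f * ip g g"
 proof (cases "ip f f = 0")
  case True
  have "ip f g = 0"
  proof (rule ccontr)
   assume n: "ip f g ~= 0"
   \<comment> \<open>At this argument the quadratic form, which is affine because its leading
     coefficient vanishes, takes the value -1.\<close>
   then show False using q[of "- (ip g g + 1) / (2 * ip f g)"] True by simp
  qed
  then show ?thesis using True by simp
 next
  case False
  then have p: "ip f f > 0" using ip_nonneg[of f] by linarith
  have "0 <= ip f f * (ip f f * (- ip f g / ip f f)^2 + 2 * ip f g * (- ip f g / ip f f) + ip g g)"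
   using q[of "- ip f g / ip f f"] p by simp
  also have "... = ip f f * ip g g - (ip f g)^2"
   using p by (simp add: field_simps power2_eq_square)
  finally show ?thesis by simp
 qed
 from real_sqrt_le_mono[OF this] show ?thesis by (simp add: real_sqrt_mult[symmetric])
qed

section \<open>Local operators with formal adjoints\<close>

definition is_op :: "(sm => sm) \<times> (sm => sm) => bool" where
 "is_op PQ \<longleftrightarrow> (ALL P:{fst PQ, snd PQ}. (ALL f g. P (f + g) = P f + P g) & (ALL c f. P (c *R f) = c *R P f) &
   (ALL f U. open U --> (ALL x:U. Fn f x = 0) --> (ALL x:U. Fn (P f) x = 0))) &
  (ALL f g. bs f \<or> bs g --> ip f (fst PQ g) = ip (snd PQ f) g)"

text \<open>Local operators are carried along with their formal adjoints, so that passing to the adjoint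
  is an involution of a ring.\<close>

typedef dop = "{PQ. is_op PQ}"
 by (intro exI[of _ "(%f. f, %f. f)"]) (auto simp: is_op_def)

setup_lifting type_definition_dop

lift_definition act :: "dop => sm => sm" is fst .
lift_definition coact :: "dop => sm => sm" is snd .

text \<open>This is the reason for demanding locality: a composite of operators can be moved across
  the pairing factor by factor only if bounded supports are kept along the way.\<close>

lemma local_bs:
 assumes "!!f U. open U ==> (!!x. x : U ==> Fn f x = 0) ==> ALL x:U. Fn (P f) x = 0" "bs f"
 shows "bs (P f)"
proof -
 obtain r where "!!x. r < norm x ==> Fn f x = 0" using assms(2) by (auto simp: bs_def bsupp_def)
 then have "ALL x:{x::real^5. r < norm x}. Fn (P f) x = 0"
  by (intro assms(1)) (auto intro!: open_Collect_less continuous_intros)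
 then show ?thesis by (auto simp: bs_def bsupp_def)
qed

lemma is_op_bs: "is_op PQ ==> bs f ==> bs (fst PQ f) & bs (snd PQ f)"
 using local_bs[of "fst PQ" f] local_bs[of "snd PQ" f] by (simp add: is_op_def)

lemma is_opI:
 assumes "!!f g. P (f + g) = P f + P g" "!!c f. P (c *R f) = c *R P f"
  "!!f U x. open U ==> (!!x. x : U ==> Fn f x = 0) ==> x : U ==> Fn (P f) x = 0"
  "!!f g. Q (f + g) = Q f + Q g" "!!c f. Q (c *R f) = c *R Q f"
  "!!f U x. open U ==> (!!x. x : U ==> Fn f x = 0) ==> x : U ==> Fn (Q f) x = 0"
  "!!f g. bs f \<or> bs g ==> ip f (P g) = ip (Q f) g"
 shows "is_op (P, Q)"
 using assms by (simp add: is_op_def)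

lemma is_opD:
 assumes "is_op (P, Q)"
 shows "P (f + g) = P f + P g" "P (c *R f) = c *R P f"
  "open U ==> (!!x. x : U ==> Fn f x = 0) ==> x : U ==> Fn (P f) x = 0"
  "Q (f + g) = Q f + Q g" "Q (c *R f) = c *R Q f"
  "open U ==> (!!x. x : U ==> Fn f x = 0) ==> x : U ==> Fn (Q f) x = 0"
  "bs f \<or> bs g ==> ip f (P g) = ip (Q f) g"
  "bs f ==> bs (P f)" "bs f ==> bs (Q f)"
 using assms is_op_bs[OF assms] by (auto simp: is_op_def)

lemma is_op_plus:
 assumes "is_op (P, Q)" "is_op (P', Q')"
 shows "is_op (%f. P f + P' f, %f. Q f + Q' f)"
proof (rule is_opI)
 show "ip f (P g + P' g) = ip (Q f + Q' f) g" if "bs f \<or> bs g" for f g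
  using that assms by (subst ip_add_right, metis is_opD(8), subst ip_add_left, metis is_opD(9)) (simp add: is_opD(7))
qed (simp_all add: is_opD[OF assms(1)] is_opD[OF assms(2)] algebra_simps scaleR_add_right)

lemma is_op_comp:
 assumes "is_op (P, Q)" "is_op (P', Q')"
 shows "is_op (%f. P (P' f), %f. Q' (Q f))"
proof (rule is_opI)
 show "ip f (P (P' g)) = ip (Q' (Q f)) g" if "bs f \<or> bs g" for f g
  using that is_opD(7)[OF assms(1), of f "P' g"] is_opD(7)[OF assms(2), of "Q f" g]
   is_opD(8)[OF assms(2), of g] is_opD(9)[OF assms(1), of f] by auto
qed (simp_all add: is_opD[OF assms(1)] is_opD[OF assms(2)])

lemma is_op_scale: "is_op (P, Q) ==> is_op (%f. c *R P f, %f. c *R Q f)"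
 by (rule is_opI) (simp_all add: is_opD scaleR_add_right)

instantiation dop :: "{ring_1, real_algebra_1}"
begin
lift_definition zero_dop :: dop is "(%f. 0, %f. 0)" by (auto simp: is_op_def)
lift_definition one_dop :: dop is "(%f. f, %f. f)" by (auto simp: is_op_def)
lift_definition plus_dop :: "dop => dop => dop" is "%(P, Q) (P', Q'). (%f. P f + P' f, %f. Q f + Q' f)"
 using is_op_plus by fast
lift_definition uminus_dop :: "dop => dop" is "%(P, Q). (%f. (-1) *R P f, %f. (-1) *R Q f)"
 using is_op_scale by fast
lift_definition minus_dop :: "dop => dop => dop" is "%(P, Q) (P', Q'). (%f. P f + (-1) *R P' f, %f. Q f + (-1) *R Q' f)"
 using is_op_plus is_op_scale by fast
lift_definition times_dop :: "dop => dop => dop" is "%(P, Q) (P', Q'). (%f. P (P' f), %f. Q' (Q f))"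
 using is_op_comp by fast
lift_definition scaleR_dop :: "real => dop => dop" is "%c (P, Q). (%f. c *R P f, %f. c *R Q f)"
 using is_op_scale by fast
instance
proof
 show "(0::dop) ~= 1"
 proof transfer
  show "(%f::sm. 0::sm, %f::sm. 0::sm) ~= (%f. f, %f. f)"
   by (auto dest: fun_cong[of _ _ "1::sm"])
 qed
qed (transfer; auto simp: is_opD algebra_simps fun_eq_iff; fail)+
end

lift_definition dual :: "dop => dop" is "%(P, Q). (Q, P)"
 by (auto simp: is_op_def ip_commute)

lemma act_linear [simp]: "act D (f + g) = act D f + act D g" "act D (c *R f) = c *R act D f"
 by (transfer; auto simp: is_opD)+

lemma act_linear' [simp]: "act D 0 = 0" "act D (- f) = - act D f" "act D (f - g) = act D f - act D g"
proof -
 show "act D 0 = 0" using act_linear(2)[of D 0 0] by simp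
 show m: "act D (- f) = - act D f" for f using act_linear(2)[of D "-1" f] by simp
 show "act D (f - g) = act D f - act D g" using act_linear(1)[of D f "- g"] m by simp
qed

lemma act_sum [simp]: "act D (SUM i:I. f i) = (SUM i:I. act D (f i))"
 by (induction I rule: infinite_finite_induct) auto

lemma act_ring [simp]: "act 0 f = 0" "act 1 f = f" "act (D + E) f = act D f + act E f" "act (- D) f = - act D f"
  "act (D - E) f = act D f - act E f" "act (D * E) f = act D (act E f)" "act (c *R D) f = c *R act D f"
 by (transfer; auto)+

lemma act_sum_left [simp]: "act (SUM i:I. D i) f = (SUM i:I. act (D i) f)"
 by (induction I rule: infinite_finite_induct) auto

lemma dual_ring [simp]: "dual (dual D) = D" "dual 0 = 0" "dual 1 = 1" "dual (D + E) = dual D + dual E" "dual (- D) = - dual D"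
  "dual (D - E) = dual D - dual E" "dual (D * E) = dual E * dual D" "dual (c *R D) = c *R dual D"
 by (transfer; auto)+

lemma dual_sum [simp]: "dual (SUM i:I. D i) = (SUM i:I. dual (D i))"
 by (induction I rule: infinite_finite_induct) auto

lemma dual_power: "dual (D ^ n) = dual D ^ n"
 by (induction n) (auto simp: power_commutes)

lemma bs_act [simp]: "bs f ==> bs (act D f)"
 by transfer (auto simp: is_opD)

lemma ip_act: "bs f \<or> bs g ==> ip f (act D g) = ip (act (dual D) f) g"
 by transfer (auto simp: is_opD)

lemma act_zero_on: "open U ==> (!!x. x : U ==> Fn f x = 0) ==> x : U ==> Fn (act D f) x = 0"
 by transfer (auto simp: is_opD)

lemma act_cong_on:
 assumes "open U" "!!x. x : U ==> Fn f x = Fn g x" "x : U"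
 shows "Fn (act D f) x = Fn (act D g) x"
 using act_zero_on[OF assms(1), of "f - g" x D] assms by simp

lemma dop_eqI:
 assumes "!!f. act D f = act E f" "!!f. act (dual D) f = act (dual E) f"
 shows "D = E"
 using assms by (transfer) (auto simp: fun_eq_iff)

lift_definition mu :: "sm => dop" is "%h. (%f. h * f, %f. h * f)"
 by (rule is_opI) (auto simp: distrib_left ip_mult_move)

lemma act_mu [simp]: "act (mu h) f = h * f"
 by transfer simp

lemma dual_mu [simp]: "dual (mu h) = mu h"
 by transfer simp

lemma mu_ring: "mu (f * g) = mu f * mu g" "mu (f + g) = mu f + mu g" "mu (f - g) = mu f - mu g" "mu (- f) = - mu f" "mu 0 = 0" "mu 1 = 1"
 "mu (c *R f) = c *R mu f"
 by (rule dop_eqI; simp add: algebra_simps)+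

section \<open>Coordinate derivatives and invariant vector fields\<close>

definition dr :: "5 => sm => sm" where
 "dr i f = Sm (%x. fder (Fn f) x (axis i 1))"

lemma Fn_dr: "Fn (dr i f) x = fder (Fn f) x (axis i 1)"
 unfolding dr_def by (subst Fn_Sm) (auto intro: smooth_on_deriv)

lemma has_derivative_Fn: "(Fn f has_derivative fder (Fn f) x) (at x)"
 using smooth_on_has_derivative[OF smooth_Fn] by blast

lemma dr_mult: "dr i (f * g) = f * dr i g + dr i f * g"
 by (rule sm_eqI) (simp add: Fn_dr times_sm.rep_eq
  fder_eqI[OF has_derivative_mult[OF has_derivative_Fn has_derivative_Fn]])

lemma dr_add: "dr i (f + g) = dr i f + dr i g"
 by (rule sm_eqI) (simp add: Fn_dr plus_sm.rep_eq
  fder_eqI[OF has_derivative_add[OF has_derivative_Fn has_derivative_Fn]])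

lemma dr_const: "dr i (c *R 1) = 0"
 by (rule sm_eqI) (simp add: Fn_dr scaleR_sm.rep_eq frechet_derivative_const)

lemma dr_scaleR: "dr i (c *R f) = c *R dr i f"
 using dr_mult[of i "c *R 1" f] by (simp add: dr_const)

lemma dr_local: "open U ==> (!!x. x : U ==> Fn f x = 0) ==> x : U ==> Fn (dr i f) x = 0"
 by (simp add: Fn_dr fder_zero_outside)

lemma ip_dr:
 assumes "bs f \<or> bs g" shows "ip f (dr i g) = ip (- dr i f) g"
proof -
 have b: "bs f ==> bs (dr i f)" for f using local_bs[of "dr i" f] dr_local by blast
 have "bs (f * g)" using assms by auto
 then have "(LINT x|lborel. Fn (dr i (f * g)) x) = 0"
  unfolding Fn_dr bs_def by (intro integral_deriv_zero smooth_Fn)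
 then have "(LINT x|lborel. Fn f x * Fn (dr i g) x + Fn (dr i f) x * Fn g x) = 0"
  by (simp add: dr_mult)
 moreover have "(LINT x|lborel. Fn f x * Fn (dr i g) x + Fn (dr i f) x * Fn g x) = ip f (dr i g) + ip (dr i f) g"
  unfolding ip_def using assms b by (intro Bochner_Integration.integral_add integrable_ip) auto
 ultimately show ?thesis by simp
qed

lift_definition Pd :: "5 => dop" is "%i. (dr i, %f. - dr i f)"
 by (rule is_opI) (use dr_local in "auto simp: dr_add dr_scaleR ip_dr")

lemma act_Pd: "act (Pd i) f = dr i f"
 by transfer simp

lemma dual_Pd [simp]: "dual (Pd i) = - Pd i"
 by (rule dop_eqI; transfer; simp)

lemma Pd_commute: "Pd i * Pd j = Pd j * Pd i"
proof -
 have "dr i (dr j f) = dr j (dr i f)" for f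
  by (rule sm_eqI) (simp add: Fn_dr[abs_def] partial_derivatives_commute[OF open_UNIV smooth_Fn])
 then show ?thesis by (intro dop_eqI) (simp_all add: act_Pd)
qed

lemma Pd_mu: "Pd i * mu h = mu h * Pd i + mu (dr i h)"
 by (rule dop_eqI) (simp_all add: act_Pd dr_mult algebra_simps)

lemma field_commutator:
 "(mu f * Pd i) * (mu g * Pd j) - (mu g * Pd j) * (mu f * Pd i) = mu (f * dr i g) * Pd j - mu (g * dr j f) * Pd i"
proof -
 have "(mu f * Pd i) * (mu g * Pd j) = mu f * (Pd i * mu g) * Pd j" for f g i j by (simp add: mult.assoc)
 then have e: "(mu f * Pd i) * (mu g * Pd j) = mu (f * g) * Pd i * Pd j + mu (f * dr i g) * Pd j" for f g i j
  by (simp add: Pd_mu mu_ring distrib_left distrib_right mult.assoc)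
 show ?thesis unfolding e using Pd_commute[of i j] by (simp add: mult.commute[of g f] mult.assoc)
qed

definition co :: "5 => sm" where "co i = Sm (%x. x $ i)"

lemma Fn_co: "Fn (co i) = (%x. x $ i)"
 unfolding co_def by (rule Fn_Sm) (auto intro: smooth_on_bounded_linear bounded_linear_vec_nth)

lemma Fn_co_apply [simp]: "Fn (co i) x = x $ i"
 by (simp add: Fn_co)

lemma dr_co: "dr i (co j) = (if i = j then 1 else 0)"
proof (rule sm_eqI)
 fix x
 have "(Fn (co j) has_derivative (%x. x $ j)) (at x)"
  unfolding Fn_co by (rule bounded_linear_imp_has_derivative[OF bounded_linear_vec_nth])
 then show "Fn (dr i (co j)) x = Fn (if i = j then 1 else 0) x"
  by (simp add: Fn_dr fder_eqI axis_def)
qed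

lemma UNIV_5: "(UNIV :: 5 set) = {1, 2, 3, 4, 5}"
 by (rule sym, rule card_subset_eq) auto

lemma forall_5: "(ALL i::5. P i) \<longleftrightarrow> P 1 & P 2 & P 3 & P 4 & P 5"
 by (metis UNIV_5 UNIV_I insert_iff empty_iff)

definition Xf :: "5 => dop" where
 "Xf i = (if i = 1 then Pd 1
  else if i = 2 then Pd 2 + mu (co 1) * Pd 3 + mu ((1 / 2) *R (co 1 * co 1)) * Pd 4 + mu (co 1 * co 2) * Pd 5
  else if i = 3 then Pd 3 + mu (co 1) * Pd 4 + mu (co 2) * Pd 5
  else Pd i)"

text \<open>In these coordinates the right-invariant vector fields are as follows; they commute with all \<open>Xf i\<close>.\<close>

definition Yf :: "5 => dop" where
 "Yf i = (if i = 1 then Pd 1 + mu (co 2) * Pd 3 + mu (co 3) * Pd 4 + mu ((1 / 2) *R (co 2 * co 2)) * Pd 5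
  else if i = 2 then Pd 2 + mu (co 3) * Pd 5
  else Pd i)"

definition comm :: "dop => dop => dop" where "comm A B = A * B - B * A"

lemma comm_simps: "comm (A + B) C = comm A C + comm B C" "comm A (B + C) = comm A B + comm A C"
 "comm (mu f * Pd i) (mu g * Pd j) = mu (f * dr i g) * Pd j - mu (g * dr j f) * Pd i"
 "comm (Pd i) (mu g * Pd j) = mu (dr i g) * Pd j"
 "comm (mu g * Pd j) (Pd i) = - (mu (dr i g) * Pd j)"
 "comm (Pd i) (Pd j) = 0"
 using field_commutator[of f i g j] field_commutator[of 1 i g j] field_commutator[of g j 1 i] dr_const[of j 1] Pd_commute[of i j]
 by (simp_all add: comm_def algebra_simps mu_ring)

lemma Xf_commutators:
 "comm (Xf 1) (Xf 2) = Xf 3" "comm (Xf 1) (Xf 3) = Xf 4" "comm (Xf 2) (Xf 3) = Xf 5"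
 "comm (Xf 4) (Xf i) = 0" "comm (Xf 5) (Xf i) = 0"
 by (simp_all add: Xf_def comm_simps dr_co dr_mult dr_scaleR) (simp_all add: mu_ring)

lemma Yf_Xf_commute: "comm (Yf i) (Xf 1) = 0" "comm (Yf i) (Xf 2) = 0"
 by (simp_all add: Xf_def Yf_def comm_simps dr_co dr_mult dr_scaleR) (simp_all add: mu_ring)

lemma Xf_rules: "Xf 2 * Xf 1 = Xf 1 * Xf 2 - Xf 3" "Xf 3 * Xf 1 = Xf 1 * Xf 3 - Xf 4" "Xf 3 * Xf 2 = Xf 2 * Xf 3 - Xf 5"
 "Xf i * Xf 4 = Xf 4 * Xf i" "Xf i * Xf 5 = Xf 5 * Xf i"
 using Xf_commutators(1-3) Xf_commutators(4,5)[of i] by (simp_all add: comm_def algebra_simps)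

lemma dual_Xf [simp]: "dual (Xf i) = - Xf i"
 by (simp add: Xf_def Pd_mu dr_co dr_mult dr_scaleR) (simp add: mu_ring)

lemma act_Xf: "Fn (act (Xf i) f) x = fder (Fn f) x (vfield i x)"
proof -
 have l: "linear (fder (Fn f) x)"
  using linear_frechet_derivative[OF smooth_on_differentiable[OF smooth_Fn]] by blast
 have "i : {1,2,3,4,5}" using UNIV_5 by blast
 then show ?thesis
  by (auto simp: Xf_def vfield_def act_Pd Fn_dr linear_add[OF l] linear_scale[OF l] power2_eq_square)
qed

text \<open>Interprets the operator expressions of the statement in the ring of operators. There the
  formal adjoint is the involution \<open>dual\<close>, and the expressions obey genuine ring
  laws.\<close>

primrec opd :: "diffop => dop" where
 "opd (X i) = Xf i"
| "opd Null = 0"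
| "opd Ident = 1"
| "opd (Add P Q) = opd P + opd Q"
| "opd (Neg P) = - opd P"
| "opd (Comp P Q) = opd P * opd Q"
| "opd (Scale c P) = c *R opd P"

lemma Fn_act_opd: "Fn (act (opd D) f) = apply_op D (Fn f)"
proof (induction D arbitrary: f)
 case (Comp P Q)
 then show ?case by simp
qed (auto simp: act_Xf fun_eq_iff)

lemma opd_adj: "opd (adj D) = dual (opd D)"
 by (induction D) auto

section \<open>Homogeneous operators\<close>

definition wd :: "5 list => dop" where "wd w = prod_list (map Xf w)"

definition words :: "nat => 5 list set" where "words n = {w. set w <= {1, 2} & length w = n}"

text \<open>Only the horizontal letters 1 and 2 occur in words; the other fields enter as iterated
  brackets, of degrees 2, 3 and 3.\<close>

definition Hom :: "nat => dop set" where "Hom n = span (wd ` words n)"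

lemma wd_simps [simp]: "wd [] = 1" "wd (i # w) = Xf i * wd w" "wd (v @ w) = wd v * wd w"
 by (simp_all add: wd_def)

lemma finite_words [simp]: "finite (words n)"
 unfolding words_def using finite_lists_length_eq[of "{1,2::5}" n] by simp

lemma words_0 [simp]: "words 0 = {[]}" by (auto simp: words_def)

lemma words_1: "words (Suc 0) = {[1], [2]}"
 by (auto simp: words_def length_Suc_conv)

lemma words_split: "w : words (m + n) ==> EX u v. w = u @ v & u : words m & v : words n"
 by (rule exI[of _ "take m w"], rule exI[of _ "drop m w"])
  (auto simp: words_def dest: in_set_takeD in_set_dropD)

lemma words_append: "u : words m ==> v : words n ==> u @ v : words (m + n)"
 by (auto simp: words_def)

lemma Hom_subspace [simp]: "subspace (Hom n)" by (simp add: Hom_def)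

lemma Hom_closed [simp]: "0 : Hom n" "P : Hom n ==> Q : Hom n ==> P + Q : Hom n"
 "P : Hom n ==> Q : Hom n ==> P - Q : Hom n" "P : Hom n ==> - P : Hom n" "P : Hom n ==> c *R P : Hom n"
 by (simp_all add: subspace_0 subspace_add subspace_diff subspace_neg subspace_scale)

lemma Hom_sum: "(!!i. i : I ==> P i : Hom n) ==> (SUM i:I. P i) : Hom n"
 using subspace_sum[OF Hom_subspace] by blast

lemma wd_Hom [simp]: "w : words n ==> wd w : Hom n"
 by (simp add: Hom_def span_base)

lemma span_bilinear:
 assumes "P : span A" "Q : span B" "!!a b. a : A ==> b : B ==> a * b : S" "subspace S"
 shows "P * Q : (S :: 'a::real_algebra_1 set)"
proof -
 have 1: "a * Q : S" if "a : A" for a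
  using assms(2)
 proof (induction rule: span_induct)
  show "subspace {x. a * x : S}"
   using assms(4) by (auto simp: subspace_def distrib_left)
 qed (use assms(3) that in auto)
 show ?thesis
  using assms(1)
 proof (induction rule: span_induct)
  show "subspace {x. x * Q : S}"
   using assms(4) by (auto simp: subspace_def distrib_right)
 qed (use 1 in auto)
qed

lemma Hom_mult: "P : Hom m ==> Q : Hom n ==> P * Q : Hom (m + n)"
 unfolding Hom_def[of m] Hom_def[of n]
 by (rule span_bilinear[where A = "wd ` words m" and B = "wd ` words n"]) (auto simp flip: wd_simps(3) simp: words_append)

lemma Hom_mult': "P : Hom m ==> Q : Hom n ==> m + n = r ==> P * Q : Hom r"
 using Hom_mult by blast

lemma Hom_one [simp]: "1 : Hom 0" using wd_Hom[of "[]" 0] by simp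

lemma Hom_power: "P : Hom d ==> P ^ j : Hom (d * j)"
 by (induction j) (auto intro: Hom_mult')

text \<open>Splits a homogeneous operator at a prescribed degree, so that in a pairing the left part
  can be moved to the other argument and both arguments carry the intended number of
  derivatives.\<close>

lemma Hom_split_induct:
 assumes "P : Hom (m + n)" "subspace {x. Q x}" "!!u v. u : words m ==> v : words n ==> Q (wd u * wd v)"
 shows "Q P"
 using assms(1) unfolding Hom_def
proof (induction rule: span_induct)
 fix x assume "x : wd ` words (m + n)"
 then obtain u v where "x = wd (u @ v)" "u : words m" "v : words n" using words_split by fastforce
 then show "Q x" using assms(3) by simp
qed (use assms(2) in simp)

lemma Hom_induct:
 assumes "P : Hom n" "subspace {x. Q x}" "!!u. u : words n ==> Q (wd u)"
 shows "Q P"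
 using Hom_split_induct[of P n 0 Q] assms by simp

lemma dual_wd: "dual (wd w) = (- 1) ^ length w *R wd (rev w)"
 by (induction w) auto

lemma dual_Hom [simp]: "P : Hom n ==> dual P : Hom n"
proof (rule Hom_induct[of P n "%P. dual P : Hom n"])
 show "subspace {x. dual x : Hom n}" by (auto simp: subspace_def)
 fix u assume "u : words n"
 then have "rev u : words n" by (simp add: words_def)
 then show "dual (wd u) : Hom n" by (simp add: dual_wd)
qed

definition xdeg :: "5 => nat" where
 "xdeg i = (if i = 1 \<or> i = 2 then 1 else if i = 3 then 2 else 3)"

lemma xdeg_simps [simp]: "xdeg 1 = 1" "xdeg 2 = 1" "xdeg 3 = 2" "xdeg 4 = 3" "xdeg 5 = 3"
 by (simp_all add: xdeg_def)

lemma Xf_Hom: "Xf i : Hom (xdeg i)"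
proof -
 have 1: "Xf 1 : Hom 1" "Xf 2 : Hom 1"
  using wd_Hom[of "[1]" 1] wd_Hom[of "[2]" 1] by (simp_all add: words_def)
 then have 3: "Xf 3 : Hom 2"
  unfolding Xf_commutators(1)[symmetric] comm_def by (intro Hom_closed) (auto intro: Hom_mult')
 then have "Xf 4 : Hom 3" "Xf 5 : Hom 3"
  unfolding Xf_commutators(2,3)[symmetric] comm_def using 1 by (auto intro!: Hom_closed intro: Hom_mult')
 then show ?thesis using 1 3 forall_5[of "%i. Xf i : Hom (xdeg i)"] by simp
qed

text \<open>\<open>Id H n\<close> is the degree \<open>n\<close> part of the two-sided ideal generated by the fields \<open>Xf l\<close> with \<open>l \<in> H\<close>.\<close>

definition Id :: "5 set => nat => dop set" where
 "Id H n = span {wd u * Xf l * wd v | u l v. l : H & set u <= {1,2} & set v <= {1,2} & length u + xdeg l + length v = n}"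

lemma Id_subspace [simp]: "subspace (Id H n)" by (simp add: Id_def)

lemma Id_closed: "0 : Id H n" "P : Id H n ==> Q : Id H n ==> P + Q : Id H n"
 "P : Id H n ==> Q : Id H n ==> P - Q : Id H n" "P : Id H n ==> - P : Id H n" "P : Id H n ==> c *R P : Id H n"
 by (simp_all add: subspace_0 subspace_add subspace_diff subspace_neg subspace_scale)

lemma Id_mult_left: "P : Hom m ==> Z : Id H n ==> P * Z : Id H (m + n)"
proof -
 assume a: "P : Hom m" "Z : Id H n"
 show ?thesis
 proof (rule span_bilinear[OF a[unfolded Hom_def Id_def] _ Id_subspace], goal_cases)
  case (1 a b)
  then obtain u l v w where "b = wd u * Xf l * wd v" "l : H" "set u <= {1,2}" "set v <= {1,2}"
   "length u + xdeg l + length v = n" "a = wd w" "w : words m" by blast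
  then show ?case unfolding Id_def
   by (intro span_base CollectI exI[of _ "w @ u"] exI[of _ l] exI[of _ v]) (auto simp: mult.assoc words_def)
 qed
qed

lemma Id_mult_right: "Z : Id H n ==> P : Hom m ==> Z * P : Id H (n + m)"
proof -
 assume a: "Z : Id H n" "P : Hom m"
 show ?thesis
 proof (rule span_bilinear[OF a[unfolded Hom_def Id_def] _ Id_subspace], goal_cases)
  case (1 b a)
  then obtain u l v w where "b = wd u * Xf l * wd v" "l : H" "set u <= {1,2}" "set v <= {1,2}"
   "length u + xdeg l + length v = n" "a = wd w" "w : words m" by blast
  then show ?case unfolding Id_def
   by (intro span_base CollectI exI[of _ u] exI[of _ l] exI[of _ "v @ w"]) (auto simp: mult.assoc words_def)
 qed
qed

lemma Id_mult: "P : Hom m ==> Z : Id H n ==> Q : Hom r ==> m + n + r = s ==> P * Z * Q : Id H s"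
 using Id_mult_left Id_mult_right by blast

lemma Xf_Id: "l : H ==> Xf l : Id H (xdeg l)"
 unfolding Id_def by (intro span_base CollectI exI[of _ "[]"] exI[of _ l]) auto

text \<open>Bracketing with \<open>c\<close> is a derivation, so it is enough to commute with the
  two generators modulo the ideal.\<close>

lemma comm_Id:
 assumes "comm (Xf 1) c : Id H (1 + d)" "comm (Xf 2) c : Id H (1 + d)" "P : Hom n" "c : Hom d"
 shows "comm P c : Id H (n + d)"
proof (rule Hom_induct[OF assms(3)])
 have "comm (x + y) c = comm x c + comm y c" "comm (r *R x) c = r *R comm x c" for x y r
  by (simp_all add: comm_def algebra_simps)
 then show "subspace {x. comm x c : Id H (n + d)}"
  by (auto simp: subspace_def Id_closed) (simp add: comm_def Id_closed)
 fix u assume "u : words n"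
 then show "comm (wd u) c : Id H (n + d)"
 proof (induction u arbitrary: n)
  case Nil
  then show ?case by (auto simp: comm_def Id_closed words_def)
 next
  case (Cons i u)
  then obtain n' where n': "n = Suc n'" "u : words n'" "i = 1 \<or> i = 2" by (auto simp: words_def)
  have e: "comm (wd (i # u)) c = Xf i * comm (wd u) c + comm (Xf i) c * wd u"
   by (simp add: comm_def algebra_simps)
  have "Xf i * comm (wd u) c : Id H (n + d)"
   using Id_mult_left[OF Xf_Hom[of i] Cons.IH[OF n'(2)]] n' by auto
  moreover have "comm (Xf i) c * wd u : Id H (n + d)"
   using Id_mult_right[of "comm (Xf i) c" H "1 + d" "wd u" n'] assms n' by (auto simp: add_ac)
  ultimately show ?case unfolding e by (rule Id_closed(2))
 qed
qed

lemma comm_power_Id: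
 assumes "comm (Xf 1) c : Id H (1 + d)" "comm (Xf 2) c : Id H (1 + d)" "P : Hom n" "c : Hom d"
 shows "P * c ^ j - c ^ j * P : Id H (n + d * j)"
proof (induction j)
 case 0
 show ?case by (simp add: Id_closed)
next
 case (Suc j)
 have e: "P * c ^ Suc j - c ^ Suc j * P = (P * c ^ j - c ^ j * P) * c + c ^ j * comm P c"
  by (simp add: comm_def right_diff_distrib left_diff_distrib mult.assoc power_Suc2 del: power_Suc)
 have "(P * c ^ j - c ^ j * P) * c : Id H (n + d * Suc j)"
  using Id_mult_right[OF Suc assms(4)] by (simp add: algebra_simps)
 moreover have "c ^ j * comm P c : Id H (n + d * Suc j)"
  using Id_mult_left[OF Hom_power[OF assms(4)] comm_Id[OF assms], of j] by (simp add: algebra_simps)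
 ultimately show ?case unfolding e by (rule Id_closed(2))
qed

section \<open>Maximal estimates\<close>

definition sq :: "sm => real" where "sq f = ip f f"

lemma sq_nonneg [simp]: "sq f >= 0" by (simp add: sq_def)

lemma sq_add_le: "bs f ==> bs g ==> sq (f + g) <= 2 * sq f + 2 * sq g"
proof -
 assume b: "bs f" "bs g"
 have "0 <= ip (f - g) (f - g)" by (rule ip_nonneg)
 then show ?thesis using b ip_add_left[of f g "f + g"] ip_add_left[of f "- g" "f - g"] ip_add_right[of f g f] ip_add_right[of f g g]
  ip_add_right[of f "- g" f] ip_add_right[of f "- g" g]
  unfolding sq_def by (simp add: ip_commute[of g f] del: ip_nonneg)
qed

lemma sq_scaleR: "sq (c *R f) = c^2 * sq f"
 by (simp add: sq_def power2_eq_square)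

lemma sq_zero [simp]: "sq 0 = 0" by (simp add: sq_def)

lemma ip_le_weighted:
 assumes "bs f" "bs g" "t > 0"
 shows "\<bar>ip f g\<bar> <= t * sq f + sq g / t"
proof -
 define a b where "a = sqrt t * sqrt (sq f)" and "b = sqrt (sq g) / sqrt t"
 have ab: "a >= 0" "b >= 0" using assms(3) by (simp_all add: a_def b_def)
 have "\<bar>ip f g\<bar> <= a * b"
  unfolding a_def b_def using ip_Cauchy_Schwarz[OF assms(1,2)] assms(3) by (simp add: sq_def)
 also have "... <= a^2 + b^2"
  using sum_squares_bound[of a b] mult_nonneg_nonneg[OF ab] by linarith
 also have "... = t * sq f + sq g / t"
  unfolding a_def b_def using assms(3) by (simp add: power_mult_distrib power_divide)
 finally show ?thesis .
qed

definition hnorm :: "nat => sm => real" where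
 "hnorm n f = (SUM w:words n. sq (act (wd w) f))"

lemma hnorm_nonneg [simp]: "hnorm n f >= 0" by (simp add: hnorm_def sum_nonneg)

text \<open>The set of operators satisfying such a bound is a subspace. \<open>Q\<close> and
  \<open>F\<close> stay general because the argument is applied to horizontal words, to cutoff
  errors and to operators with cutoff coefficients.\<close>

lemma sq_bound_span:
 assumes "Z : span S" "!!x. x : S ==> EX C>=0. ALL f. Q f --> bs (act x f) & sq (act x f) <= C * F f"
 shows "EX C>=0. ALL f. Q f --> bs (act Z f) & sq (act Z f) <= C * F f"
 using assms(1)
proof (induction rule: span_induct)
 define P where "P Z C \<longleftrightarrow> 0 <= C & (ALL f. Q f --> bs (act Z f) & sq (act Z f) <= C * F f)" for Z C
 have "P 0 0" by (simp add: P_def)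
 moreover have "P (x + y) (2 * C + 2 * D)" if a: "P x C" "P y D" for x y C D
  unfolding P_def
 proof (intro conjI allI impI)
  fix f assume f: "Q f"
  have "sq (act (x + y) f) <= 2 * sq (act x f) + 2 * sq (act y f)" using sq_add_le a f by (simp add: P_def)
  also have "... <= 2 * (C * F f) + 2 * (D * F f)" using a f unfolding P_def by (intro add_mono mult_left_mono) auto
  finally show "sq (act (x + y) f) <= (2 * C + 2 * D) * F f" by (simp add: algebra_simps)
 qed (use a in "auto simp: P_def")
 moreover have "P (c *R x) (c^2 * C)" if "P x C" for x c C
  using that by (simp add: P_def sq_scaleR mult.assoc mult_left_mono)
 ultimately have "subspace {Z. EX C. P Z C}" unfolding subspace_def by blast
 then show "subspace {Z. EX C>=0. ALL f. Q f --> bs (act Z f) & sq (act Z f) <= C * F f}" unfolding P_def .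
qed (rule assms(2))

lemma hnorm_bound:
 assumes "P : Hom n"
 shows "EX C>=0. ALL f. bs f --> sq (act P f) <= C * hnorm n f"
proof -
 have "EX C>=0. ALL f. bs f --> bs (act P f) & sq (act P f) <= C * hnorm n f"
  by (rule sq_bound_span[OF assms[unfolded Hom_def]]) (auto simp: hnorm_def intro!: exI[of _ 1] member_le_sum)
 then show ?thesis by blast
qed

text \<open>A row \<open>(d, r)\<close> stands for the scalar operator \<open>u \<mapsto> \<Sum>b<N. r b (u b)\<close>, homogeneous of degree \<open>d\<close>.\<close>

definition rowact :: "nat => (nat => dop) => (nat => sm) => sm" where
 "rowact N r u = (SUM b<N. act (r b) (u b))"

locale estimate =
 fixes k N :: nat and rows :: "(nat \<times> (nat => dop)) set"
 assumes finite_rows: "finite rows"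
  and row_Hom: "(d, r) : rows ==> b < N ==> r b : Hom d"
  and row_le: "(d, r) : rows ==> d <= k"
begin

definition tv :: "(nat => sm) => bool" where "tv u \<longleftrightarrow> (ALL b<N. bs (u b))"

definition Nk :: "(nat => sm) => real" where "Nk u = (SUM b<N. hnorm k (u b))"

definition Rk :: "(nat => sm) => real" where "Rk u = (SUM (d, r):rows. hnorm (k - d) (rowact N r u))"

lemma Nk_nonneg [simp]: "Nk u >= 0" by (simp add: Nk_def sum_nonneg)
lemma tv_bs [simp]: "tv u ==> b < N ==> bs (u b)" by (simp add: tv_def)
lemma tv_row [simp]: "tv u ==> bs (rowact N r u)"
 unfolding rowact_def by (intro bs_sum) simp

text \<open>The quantities that can be absorbed. If \<open>Nk\<close> itself is small, the choice e
  = 1 / 2 gives the maximal estimate; \<open>Nk u\<close> is finite for every admissible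
  \<open>u\<close>, so the subtraction is legitimate.\<close>

definition small :: "((nat => sm) => real) => bool" where
 "small F \<longleftrightarrow> (ALL e>0. EX C>=0. ALL u. tv u --> \<bar>F u\<bar> <= e * Nk u + C * Rk u)"

lemma small_mono: "small F ==> (!!u. tv u ==> \<bar>G u\<bar> <= \<bar>F u\<bar>) ==> small G"
 unfolding small_def by (meson order_trans)

lemma small_cong: "small F ==> (!!u. tv u ==> G u = F u) ==> small G"
 by (rule small_mono) auto

lemma small_add: assumes "small F" "small G" shows "small (%u. F u + G u)"
 unfolding small_def
proof (intro allI impI)
 fix e :: real assume "e > 0"
 then obtain C D where *: "C >= 0" "D >= 0" "!!u. tv u ==> \<bar>F u\<bar> <= e / 2 * Nk u + C * Rk u" "!!u. tv u ==> \<bar>G u\<bar> <= e / 2 * Nk u + D * Rk u"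
  using assms unfolding small_def by (metis half_gt_zero)
 have "\<bar>F u + G u\<bar> <= e * Nk u + (C + D) * Rk u" if "tv u" for u
 proof -
  have "\<bar>F u + G u\<bar> <= (e / 2 * Nk u + C * Rk u) + (e / 2 * Nk u + D * Rk u)"
   using *(3,4)[OF that] abs_triangle_ineq[of "F u" "G u"] by linarith
  then show ?thesis by (simp add: algebra_simps)
 qed
 then show "EX C>=0. ALL u. tv u --> \<bar>F u + G u\<bar> <= e * Nk u + C * Rk u"
  using * by (intro exI[of _ "C + D"]) auto
qed

lemma small_cmult: assumes "small F" shows "small (%u. c * F u)"
proof (cases "c = 0")
 case True
 then show ?thesis by (auto simp: small_def intro!: exI[of _ 0])
next
 case False
 show ?thesis unfolding small_def
 proof (intro allI impI)
  fix e :: real assume "e > 0"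
  then have "e / \<bar>c\<bar> > 0" using False by simp
  then obtain C where *: "C >= 0" "!!u. tv u ==> \<bar>F u\<bar> <= e / \<bar>c\<bar> * Nk u + C * Rk u"
   using assms unfolding small_def by metis
  have "\<bar>c * F u\<bar> <= e * Nk u + (\<bar>c\<bar> * C) * Rk u" if "tv u" for u
  proof -
   have "\<bar>c\<bar> * \<bar>F u\<bar> <= \<bar>c\<bar> * (e / \<bar>c\<bar> * Nk u + C * Rk u)" using *(2)[OF that] by (rule mult_left_mono) simp
   also have "... = e * Nk u + (\<bar>c\<bar> * C) * Rk u" using False by (simp add: distrib_left)
   finally show ?thesis by (simp add: abs_mult)
  qed
  then show "EX C>=0. ALL u. tv u --> \<bar>c * F u\<bar> <= e * Nk u + C * Rk u"
   using * by (intro exI[of _ "\<bar>c\<bar> * C"]) auto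
 qed
qed

lemma small_zero: "small (%u. 0)"
 by (auto simp: small_def intro!: exI[of _ 0])

lemma small_sum: "(!!i. i : I ==> small (F i)) ==> small (%u. SUM i:I. F i u)"
 by (induction I rule: infinite_finite_induct) (auto intro: small_add small_zero)

lemma hnorm_le_Nk: "b < N ==> hnorm k (u b) <= Nk u"
 unfolding Nk_def by (rule member_le_sum) auto

lemma hnorm_le_Rk: "(d, r) : rows ==> hnorm (k - d) (rowact N r u) <= Rk u"
 unfolding Rk_def using member_le_sum[of "(d, r)" rows "%(d, r). hnorm (k - d) (rowact N r u)"] finite_rows by auto

lemma Hom_bound_Nk:
 assumes "P : Hom k" shows "EX C>0. ALL u b. tv u --> b < N --> sq (act P (u b)) <= C * Nk u"
proof -
 obtain C where C: "C >= 0" "!!f. bs f ==> sq (act P f) <= C * hnorm k f" using hnorm_bound[OF assms] by blast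
 have "sq (act P (u b)) <= (C + 1) * Nk u" if "tv u" "b < N" for u b
 proof -
  have "sq (act P (u b)) <= C * hnorm k (u b)" using C that by simp
  also have "... <= (C + 1) * Nk u" using C(1) hnorm_le_Nk[OF that(2), of u] by (intro mult_mono) auto
  finally show ?thesis .
 qed
 then show ?thesis using C(1) by (intro exI[of _ "C + 1"]) auto
qed

text \<open>One factor is only bounded by \<open>Nk\<close>. Young's inequality with weight t = e /
  (2 C) makes its share e / 2; the other factor must then be small with the sharper tolerance t e /
  2, as its contribution is divided by t.\<close>

lemma small_product:
 assumes F: "!!u. tv u ==> bs (F u)" "!!u. tv u ==> sq (F u) <= C * Nk u" "C > 0"
  and G: "!!u. tv u ==> bs (G u)" "small (%u. sq (G u))"
 shows "small (%u. ip (F u) (G u))"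
 unfolding small_def
proof (intro allI impI)
 fix e :: real assume e: "e > 0"
 define t where "t = e / (2 * C)"
 have t: "t > 0" "t * C = e / 2" using e F(3) by (auto simp: t_def)
 have "t * e / 2 > 0" using t e by simp
 from G(2)[unfolded small_def, rule_format, OF this]
 obtain D where D: "D >= 0" "!!u. tv u ==> \<bar>sq (G u)\<bar> <= (t * e / 2) * Nk u + D * Rk u"
  by blast
 then have D: "D >= 0" "!!u. tv u ==> sq (G u) <= (t * e / 2) * Nk u + D * Rk u"
  using abs_of_nonneg[OF sq_nonneg] by simp_all
 have "\<bar>ip (F u) (G u)\<bar> <= e * Nk u + D / t * Rk u" if u: "tv u" for u
 proof -
  have "\<bar>ip (F u) (G u)\<bar> <= t * sq (F u) + sq (G u) / t" using F(1) G(1) u t by (intro ip_le_weighted) auto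
  also have "... <= t * (C * Nk u) + ((t * e / 2) * Nk u + D * Rk u) / t"
   using F(2)[OF u] D(2)[OF u] t by (intro add_mono mult_left_mono divide_right_mono) auto
  also have "... = (t * C) * Nk u + e / 2 * Nk u + D / t * Rk u" using t(1) by (simp add: field_simps)
  finally show ?thesis by (simp add: t(2))
 qed
 then show "EX C>=0. ALL u. tv u --> \<bar>ip (F u) (G u)\<bar> <= e * Nk u + C * Rk u"
  using D(1) t(1) by (intro exI[of _ "D / t"]) auto
qed

text \<open>Of the 2k - d derivatives in \<open>Q\<close>, k are moved to \<open>u a\<close>, where
  they are bounded by \<open>Nk\<close>; the remaining k - d act on the row and are counted in
  \<open>Rk\<close>.\<close>

lemma small_row:
 assumes "(d, r) : rows" "a < N" "Q : Hom (2 * k - d)"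
 shows "small (%u. ip (u a) (act Q (rowact N r u)))"
proof -
 have q: "Q : Hom (k + (k - d))" using assms(3) row_le[OF assms(1)] by (simp add: mult_2)
 show ?thesis
 proof (rule Hom_split_induct[OF q])
  have "small (%u. ip (u a) (act (x + y) (rowact N r u)))"
   if "small (%u. ip (u a) (act x (rowact N r u)))" "small (%u. ip (u a) (act y (rowact N r u)))" for x y
   by (rule small_cong[OF small_add[OF that]]) (simp add: ip_add_right assms(2))
  moreover have "small (%u. ip (u a) (act (c *R x) (rowact N r u)))"
   if "small (%u. ip (u a) (act x (rowact N r u)))" for x c
   by (rule small_cong[OF small_cmult[OF that, of c]]) simp
  ultimately show "subspace {Q. small (%u. ip (u a) (act Q (rowact N r u)))}"
   by (auto simp: subspace_def small_zero)
  fix v w assume vw: "v : words k" "w : words (k - d)"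
  obtain C where C: "C > 0" "!!u. tv u ==> sq (act (dual (wd v)) (u a)) <= C * Nk u"
   using Hom_bound_Nk[OF dual_Hom[OF wd_Hom[OF vw(1)]]] assms(2) by blast
  have "small (%u. sq (act (wd w) (rowact N r u)))"
   unfolding small_def
  proof (intro allI impI exI[of _ 1] conjI)
   fix e :: real and u assume "e > 0" "tv u"
   have "sq (act (wd w) (rowact N r u)) <= hnorm (k - d) (rowact N r u)"
    unfolding hnorm_def using vw(2) by (intro member_le_sum) auto
   also have "... <= Rk u" using hnorm_le_Rk[OF assms(1)] .
   moreover have "e * Nk u >= 0" using \<open>e > 0\<close> by simp
   ultimately show "\<bar>sq (act (wd w) (rowact N r u))\<bar> <= e * Nk u + 1 * Rk u"
    using sq_nonneg[of "act (wd w) (rowact N r u)"] by linarith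
  qed simp
  then have "small (%u. ip (act (dual (wd v)) (u a)) (act (wd w) (rowact N r u)))"
   using C assms(2) by (intro small_product[where C = C]) auto
  then show "small (%u. ip (u a) (act (wd v * wd w) (rowact N r u)))"
   by (rule small_cong) (simp add: ip_act assms(2))
 qed
qed

definition neg :: "dop => bool" where
 "neg Z \<longleftrightarrow> (ALL a<N. ALL b<N. small (%u. ip (u a) (act Z (u b))))"

lemma neg_subspace: "subspace {Z. neg Z}"
proof -
 have "neg (x + y)" if "neg x" "neg y" for x y
  unfolding neg_def
 proof (intro allI impI)
  fix a b assume ab: "a < N" "b < N"
  have "small (%u. ip (u a) (act x (u b)) + ip (u a) (act y (u b)))"
   using that ab by (intro small_add) (simp_all add: neg_def)
  then show "small (%u. ip (u a) (act (x + y) (u b)))"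
   by (rule small_cong) (simp add: ip_add_right ab)
 qed
 moreover have "neg (c *R x)" if "neg x" for x c
  using that small_cmult by (auto simp: neg_def)
 ultimately show ?thesis by (auto simp: subspace_def neg_def small_zero)
qed

lemma neg_diff: "neg x ==> neg (y - x) ==> neg y"
 using subspace_add[OF neg_subspace, of x "y - x"] by simp

text \<open>Operators of degree 2k are judged by pairings (\<open>neg\<close>), those of degree k by
  norms. \<open>gdI\<close> and \<open>neg_mult_gd\<close> lead from one notion to the
  other.\<close>

definition gd :: "dop => bool" where
 "gd P \<longleftrightarrow> P : Hom k & (ALL a<N. small (%u. sq (act P (u a))))"

lemma gdI: "P : Hom k ==> neg (dual P * P) ==> gd P"
 unfolding gd_def neg_def sq_def
proof (intro conjI allI impI)
 fix a assume "ALL a<N. ALL b<N. small (%u. ip (u a) (act (dual P * P) (u b)))" "a < N"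
 then have "small (%u. ip (u a) (act (dual P * P) (u a)))" by blast
 then show "small (%u. ip (act P (u a)) (act P (u a)))"
  by (rule small_cong) (use \<open>a < N\<close> in \<open>simp add: ip_act[of _ "act P _" "dual P"]\<close>)
qed

lemma gd_subspace: "subspace {P. gd P}"
proof -
 have "gd (x + y)" if "gd x" "gd y" for x y
  unfolding gd_def
 proof (intro conjI allI impI)
  fix a assume a: "a < N"
  have "small (%u. 2 * sq (act x (u a)) + 2 * sq (act y (u a)))"
   using that a by (intro small_add small_cmult) (auto simp: gd_def)
  then show "small (%u. sq (act (x + y) (u a)))"
   by (rule small_mono) (use a sq_add_le in auto)
 qed (use that in "auto simp: gd_def")
 moreover have "gd (c *R x)" if "gd x" for x c
  using that small_cmult by (auto simp: gd_def sq_scaleR)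
 ultimately show ?thesis by (auto simp: subspace_def gd_def small_zero)
qed

lemma neg_mult_gd: assumes "Q : Hom k" "gd P" shows "neg (Q * P)"
 unfolding neg_def
proof (intro allI impI)
 fix a b assume ab: "a < N" "b < N"
 obtain C where C: "C > 0" "!!u. tv u ==> sq (act (dual Q) (u a)) <= C * Nk u"
  using Hom_bound_Nk[OF dual_Hom[OF assms(1)]] ab(1) by blast
 have "small (%u. ip (act (dual Q) (u a)) (act P (u b)))"
  using C assms(2) ab by (intro small_product[where C = C]) (auto simp: gd_def)
 then show "small (%u. ip (u a) (act (Q * P) (u b)))"
  by (rule small_cong) (simp add: ip_act ab)
qed

text \<open>Pairings of total degree 2k may be computed modulo the ideal generated by the fields of
  a handled set.\<close>

definition handled :: "5 set => bool" where
 "handled H \<longleftrightarrow> (ALL Z:Id H (2 * k). neg Z)"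

lemma handled_empty: "handled {}"
 unfolding handled_def Id_def using subspace_0[OF neg_subspace] by simp

lemma neg_factor_gd:
 assumes "P : Hom (k + j)" "!!v. v : words j ==> gd (wd v * c)"
 shows "neg (P * c)"
proof (rule Hom_split_induct[OF assms(1), of "%P. neg (P * c)"])
 show "subspace {x. neg (x * c)}"
  using neg_subspace by (auto simp: subspace_def distrib_right)
 show "neg (wd u * wd v * c)" if "u : words k" "v : words j" for u v
  using neg_mult_gd[OF wd_Hom[OF that(1)] assms(2)[OF that(2)]] by (simp add: mult.assoc)
qed

text \<open>Once a pure power of the field \<open>c\<close> is negligible, so is every word containing \<open>c\<close>: moving
  half of the factors across, \<open>\<parallel>P c\<^sup>j u\<parallel>\<^sup>2\<close> is up to commutators the pairing of \<open>u\<close> with \<open>P* P c\<^sup>2\<^sup>j u\<close>.\<close>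

lemma gd_powers:
 assumes H: "handled H" and c: "comm (Xf 1) c : Id H (1 + d)" "comm (Xf 2) c : Id H (1 + d)" "c : Hom d" "dual c = - c"
  and k: "k = d * m + p" and pure: "!!w. w : words p ==> gd (wd w * c ^ m)"
  and j: "1 <= j" "j <= m" and P: "P : Hom (k - d * j)"
 shows "gd (P * c ^ j)"
 using j P
proof (induction "m - j" arbitrary: j P rule: less_induct)
 case less
 show ?case
 proof (cases "j = m")
  case True
  have "gd (x * c ^ m)" if "x : Hom p" for x
   by (rule Hom_induct[OF that])
    (use gd_subspace pure in "auto simp: subspace_def distrib_right")
  then show ?thesis using less.prems k True by simp
 next
  case False
  then have jm: "j < m" using less.prems by simp
  have dj: "d * j <= d * m" using jm by simp
  have PP: "dual P * P : Hom (2 * k - 2 * d * j)"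
   using dj k by (intro Hom_mult'[OF dual_Hom[OF less.prems(3)] less.prems(3)]) (simp add: diff_mult_distrib2 mult_ac)
  have cj: "c ^ j : Hom (d * j)" using Hom_power[OF c(3)] .
  have Pc: "P * c ^ j : Hom k"
   using dj k by (intro Hom_mult'[OF less.prems(3) cj]) linarith
  \<comment> \<open>For 2j at most m the doubled power is closer to m than j, so the induction
    hypothesis applies to it. Beyond m the factor \<open>c ^ m\<close> splits off on the right and
    the surplus powers join the left factor.\<close>
  have n: "neg (dual P * P * c ^ (2 * j))"
  proof (cases "2 * j <= m")
   case True
   have d2j: "2 * d * j <= d * m" using mult_le_mono2[OF True, of d] by (simp add: mult_ac)
   show ?thesis
   proof (rule neg_factor_gd[of _ "k - d * (2 * j)"])
    show "dual P * P : Hom (k + (k - d * (2 * j)))"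
    proof -
     have "2 * k - 2 * d * j = k + (k - 2 * d * j)" using d2j k by linarith
     then show ?thesis using PP by (simp add: mult_ac)
    qed
    show "gd (wd v * c ^ (2 * j))" if "v : words (k - d * (2 * j))" for v
     using less.prems jm True that by (intro less.hyps) auto
   qed
  next
   case False
   have e: "2 * d * j = d * (2 * j - m) + d * m"
    using False by (simp add: diff_mult_distrib2 mult_ac)
   have "neg (dual P * P * c ^ (2 * j - m) * c ^ m)"
   proof (rule neg_factor_gd[of _ p])
    have dd: "d * m <= d * (2 * j)" "d * (2 * j) <= 2 * (d * m)" using False jm by simp_all
    show "dual P * P * c ^ (2 * j - m) : Hom (k + p)"
    proof (rule Hom_mult'[OF PP Hom_power[OF c(3)]])
     have "d * (2 * j - m) = 2 * d * j - d * m" "2 * d * j = d * (2 * j)"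
      by (simp_all add: diff_mult_distrib2 mult_ac)
     then show "2 * k - 2 * d * j + d * (2 * j - m) = k + p" using dd k by linarith
    qed
   qed (rule pure)
   moreover have "c ^ (2 * j - m) * c ^ m = c ^ (2 * j)" using False by (simp flip: power_add)
   ultimately show ?thesis by (simp add: mult.assoc)
  qed
  have "(dual P * P) * c ^ j - c ^ j * (dual P * P) : Id H ((2 * k - 2 * d * j) + d * j)"
   by (rule comm_power_Id[OF c(1,2) PP c(3)])
  from Id_mult_right[OF this cj]
  have "((dual P * P) * c ^ j - c ^ j * (dual P * P)) * c ^ j : Id H (2 * k)"
   using dj k by (simp add: add.assoc mult_ac)
  then have "neg (dual P * P * c ^ (2 * j) - c ^ j * dual P * P * c ^ j)"
   using H by (simp add: handled_def left_diff_distrib mult.assoc mult_2 power_add)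
  then have "neg (c ^ j * dual P * P * c ^ j)"
   using neg_diff[of "dual P * P * c ^ (2 * j)" "c ^ j * dual P * P * c ^ j"] n subspace_neg[OF neg_subspace] by fastforce
  moreover have "dual (P * c ^ j) * (P * c ^ j) = (- 1) ^ j *R (c ^ j * dual P * P * c ^ j)"
  proof -
   have "(- c) ^ j = (- 1) ^ j *R c ^ j" by (induction j) auto
   then show ?thesis by (simp add: dual_power c(4) mult.assoc)
  qed
  ultimately have "neg (dual (P * c ^ j) * (P * c ^ j))"
   using subspace_scale[OF neg_subspace] by simp
  then show ?thesis by (rule gdI[OF Pc])
 qed
qed

text \<open>A monomial containing \<open>Xf l\<close> becomes, modulo the ideal of \<open>H\<close>,
  one with \<open>Xf l\<close> at the right end. There \<open>gd_powers\<close>, used with a single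
  factor \<open>Xf l\<close>, makes it negligible.\<close>

lemma handled_insert:
 assumes H: "handled H" and c: "comm (Xf 1) (Xf l) : Id H (1 + xdeg l)" "comm (Xf 2) (Xf l) : Id H (1 + xdeg l)"
  and k: "k = xdeg l * m + p" "m >= 1" and pure: "!!w. w : words p ==> gd (wd w * Xf l ^ m)"
 shows "handled (insert l H)"
 unfolding handled_def
proof
 fix Z assume "Z : Id (insert l H) (2 * k)"
 then show "neg Z" unfolding Id_def
 proof (induction rule: span_induct)
  fix x assume "x : {wd u * Xf i * wd v | u i v. i : insert l H & set u <= {1,2} & set v <= {1,2} & length u + xdeg i + length v = 2 * k}"
  then obtain u i v where x: "x = wd u * Xf i * wd v" "i : insert l H" "set u <= {1,2}" "set v <= {1,2}" "length u + xdeg i + length v = 2 * k"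
   by auto
  show "neg x"
  proof (cases "i : H")
   case True
   then have "x : Id H (2 * k)" unfolding Id_def x(1) using x by (intro span_base) blast
   then show ?thesis using H by (simp add: handled_def)
  next
   case False
   then have i: "i = l" using x by simp
   have uv: "wd u : Hom (length u)" "wd v : Hom (length v)" using x by (auto intro!: wd_Hom simp: words_def)
   have "comm (wd v) (Xf l) : Id H (length v + xdeg l)"
    by (rule comm_Id[OF c uv(2) Xf_Hom])
   from Id_mult_left[OF uv(1) this] have "wd u * comm (wd v) (Xf l) : Id H (2 * k)"
    using x(5) i by (simp add: add_ac)
   then have n1: "neg (wd u * wd v * Xf l - x)" using H x(1) i by (simp add: handled_def comm_def algebra_simps)
   have dk: "xdeg l <= k" using k by (cases m) auto
   have "neg (wd u * wd v * Xf l)"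
   proof (rule neg_factor_gd[of _ "k - xdeg l"])
    show "wd u * wd v : Hom (k + (k - xdeg l))"
     using x(5) i dk by (intro Hom_mult'[OF uv]) simp
    show "gd (wd v * Xf l)" if "v : words (k - xdeg l)" for v
     using gd_powers[OF H c Xf_Hom dual_Xf k(1) pure, of 1 "wd v"] that k by simp
   qed
   from neg_diff[OF this, of x] show ?thesis using subspace_neg[OF neg_subspace] n1 by fastforce
  qed
 qed (rule neg_subspace)
qed

text \<open>Since k is at least 1, every \<open>dual (wd w) * wd w\<close> contains a letter 1 or 2
  and thus lies in the ideal of \<open>H\<close>. So each square in \<open>Nk\<close> is small, and
  half of \<open>Nk\<close> can be absorbed.\<close>

lemma maximal_estimate:
 assumes "handled H" "1 : H" "2 : H" "k >= 1"
 shows "EX C>=0. ALL u. tv u --> Nk u <= C * Rk u"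
proof -
 have "neg (dual (wd w) * wd w)" if w: "w : words k" for w
 proof -
  obtain i v where iv: "w = i # v" using assms(4) w by (cases w) (auto simp: words_def)
  have v: "set (rev w) <= {1,2}" "set v <= {1,2}" "i = 1 \<or> i = 2" "length (rev w) + xdeg i + length v = 2 * k"
   using w iv assms(4) by (auto simp: words_def)
  have "wd (rev w) * Xf i * wd v : Id H (2 * k)"
   unfolding Id_def using v assms(2,3) by (intro span_base) blast
  moreover have "dual (wd w) * wd w = (- 1) ^ length w *R (wd (rev w) * Xf i * wd v)"
   by (simp add: dual_wd iv mult.assoc)
  ultimately show ?thesis using assms(1) subspace_scale[OF neg_subspace] by (simp add: handled_def)
 qed
 then have "gd (wd w)" if "w : words k" for w using that by (intro gdI) auto
 then have "small (%u. Nk u)" unfolding Nk_def hnorm_def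
  by (intro small_sum) (auto simp: gd_def)
 then obtain C where C: "C >= 0" "!!u. tv u ==> Nk u <= 1 / 2 * Nk u + C * Rk u"
  unfolding small_def by (metis abs_of_nonneg Nk_nonneg half_gt_zero_iff zero_less_one)
 then have "Nk u <= (2 * C) * Rk u" if "tv u" for u using C(2)[OF that] by simp
 then show ?thesis using C(1) by (intro exI[of _ "2 * C"]) auto
qed

end

section \<open>Homotopies for the Rumin complex\<close>

definition ent :: "dop list list => nat => nat => dop" where "ent M i j = M ! i ! j"

text \<open>The differentials after rescaling the middle components in degrees 2 and 3, which removes
  the square roots.\<close>

definition dmat :: "nat => nat => nat => dop" where
 "dmat h = ent (
  if h = 0 then [[Xf 1], [Xf 2]]
  else if h = 1 then
   [[- (Xf 1 * Xf 1 * Xf 2) - Xf 1 * Xf 3 - Xf 4, Xf 1 * Xf 1 * Xf 1],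
   [- (Xf 1 * Xf 2 * Xf 2 + Xf 5), Xf 2 * Xf 1 * Xf 1 - Xf 4],
   [- (Xf 2 * Xf 2 * Xf 2), Xf 2 * Xf 2 * Xf 1 - Xf 2 * Xf 3 - Xf 5]]
  else if h = 2 then
   [[- (Xf 1 * Xf 2) - Xf 3, Xf 1 * Xf 1, 0],
   [- (Xf 2 * Xf 2), - 3 *R Xf 3, Xf 1 * Xf 1],
   [0, - (Xf 2 * Xf 2), Xf 2 * Xf 1 - Xf 3]]
  else
   [[(Xf 1 * Xf 2 + Xf 3) * Xf 2 - Xf 5, - (Xf 1 * Xf 1 * Xf 2) + Xf 4, Xf 1 * Xf 1 * Xf 1],
   [Xf 2 * Xf 2 * Xf 2, - (Xf 2 * Xf 2 * Xf 1 + Xf 5), Xf 2 * Xf 1 * Xf 1 - Xf 3 * Xf 1 + Xf 4]])"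

text \<open>The map \<open>Xf l ^ n\<close> is null homotopic modulo the ideal of \<open>H\<close>.
  Here \<open>nl\<close>, \<open>nh\<close> count the components in the neighbouring degrees and
  \<open>ol\<close>, \<open>oh\<close> are the orders of the incoming and outgoing differential;
  homogeneity then fixes the degrees of \<open>K\<close> and \<open>L\<close>.\<close>

definition homotopy :: "nat => nat => nat => nat => nat => (nat => nat => dop) => (nat => nat => dop) => 5 set => 5 => nat => bool" where
 "homotopy N nl nh ol oh dl dh H l n \<longleftrightarrow> ol <= xdeg l * n & oh <= xdeg l * n &
  (EX K L. (ALL c<nl. ALL b<N. K c b : Hom (xdeg l * n - ol)) & (ALL a<N. ALL c<nh. L a c : Hom (xdeg l * n - oh)) &
   (ALL a<N. ALL b<N. (if a = b then Xf l ^ n else 0) - (SUM c<nl. dl a c * K c b) - (SUM c<nh. L a c * dh c b) : Id H (xdeg l * n)))"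

lemma Hom_Xf_mult: "xdeg i <= r ==> P : Hom (r - xdeg i) ==> Xf i * P : Hom r"
 by (rule Hom_mult'[OF Xf_Hom]) auto

lemma Hom_Xf: "xdeg i = r ==> Xf i : Hom r"
 using Xf_Hom by auto

lemma Id_Xf_mult: "xdeg i <= r ==> P : Id H (r - xdeg i) ==> Xf i * P : Id H r"
 using Id_mult_left[OF Xf_Hom[of i], of P H "r - xdeg i"] by simp

lemma Id_Xf: "xdeg i = r ==> i : H ==> Xf i : Id H r"
 using Xf_Id by auto

lemma all_less_numerals: "(ALL i<1. P i) \<longleftrightarrow> P (0::nat)" "(ALL i<2. P i) \<longleftrightarrow> P (0::nat) & P 1" "(ALL i<3. P i) \<longleftrightarrow> P (0::nat) & P 1 & P 2"
proof -
 have "i < 1 \<longleftrightarrow> i = 0" "i < 2 \<longleftrightarrow> i = 0 \<or> i = 1" "i < 3 \<longleftrightarrow> i = 0 \<or> i = 1 \<or> i = 2" for i :: nat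
  by linarith+
 then show "(ALL i<1. P i) \<longleftrightarrow> P (0::nat)" "(ALL i<2. P i) \<longleftrightarrow> P (0::nat) & P 1"
  "(ALL i<3. P i) \<longleftrightarrow> P (0::nat) & P 1 & P 2" by auto
qed

lemma sum_less_numerals: "(SUM i<1. f i) = f (0::nat)" "(SUM i<2. f i) = f (0::nat) + f 1" "(SUM i<3. f i) = f (0::nat) + f 1 + (f 2::'a::comm_monoid_add)"
proof -
 have "{..<1} = {0::nat}" "{..<2} = {0, 1::nat}" "{..<3} = {0, 1, 2::nat}" by auto
 then show "(SUM i<1. f i) = f (0::nat)" "(SUM i<2. f i) = f (0::nat) + f 1"
  "(SUM i<3. f i) = f (0::nat) + f 1 + (f 2::'a::comm_monoid_add)" by (simp_all add: add.assoc)
qed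

text \<open>These rules and \<open>Xf_assoc\<close> rewrite products to increasing order of the
  indices, a Poincare-Birkhoff-Witt normal form. In that form the fields of high index stand at the
  right end, so membership in the ideal can be read off from the last factor by \<open>Id_Xf\<close>
  and \<open>Id_Xf_mult\<close>.\<close>

lemma Xf_sort: "Xf 2 * Xf 1 = Xf 1 * Xf 2 - Xf 3" "Xf 3 * Xf 1 = Xf 1 * Xf 3 - Xf 4" "Xf 3 * Xf 2 = Xf 2 * Xf 3 - Xf 5"
  "Xf 4 * Xf 1 = Xf 1 * Xf 4" "Xf 4 * Xf 2 = Xf 2 * Xf 4" "Xf 4 * Xf 3 = Xf 3 * Xf 4"
  "Xf 5 * Xf 1 = Xf 1 * Xf 5" "Xf 5 * Xf 2 = Xf 2 * Xf 5" "Xf 5 * Xf 3 = Xf 3 * Xf 5" "Xf 5 * Xf 4 = Xf 4 * Xf 5"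
 by (rule Xf_rules Xf_rules[symmetric])+

lemma Xf_assoc: "Xf 2 * (Xf 1 * P) = Xf 1 * (Xf 2 * P) - Xf 3 * P"
  "Xf 3 * (Xf 1 * P) = Xf 1 * (Xf 3 * P) - Xf 4 * P" "Xf 3 * (Xf 2 * P) = Xf 2 * (Xf 3 * P) - Xf 5 * P"
  "Xf 4 * (Xf 1 * P) = Xf 1 * (Xf 4 * P)" "Xf 4 * (Xf 2 * P) = Xf 2 * (Xf 4 * P)" "Xf 4 * (Xf 3 * P) = Xf 3 * (Xf 4 * P)"
  "Xf 5 * (Xf 1 * P) = Xf 1 * (Xf 5 * P)" "Xf 5 * (Xf 2 * P) = Xf 2 * (Xf 5 * P)" "Xf 5 * (Xf 3 * P) = Xf 3 * (Xf 5 * P)"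
  "Xf 5 * (Xf 4 * P) = Xf 4 * (Xf 5 * P)"
 by (simp_all add: mult.assoc[symmetric] Xf_sort left_diff_distrib)

lemma scaleR_3: "3 *R (v::'a::real_vector) = v + v + v"
 using scaleR_left_distrib[of 2 1 v] by (simp add: scaleR_2)

lemmas homotopy_simps = scaleR_2 scaleR_3 all_less_numerals sum_less_numerals dmat_def ent_def
 Hom_Xf_mult Hom_Xf Id_Xf_mult Id_Xf Id_closed mult.assoc Xf_assoc Xf_sort
 distrib_left distrib_right left_diff_distrib right_diff_distrib scaleR_right_distrib scaleR_right_diff_distrib
 power3_eq_cube power2_eq_square

lemma homotopyI:
 assumes "ol <= xdeg l * n & oh <= xdeg l * n & (ALL c<nl. ALL b<N. ent A c b : Hom (xdeg l * n - ol)) & (ALL a<N. ALL c<nh. ent B a c : Hom (xdeg l * n - oh)) &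
   (ALL a<N. ALL b<N. (if a = b then Xf l ^ n else 0) - (SUM c<nl. dl a c * ent A c b) - (SUM c<nh. ent B a c * dh c b) : Id H (xdeg l * n))"
 shows "homotopy N nl nh ol oh dl dh H l n"
 using assms unfolding homotopy_def by blast

section \<open>The explicit homotopies in degrees 1, 2 and 3\<close>

lemma homotopy_1_4: "homotopy 2 1 3 1 3 (dmat 0) (dmat 1) {} 4 1"
 by (rule homotopyI[where A = "[[- Xf 3 - Xf 1 * Xf 2, Xf 1 * Xf 1]]"
   and B = "[[- 1, 0, 0], [0, - 1, 0]]"]) (simp add: homotopy_simps)

lemma homotopy_1_5: "homotopy 2 1 3 1 3 (dmat 0) (dmat 1) {4} 5 1"
 by (rule homotopyI[where A = "[[- Xf 2 * Xf 2, - (2) *R (Xf 3) + Xf 1 * Xf 2]]"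
   and B = "[[0, - 1, 0], [0, 0, - 1]]"]) (simp add: homotopy_simps)

lemma homotopy_1_3: "homotopy 2 1 3 1 3 (dmat 0) (dmat 1) {4, 5} 3 2"
 by (rule homotopyI[where A = "[[- Xf 2 * Xf 3 - Xf 1 * Xf 2 * Xf 2, - Xf 1 * Xf 3 + Xf 1 * Xf 1 * Xf 2]]"
   and B = "[[Xf 2, - (2) *R (Xf 1), 0], [0, 0, - Xf 1]]"]) (simp add: homotopy_simps)

lemma homotopy_1_1: "homotopy 2 1 3 1 3 (dmat 0) (dmat 1) {3, 4, 5} 1 3"
 by (rule homotopyI[where A = "[[Xf 1 * Xf 1, 0]]"
   and B = "[[0, 0, 0], [1, 0, 0]]"]) (simp add: homotopy_simps)

lemma homotopy_1_2: "homotopy 2 1 3 1 3 (dmat 0) (dmat 1) {1, 3, 4, 5} 2 3"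
 by (rule homotopyI[where A = "[[0, Xf 2 * Xf 2]]"
   and B = "[[0, 0, - 1], [0, 0, 0]]"]) (simp add: homotopy_simps)

lemma homotopy_2_4: "homotopy 3 2 3 3 2 (dmat 1) (dmat 2) {} 4 1"
 by (rule homotopyI[where A = "[[- 1, 0, 0], [0, - 1, 0]]"
   and B = "[[Xf 1, 0, 0], [Xf 2, 0, 0], [0, Xf 2, - Xf 1]]"]) (simp add: homotopy_simps)

lemma homotopy_2_5: "homotopy 3 2 3 3 2 (dmat 1) (dmat 2) {4} 5 1"
 by (rule homotopyI[where A = "[[0, - 1, 0], [0, 0, - 1]]"
   and B = "[[- Xf 2, Xf 1, 0], [0, 0, Xf 1], [0, 0, Xf 2]]"]) (simp add: homotopy_simps)

lemma homotopy_2_3: "homotopy 3 2 3 3 2 (dmat 1) (dmat 2) {4, 5} 3 2"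
 by (rule homotopyI[where A = "[[Xf 2, - (2) *R (Xf 1), 0], [0, 0, - Xf 1]]"
   and B = "[[- Xf 3 - (2) *R (Xf 1 * Xf 2), Xf 1 * Xf 1, 0], [- Xf 2 * Xf 2, - Xf 3, Xf 1 * Xf 1], [0, - Xf 2 * Xf 2, - (3) *R (Xf 3) + (2) *R (Xf 1 * Xf 2)]]"]) (simp add: homotopy_simps)

lemma homotopy_2_1: "homotopy 3 2 3 3 2 (dmat 1) (dmat 2) {3, 4, 5} 1 3"
 by (rule homotopyI[where A = "[[0, 0, 0], [1, 0, 0]]"
   and B = "[[0, 0, 0], [Xf 1, 0, 0], [0, Xf 1, 0]]"]) (simp add: homotopy_simps)

lemma homotopy_2_2: "homotopy 3 2 3 3 2 (dmat 1) (dmat 2) {1, 3, 4, 5} 2 3"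
 by (rule homotopyI[where A = "[[0, 0, - 1], [0, 0, 0]]"
   and B = "[[0, - Xf 2, 0], [0, 0, - Xf 2], [0, 0, 0]]"]) (simp add: homotopy_simps)

lemma homotopy_3_4: "homotopy 3 3 2 2 3 (dmat 2) (dmat 3) {} 4 1"
 by (rule homotopyI[where A = "[[Xf 1, 0, 0], [Xf 2, 0, 0], [0, Xf 2, - Xf 1]]"
   and B = "[[0, 0], [1, 0], [0, 1]]"]) (simp add: homotopy_simps)

lemma homotopy_3_5: "homotopy 3 3 2 2 3 (dmat 2) (dmat 3) {4} 5 1"
 by (rule homotopyI[where A = "[[- Xf 2, Xf 1, 0], [0, 0, Xf 1], [0, 0, Xf 2]]"
   and B = "[[- 1, 0], [0, - 1], [0, 0]]"]) (simp add: homotopy_simps)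

lemma homotopy_3_3: "homotopy 3 3 2 2 3 (dmat 2) (dmat 3) {4, 5} 3 2"
 by (rule homotopyI[where A = "[[- Xf 3 - (2) *R (Xf 1 * Xf 2), Xf 1 * Xf 1, 0], [- Xf 2 * Xf 2, - Xf 3, Xf 1 * Xf 1], [0, - Xf 2 * Xf 2, (2) *R (Xf 1 * Xf 2) - (3) *R (Xf 3)]]"
   and B = "[[- Xf 1, 0], [- (2) *R (Xf 2), 0], [0, - Xf 2]]"]) (simp add: homotopy_simps)

lemma homotopy_3_1: "homotopy 3 3 2 2 3 (dmat 2) (dmat 3) {3, 4, 5} 1 3"
 by (rule homotopyI[where A = "[[0, 0, 0], [Xf 1, 0, 0], [0, Xf 1, 0]]"
   and B = "[[0, 0], [0, 0], [1, 0]]"]) (simp add: homotopy_simps)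

lemma homotopy_3_2: "homotopy 3 3 2 2 3 (dmat 2) (dmat 3) {1, 3, 4, 5} 2 3"
 by (rule homotopyI[where A = "[[0, - Xf 2, 0], [0, 0, - Xf 2], [0, 0, 0]]"
   and B = "[[0, 1], [0, 0], [0, 0]]"]) (simp add: homotopy_simps)

section \<open>The maximal estimate from homotopies\<close>

definition Bp :: "nat => dop" where "Bp p = (SUM w:words p. dual (wd w) * wd w)"

lemma Bp_Hom: "Bp p : Hom (2 * p)"
 unfolding Bp_def by (intro Hom_sum Hom_mult'[of _ p _ p]) auto

lemma dual_Bp [simp]: "dual (Bp p) = Bp p"
 by (simp add: Bp_def)

text \<open>A row of the codifferential, preceded by \<open>Bp p\<close>, which is the identity for
  p = 0 and -(X1^2 + X2^2) for p = 1. The weights account for the rescaled basis: the adjoint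
  belongs to the orthonormal basis, so passing to \<open>dmat\<close> and to rescaled components
  leaves the square of a scale factor.\<close>

definition lrow :: "(nat => real) => nat => (nat => nat => dop) => nat => nat => dop" where
 "lrow wt p dl c a = wt a *R (dual (dl a c) * Bp p)"

definition hrows :: "(nat => real) => nat => nat => nat => nat => nat => (nat => nat => dop) => (nat => nat => dop) => (nat \<times> (nat => dop)) set" where
 "hrows wt p nl nh ol oh dl dh = (%c. (ol + 2 * p, lrow wt p dl c)) ` {..<nl} \<union> (%c. (oh, dh c)) ` {..<nh}"

text \<open>The number 6 is the least common multiple of the weights 1, 2, 3 of the fields, so each
  of them has a power of degree exactly 6. The p further derivatives make room for
  \<open>Bp p\<close>.\<close>

locale homotopy_system =
 fixes N nl nh ol oh p k :: nat and wt :: "nat => real" and dl dh :: "nat => nat => dop"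
 assumes dl: "!!a c. a < N ==> c < nl ==> dl a c : Hom ol" and dh: "!!c b. c < nh ==> b < N ==> dh c b : Hom oh"
  and wt: "!!a. a < N ==> wt a > 0" and ord: "ol + 2 * p <= k" "oh <= k" and k: "k = 6 + p"
begin

sublocale estimate k N "hrows wt p nl nh ol oh dl dh"
proof
 show "finite (hrows wt p nl nh ol oh dl dh)" by (simp add: hrows_def)
 fix d r assume dr: "(d, r) : hrows wt p nl nh ol oh dl dh"
 then show "d <= k" using ord by (auto simp: hrows_def)
 fix b assume "b < N"
 then show "r b : Hom d" using dr
  by (auto simp: hrows_def dh lrow_def intro!: Hom_closed Hom_mult'[OF dual_Hom[OF dl] Bp_Hom])
qed

text \<open>With q + n = 2m the homotopy turns the pairing of \<open>u\<close> with
  \<open>x ^ q * Bp p * x ^ n\<close> applied to \<open>u\<close> into terms through rows and terms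
  in the ideal. Balancing the powers to \<open>x ^ m * Bp p * x ^ m\<close> costs only commutators.
  Up to the sign (-1)^m this operator is the sum over words of the adjoint of
  \<open>wd w * x ^ m\<close> times itself, so no cancellation can hide an individual
  square.\<close>

lemma pure_power:
 assumes H: "handled H" and c: "comm (Xf 1) (Xf l) : Id H (1 + xdeg l)" "comm (Xf 2) (Xf l) : Id H (1 + xdeg l)"
  and hom: "homotopy N nl nh ol oh dl dh H l n" and m: "k = xdeg l * m + p" "n <= 2 * m" and w: "w : words p"
 shows "gd (wd w * Xf l ^ m)"
proof -
 define d where "d = xdeg l"
 define x where "x = Xf l"
 have xH: "x : Hom d" unfolding x_def d_def by (rule Xf_Hom)
 have xp: "x ^ j : Hom (d * j)" for j using Hom_power[OF xH] .
 obtain K L where od: "ol <= d * n" "oh <= d * n" and K: "!!c b. c < nl ==> b < N ==> K c b : Hom (d * n - ol)"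
  and L: "!!a c. a < N ==> c < nh ==> L a c : Hom (d * n - oh)"
  and I: "!!a b. a < N ==> b < N ==> (if a = b then x ^ n else 0) - (SUM c<nl. dl a c * K c b) - (SUM c<nh. L a c * dh c b) : Id H (d * n)"
  using hom unfolding homotopy_def d_def x_def by blast
 define q where "q = 2 * m - n"
 let ?J = "%u Z a b. ip (u a :: sm) (act Z (u b))" and ?r = "%c u. rowact N (lrow wt p dl c) u"
 let ?C = "%a c. x ^ q * (Bp p * dl a c) - (Bp p * dl a c) * x ^ q" and ?B = "%a b c. Bp p * dl a c * x ^ q * K c b"
 have dq: "d * q + d * n = 2 * (d * m)" using m(2) by (simp add: q_def flip: distrib_left)
 have k2: "2 * k = d * q + d * n + 2 * p" using dq m(1) by (simp add: d_def)
 define E where "E a b = (if a = b then x ^ n else 0) - (SUM c<nl. dl a c * K c b) - (SUM c<nh. L a c * dh c b)" for a b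
 let ?F = "%a b. E a b + (SUM c<nl. dl a c * K c b) + (SUM c<nh. L a c * dh c b)"
 have BH: "Bp p : Hom (2 * p)" by (rule Bp_Hom)
 have sm_Id: "small (%u. ip (u a) (act Z (u b)))" if "Z : Id H (2 * k)" "a < N" "b < N" for Z a b
  using H that by (simp add: handled_def neg_def)
 have comm: "P * x ^ j - x ^ j * P : Id H (r + d * j)" if "P : Hom r" for P r j
  using comm_power_Id[OF c that Xf_Hom] by (simp add: x_def d_def)
 text \<open>Pair the homotopy identity with \<open>u\<close>: the part through \<open>dl\<close> is moved onto the left factor,
    where it becomes a row.\<close>
 have s1: "small (%u. SUM a<N. wt a * ?J u (x ^ q * Bp p * x ^ n) a a)"
 proof -
  have e1: "small (%u. SUM a<N. SUM b<N. wt a * ?J u (x ^ q * Bp p * E a b) a b)"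
  proof (intro small_sum small_cmult sm_Id)
   fix a b assume "a : {..<N}" "b : {..<N}"
   then have "E a b : Id H (d * n)" unfolding E_def using I by simp
   moreover have "x ^ q * Bp p : Hom (d * q + 2 * p)" by (intro Hom_mult xp BH)
   ultimately show "x ^ q * Bp p * E a b : Id H (2 * k)"
    using Id_mult_left[of "x ^ q * Bp p" "d * q + 2 * p" "E a b" H "d * n"] k2 by (simp add: add_ac)
  qed auto
  have e2: "small (%u. SUM a<N. SUM c<nh. wt a * ip (u a) (act (x ^ q * Bp p * L a c) (rowact N (dh c) u)))"
  proof (intro small_sum small_cmult small_row[where d = oh])
   fix a c assume ac: "a : {..<N}" "c : {..<nh}"
   then show "(oh, dh c) : hrows wt p nl nh ol oh dl dh" by (simp add: hrows_def)
   show "x ^ q * Bp p * L a c : Hom (2 * k - oh)"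
    using ac k2 od by (intro Hom_mult'[OF Hom_mult[OF xp BH] L]) auto
  qed auto
  have e3: "small (%u. SUM b<N. SUM c<nl. ip (u b) (act (dual (x ^ q * K c b)) (?r c u)))"
  proof (intro small_sum small_row[where d = "ol + 2 * p"])
   fix b c assume bc: "b : {..<N}" "c : {..<nl}"
   then show "(ol + 2 * p, lrow wt p dl c) : hrows wt p nl nh ol oh dl dh" by (simp add: hrows_def)
   show "dual (x ^ q * K c b) : Hom (2 * k - (ol + 2 * p))"
    using bc k2 od by (intro dual_Hom Hom_mult'[OF xp K]) auto
  qed auto
  have e4: "small (%u. SUM a<N. SUM b<N. SUM c<nl. wt a * ?J u (?C a c * K c b) a b)"
  proof (intro small_sum small_cmult sm_Id)
   fix a b c assume abc: "a : {..<N}" "b : {..<N}" "c : {..<nl}"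
   have "Bp p * dl a c : Hom (2 * p + ol)" using abc by (intro Hom_mult BH dl) auto
   from comm[OF this, of q] have "?C a c : Id H (2 * p + ol + d * q)"
    using Id_closed(4) by fastforce
   from Id_mult_right[OF this K[of c b]] abc
   show "?C a c * K c b : Id H (2 * k)"
    using k2 od by (simp add: add_ac)
  qed auto
  \<comment> \<open>The four groups are: the remainder of the homotopy, which lies in the ideal; the
    part through \<open>dh\<close>; the part through \<open>dl\<close>, transferred to the left
    argument; and the commutators caused by moving \<open>x ^ q\<close> past
    \<open>Bp p * dl a c\<close> before this transfer.\<close>
  have eq: "(SUM a<N. wt a * ?J u (x ^ q * Bp p * x ^ n) a a) =
   (SUM a<N. SUM b<N. wt a * ?J u (x ^ q * Bp p * E a b) a b) +
   (SUM a<N. SUM c<nh. wt a * ip (u a) (act (x ^ q * Bp p * L a c) (rowact N (dh c) u))) +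
   ((SUM b<N. SUM c<nl. ip (u b) (act (dual (x ^ q * K c b)) (?r c u))) +
   (SUM a<N. SUM b<N. SUM c<nl. wt a * ?J u (?C a c * K c b) a b))"
   if u: "tv u" for u
  proof -
   let ?T = "%a b. ?J u (x ^ q * Bp p * E a b) a b +
    (SUM c<nl. ?J u (?B a b c) a b + ?J u (?C a c * K c b) a b) +
    (SUM c<nh. ?J u (x ^ q * Bp p * (L a c * dh c b)) a b)"
   have 1: "ip (u a) (act (x ^ q * Bp p * L a c) (rowact N (dh c) u)) = (SUM b<N. ?J u (x ^ q * Bp p * (L a c * dh c b)) a b)"
    if "a < N" for a c
    using u that by (simp add: rowact_def ip_sum_right)
   have 2: "(SUM b<N. SUM c<nl. ip (u b) (act (dual (x ^ q * K c b)) (?r c u))) =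
    (SUM a<N. SUM b<N. SUM c<nl. wt a * ?J u (?B a b c) a b)"
   proof -
    have "ip (u b) (act (dual (x ^ q * K c b)) (?r c u)) =
     (SUM a<N. wt a * ?J u (?B a b c) a b)" if "b < N" for b c
    proof -
     have "ip (u b) (act (dual (x ^ q * K c b)) (?r c u)) = ip (?r c u) (act (x ^ q * K c b) (u b))"
      using u that by (subst ip_act) (auto simp: ip_commute)
     also have "... = (SUM a<N. ip (act (lrow wt p dl c a) (u a)) (act (x ^ q * K c b) (u b)))"
      unfolding rowact_def using u by (subst ip_sum_left) auto
     also have "... = (SUM a<N. wt a * ?J u (?B a b c) a b)"
     proof (rule sum.cong[OF refl])
      fix a assume "a : {..<N}"
      then show "ip (act (lrow wt p dl c a) (u a)) (act (x ^ q * K c b) (u b)) = wt a * ?J u (?B a b c) a b"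
       using u ip_act[of "u a" "act (x ^ q * K c b) (u b)" "Bp p * dl a c"] by (simp add: lrow_def mult.assoc)
     qed
     finally show ?thesis .
    qed
    then have "(SUM b<N. SUM c<nl. ip (u b) (act (dual (x ^ q * K c b)) (?r c u))) =
     (SUM b<N. SUM c<nl. SUM a<N. wt a * ?J u (?B a b c) a b)" by simp
    also have "... = (SUM b<N. SUM a<N. SUM c<nl. wt a * ?J u (?B a b c) a b)"
     by (intro sum.cong refl sum.swap)
    also have "... = (SUM a<N. SUM b<N. SUM c<nl. wt a * ?J u (?B a b c) a b)"
     by (rule sum.swap)
    finally show ?thesis .
   qed
   have 3: "?J u (x ^ q * Bp p * x ^ n) a a = (SUM b<N. ?J u (x ^ q * Bp p * ?F a b) a b)"
    if a: "a < N" for a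
   proof -
    have "(SUM b<N. ?J u (x ^ q * Bp p * ?F a b) a b) =
     (SUM b<N. if b = a then ?J u (x ^ q * Bp p * x ^ n) a a else 0)"
     by (intro sum.cong refl) (auto simp: E_def)
    then show ?thesis using a by simp
   qed
   have 4: "?J u (x ^ q * Bp p * ?F a b) a b =
    ?J u (x ^ q * Bp p * E a b) a b + (SUM c<nl. ?J u (x ^ q * Bp p * (dl a c * K c b)) a b) +
     (SUM c<nh. ?J u (x ^ q * Bp p * (L a c * dh c b)) a b)" if "a < N" "b < N" for a b
    using u that by (simp add: ip_add_right ip_sum_right)
   have 5: "?J u (x ^ q * Bp p * (dl a c * K c b)) a b =
    ?J u (?B a b c) a b + ?J u (?C a c * K c b) a b"
    if "a < N" "b < N" for a b c
    using u that by (subst ip_add_right[symmetric]) (auto simp: left_diff_distrib mult.assoc)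
   have "(SUM a<N. wt a * ?J u (x ^ q * Bp p * x ^ n) a a) =
    (SUM a<N. SUM b<N. wt a * ?T a b)"
   proof (rule sum.cong[OF refl])
    fix a assume "a : {..<N}"
    then have a: "a < N" by simp
    show "wt a * ?J u (x ^ q * Bp p * x ^ n) a a =
     (SUM b<N. wt a * ?T a b)"
     unfolding 3[OF a] sum_distrib_left[of "wt a" _ "{..<N}"]
    proof (rule sum.cong[OF refl])
     fix b assume "b : {..<N}"
     then have b: "b < N" by simp
     show "wt a * ?J u (x ^ q * Bp p * ?F a b) a b =
      wt a * ?T a b"
      unfolding 4[OF a b] 5[OF a b] ..
    qed
   qed
   also have "... = (SUM a<N. SUM b<N. wt a * ?J u (x ^ q * Bp p * E a b) a b) +
    (SUM a<N. SUM b<N. SUM c<nh. wt a * ?J u (x ^ q * Bp p * (L a c * dh c b)) a b) +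
    ((SUM a<N. SUM b<N. SUM c<nl. wt a * ?J u (?B a b c) a b) +
    (SUM a<N. SUM b<N. SUM c<nl. wt a * ?J u (?C a c * K c b) a b))"
    by (simp only: distrib_left sum.distrib sum_distrib_left add_ac)
   also have "(SUM a<N. SUM b<N. SUM c<nh. wt a * ?J u (x ^ q * Bp p * (L a c * dh c b)) a b) =
    (SUM a<N. SUM c<nh. wt a * ip (u a) (act (x ^ q * Bp p * L a c) (rowact N (dh c) u)))"
    by (intro sum.cong refl trans[OF sum.swap]) (simp only: 1 lessThan_iff sum_distrib_left)
   finally show ?thesis unfolding 2 .
  qed
  show ?thesis
   by (rule small_cong[OF small_add[OF small_add[OF e1 e2] small_add[OF e3 e4]] eq])
 qed
 \<comment> \<open>Equalizes the powers of \<open>x\<close> on both sides of \<open>Bp p\<close>.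
   The surplus sits on the left for n at most m and on the right otherwise; either way moving it
   across leaves a commutator in the ideal.\<close>
 have s2: "small (%u. SUM a<N. wt a * ?J u (x ^ m * Bp p * x ^ m - x ^ q * Bp p * x ^ n) a a)"
 proof (intro small_sum small_cmult sm_Id)
  have "x ^ m * Bp p * x ^ m - x ^ q * Bp p * x ^ n : Id H (2 * k)"
  proof (cases "n <= m")
   case True
   then have "q = (m - n) + m" "m = (m - n) + n" using m(2) by (auto simp: q_def)
   then have "x ^ q = x ^ m * x ^ (m - n)" "x ^ m = x ^ (m - n) * x ^ n"
    by (metis power_add add.commute)+
   then have "x ^ m * Bp p * x ^ m - x ^ q * Bp p * x ^ n = x ^ m * (Bp p * x ^ (m - n) - x ^ (m - n) * Bp p) * x ^ n"
    by (simp add: left_diff_distrib right_diff_distrib mult.assoc)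
   moreover have "d * m + (2 * p + d * (m - n)) + d * n = 2 * k"
    using mult_le_mono2[OF True, of d] m(1)[folded d_def] diff_mult_distrib2[of d m n] by linarith
   ultimately show ?thesis using Id_mult[OF xp comm[OF BH] xp] by metis
  next
   case False
   then have "m = q + (n - m)" "n = (n - m) + m" using m(2) by (auto simp: q_def)
   then have "x ^ m = x ^ q * x ^ (n - m)" "x ^ n = x ^ (n - m) * x ^ m"
    by (metis power_add)+
   then have "x ^ m * Bp p * x ^ m - x ^ q * Bp p * x ^ n = - (x ^ q * (Bp p * x ^ (n - m) - x ^ (n - m) * Bp p) * x ^ m)"
    by (simp add: left_diff_distrib right_diff_distrib mult.assoc)
   moreover have "d * q + (2 * p + d * (n - m)) + d * m = 2 * k"
    using mult_le_mono2[of m n d] False k2 dq diff_mult_distrib2[of d n m] by linarith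
   ultimately show ?thesis using Id_mult[OF xp comm[OF BH] xp] Id_closed(4) by metis
  qed
  then show "x ^ m * Bp p * x ^ m - x ^ q * Bp p * x ^ n : Id H (2 * k)" .
 qed auto
 have s3: "small (%u. SUM a<N. wt a * ?J u (x ^ m * Bp p * x ^ m) a a)"
  by (rule small_cong[OF small_add[OF s1 s2]])
   (auto simp: sum.distrib[symmetric] distrib_left[symmetric] ip_add_right[symmetric] intro!: sum.cong)
 have wp: "wd w * x ^ m : Hom k"
  using w m(1) by (intro Hom_mult'[OF wd_Hom xp]) (auto simp: d_def)
 moreover have "small (%u. sq (act (wd w * x ^ m) (u b)))" if b: "b < N" for b
 proof -
  have "small (%u. 1 / wt b * (SUM a<N. wt a * ?J u (x ^ m * Bp p * x ^ m) a a))"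
   by (rule small_cmult[OF s3])
  then show ?thesis
  proof (rule small_mono)
   fix u assume u: "tv u"
   have e: "?J u (x ^ m * Bp p * x ^ m) a a = (-1) ^ m * (SUM v:words p. sq (act (wd v * x ^ m) (u a)))" if "a < N" for a
   proof -
    have "dual (x ^ m) = (- 1) ^ m *R x ^ m"
    proof -
     have "(- x) ^ m = (- 1) ^ m *R x ^ m" by (induction m) auto
     then show ?thesis by (simp add: dual_power x_def)
    qed
    then have "act (x ^ m) f = (- 1) ^ m *R act (dual (x ^ m)) f" for f by simp
    then have "act (x ^ m * Bp p * x ^ m) (u a) = (- 1) ^ m *R (SUM v:words p. act (dual (wd v * x ^ m) * (wd v * x ^ m)) (u a))"
     by (simp add: Bp_def scaleR_sum_right)
    moreover have "?J u (dual (wd v * x ^ m) * (wd v * x ^ m)) a a = sq (act (wd v * x ^ m) (u a))" for v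
     using u that unfolding sq_def by (simp add: ip_act[of _ "act _ _" "dual (wd v)"] ip_act[of _ "act _ _" "dual (x ^ m)"])
    ultimately show ?thesis using u that by (simp add: ip_sum_right del: dual_ring act_ring)
   qed
   have "\<bar>SUM a<N. wt a * ?J u (x ^ m * Bp p * x ^ m) a a\<bar> = \<bar>(-1) ^ m * (SUM a<N. wt a * (SUM v:words p. sq (act (wd v * x ^ m) (u a))))\<bar>"
    unfolding sum_distrib_left[of "(- 1) ^ m"]
    by (rule arg_cong[where f = abs], rule sum.cong[OF refl]) (simp only: e lessThan_iff mult.left_commute)
   also have "... = (SUM a<N. wt a * (SUM v:words p. sq (act (wd v * x ^ m) (u a))))"
   proof -
    have "0 <= (SUM a<N. wt a * (SUM v:words p. sq (act (wd v * x ^ m) (u a))))"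
     using wt by (intro sum_nonneg mult_nonneg_nonneg) (auto intro: less_imp_le)
    then show ?thesis by (simp add: abs_mult power_abs)
   qed
   also have "... >= wt b * (SUM v:words p. sq (act (wd v * x ^ m) (u b)))"
    using b less_imp_le[OF wt] by (intro member_le_sum[where f = "%a. wt a * (SUM v:words p. sq (act (wd v * x ^ m) (u a)))"]) (auto intro!: mult_nonneg_nonneg sum_nonneg)
   also have "wt b * (SUM v:words p. sq (act (wd v * x ^ m) (u b))) >= wt b * sq (act (wd w * x ^ m) (u b))"
    using less_imp_le[OF wt[OF b]] w by (intro mult_left_mono member_le_sum) auto
   finally have "wt b * sq (act (wd w * x ^ m) (u b)) <= \<bar>SUM a<N. wt a * ?J u (x ^ m * Bp p * x ^ m) a a\<bar>" .
   then show "\<bar>sq (act (wd w * x ^ m) (u b))\<bar> <= \<bar>1 / wt b * (SUM a<N. wt a * ?J u (x ^ m * Bp p * x ^ m) a a)\<bar>"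
    using wt[OF b] by (simp add: abs_mult field_simps)
  qed
 qed
 ultimately show ?thesis by (simp add: gd_def x_def)
qed

text \<open>Each field commutes with X1 and X2 modulo the fields adjoined before it. The exponents
  2, 2, 3, 6, 6 are those for which the pure power has degree 6.\<close>

lemma system_estimate:
 assumes "homotopy N nl nh ol oh dl dh {} 4 1" "homotopy N nl nh ol oh dl dh {4} 5 1"
  "homotopy N nl nh ol oh dl dh {4, 5} 3 2" "homotopy N nl nh ol oh dl dh {3, 4, 5} 1 3"
  "homotopy N nl nh ol oh dl dh {1, 3, 4, 5} 2 3"
 shows "EX C>=0. ALL u. tv u --> Nk u <= C * Rk u"
proof -
 have z: "comm (Xf i) (Xf 4) = 0" "comm (Xf i) (Xf 5) = 0" "comm (Xf i) (Xf i) = 0" for i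
  using Xf_rules(4,5)[of i] by (simp_all add: comm_def)
 have s: "comm (Xf 2) (Xf 1) = - Xf 3" using Xf_commutators(1) by (simp add: comm_def Xf_sort)
 have h4: "handled {4}"
  using handled_insert[OF handled_empty, of 4 2] pure_power[OF handled_empty _ _ assms(1), of 2] k
  by (simp add: z Id_closed)
 have h5: "handled {4, 5}"
  using handled_insert[OF h4, of 5 2] pure_power[OF h4 _ _ assms(2), of 2] k
  by (simp add: z Id_closed insert_commute)
 have h3: "handled {3, 4, 5}"
  using handled_insert[OF h5, of 3 3] pure_power[OF h5 _ _ assms(3), of 3] k
  by (simp add: Xf_commutators Id_Xf)
 have h1: "handled {1, 3, 4, 5}"
  using handled_insert[OF h3, of 1 6] pure_power[OF h3 _ _ assms(4), of 6] k
  by (simp add: z s Id_Xf Id_closed)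
 have h2: "handled {2, 1, 3, 4, 5}"
  using handled_insert[OF h1, of 2 6] pure_power[OF h1 _ _ assms(5), of 6] k
  by (simp add: z Xf_commutators Id_Xf Id_closed)
 show ?thesis using k by (intro maximal_estimate[OF h2]) auto
qed

end

section \<open>Localization\<close>

definition derivation :: "dop => bool" where
 "derivation D \<longleftrightarrow> (ALL h. D * mu h = mu h * D + mu (act D h))"

lemma derivation_act: "derivation D ==> act D (h * f) = h * act D f + act D h * f"
proof -
 assume "derivation D"
 then have "D * mu h = mu h * D + mu (act D h)" by (simp add: derivation_def)
 from arg_cong[OF this, of "%E. act E f"] show ?thesis by simp
qed

lemma derivation_rules: "derivation (Pd i)" "derivation D ==> derivation E ==> derivation (D + E)"
  "derivation D ==> derivation (mu g * D)"
 by (auto simp: derivation_def Pd_mu act_Pd mu_ring algebra_simps)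
  (simp add: mult.assoc[symmetric] mu_ring[symmetric] mult.commute)

lemma derivation_Xf: "derivation (Xf i)"
 by (simp add: Xf_def derivation_rules)

text \<open>A derivative costs at most one power of the cutoff; only the existence of a smooth
  coefficient matters.\<close>

lemma derivation_power: "derivation D ==> EX c. act D (f ^ Suc e) = c * f ^ e"
proof (induction e)
 case 0
 then show ?case by auto
next
 case (Suc e)
 then obtain c where "act D (f ^ Suc e) = c * f ^ e" by blast
 then have "act D (f * f ^ Suc e) = (c + act D f) * f ^ Suc e"
  by (subst derivation_act[OF Suc.prems]) (simp add: algebra_simps)
 then show ?case by auto
qed

lemma mult_bounded:
 assumes "bs z" shows "EX M>=0. ALL f. sq (c * (z * f)) <= M * sq (z * f)"
proof -
 obtain r where r: "!!x. r < norm x ==> Fn z x = 0" using assms by (auto simp: bs_def bsupp_def)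
 have "compact ((%x. (Fn c x)^2) ` cball 0 r)"
  by (intro compact_continuous_image continuous_on_power continuous_on_subset[OF cont_Fn] compact_cball) auto
 from compact_imp_bounded[OF this]
 obtain M where M0: "ALL y:(%x. (Fn c x)^2) ` cball 0 r. norm y <= M"
  unfolding bounded_iff ..
 have M: "(Fn c x)^2 <= M" if "norm x <= r" for x
 proof -
  have "x : cball 0 r" using that by simp
  from M0[rule_format, OF imageI[OF this]] show ?thesis
   using abs_ge_self[of "(Fn c x)^2"] unfolding real_norm_def by linarith
 qed
 show ?thesis
 proof (intro exI[of _ "\<bar>M\<bar>"] conjI allI)
  fix f
  have b: "bs (z * f)" using assms by simp
  show "sq (c * (z * f)) <= \<bar>M\<bar> * sq (z * f)"
   unfolding sq_def ip_def integral_mult_right_zero[symmetric]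
  proof (rule integral_mono)
   show "integrable lborel (%x. Fn (c * (z * f)) x * Fn (c * (z * f)) x)" by (rule integrable_ip) (use b in auto)
   show "integrable lborel (%x. \<bar>M\<bar> * (Fn (z * f) x * Fn (z * f) x))" by (rule integrable_mult_right, rule integrable_ip) (use b in auto)
   fix x
   show "Fn (c * (z * f)) x * Fn (c * (z * f)) x <= \<bar>M\<bar> * (Fn (z * f) x * Fn (z * f) x)"
   proof (cases "norm x <= r")
    case True
    have "Fn (c * (z * f)) x * Fn (c * (z * f)) x = (Fn c x)^2 * (Fn (z * f) x * Fn (z * f) x)"
     by (simp add: power2_eq_square)
    also have "... <= \<bar>M\<bar> * (Fn (z * f) x * Fn (z * f) x)"
     using M[OF True] by (intro mult_right_mono) auto
    finally show ?thesis .
   qed (use r[of x] in auto)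
  qed
 qed auto
qed

section \<open>Commutators with cutoff functions\<close>

definition cutoff_errors :: "sm => nat => nat => dop set" where
 "cutoff_errors z i n = span {mu (c * z ^ (i - n + j)) * wd w | c j w. j < n & w : words j}"

lemma cutoff_errors_subspace: "subspace (cutoff_errors z i n)" by (simp add: cutoff_errors_def)

lemma cutoff_errorsI: "j < n ==> w : words j ==> e = i - n + j ==> mu (c * z ^ e) * wd w : cutoff_errors z i n"
 unfolding cutoff_errors_def by (intro span_base) blast

text \<open>Every derivative that falls on the cutoff removes one power of it together with one
  derivative of the argument; so an error with j < n derivatives still carries
  \<open>z ^ (i - n + j)\<close>.\<close>

lemma cutoff_commutator:
 assumes "P : Hom n" "n <= i"
 shows "P * mu (z ^ i) - mu (z ^ i) * P : cutoff_errors z i n"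
proof (rule Hom_induct[OF assms(1)])
 have "(x + y) * a - a * (x + y) = (x * a - a * x) + (y * a - a * y)" "(c *R x) * a - a * (c *R x) = c *R (x * a - a * x)"
  for x y a :: dop and c by (simp_all add: algebra_simps)
 then show "subspace {x. x * mu (z ^ i) - mu (z ^ i) * x : cutoff_errors z i n}"
  using cutoff_errors_subspace[of z i n] unfolding subspace_def by simp
 fix u assume "u : words n"
 then show "wd u * mu (z ^ i) - mu (z ^ i) * wd u : cutoff_errors z i n"
  using assms(2)
 proof (induction u arbitrary: n)
  case Nil
  then show ?case using subspace_0[OF cutoff_errors_subspace] by simp
 next
  case (Cons l u)
  then obtain m where m: "n = Suc m" "u : words m" "l = 1 \<or> l = 2" by (auto simp: words_def)
  define E where "E = wd u * mu (z ^ i) - mu (z ^ i) * wd u"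
  have E: "E : cutoff_errors z i m" unfolding E_def using Cons.IH[OF m(2)] Cons.prems(2) m(1) by simp
  have XE: "Xf l * E : cutoff_errors z i n"
   using E unfolding cutoff_errors_def[of z i m]
  proof (induction rule: span_induct)
   show "subspace {x. Xf l * x : cutoff_errors z i n}"
    using cutoff_errors_subspace[of z i n] by (auto simp: subspace_def distrib_left)
   fix x assume "x : {mu (c * z ^ (i - m + j)) * wd w |c j w. j < m & w : words j}"
   then obtain c j w where x: "x = mu (c * z ^ (i - m + j)) * wd w" "j < m" "w : words j" by blast
   obtain e where e: "i - m + j = Suc e" "e = i - n + j" using x(2) Cons.prems(2) m(1) by (cases "i - m + j") auto
   obtain c' where c': "act (Xf l) (z ^ Suc e) = c' * z ^ e" using derivation_power[OF derivation_Xf] by blast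
   have "act (Xf l) (c * z ^ Suc e) = (c * c' + act (Xf l) c * z) * z ^ e"
    unfolding derivation_act[OF derivation_Xf] c' by (simp add: algebra_simps)
   then have "Xf l * x = mu (c * z ^ Suc e) * wd (l # w) + mu ((c * c' + act (Xf l) c * z) * z ^ e) * wd w"
    using derivation_Xf[of l] unfolding x(1) e(1) derivation_def by (simp add: mult.assoc[symmetric] distrib_right)
   moreover have "mu (c * z ^ Suc e) * wd (l # w) : cutoff_errors z i n"
    using x m e Cons.prems(2) by (intro cutoff_errorsI[of "Suc j"]) (auto simp: words_def)
   moreover have "mu ((c * c' + act (Xf l) c * z) * z ^ e) * wd w : cutoff_errors z i n"
    using x m e by (intro cutoff_errorsI[of j]) auto
   ultimately show "Xf l * x : cutoff_errors z i n" using subspace_add[OF cutoff_errors_subspace] by simp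
  qed
  obtain e where e: "i = Suc e" using Cons.prems(2) m(1) by (cases i) auto
  obtain c' where c': "act (Xf l) (z ^ Suc e) = c' * z ^ e" using derivation_power[OF derivation_Xf] by blast
  have "mu (c' * z ^ e) * wd u : cutoff_errors z i n"
   using m e Cons.prems(2) by (intro cutoff_errorsI[of m]) auto
  moreover have "wd (l # u) * mu (z ^ i) - mu (z ^ i) * wd (l # u) = Xf l * E + mu (c' * z ^ e) * wd u"
  proof -
   have "Xf l * mu (z ^ i) = mu (z ^ i) * Xf l + mu (c' * z ^ e)"
    using derivation_Xf[of l] c' unfolding e derivation_def by simp
   then have "Xf l * mu (z ^ i) * wd u = (mu (z ^ i) * Xf l + mu (c' * z ^ e)) * wd u" by simp
   then show ?thesis by (simp add: E_def algebra_simps)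
  qed
  ultimately show ?case using XE subspace_add[OF cutoff_errors_subspace] by simp
 qed
qed

text \<open>The power of the cutoff grows with the order, which matches the errors of commuting with
  \<open>z ^ (k + 1)\<close> and the integration by parts in the interpolation. The shift j + 1
  keeps the support bounded even for j = 0.\<close>

definition znorm :: "sm => nat => sm => real" where
 "znorm z j f = (SUM w:words j. sq (z ^ (j + 1) * act (wd w) f))"

lemma znorm_nonneg [simp]: "znorm z j f >= 0" by (simp add: znorm_def sum_nonneg)

lemma cutoff_error_bound:
 assumes "bs z" "Z : cutoff_errors z (Suc k) k"
 shows "EX C>=0. ALL f. bs (act Z f) & sq (act Z f) <= C * (SUM j<k. znorm z j f)"
proof (rule sq_bound_span[where Q = "%_. True", simplified, OF assms(2)[unfolded cutoff_errors_def]])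
 fix x assume "x : {mu (c * z ^ (Suc k - k + j)) * wd w |c j w. j < k & w : words j}"
 then obtain c j w where x: "x = mu (c * z ^ (j + 1)) * wd w" "j < k" "w : words j"
  by (auto simp: Suc_diff_le)
 have bz: "bs (z ^ (j + 1))" using assms(1) by simp
 obtain M where M: "M >= 0" "!!f. sq (c * (z ^ (j + 1) * f)) <= M * sq (z ^ (j + 1) * f)" using mult_bounded[OF bz] by blast
 show "EX C>=0. ALL f. bs (act x f) & sq (act x f) <= C * (SUM j<k. znorm z j f)"
 proof (intro exI[of _ M] conjI allI)
  fix f
  show "bs (act x f)" using bz unfolding x(1) by simp
  have "sq (act x f) <= M * sq (z ^ (j + 1) * act (wd w) f)" using M(2)[of "act (wd w) f"] by (simp add: x(1) mult.assoc)
  also have "... <= M * znorm z j f"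
   unfolding znorm_def using M(1) x(3) by (intro mult_left_mono member_le_sum) auto
  also have "... <= M * (SUM j<k. znorm z j f)"
   using M(1) x(2) by (intro mult_left_mono member_le_sum) auto
  finally show "sq (act x f) <= M * (SUM j<k. znorm z j f)" .
 qed (rule M(1))
qed

text \<open>One integration by parts: \<open>z ^ (2 * j + 4)\<close> is the square of the weight of
  order j + 1 and also the product of the weights of orders j + 2 and j. The term in which the
  derivative falls on the cutoff is of the same kind. Repeating the leading letter of a word yields
  only some of the words of the next length, so their sum is at most the next norm.\<close>

lemma znorm_interpolation:
 assumes "bs z" "e > 0"
 shows "EX C>=0. ALL f. znorm z (Suc j) f <= e * znorm z (Suc (Suc j)) f + C * znorm z j f"
proof -
 have "EX C>=0. ALL g. sq (z ^ (j + 2) * act (Xf i) g) <= e * sq (z ^ (j + 3) * act (Xf i) (act (Xf i) g)) + C * sq (z ^ (j + 1) * g)" for i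
 proof -
  obtain c where c: "act (Xf i) (z ^ Suc (2 * j + 3)) = c * z ^ (2 * j + 3)" using derivation_power[OF derivation_Xf] by blast
  have bz: "bs (z ^ (j + 1))" "bs (z ^ (j + 2))" "bs (z ^ (j + 3))" using assms(1) by (simp_all add: numeral_eq_Suc)
  obtain M where M: "M >= 0" "!!f. sq (c * (z ^ (j + 1) * f)) <= M * sq (z ^ (j + 1) * f)" using mult_bounded[OF bz(1)] by blast
  show ?thesis
  proof (intro exI[of _ "4 / e + 4 * M"] conjI allI)
   show "0 <= 4 / e + 4 * M" using M assms by simp
   fix g
   define Xg XXg where "Xg = act (Xf i) g" and "XXg = act (Xf i) Xg"
   have split: "ip (a * b * f) h = ip (a * f) (b * h)" for a b f h by (simp add: ip_def mult_ac)
   have pw: "z ^ (2 * j + 4) = z ^ (j + 2) * z ^ (j + 2)" "z ^ (2 * j + 4) = z ^ (j + 3) * z ^ (j + 1)"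
    "z ^ (2 * j + 3) = z ^ (j + 2) * z ^ (j + 1)"
   proof -
    have "2 * j + 4 = (j + 2) + (j + 2)" "2 * j + 4 = (j + 3) + (j + 1)" "2 * j + 3 = (j + 2) + (j + 1)" by linarith+
    then show "z ^ (2 * j + 4) = z ^ (j + 2) * z ^ (j + 2)" "z ^ (2 * j + 4) = z ^ (j + 3) * z ^ (j + 1)"
     "z ^ (2 * j + 3) = z ^ (j + 2) * z ^ (j + 1)"
     by (metis power_add)+
   qed
   have "sq (z ^ (j + 2) * Xg) = ip (z ^ (2 * j + 4) * Xg) Xg"
    unfolding pw(1) split sq_def ..
   also have "... = - ip (act (Xf i) (z ^ (2 * j + 4) * Xg)) g"
    unfolding Xg_def using assms(1) by (subst ip_act) (auto simp: numeral_eq_Suc)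
   also have "act (Xf i) (z ^ (2 * j + 4) * Xg) = z ^ (2 * j + 4) * XXg + c * z ^ (2 * j + 3) * Xg"
    using derivation_act[OF derivation_Xf, of i "z ^ (2 * j + 4)" Xg] c by (simp add: XXg_def numeral_eq_Suc)
   also have "ip ... g = ip (z ^ (2 * j + 4) * XXg) g + ip (c * z ^ (2 * j + 3) * Xg) g"
    using assms(1) by (intro ip_add_left) (simp add: numeral_eq_Suc)
   also have "ip (z ^ (2 * j + 4) * XXg) g = ip (z ^ (j + 3) * XXg) (z ^ (j + 1) * g)"
    unfolding pw(2) split ..
   also have "ip (c * z ^ (2 * j + 3) * Xg) g = ip (z ^ (j + 2) * Xg) (c * (z ^ (j + 1) * g))"
    unfolding pw(3) by (simp add: ip_def mult_ac)
   finally have "sq (z ^ (j + 2) * Xg) <= \<bar>ip (z ^ (j + 3) * XXg) (z ^ (j + 1) * g)\<bar> + \<bar>ip (z ^ (j + 2) * Xg) (c * (z ^ (j + 1) * g))\<bar>"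
    by linarith
   \<comment> \<open>The weight 1 / 2 in the second product makes its first order part half of the
     left-hand side, which is then absorbed.\<close>
   also have "... <= (e / 2 * sq (z ^ (j + 3) * XXg) + sq (z ^ (j + 1) * g) / (e / 2)) +
    (1 / 2 * sq (z ^ (j + 2) * Xg) + sq (c * (z ^ (j + 1) * g)) / (1 / 2))"
    using assms bz by (intro add_mono ip_le_weighted) auto
   also have "... <= (e / 2 * sq (z ^ (j + 3) * XXg) + sq (z ^ (j + 1) * g) / (e / 2)) +
    (1 / 2 * sq (z ^ (j + 2) * Xg) + M * sq (z ^ (j + 1) * g) / (1 / 2))"
    using M(2)[of g] by (intro add_mono order_refl divide_right_mono) auto
   finally show "sq (z ^ (j + 2) * act (Xf i) g) <= e * sq (z ^ (j + 3) * act (Xf i) (act (Xf i) g)) + (4 / e + 4 * M) * sq (z ^ (j + 1) * g)"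
    unfolding Xg_def XXg_def by (simp add: algebra_simps)
  qed
 qed
 then obtain C where C: "!!i. C i >= 0" "!!i g. sq (z ^ (j + 2) * act (Xf i) g) <= e * sq (z ^ (j + 3) * act (Xf i) (act (Xf i) g)) + C i * sq (z ^ (j + 1) * g)"
  by metis
 have wS: "words (Suc n) = (%(i, w). i # w) ` ({1, 2} \<times> words n)" for n
  by (auto simp: words_def length_Suc_conv)
 have inj: "inj_on (%(i, w). i # w) S" for S :: "(5 \<times> 5 list) set" by (auto simp: inj_on_def)
 have zS: "znorm z (Suc n) f = (SUM (i, w):{1, 2} \<times> words n. sq (z ^ (n + 2) * act (Xf i) (act (wd w) f)))" for n f
  unfolding znorm_def wS by (subst sum.reindex[OF inj]) (simp add: case_prod_unfold)
 show ?thesis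
 proof (intro exI[of _ "C 1 + C 2"] conjI allI)
  fix f
  have "znorm z (Suc j) f <= (SUM (i, w):{1, 2} \<times> words j. e * sq (z ^ (j + 3) * act (Xf i) (act (Xf i) (act (wd w) f))) + C i * sq (z ^ (j + 1) * act (wd w) f))"
   unfolding zS by (intro sum_mono) (use C(2) in auto)
  also have "... = e * (SUM (i, w):{1, 2} \<times> words j. sq (z ^ (j + 3) * act (Xf i) (act (wd (i # w)) f))) + (C 1 + C 2) * znorm z j f"
   unfolding sum.cartesian_product[symmetric]
   by (simp add: sum.distrib znorm_def distrib_right sum_distrib_left distrib_left)
  also have "(SUM (i, w):{1, 2} \<times> words j. sq (z ^ (j + 3) * act (Xf i) (act (wd (i # w)) f))) =
   (SUM (i, w):(%(i, w). (i, i # w)) ` ({1, 2} \<times> words j). sq (z ^ (j + 3) * act (Xf i) (act (wd w) f)))"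
   by (subst sum.reindex) (auto simp: inj_on_def case_prod_unfold)
  also have "... <= znorm z (Suc (Suc j)) f"
  proof -
   have "(%(i, w). (i, i # w)) ` ({1, 2} \<times> words j) <= {1, 2} \<times> words (Suc j)" by (auto simp: words_def)
   moreover have e: "Suc j + 2 = j + 3" by simp
   ultimately show ?thesis unfolding zS e by (intro sum_mono2) auto
  qed
  finally show "znorm z (Suc j) f <= e * znorm z (Suc (Suc j)) f + (C 1 + C 2) * znorm z j f"
   using assms(2) by simp
 qed (use C(1)[of 1] C(1)[of 2] in simp)
qed

text \<open>From three consecutive norms to top and bottom: induction first bounds each norm by its
  successor and the zeroth one, and then these bounds are chained up to k.\<close>

lemma interpolation_chain:
 fixes a :: "nat => 'v => real"
 assumes nn: "!!j v. a j v >= 0"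
  and step: "!!j e. e > 0 ==> EX C>=0. ALL v. a (Suc j) v <= e * a (Suc (Suc j)) v + C * a j v"
  and jk: "j < k" and e: "e > (0::real)"
 shows "EX C>=0. ALL v. a j v <= e * a k v + C * a 0 v"
proof -
 have one: "EX C>=0. ALL v. a j v <= e * a (Suc j) v + C * a 0 v" if "e > 0" for j e
  using that
 proof (induction j arbitrary: e)
  case 0
  then show ?case using nn by (intro exI[of _ 1]) simp
 next
  case (Suc j)
  obtain C where C: "C >= 0" "!!v. a (Suc j) v <= e / 2 * a (Suc (Suc j)) v + C * a j v"
   using step[of "e / 2" j] Suc.prems by auto
  \<comment> \<open>With this tolerance the contribution of \<open>a (Suc j) v\<close> on the right
    is at most half of the left-hand side.\<close>
  obtain D where D: "D >= 0" "!!v. a j v <= 1 / (2 * (C + 1)) * a (Suc j) v + D * a 0 v"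
   using Suc.IH[of "1 / (2 * (C + 1))"] C(1) by auto
  have "a (Suc j) v <= e * a (Suc (Suc j)) v + (2 * C * D) * a 0 v" for v
  proof -
   have "C * a j v <= C * (1 / (2 * (C + 1)) * a (Suc j) v + D * a 0 v)" using D(2) C(1) by (rule mult_left_mono)
   also have "... = (C / (C + 1)) * (a (Suc j) v / 2) + C * D * a 0 v" using C(1) by (simp add: field_simps)
   also have "... <= 1 * (a (Suc j) v / 2) + C * D * a 0 v"
    using C(1) nn[of "Suc j" v] by (intro add_mono order_refl mult_right_mono) (auto simp: divide_simps)
   finally show ?thesis using C(2)[of v] by (simp add: algebra_simps)
  qed
  then show ?case using C D by (intro exI[of _ "2 * C * D"]) auto
 qed
 show ?thesis
  using jk e
 proof (induction "k - j" arbitrary: j e)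
  case (Suc n)
  show ?case
  proof (cases "Suc j = k")
   case True
   then show ?thesis using one[OF Suc.prems(2), of j] by simp
  next
   case False
   obtain C where C: "C >= 0" "!!v. a j v <= 1 * a (Suc j) v + C * a 0 v" using one[of 1 j] by auto
   obtain D where D: "D >= 0" "!!v. a (Suc j) v <= e * a k v + D * a 0 v"
    using Suc.hyps(1)[of "Suc j" e] Suc.hyps(2) Suc.prems False by fastforce
   have "a j v <= e * a k v + (D + C) * a 0 v" for v
    using C(2)[of v] D(2)[of v] by (simp add: algebra_simps)
   then show ?thesis using C D by (intro exI[of _ "D + C"]) auto
  qed
 qed simp
qed

text \<open>The requirement k >= 3 makes horizontal derivatives up to order 3 available; with smooth
  coefficients these express every coordinate derivative.\<close>

locale maximal = estimate +
 assumes max: "EX C>=0. ALL u. tv u --> Nk u <= C * Rk u" and k_ge: "k >= 3"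
begin

definition zN :: "sm => nat => (nat => sm) => real" where
 "zN z j v = (SUM b<N. znorm z j (v b))"

definition zR :: "sm => (nat => sm) => real" where
 "zR z v = (SUM (d, r):rows. SUM w:words (k - d). sq (z ^ (k + 1) * act (wd w) (rowact N r v)))"

lemma zN_nonneg [simp]: "zN z j v >= 0" by (simp add: zN_def sum_nonneg)
lemma zR_nonneg [simp]: "zR z v >= 0" by (auto simp: zR_def intro!: sum_nonneg)

lemma cutoff_term:
 assumes "bs z" "P : Hom k"
 shows "EX C>=0. ALL f. bs (act P (z ^ (k + 1) * f) - z ^ (k + 1) * act P f) &
  sq (act P (z ^ (k + 1) * f) - z ^ (k + 1) * act P f) <= C * (SUM j<k. znorm z j f)"
 using cutoff_error_bound[OF assms(1) cutoff_commutator[OF assms(2), of "Suc k" z]] by simp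

lemma sq_sum_le: "(!!b. b < n ==> bs (f b)) ==> sq (SUM b<n. f b) <= 2 ^ n * (SUM b<n. sq (f b))"
proof (induction n)
 case (Suc n)
 have "sq (SUM b<Suc n. f b) <= 2 * sq (SUM b<n. f b) + 2 * sq (f n)"
  using sq_add_le[of "SUM b<n. f b" "f n"] Suc.prems bs_sum[of "{..<n}" f] by simp
 also have "... <= 2 * (2 ^ n * (SUM b<n. sq (f b))) + 2 ^ Suc n * sq (f n)"
  using Suc by (intro add_mono mult_left_mono mult_right_mono) auto
 finally show ?case by (simp add: algebra_simps)
qed simp

text \<open>The maximal estimate is applied to \<open>z ^ (k + 1)\<close> times the given functions.
  Commutators of the cutoff with words and with rows have order below k and are collected in the sum
  on the right.\<close>

lemma top_estimate:
 assumes z: "bs z"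
 shows "EX C>=0. ALL v. zN z k v <= C * (zR z v + (SUM j<k. zN z j v))"
proof -
 obtain C0 where C0: "C0 >= 0" "!!u. tv u ==> Nk u <= C0 * Rk u" using max by blast
 have bz: "bs (z ^ (k + 1))" using z by simp
 let ?E = "%P f. act P (z ^ (k + 1) * f) - z ^ (k + 1) * act P f"
 define S where "S v = (SUM j<k. zN z j v)" for v
 have Sb: "(SUM j<k. znorm z j (v b)) <= S v" if "b < N" for v b
  unfolding S_def zN_def by (intro sum_mono member_le_sum) (use that in auto)
 have Snn: "S v >= 0" for v by (simp add: S_def sum_nonneg)
 have "ALL w:words k. EX C>=0. ALL f. bs (?E (wd w) f) &
  sq (?E (wd w) f) <= C * (SUM j<k. znorm z j f)"
  using cutoff_term[OF z wd_Hom] by blast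
 then obtain C1 where C1: "!!w. w : words k ==> C1 w >= 0" "!!w f. w : words k ==> bs (?E (wd w) f)"
  "!!w f. w : words k ==> sq (?E (wd w) f) <= C1 w * (SUM j<k. znorm z j f)"
  by metis
 have "ALL dr:rows. ALL w:words (k - fst dr). ALL b<N. EX C>=0. ALL f. bs (?E (wd w * snd dr b) f) &
  sq (?E (wd w * snd dr b) f) <= C * (SUM j<k. znorm z j f)"
 proof (intro ballI allI impI cutoff_term[OF z])
  fix dr w b assume a: "dr : rows" "w : words (k - fst dr)" "b < N"
  then have "snd dr b : Hom (fst dr)" "fst dr <= k" using row_Hom[of "fst dr" "snd dr"] row_le[of "fst dr" "snd dr"] by auto
  then show "wd w * snd dr b : Hom k" using a by (intro Hom_mult'[OF wd_Hom]) auto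
 qed
 then obtain C2 where C2: "!!dr w b. dr : rows ==> w : words (k - fst dr) ==> b < N ==> C2 dr w b >= 0 & (ALL f. bs (?E (wd w * snd dr b) f) &
  sq (?E (wd w * snd dr b) f) <= C2 dr w b * (SUM j<k. znorm z j f))"
  by metis
 define K1 where "K1 = (SUM b<N. SUM w:words k. 2 * C1 w)"
 define K2 where "K2 = (SUM dr:rows. SUM w:words (k - fst dr). 2 * (2 ^ N * (SUM b<N. C2 dr w b)))"
 have K: "K1 >= 0" "K2 >= 0" unfolding K1_def K2_def using C1(1) C2 by (auto intro!: sum_nonneg mult_nonneg_nonneg)
 have "zN z k v <= (2 * C0 * 2 + (2 * C0 * K2 + K1)) * (zR z v + S v)" for v
 proof -
  define u where "u b = z ^ (k + 1) * v b" for b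
  have tu: "tv u" using bz by (simp add: tv_def u_def)
  have "zN z k v <= (SUM b<N. SUM w:words k. 2 * sq (act (wd w) (u b)) + 2 * C1 w * S v)"
   unfolding zN_def znorm_def
  proof (intro sum_mono)
   fix b w assume bw: "b : {..<N}" "w : words k"
   define E where "E = act (wd w) (u b) - z ^ (k + 1) * act (wd w) (v b)"
   have E: "bs E" "sq E <= C1 w * S v"
    using C1(2,3)[OF bw(2), of "v b"] mult_left_mono[OF Sb C1(1)[OF bw(2)], of b v] bw by (auto simp: E_def u_def)
   have "sq (act (wd w) (u b) + (- 1) *R E) <= 2 * sq (act (wd w) (u b)) + 2 * sq ((- 1) *R E)"
    using E tu bw by (intro sq_add_le) auto
   then show "sq (z ^ (k + 1) * act (wd w) (v b)) <= 2 * sq (act (wd w) (u b)) + 2 * C1 w * S v"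
    using E(2) unfolding sq_scaleR by (simp add: E_def)
  qed
  also have "... = 2 * Nk u + K1 * S v"
   unfolding Nk_def hnorm_def K1_def sum.distrib by (simp only: sum_distrib_left sum_distrib_right)
  also have "Nk u <= C0 * Rk u" using C0 tu by blast
  also have "Rk u <= (SUM dr:rows. SUM w:words (k - fst dr). 2 * sq (z ^ (k + 1) * act (wd w) (rowact N (snd dr) v)) + 2 * (2 ^ N * (SUM b<N. C2 dr w b)) * S v)"
   unfolding Rk_def hnorm_def case_prod_unfold
  proof (intro sum_mono)
   fix dr w assume dw: "dr : rows" "w : words (k - fst dr)"
   define E where "E b = act (wd w * snd dr b) (u b) - z ^ (k + 1) * act (wd w * snd dr b) (v b)" for b
   have Eb: "bs (E b)" "sq (E b) <= C2 dr w b * S v" if b: "b < N" for b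
    using C2[OF dw b] mult_left_mono[OF Sb[OF b], of "C2 dr w b" v] unfolding E_def u_def by (auto intro: order_trans)
   have e: "act (wd w) (rowact N (snd dr) u) = z ^ (k + 1) * act (wd w) (rowact N (snd dr) v) + (SUM b<N. E b)"
    by (simp add: rowact_def E_def sum_subtractf sum_distrib_left)
   have "sq (act (wd w) (rowact N (snd dr) u)) <= 2 * sq (z ^ (k + 1) * act (wd w) (rowact N (snd dr) v)) + 2 * sq (SUM b<N. E b)"
    unfolding e using bz Eb(1) by (intro sq_add_le bs_sum) auto
   also have "sq (SUM b<N. E b) <= 2 ^ N * (SUM b<N. sq (E b))" using Eb by (intro sq_sum_le) auto
   also have "(SUM b<N. sq (E b)) <= (SUM b<N. C2 dr w b * S v)" using Eb by (intro sum_mono) auto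
   finally show "sq (act (wd w) (rowact N (snd dr) u)) <= 2 * sq (z ^ (k + 1) * act (wd w) (rowact N (snd dr) v)) + 2 * (2 ^ N * (SUM b<N. C2 dr w b)) * S v"
    by (simp add: sum_distrib_right mult.assoc)
  qed
  also have "... = 2 * zR z v + K2 * S v"
   by (simp add: zR_def K2_def sum.distrib sum_distrib_left sum_distrib_right case_prod_unfold)
  finally have "zN z k v <= 2 * (C0 * (2 * zR z v + K2 * S v)) + K1 * S v"
   using C0(1) by (simp add: mult_left_mono)
  also have "... = (2 * C0 * 2) * zR z v + (2 * C0 * K2 + K1) * S v" by (simp add: algebra_simps)
  also have "... <= (2 * C0 * 2 + (2 * C0 * K2 + K1)) * zR z v + (2 * C0 * 2 + (2 * C0 * K2 + K1)) * S v"
  proof (rule add_mono; rule mult_right_mono)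
   have "0 <= C0 * K2" using C0(1) K by simp
   then show "2 * C0 * 2 <= 2 * C0 * 2 + (2 * C0 * K2 + K1)" "2 * C0 * K2 + K1 <= 2 * C0 * 2 + (2 * C0 * K2 + K1)"
    using C0(1) K by simp_all
  qed (simp_all add: Snn)
  finally show ?thesis by (simp add: distrib_left)
 qed
 then show ?thesis unfolding S_def using C0(1) K by (intro exI[of _ "2 * C0 * 2 + (2 * C0 * K2 + K1)"]) auto
qed

theorem local_estimate:
 assumes z: "bs z"
 shows "EX C>=0. ALL v. ALL j<=3. zN z j v <= C * (zR z v + zN z 0 v)"
proof -
 have step: "EX C>=0. ALL v. zN z (Suc j) v <= e * zN z (Suc (Suc j)) v + C * zN z j v" if "e > 0" for j e
 proof -
  obtain C where C: "C >= 0" "!!f. znorm z (Suc j) f <= e * znorm z (Suc (Suc j)) f + C * znorm z j f"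
   using znorm_interpolation[OF z \<open>e > 0\<close>, of j] by blast
  have "zN z (Suc j) v <= e * zN z (Suc (Suc j)) v + C * zN z j v" for v
   unfolding zN_def sum_distrib_left sum.distrib[symmetric] by (intro sum_mono C)
  then show ?thesis using C(1) by blast
 qed
 note chain = interpolation_chain[of "zN z", OF zN_nonneg step]
 obtain C0 where C0: "C0 >= 0" "!!v. zN z k v <= C0 * (zR z v + (SUM j<k. zN z j v))" using top_estimate[OF z] by blast
 \<comment> \<open>The k intermediate norms together then return at most half of the top
   norm.\<close>
 define e where "e = 1 / (2 * (C0 + 1) * k)"
 have e: "e > 0" "C0 * (k * e) <= 1 / 2" using C0(1) k_ge by (auto simp: e_def divide_simps)
 have "ALL j<k. EX C>=0. ALL v. zN z j v <= e * zN z k v + C * zN z 0 v" using chain e(1) by blast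
 then obtain D where D: "!!j. j < k ==> D j >= 0" "!!j v. j < k ==> zN z j v <= e * zN z k v + D j * zN z 0 v" by metis
 define DD where "DD = (SUM j<k. D j)"
 have DD: "DD >= 0" unfolding DD_def using D(1) by (auto intro: sum_nonneg)
 have top: "zN z k v <= (2 * C0 * (DD + 1)) * (zR z v + zN z 0 v)" for v
 proof -
  have "(SUM j<k. zN z j v) <= (SUM j<k. e * zN z k v + D j * zN z 0 v)" using D(2) by (intro sum_mono) auto
  also have "... = k * e * zN z k v + DD * zN z 0 v" by (simp add: sum.distrib DD_def sum_distrib_right)
  finally have "C0 * (zR z v + (SUM j<k. zN z j v)) <= C0 * (zR z v + (k * e * zN z k v + DD * zN z 0 v))"
   using C0(1) by (intro mult_left_mono) auto
  also have "... = C0 * (k * e) * zN z k v + C0 * (zR z v + DD * zN z 0 v)" by (simp add: algebra_simps)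
  also have "... <= 1 / 2 * zN z k v + C0 * ((DD + 1) * zR z v + (DD + 1) * zN z 0 v)"
   using e(2) C0(1) DD by (intro add_mono mult_right_mono mult_left_mono) (auto simp: distrib_right)
  finally show ?thesis using C0(2)[of v] by (simp add: algebra_simps)
 qed
 have all: "EX C>=0. ALL v. zN z j v <= C * (zR z v + zN z 0 v)" if "j <= k" for j
 proof (cases "j = k")
  case True
  then show ?thesis using top C0(1) DD by (intro exI[of _ "2 * C0 * (DD + 1)"]) auto
 next
  case False
  then obtain C where C: "C >= 0" "!!v. zN z j v <= 1 * zN z k v + C * zN z 0 v" using chain[of j k 1] \<open>j <= k\<close> by auto
  have "zN z j v <= (2 * C0 * (DD + 1) + C) * (zR z v + zN z 0 v)" for v
  proof -
   have "C * zN z 0 v <= C * (zR z v + zN z 0 v)" using C(1) by (intro mult_left_mono) auto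
   then show ?thesis using C(2)[of v] top[of v] by (simp add: algebra_simps)
  qed
  then show ?thesis using C(1) C0(1) DD by (intro exI[of _ "2 * C0 * (DD + 1) + C"]) auto
 qed
 have "ALL j:{..3}. EX C>=0. ALL v. zN z j v <= C * (zR z v + zN z 0 v)" using all k_ge by auto
 then obtain C where C: "!!j. j <= 3 ==> C j >= 0" "!!j v. j <= 3 ==> zN z j v <= C j * (zR z v + zN z 0 v)"
  by (metis atMost_iff)
 show ?thesis
 proof (intro exI[of _ "SUM j<=3. C j"] conjI allI impI)
  fix v and j :: nat assume j: "j <= 3"
  have "C j <= (SUM j<=3. C j)" using C(1) j by (intro member_le_sum) auto
  then have "C j * (zR z v + zN z 0 v) <= (SUM j<=3. C j) * (zR z v + zN z 0 v)" by (intro mult_right_mono) auto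
  then show "zN z j v <= (SUM j<=3. C j) * (zR z v + zN z 0 v)" using C(2)[OF j, of v] by linarith
 qed (use C(1) in "auto intro: sum_nonneg")
qed

end

section \<open>Pointwise estimates\<close>

lemma abs_le_integral_deriv:
 fixes g :: "real => real"
 assumes g: "!!t. (g has_real_derivative g' t) (at t)" "continuous_on UNIV g'" and R: "!!t. R < t ==> g t = 0"
 shows "ennreal \<bar>g 0\<bar> <= (\<integral>\<^sup>+t. ennreal \<bar>g' t\<bar> \<partial>lborel)"
proof -
 define b where "b = max 0 R + 1"
 have b: "0 <= b" "g b = 0" using R[of b] by (auto simp: b_def)
 have "has_bochner_integral lborel (%x. indicator {0..b} x *R g' x) (g b - g 0)"
  using g b(1) by (intro has_bochner_integral_FTC_Icc)
   (auto intro: continuous_on_subset has_field_derivative_at_within simp: has_real_derivative_iff_has_vector_derivative[symmetric])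
 then have i: "integrable lborel (%x. indicator {0..b} x *R g' x)" "(LINT x|lborel. indicator {0..b} x *R g' x) = - g 0"
  using b(2) by (auto simp: has_bochner_integral_iff)
 have "ennreal \<bar>g 0\<bar> = ennreal (norm (LINT x|lborel. indicator {0..b} x *R g' x))" using i(2) by simp
 also have "... <= (\<integral>\<^sup>+x. norm (indicator {0..b} x *R g' x) \<partial>lborel)" by (rule integral_norm_bound_ennreal[OF i(1)])
 also have "... <= (\<integral>\<^sup>+t. ennreal \<bar>g' t\<bar> \<partial>lborel)"
  by (intro nn_integral_mono) (auto simp: indicator_def)
 finally show ?thesis .
qed

lemma bsupp_iter_deriv: "bsupp h ==> bsupp (iter_deriv vs h)"
 by (induction vs) (auto intro: bsupp_deriv)

text \<open>Each new direction is handled by the fundamental theorem of calculus along a line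
  leaving the support, and the integral over this line is joined to the product measure. With all
  basis directions it gives a bound of the supremum by the integral of the full mixed
  derivative.\<close>

lemma abs_le_integral_iter_deriv_partial:
 fixes h :: "'a::euclidean_space => real"
 assumes h: "smooth h" "bsupp h" and vs: "set vs <= Basis" "distinct vs"
 shows "ennreal \<bar>h x\<bar> <= (\<integral>\<^sup>+f. ennreal \<bar>iter_deriv vs h (x + (SUM b:set vs. f b *R b))\<bar> \<partial>(\<Pi>\<^sub>M b\<in>set vs. (lborel :: real measure)))"
 using vs
proof (induction vs)
 case Nil
 interpret product_sigma_finite "%b::'a. lborel :: real measure" by standard
 show ?case by (simp add: PiM_empty nn_integral_count_space_finite del: nn_integral_const)
next
 case (Cons b vs)
 interpret product_sigma_finite "%b::'a. lborel :: real measure" by standard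
 define G where "G = iter_deriv vs h"
 have G: "smooth G" "bsupp G" unfolding G_def using h smooth_on_iter_deriv bsupp_iter_deriv by auto
 define G' where "G' = (%p. fder G p b)"
 have cG': "continuous_on UNIV G'" unfolding G'_def using continuous_on_deriv G(1) by blast
 obtain r where r: "!!p. r < norm p ==> G p = 0" using G(2) by (auto simp: bsupp_def)
 have b: "b : Basis" "b ~: set vs" using Cons.prems by auto
 have line: "ennreal \<bar>G p\<bar> <= (\<integral>\<^sup>+t. ennreal \<bar>G' (p + t *R b)\<bar> \<partial>lborel)" for p
 proof -
  have "((%t. G (p + t *R b)) has_real_derivative G' (p + t *R b)) (at t)" for t
   using has_real_derivative_line[OF G(1), of p t b] by (simp add: G'_def)
  moreover have "continuous_on UNIV (%t. G' (p + t *R b))"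
   by (rule continuous_on_compose2[OF cG']) (auto intro!: continuous_intros)
  moreover have "G (p + t *R b) = 0" if "norm p + r < t" for t
  proof (rule r)
   have "\<bar>t\<bar> = norm (t *R b)" using b(1) by simp
   also have "... <= norm (p + t *R b) + norm p" using norm_triangle_ineq4[of "p + t *R b" p] by simp
   finally show "r < norm (p + t *R b)" using that by linarith
  qed
  ultimately show ?thesis using abs_le_integral_deriv[of "%t. G (p + t *R b)" "%t. G' (p + t *R b)" "norm p + r"] by simp
 qed
 have meas: "(%f. ennreal \<bar>G' (x + (SUM c:insert b (set vs). f c *R c))\<bar>) : borel_measurable (\<Pi>\<^sub>M c\<in>insert b (set vs). (lborel :: real measure))"
 proof -
  have "(%f. x + (SUM c:insert b (set vs). f c *R c)) : borel_measurable (\<Pi>\<^sub>M c\<in>insert b (set vs). (lborel :: real measure))"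
   by (intro borel_measurable_add borel_measurable_sum borel_measurable_scaleR borel_measurable_const)
    (use measurable_component_singleton[of _ "insert b (set vs)" "%_. lborel :: real measure"] in auto)
  from measurable_compose[OF this borel_measurable_continuous_onI[OF cG']] show ?thesis by measurable
 qed
 have "ennreal \<bar>h x\<bar> <= (\<integral>\<^sup>+f. ennreal \<bar>G (x + (SUM c:set vs. f c *R c))\<bar> \<partial>(\<Pi>\<^sub>M c\<in>set vs. (lborel :: real measure)))"
  using Cons unfolding G_def by auto
 also have "... <= (\<integral>\<^sup>+f. (\<integral>\<^sup>+t. ennreal \<bar>G' (x + (SUM c:insert b (set vs). (f(b := t)) c *R c))\<bar> \<partial>lborel) \<partial>(\<Pi>\<^sub>M c\<in>set vs. (lborel :: real measure)))"
 proof (rule nn_integral_mono)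
  fix f
  have "(SUM c:insert b (set vs). (f(b := t)) c *R c) = t *R b + (SUM c:set vs. f c *R c)" for t
   using b(2) by (simp) (intro sum.cong, auto)
  then show "ennreal \<bar>G (x + (SUM c:set vs. f c *R c))\<bar> <= (\<integral>\<^sup>+t. ennreal \<bar>G' (x + (SUM c:insert b (set vs). (f(b := t)) c *R c))\<bar> \<partial>lborel)"
   using line[of "x + (SUM c:set vs. f c *R c)"] by (simp add: add_ac)
 qed
 also have "... = (\<integral>\<^sup>+f. ennreal \<bar>G' (x + (SUM c:insert b (set vs). f c *R c))\<bar> \<partial>(\<Pi>\<^sub>M c\<in>insert b (set vs). (lborel :: real measure)))"
  using product_nn_integral_insert[OF _ b(2) meas] by simp
 finally show ?case unfolding G'_def G_def by simp
qed

lemma abs_le_integral_iter_deriv: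
 fixes h :: "'a::euclidean_space => real"
 assumes h: "smooth h" "bsupp h" and vs: "set vs = Basis" "distinct vs"
 shows "\<bar>h x\<bar> <= (LINT y|lborel. \<bar>iter_deriv vs h y\<bar>)"
proof -
 define G where "G = iter_deriv vs h"
 have G: "smooth G" "bsupp G" unfolding G_def using h smooth_on_iter_deriv bsupp_iter_deriv by auto
 have cG: "continuous_on UNIV G" using G(1) smooth_on_continuous_on by blast
 then have mG: "G : borel_measurable borel" by (rule borel_measurable_continuous_onI)
 have iG: "integrable lborel (%y. \<bar>G y\<bar>)" using integrable_bsupp[OF cG G(2)] by (rule integrable_abs)
 have mp: "(%f. SUM b:Basis. f b *R b) : measurable (\<Pi>\<^sub>M b\<in>(Basis::'a set). (lborel :: real measure)) borel"
  by (intro borel_measurable_sum borel_measurable_scaleR borel_measurable_const)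
   (use measurable_component_singleton[of _ "Basis :: 'a set" "%_. lborel :: real measure"] in auto)
 have "ennreal \<bar>h x\<bar> <= (\<integral>\<^sup>+f. ennreal \<bar>G (x + (SUM b:Basis. f b *R b))\<bar> \<partial>(\<Pi>\<^sub>M b\<in>(Basis::'a set). (lborel :: real measure)))"
  using abs_le_integral_iter_deriv_partial[OF h, of vs x] vs unfolding G_def by simp
 also have "... = (\<integral>\<^sup>+y. ennreal \<bar>G (x + y)\<bar> \<partial>distr (\<Pi>\<^sub>M b\<in>(Basis::'a set). (lborel :: real measure)) borel (%f. SUM b:Basis. f b *R b))"
  using mG by (subst nn_integral_distr[OF mp]) auto
 also have "... = (\<integral>\<^sup>+y. ennreal \<bar>G (x + y)\<bar> \<partial>lborel)" by (subst lborel_eq[symmetric]) simp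
 also have "... = (\<integral>\<^sup>+y. ennreal \<bar>G y\<bar> \<partial>distr lborel borel ((+) x))"
  using mG by (subst nn_integral_distr) auto
 also have "... = (\<integral>\<^sup>+y. ennreal \<bar>G y\<bar> \<partial>lborel)" by (simp add: lborel_distr_plus)
 also have "... = ennreal (LINT y|lborel. \<bar>G y\<bar>)" by (rule nn_integral_eq_integral[OF iG]) simp
 finally show ?thesis unfolding G_def by (subst (asm) ennreal_le_iff) auto
qed

section \<open>A Sobolev inequality\<close>

definition pdw :: "5 list => dop" where "pdw s = prod_list (map Pd s)"
definition yw :: "5 list => dop" where "yw y = prod_list (map Yf y)"

lemma pdw_simps [simp]: "pdw [] = 1" "pdw (i # s) = Pd i * pdw s" by (simp_all add: pdw_def)
lemma yw_simps [simp]: "yw [] = 1" "yw (i # s) = Yf i * yw s" by (simp_all add: yw_def)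

lemma Fn_pdw: "Fn (act (pdw s) f) = iter_deriv (map (%i. axis i 1) s) (Fn f)"
proof (induction s)
 case (Cons i s)
 then show ?case by (intro ext) (simp add: act_Pd Fn_dr)
qed simp

lemma pdw_product: "EX L. (ALL (a, b):set L. length a <= length s & length b <= length s) &
 (ALL f g. act (pdw s) (f * g) = (SUM (a, b)<-L. act (pdw a) f * act (pdw b) g))"
proof (induction s)
 case Nil
 show ?case by (intro exI[of _ "[([], [])]"]) simp
next
 case (Cons i s)
 then obtain L where L: "ALL (a, b):set L. length a <= length s & length b <= length s"
  "!!f g. act (pdw s) (f * g) = (SUM (a, b)<-L. act (pdw a) f * act (pdw b) g)" by blast
 have sl: "act D (SUM x<-M. h x) = (SUM x<-M. act D (h x))" for D and M :: "(5 list \<times> 5 list) list" and h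
  by (induction M) auto
 have der: "act (Pd i) (f * g) = act (Pd i) f * g + f * act (Pd i) g" for f g
  by (simp add: act_Pd dr_mult)
 have sd: "(SUM x<-M. h x + h' x) = (SUM x<-M. h x) + (SUM x<-M. h' x)" for M :: "(5 list \<times> 5 list) list" and h h' :: "_ => sm"
  by (induction M) (auto simp: algebra_simps)
 show ?case
 proof (intro exI[of _ "map (%(a, b). (i # a, b)) L @ map (%(a, b). (a, i # b)) L"] conjI allI)
  show "ALL (a, b):set (map (%(a, b). (i # a, b)) L @ map (%(a, b). (a, i # b)) L). length a <= length (i # s) & length b <= length (i # s)"
   using L(1) by fastforce
  fix f g
  show "act (pdw (i # s)) (f * g) = (SUM (a, b)<-map (%(a, b). (i # a, b)) L @ map (%(a, b). (a, i # b)) L. act (pdw a) f * act (pdw b) g)"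
   by (simp add: L(2) sl der sd case_prod_unfold o_def)
 qed
qed

text \<open>Applying the preceding integral bound to \<open>f * f\<close> converts it into square
  norms: by the Leibniz rule the mixed derivative of the square is a sum of products of two
  derivatives of f, and each product is at most the sum of the two squares.\<close>

lemma sobolev:
 "EX S C. finite S & (ALL s:S. length s <= 5) & C >= 0 & (ALL f x. bs f --> (Fn f x)^2 <= C * (SUM s:S. sq (act (pdw s) f)))"
proof -
 let ?s = "[1, 2, 3, 4, 5 :: 5]" and ?P = "%L f. SUM (a, b)<-L. act (pdw a) f * act (pdw b) f"
  and ?q = "%f a b y. Fn (act (pdw a) f) y * Fn (act (pdw a) f) y + Fn (act (pdw b) f) y * Fn (act (pdw b) f) y"
 have B: "set (map (%i. axis i 1) ?s) = (Basis :: (real^5) set)"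
 proof -
  have "(Basis :: (real^5) set) = (%i. axis i 1) ` UNIV" by (auto simp: Basis_vec_def)
  then show ?thesis unfolding UNIV_5 by simp
 qed
 have di: "distinct (map (%i. axis i (1::real)) ?s)"
  by (simp add: axis_eq_axis)
 obtain L where L: "ALL (a, b):set L. length a <= length ?s & length b <= length ?s"
  "!!f g. act (pdw ?s) (f * g) = (SUM (a, b)<-L. act (pdw a) f * act (pdw b) g)" using pdw_product[of ?s] by blast
 define S where "S = fst ` set L \<union> snd ` set L"
 let ?S = "%f. SUM s:S. sq (act (pdw s) f)"
 have S: "finite S" "ALL s:S. length s <= 5" using L(1) by (auto simp: S_def)
 have "(Fn f x)^2 <= (real (2 * length L)) * ?S f" if f: "bs f" for f x
 proof -
  have "(Fn f x)^2 = \<bar>Fn (f * f) x\<bar>" by (simp add: power2_eq_square)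
  also have "... <= (LINT y|lborel. \<bar>iter_deriv (map (%i. axis i 1) ?s) (Fn (f * f)) y\<bar>)"
   using f by (intro abs_le_integral_iter_deriv B di smooth_Fn) (use bs_simps(2)[OF f, of f] in "simp only: bs_def")
  also have "iter_deriv (map (%i. axis i 1) ?s) (Fn (f * f)) = Fn (?P L f)"
   unfolding Fn_pdw[symmetric] L(2) ..
  also have "(LINT y|lborel. \<bar>Fn (?P L f) y\<bar>) <= (LINT y|lborel. (SUM (a, b)<-L. ?q f a b y))"
  proof (rule integral_mono)
   have i: "integrable lborel (%y. SUM (a, b)<-M. ?q f a b y)" for M
    by (induction M) (use f in "auto intro!: Bochner_Integration.integrable_add")
   then show "integrable lborel (%y. SUM (a, b)<-L. ?q f a b y)" .
   have "bs (?P M f)" for M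
    by (induction M) (use f in auto)
   then show "integrable lborel (%y. \<bar>Fn (?P L f) y\<bar>)"
    unfolding bs_def by (intro integrable_abs integrable_bsupp cont_Fn)
   fix y
   show "\<bar>Fn (?P L f) y\<bar> <= (SUM (a, b)<-L. ?q f a b y)"
   proof (induction L)
    case (Cons ab L)
    have "\<bar>p * q\<bar> <= p * p + q * q" for p q :: real
    proof -
     have "2 * (\<bar>p\<bar> * \<bar>q\<bar>) <= p * p + q * q"
      using sum_squares_bound[of "\<bar>p\<bar>" "\<bar>q\<bar>"] by (simp add: power2_eq_square mult.assoc)
     moreover have "0 <= \<bar>p\<bar> * \<bar>q\<bar>" by simp
     ultimately show ?thesis unfolding abs_mult by linarith
    qed
    from this[of "Fn (act (pdw (fst ab)) f) y" "Fn (act (pdw (snd ab)) f) y"] Cons show ?case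
     by (simp add: case_prod_unfold)
   qed simp
  qed
  also have "... = (SUM (a, b)<-L. sq (act (pdw a) f) + sq (act (pdw b) f))"
  proof -
   have "integrable lborel (%y. SUM (a, b)<-M. ?q f a b y) &
    (LINT y|lborel. (SUM (a, b)<-M. ?q f a b y)) = (SUM (a, b)<-M. sq (act (pdw a) f) + sq (act (pdw b) f))" for M
   proof (induction M)
    case (Cons ab M)
    have "integrable lborel (%y. Fn (act (pdw a) f) y * Fn (act (pdw a) f) y)" for a using f by (intro integrable_ip) simp
    then show ?case using Cons by (cases ab) (simp add: sq_def ip_def)
   qed simp
   then show ?thesis by blast
  qed
  also have "... <= real (2 * length L) * ?S f"
  proof -
   have S1: "finite S" "fst ` set L \<union> snd ` set L <= S" by (auto simp: S_def)
   have "(SUM (a, b)<-M. sq (act (pdw a) f) + sq (act (pdw b) f)) <= real (2 * length M) * ?S f"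
    if "fst ` set M \<union> snd ` set M <= S" for M
    using that
   proof (induction M)
    case (Cons ab M)
    have "sq (act (pdw a) f) <= ?S f" if "a : S" for a
     using S1(1) that by (intro member_le_sum) auto
    then have "sq (act (pdw (fst ab)) f) <= ?S f" "sq (act (pdw (snd ab)) f) <= ?S f"
     using Cons.prems by auto
    then show ?case using Cons by (simp add: case_prod_unfold algebra_simps)
   qed simp
   from this[OF S1(2)] show ?thesis .
  qed
  finally show ?thesis .
 qed
 then show ?thesis using S by (intro exI[of _ S] exI[of _ "real (2 * length L)"]) auto
qed

section \<open>Conversion between horizontal, right-invariant and coordinate derivatives\<close>

definition ops :: "sm => nat => (5 list => dop) => 5 list set => dop set" where
 "ops z e W I = span {mu (c * z ^ e) * W w | c w. w : I}"

lemma ops_subspace: "subspace (ops z e W I)" by (simp add: ops_def)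

lemma opsI: "w : I ==> mu (c * z ^ e) * W w : ops z e W I"
 unfolding ops_def by (intro span_base) blast

lemma ops_add: "P : ops z e W I ==> Q : ops z e W I ==> P + Q : ops z e W I"
 by (rule subspace_add[OF ops_subspace])

lemma ops_sum: "(!!i. i : J ==> P i : ops z e W I) ==> (SUM i:J. P i) : ops z e W I"
 by (rule subspace_sum[OF ops_subspace])

lemma ops_mono: "I <= J ==> ops z e W I <= ops z e W J"
 unfolding ops_def by (intro span_mono) blast

lemma mu_ops: "P : ops z e W I ==> mu g * P : ops z e W I"
 unfolding ops_def
proof (induction rule: span_induct)
 show "subspace {P. mu g * P : span {mu (c * z ^ e) * W w |c w. w : I}}"
  using subspace_span by (auto simp: subspace_def distrib_left)
 fix x assume "x : {mu (c * z ^ e) * W w |c w. w : I}"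
 then obtain c w where "x = mu (c * z ^ e) * W w" "w : I" by blast
 then have "mu g * x = mu ((g * c) * z ^ e) * W w" "w : I" by (simp_all add: mu_ring mult.assoc)
 then show "mu g * x : span {mu (c * z ^ e) * W w |c w. w : I}" by (intro span_base) blast
qed

lemma ops_bound:
 assumes "bs z" "e > 0" "Z : ops z e W I" "finite I"
 shows "EX C>=0. ALL f. bs (act Z f) & sq (act Z f) <= C * (SUM w:I. sq (z ^ e * act (W w) f))"
proof (rule sq_bound_span[where Q = "%_. True", simplified, OF assms(3)[unfolded ops_def]])
 let ?S = "%f. SUM w:I. sq (z ^ e * act (W w) f)"
 fix x assume "x : {mu (c * z ^ e) * W w |c w. w : I}"
 then obtain c w where x: "x = mu (c * z ^ e) * W w" "w : I" by blast
 have bz: "bs (z ^ e)" using assms(1,2) by (cases e) auto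
 obtain M where M: "M >= 0" "!!f. sq (c * (z ^ e * f)) <= M * sq (z ^ e * f)" using mult_bounded[OF bz] by blast
 show "EX C>=0. ALL f. bs (act x f) & sq (act x f) <= C * ?S f"
 proof (intro exI[of _ M] conjI allI)
  fix f
  show "bs (act x f)" using bz unfolding x(1) by simp
  have "sq (act x f) <= M * sq (z ^ e * act (W w) f)" using M(2)[of "act (W w) f"] by (simp add: x(1) mult.assoc)
  also have "... <= M * ?S f"
   using M(1) x(2) assms(4) by (intro mult_left_mono member_le_sum[of w I "%w. sq (z ^ e * act (W w) f)"]) auto
  finally show "sq (act x f) <= M * ?S f" .
 qed (rule M(1))
qed

definition words3 :: "5 list set" where "words3 = words 1 \<union> words 2 \<union> words 3"

lemma finite_words3 [simp]: "finite words3" by (simp add: words3_def)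

lemma Hom_ops: "P : Hom n ==> words n <= I ==> mu (c * z ^ e) * P : ops z e wd I"
proof (rule Hom_induct[of P n "%P. mu (c * z ^ e) * P : ops z e wd I"])
 show "subspace {x. mu (c * z ^ e) * x : ops z e wd I}"
  using ops_subspace[of z e wd I] by (auto simp: subspace_def distrib_left)
qed (auto intro: opsI)

lemma Xf_ops: "mu (c * z ^ e) * Xf i : ops z e wd words3"
proof (rule Hom_ops[OF Xf_Hom])
 have "i = 1 \<or> i = 2 \<or> i = 3 \<or> i = 4 \<or> i = 5" using UNIV_5 by blast
 then have "xdeg i : {1, 2, 3}" by auto
 then show "words (xdeg i) <= words3" by (auto simp: words3_def)
qed

lemma field_combination:
 fixes F :: "5 => dop"
 assumes "P = mu c1 * F 1 + mu c2 * F 2 + mu c3 * F 3 + mu c4 * F 4 + mu c5 * F 5"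
 shows "EX c. P = (SUM l:UNIV. mu (c l) * F l)"
 by (rule exI[of _ "%l::5. if l = 1 then c1 else if l = 2 then c2 else if l = 3 then c3 else if l = 4 then c4 else c5"])
  (unfold UNIV_5 assms, simp add: add.assoc)

text \<open>The coefficient matrix of the fields is unipotent, so the coordinate derivatives are
  recovered with polynomial coefficients. \<open>Pd_Yf\<close> does the same on the right-invariant
  side.\<close>

lemma Pd_Xf: "EX c. Pd i = (SUM l:UNIV. mu (c l) * Xf l)"
proof -
 have h: "mu (co 1) * mu (co 1) * Pd 4 = (1 / 2) *R (mu (co 1) * mu (co 1) * Pd 4) + (1 / 2) *R (mu (co 1) * mu (co 1) * Pd 4)"
  by (simp flip: scaleR_left_distrib)
 have mc: "mu (co 2) * mu (co 1) = mu (co 1) * mu (co 2)" by (simp flip: mu_ring(1) add: mult.commute)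
 have 1: "Pd 1 = mu 1 * Xf 1 + mu 0 * Xf 2 + mu 0 * Xf 3 + mu 0 * Xf 4 + mu 0 * Xf 5" by (simp add: mu_ring Xf_def)
 have 2: "Pd 2 = mu 0 * Xf 1 + mu 1 * Xf 2 + mu (- co 1) * Xf 3 + mu ((1 / 2) *R (co 1 * co 1)) * Xf 4 + mu 0 * Xf 5"
  by (simp add: mu_ring Xf_def algebra_simps mc) (use h in "simp add: mult.assoc")
 have 3: "Pd 3 = mu 0 * Xf 1 + mu 0 * Xf 2 + mu 1 * Xf 3 + mu (- co 1) * Xf 4 + mu (- co 2) * Xf 5"
  by (simp add: mu_ring Xf_def algebra_simps)
 have 4: "Pd 4 = mu 0 * Xf 1 + mu 0 * Xf 2 + mu 0 * Xf 3 + mu 1 * Xf 4 + mu 0 * Xf 5" by (simp add: mu_ring Xf_def)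
 have 5: "Pd 5 = mu 0 * Xf 1 + mu 0 * Xf 2 + mu 0 * Xf 3 + mu 0 * Xf 4 + mu 1 * Xf 5" by (simp add: mu_ring Xf_def)
 have "ALL i. EX c. Pd i = (SUM l:UNIV. mu (c l) * Xf l)"
  unfolding forall_5 by (intro conjI field_combination[OF 1] field_combination[OF 2] field_combination[OF 3] field_combination[OF 4] field_combination[OF 5])
 then show ?thesis ..
qed

lemma Pd_Yf: "EX c. Pd i = (SUM l:UNIV. mu (c l) * Yf l)"
proof -
 have 1: "Pd 1 = mu 1 * Yf 1 + mu 0 * Yf 2 + mu (- co 2) * Yf 3 + mu (- co 3) * Yf 4 + mu (- ((1 / 2) *R (co 2 * co 2))) * Yf 5"
  by (simp add: mu_ring Yf_def)
 have 2: "Pd 2 = mu 0 * Yf 1 + mu 1 * Yf 2 + mu 0 * Yf 3 + mu 0 * Yf 4 + mu (- co 3) * Yf 5"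
  by (simp add: mu_ring Yf_def)
 have 3: "Pd 3 = mu 0 * Yf 1 + mu 0 * Yf 2 + mu 1 * Yf 3 + mu 0 * Yf 4 + mu 0 * Yf 5" by (simp add: mu_ring Yf_def)
 have 4: "Pd 4 = mu 0 * Yf 1 + mu 0 * Yf 2 + mu 0 * Yf 3 + mu 1 * Yf 4 + mu 0 * Yf 5" by (simp add: mu_ring Yf_def)
 have 5: "Pd 5 = mu 0 * Yf 1 + mu 0 * Yf 2 + mu 0 * Yf 3 + mu 0 * Yf 4 + mu 1 * Yf 5" by (simp add: mu_ring Yf_def)
 have "ALL i. EX c. Pd i = (SUM l:UNIV. mu (c l) * Yf l)"
  unfolding forall_5 by (intro conjI field_combination[OF 1] field_combination[OF 2] field_combination[OF 3] field_combination[OF 4] field_combination[OF 5])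
 then show ?thesis ..
qed

lemma mu_mu: "mu a * (mu b * P) = mu (a * b) * P"
 by (simp add: mu_ring(1) mult.assoc)

lemma Pd_ops: "mu (c * z ^ e) * Pd i : ops z e wd words3"
proof -
 obtain g where "Pd i = (SUM l:UNIV. mu (g l) * Xf l)" using Pd_Xf by blast
 then have "mu (c * z ^ e) * Pd i = (SUM l:UNIV. mu (g l) * (mu (c * z ^ e) * Xf l))"
  by (simp add: sum_distrib_left mu_mu mult_ac)
 then show ?thesis by (simp only:) (intro ops_sum mu_ops Xf_ops)
qed

lemma Yf_ops: "mu (z ^ e) * Yf i : ops z e wd words3"
proof -
 have "mu (z ^ e) * Pd j : ops z e wd words3" for j using Pd_ops[of 1 z e j] by simp
 moreover have "mu (z ^ e) * (mu g * Pd j) : ops z e wd words3" for g j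
  using Pd_ops[of g z e j] by (simp add: mu_mu mult_ac)
 ultimately show ?thesis by (simp add: Yf_def distrib_left ops_add)
qed

text \<open>The derivative either falls on the coefficient, at the price of one power of
  \<open>z\<close>, or reaches the word, where it is rewritten through the right-invariant
  fields.\<close>

lemma Pd_ops_yw:
 assumes "P : ops z (Suc e) yw {y. length y <= n}"
 shows "Pd i * P : ops z e yw {y. length y <= Suc n}"
 using assms unfolding ops_def[of z "Suc e"]
proof (induction rule: span_induct)
 show "subspace {x. Pd i * x : ops z e yw {y. length y <= Suc n}}"
  using ops_subspace[of z e yw] by (auto simp: subspace_def distrib_left)
 fix x assume "x : {mu (c * z ^ Suc e) * yw w |c w. w : {y. length y <= n}}"
 then obtain c y where x: "x = mu (c * z ^ Suc e) * yw y" "length y <= n" by blast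
 obtain c' where c': "act (Pd i) (z ^ Suc e) = c' * z ^ e" using derivation_power[OF derivation_rules(1)] by blast
 have "act (Pd i) (c * z ^ Suc e) = (c * c' + act (Pd i) c * z) * z ^ e"
  unfolding derivation_act[OF derivation_rules(1)] c' by (simp add: algebra_simps)
 then have "Pd i * x = mu (c * z ^ Suc e) * (Pd i * yw y) + mu ((c * c' + act (Pd i) c * z) * z ^ e) * yw y"
  unfolding x(1) mult.assoc[symmetric] Pd_mu act_Pd by (simp add: distrib_right mult.assoc)
 moreover have "mu ((c * c' + act (Pd i) c * z) * z ^ e) * yw y : ops z e yw {y. length y <= Suc n}"
  using x(2) by (intro opsI) auto
 moreover have "mu (c * z ^ Suc e) * (Pd i * yw y) : ops z e yw {y. length y <= Suc n}"
 proof -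
  obtain g where g: "Pd i = (SUM l:UNIV. mu (g l) * Yf l)" using Pd_Yf by blast
  have "mu (c * z ^ Suc e) * (Pd i * yw y) = (SUM l:UNIV. mu ((c * z * g l) * z ^ e) * yw (l # y))"
   unfolding g by (simp add: sum_distrib_left sum_distrib_right mu_mu mult_ac)
  moreover have "mu ((c * z * g l) * z ^ e) * yw (l # y) : ops z e yw {y. length y <= Suc n}" for l
   using x(2) by (intro opsI) simp
  ultimately show ?thesis by (simp only:) (intro ops_sum)
 qed
 ultimately show "Pd i * x : ops z e yw {y. length y <= Suc n}" using ops_add by simp
qed

lemma pdw_ops_yw:
 assumes "P : ops z (e + length s) yw {y. length y <= n}"
 shows "pdw s * P : ops z e yw {y. length y <= n + length s}"
 using assms
proof (induction s arbitrary: e)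
 case (Cons i s)
 from Cons.IH[of "Suc e"] Cons.prems have "pdw s * P : ops z (Suc e) yw {y. length y <= n + length s}" by simp
 from Pd_ops_yw[OF this, of i] show ?case by (simp add: mult.assoc)
qed simp

lemma commute_mult: "a * b = b * a ==> a * c = c * a ==> a * (b * c) = (b * c) * (a :: 'a::semigroup_mult)"
 by (metis mult.assoc)

lemma Yf_commute_Hom: "P : Hom n ==> Yf i * P = P * Yf i"
proof (rule Hom_induct[of P n "%P. Yf i * P = P * Yf i"])
 show "subspace {x. Yf i * x = x * Yf i}" by (auto simp: subspace_def algebra_simps)
 show "Yf i * wd u = wd u * Yf i" if "u : words n" for u
  using that
 proof (induction u arbitrary: n)
  case (Cons l u)
  then have "l = 1 \<or> l = 2" "u : words (length u)" by (auto simp: words_def)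
  then have "Yf i * Xf l = Xf l * Yf i" using Yf_Xf_commute[of i] by (auto simp: comm_def)
  from commute_mult[OF this Cons.IH[OF \<open>u : words (length u)\<close>]] show ?case by simp
 qed simp
qed

lemma yw_commute_Hom: "P : Hom n ==> yw y * P = P * yw y"
proof (induction y)
 case (Cons i y)
 from commute_mult[OF Yf_commute_Hom[OF Cons.prems, of i, symmetric] Cons.IH[OF Cons.prems, symmetric]]
 show ?case by simp
qed simp

lemma finite_lists5: "finite {y :: 5 list. length y <= m}"
 using finite_lists_length_le[of "UNIV :: 5 set" m] by simp

section \<open>Estimates for right-invariant derivatives\<close>

context maximal
begin

abbreviation row_deriv :: "5 list => 5 list => (nat => dop) => (nat => sm) => real^5 => real" where
 "row_deriv w y r v \<equiv> Fn (act (wd w) (act (yw y) (rowact N r v)))"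

definition QY :: "sm => nat => (nat => sm) => real" where
 "QY z m v = (SUM (d, r):rows. SUM y:{y. length y <= m}. SUM w:words (k - d). sq (z * act (wd w) (act (yw y) (rowact N r v))))"

definition ZN :: "sm => (nat => sm) => real" where "ZN z v = (SUM b<N. sq (z * v b))"

lemma QY_nonneg [simp]: "QY z m v >= 0" by (auto simp: QY_def intro!: sum_nonneg)
lemma ZN_nonneg [simp]: "ZN z v >= 0" by (auto simp: ZN_def intro!: sum_nonneg)

lemma QY_mono: "m <= n ==> QY z m v <= QY z n v"
 unfolding QY_def case_prod_unfold by (intro sum_mono sum_mono2 finite_lists5) (auto intro!: sum_nonneg)

lemma rowact_yw: "(d, r) : rows ==> rowact N r (%b. act (yw y) (v b)) = act (yw y) (rowact N r v)"
proof -
 assume "(d, r) : rows"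
 then have eq: "yw y * r b = r b * yw y" if "b < N" for b using yw_commute_Hom[OF row_Hom] that by blast
 have "act (r b) (act (yw y) (v b)) = act (yw y) (act (r b) (v b))" if "b < N" for b
  using arg_cong[OF eq[OF that], of "%D. act D (v b)"] by simp
 then show ?thesis by (simp add: rowact_def)
qed

text \<open>A right-invariant field is a combination of horizontal words of lengths 1 to 3. The
  fourth power of the cutoff is the largest one in the norms of order at most 3, and it contains all
  the others.\<close>

lemma first_order_estimate:
 assumes z: "bs z"
 shows "EX C>=0. ALL v. ALL b<N. ALL i. sq (z ^ 4 * act (Yf i) (v b)) <= C * (zR z v + ZN z v)"
proof -
 obtain C0 where C0: "C0 >= 0" "!!v j. j <= 3 ==> zN z j v <= C0 * (zR z v + zN z 0 v)" using local_estimate[OF z] by blast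
 have z0: "zN z 0 v = ZN z v" for v by (simp add: zN_def ZN_def znorm_def)
 have "EX C>=0. ALL v. ALL b<N. sq (z ^ 4 * act (Yf i) (v b)) <= C * (zR z v + ZN z v)" for i
 proof -
  obtain D where D: "D >= 0" "!!f. sq (act (mu (z ^ 4) * Yf i) f) <= D * (SUM w:words3. sq (z ^ 4 * act (wd w) f))"
   using ops_bound[OF z _ Yf_ops[of z 4 i]] by auto
  have "EX M>=0. ALL f. sq (z ^ (3 - j) * (z ^ (j + 1) * f)) <= M * sq (z ^ (j + 1) * f)" for j
   by (rule mult_bounded) (use z in simp)
  then obtain M where M: "!!j. M j >= 0" "!!j f. sq (z ^ (3 - j) * (z ^ (j + 1) * f)) <= M j * sq (z ^ (j + 1) * f)" by metis
  have wle: "(SUM w:words j. sq (z ^ 4 * act (wd w) f)) <= M j * znorm z j f" if "j <= 3" for j f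
  proof -
   have "z ^ (3 - j) * (z ^ (j + 1) * g) = z ^ 4 * g" for g
    using that by (simp flip: power_add mult.assoc add: power_Suc[symmetric] del: power_Suc)
   then show ?thesis unfolding znorm_def sum_distrib_left using M(2)[of j] by (intro sum_mono) metis
  qed
  define MM where "MM = M 1 + M 2 + M 3"
  have "sq (z ^ 4 * act (Yf i) (v b)) <= (D * (MM * C0)) * (zR z v + ZN z v)" if b: "b < N" for v b
  proof -
   have "sq (z ^ 4 * act (Yf i) (v b)) <= D * (SUM w:words3. sq (z ^ 4 * act (wd w) (v b)))"
    using D(2)[of "v b"] by simp
   also have "(SUM w:words3. sq (z ^ 4 * act (wd w) (v b))) = (SUM w:words 1. sq (z ^ 4 * act (wd w) (v b))) + (SUM w:words 2. sq (z ^ 4 * act (wd w) (v b))) + (SUM w:words 3. sq (z ^ 4 * act (wd w) (v b)))"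
   proof -
    have "words 1 \<inter> words 2 = {}" "(words 1 \<union> words 2) \<inter> words 3 = {}" by (auto simp: words_def)
    then show ?thesis unfolding words3_def by (simp add: sum.union_disjoint)
   qed
   also have "... <= M 1 * znorm z 1 (v b) + M 2 * znorm z 2 (v b) + M 3 * znorm z 3 (v b)"
    by (intro add_mono wle) auto
   also have "... <= M 1 * (C0 * (zR z v + ZN z v)) + M 2 * (C0 * (zR z v + ZN z v)) + M 3 * (C0 * (zR z v + ZN z v))"
   proof -
    have "znorm z j (v b) <= C0 * (zR z v + ZN z v)" if "j <= 3" for j
    proof -
     have "znorm z j (v b) <= zN z j v" unfolding zN_def using b by (intro member_le_sum) auto
     then show ?thesis using C0(2)[OF that, of v] by (simp add: z0)
    qed
    then show ?thesis by (intro add_mono mult_left_mono M(1)) auto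
   qed
   finally have "sq (z ^ 4 * act (Yf i) (v b)) <= D * (M 1 * (C0 * (zR z v + ZN z v)) + M 2 * (C0 * (zR z v + ZN z v)) + M 3 * (C0 * (zR z v + ZN z v)))"
    using D(1) by (simp add: mult_left_mono)
   then show ?thesis by (simp add: MM_def algebra_simps)
  qed
  then show ?thesis using D(1) C0(1) M(1) by (intro exI[of _ "D * (MM * C0)"]) (auto simp: MM_def)
 qed
 then obtain C where C: "!!i. C i >= 0" "!!i v b. b < N ==> sq (z ^ 4 * act (Yf i) (v b)) <= C i * (zR z v + ZN z v)" by metis
 show ?thesis
 proof (intro exI[of _ "SUM i:UNIV. C i"] conjI allI impI)
  fix v b i assume "b < N"
  then have "sq (z ^ 4 * act (Yf i) (v b)) <= C i * (zR z v + ZN z v)" using C(2) by blast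
  also have "... <= (SUM i:UNIV. C i) * (zR z v + ZN z v)"
   by (intro mult_right_mono member_le_sum) (auto simp: C(1) zR_nonneg)
  finally show "sq (z ^ 4 * act (Yf i) (v b)) <= (SUM i:UNIV. C i) * (zR z v + ZN z v)" .
 qed (auto intro: sum_nonneg C(1))
qed

text \<open>The first order estimate is used with the cutoff \<open>z ^ (4 ^ m)\<close> in place of
  \<open>z\<close> and with the \<open>m\<close>-fold right-invariant derivatives as the functions;
  rows pass through these derivatives unchanged. Each round raises the exponent to four times its
  value.\<close>

lemma iterated_estimate:
 assumes z: "bs z"
 shows "EX C>=0. ALL v y. ALL b<N. length y = m --> sq (z ^ (4 ^ m) * act (yw y) (v b)) <= C * (QY z m v + ZN z v)"
proof (induction m)
 case 0
 show ?case
 proof (intro exI[of _ 1] conjI allI impI)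
  fix v y b assume "b < N" "length (y :: 5 list) = 0"
  moreover have "sq (z * v b) <= ZN z v" if "b < N" for b
   unfolding ZN_def using that by (intro member_le_sum[of b "{..<N}" "%b. sq (z * v b)"]) auto
  ultimately show "sq (z ^ 4 ^ 0 * act (yw y) (v b)) <= 1 * (QY z 0 v + ZN z v)" using QY_nonneg[of z 0 v] by (simp add: add_increasing)
 qed simp
next
 case (Suc m)
 then obtain C where C: "C >= 0" "!!v y b. b < N ==> length y = m ==> sq (z ^ (4 ^ m) * act (yw y) (v b)) <= C * (QY z m v + ZN z v)" by blast
 define zm where "zm = z ^ (4 ^ m)"
 have "4 ^ m ~= (0::nat)" by simp
 then obtain q where q: "4 ^ m = Suc q" by (metis not0_implies_Suc)
 have bz: "bs zm" using z by (simp add: zm_def q)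
 obtain D where D: "D >= 0" "!!v b i. b < N ==> sq (zm ^ 4 * act (Yf i) (v b)) <= D * (zR zm v + ZN zm v)" using first_order_estimate[OF bz] by blast
 obtain M where M: "M >= 0" "!!f. sq ((z ^ q * zm ^ k) * (z * f)) <= M * sq (z * f)" using mult_bounded[OF z] by blast
 have "sq (z ^ (4 ^ Suc m) * act (yw y) (v b)) <= (D * (M + N * C)) * (QY z (Suc m) v + ZN z v)" if b: "b < N" and y: "length y = Suc m" for v y b
 proof -
  obtain i y' where y': "y = i # y'" "length y' = m" using y by (cases y) auto
  define u where "u b = act (yw y') (v b)" for b
  have "sq (z ^ (4 ^ Suc m) * act (yw y) (v b)) = sq (zm ^ 4 * act (Yf i) (u b))"
   by (simp add: zm_def u_def y' power_mult[symmetric] mult.commute)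
  also have "... <= D * (zR zm u + ZN zm u)" using D(2)[OF b] .
  also have "zR zm u <= M * QY z (Suc m) v"
  proof -
   have "zR zm u <= (SUM (d, r):rows. SUM w:words (k - d). M * sq (z * act (wd w) (act (yw y') (rowact N r v))))"
    unfolding zR_def case_prod_unfold
   proof (intro sum_mono)
    fix dr w assume dr: "dr : rows"
    then have "rowact N (snd dr) u = act (yw y') (rowact N (snd dr) v)" unfolding u_def using rowact_yw[of "fst dr" "snd dr"] by simp
    moreover have "zm ^ (k + 1) * f = (z ^ q * zm ^ k) * (z * f)" for f
     by (simp add: zm_def q mult_ac)
    ultimately show "sq (zm ^ (k + 1) * act (wd w) (rowact N (snd dr) u)) <= M * sq (z * act (wd w) (act (yw y') (rowact N (snd dr) v)))"
     using M(2) by metis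
   qed
   also have "... = M * (SUM (d, r):rows. SUM w:words (k - d). sq (z * act (wd w) (act (yw y') (rowact N r v))))"
    by (simp add: sum_distrib_left case_prod_unfold)
   also have "... <= M * QY z (Suc m) v"
    unfolding QY_def case_prod_unfold using y'(2) finite_lists5[of "Suc m"] M(1)
    by (intro mult_left_mono sum_mono member_le_sum[of y' "{y. length y <= Suc m}" "%y. SUM w:words _. sq (z * act (wd w) (act (yw y) _))"]) (auto intro!: sum_nonneg)
   finally show ?thesis .
  qed
  also have "ZN zm u <= N * (C * (QY z (Suc m) v + ZN z v))"
  proof -
   have "ZN zm u <= (SUM b<N. C * (QY z (Suc m) v + ZN z v))"
    unfolding ZN_def[of zm]
   proof (intro sum_mono)
    fix b assume "b : {..<N}"
    then have "sq (zm * u b) <= C * (QY z m v + ZN z v)" using C(2)[of b y' v] y'(2) by (simp add: zm_def u_def)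
    also have "... <= C * (QY z (Suc m) v + ZN z v)" using C(1) QY_mono[of m "Suc m" z v] by (intro mult_left_mono) auto
    finally show "sq (zm * u b) <= C * (QY z (Suc m) v + ZN z v)" .
   qed
   then show ?thesis by simp
  qed
  finally have "sq (z ^ (4 ^ Suc m) * act (yw y) (v b)) <= D * (M * QY z (Suc m) v + N * (C * (QY z (Suc m) v + ZN z v)))"
   using D(1) by (simp add: mult_left_mono)
  also have "... <= D * (M * (QY z (Suc m) v + ZN z v) + N * (C * (QY z (Suc m) v + ZN z v)))"
   using D(1) M(1) C(1) ZN_nonneg[of z v] by (intro mult_left_mono add_mono) auto
  finally show ?thesis by (simp add: algebra_simps)
 qed
 then show ?case using D(1) M(1) C(1) by (intro exI[of _ "D * (M + N * C)"]) auto
qed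

lemma pointwise_estimate:
 assumes z: "bs z"
 shows "EX q m. EX C>=0. ALL v. ALL b<N. ALL x. (Fn (z ^ q * act (yw y) (v b)) x)^2 <= C * (QY z m v + ZN z v)"
proof -
 obtain S C where S: "finite S" "!!s. s : S ==> length s <= 5" "C >= 0"
  "!!f x. bs f ==> (Fn f x)^2 <= C * (SUM s:S. sq (act (pdw s) f))" using sobolev by metis
 \<comment> \<open>The Sobolev inequality takes up to five coordinate derivatives; turned into
   right-invariant ones they lengthen the word by at most five and cost at most five powers of
   \<open>z\<close>. This gives \<open>m\<close> and the 5 in \<open>q\<close>, while
   \<open>4 ^ m\<close> dominates the exponents for all shorter words.\<close>
 define m where "m = length y + 5"
 define e where "e = (4 ^ m :: nat)"
 have e0: "e > 0" by (simp add: e_def)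
 define q where "q = e + 5"
 have bq: "bs (z ^ q)" using z by (simp add: q_def numeral_eq_Suc)
 have "EX D>=0. ALL v. ALL b<N. sq (act (pdw s) (z ^ q * act (yw y) (v b))) <= D * (QY z m v + ZN z v)" if s: "s : S" for s
 proof -
  have "mu (z ^ (5 - length s) * z ^ (e + length s)) * yw y : ops z (e + length s) yw {y'. length y' <= length y}"
   by (intro opsI) simp
  moreover have "z ^ (5 - length s) * z ^ (e + length s) = z ^ q"
   using S(2)[OF s] by (simp flip: power_add add: q_def add.commute)
  ultimately have "pdw s * (mu (z ^ q) * yw y) : ops z e yw {y'. length y' <= length y + length s}"
   using pdw_ops_yw by metis
  also have "... <= ops z e yw {y'. length y' <= m}"
   using S(2)[OF s] by (intro ops_mono) (auto simp: m_def)
  finally obtain D where D: "D >= 0" "!!f. sq (act (pdw s * (mu (z ^ q) * yw y)) f) <= D * (SUM y':{y'. length y' <= m}. sq (z ^ e * act (yw y') f))"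
   using ops_bound[OF z e0 _ finite_lists5] by blast
  have "ALL j. EX E>=0. ALL v y. ALL b<N. length y = j --> sq (z ^ (4 ^ j) * act (yw y) (v b)) <= E * (QY z j v + ZN z v)"
   using iterated_estimate[OF z] by blast
  then obtain E where E: "!!j. E j >= 0" "!!j v y b. b < N ==> length y = j ==> sq (z ^ (4 ^ j) * act (yw y) (v b)) <= E j * (QY z j v + ZN z v)"
   by metis
  have "ALL j. EX M>=0. ALL f. sq (z ^ (e - 4 ^ j) * (z ^ (4 ^ j) * f)) <= M * sq (z ^ (4 ^ j) * f)"
  proof
   fix j :: nat
   have "(4::nat) ^ j ~= 0" by simp
   then have "bs (z ^ (4 ^ j))" using z by (metis bs_simps(2) not0_implies_Suc power_Suc)
   then show "EX M>=0. ALL f. sq (z ^ (e - 4 ^ j) * (z ^ (4 ^ j) * f)) <= M * sq (z ^ (4 ^ j) * f)" by (rule mult_bounded)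
  qed
  then obtain M where M: "!!j. M j >= 0" "!!j f. sq (z ^ (e - 4 ^ j) * (z ^ (4 ^ j) * f)) <= M j * sq (z ^ (4 ^ j) * f)" by metis
  define G where "G = (SUM y':{y' :: 5 list. length y' <= m}. M (length y') * E (length y'))"
  have "sq (act (pdw s) (z ^ q * act (yw y) (v b))) <= (D * G) * (QY z m v + ZN z v)" if b: "b < N" for v b
  proof -
   have "sq (act (pdw s) (z ^ q * act (yw y) (v b))) <= D * (SUM y':{y'. length y' <= m}. sq (z ^ e * act (yw y') (v b)))"
    using D(2)[of "v b"] by simp
   also have "... <= D * (SUM y':{y' :: 5 list. length y' <= m}. (M (length y') * E (length y')) * (QY z m v + ZN z v))"
   proof (intro mult_left_mono sum_mono D(1))
    fix y' assume "y' : {y' :: 5 list. length y' <= m}"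
    then have l: "length y' <= m" by simp
    have "(4::nat) ^ length y' <= e" unfolding e_def using l by (intro power_increasing) auto
    then have "z ^ (e - 4 ^ length y') * (z ^ (4 ^ length y') * f) = z ^ e * f" for f
     by (simp flip: power_add mult.assoc)
    then have "sq (z ^ e * act (yw y') (v b)) <= M (length y') * sq (z ^ (4 ^ length y') * act (yw y') (v b))"
     using M(2) by metis
    also have "... <= M (length y') * (E (length y') * (QY z (length y') v + ZN z v))"
     using E(2)[OF b] M(1) by (intro mult_left_mono) auto
    also have "... <= M (length y') * (E (length y') * (QY z m v + ZN z v))"
     using E(1) M(1) QY_mono[OF l] by (intro mult_left_mono add_right_mono) auto
    finally show "sq (z ^ e * act (yw y') (v b)) <= (M (length y') * E (length y')) * (QY z m v + ZN z v)" by (simp add: mult.assoc)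
   qed
   also have "... = (D * G) * (QY z m v + ZN z v)" by (simp add: G_def sum_distrib_right mult.assoc)
   finally show ?thesis .
  qed
  moreover have "D * G >= 0" unfolding G_def using D(1) M(1) E(1) by (intro mult_nonneg_nonneg sum_nonneg) auto
  ultimately show ?thesis by blast
 qed
 then obtain D where D: "!!s. s : S ==> D s >= 0" "!!s v b. s : S ==> b < N ==> sq (act (pdw s) (z ^ q * act (yw y) (v b))) <= D s * (QY z m v + ZN z v)"
  by metis
 show ?thesis
 proof (rule exI[of _ q], rule exI[of _ m], rule exI[of _ "C * (SUM s:S. D s)"], intro conjI allI impI)
  fix v b x assume b: "b < N"
  have "(Fn (z ^ q * act (yw y) (v b)) x)^2 <= C * (SUM s:S. sq (act (pdw s) (z ^ q * act (yw y) (v b))))"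
   using bq by (intro S(4)) simp
  also have "... <= C * (SUM s:S. D s * (QY z m v + ZN z v))" using S(3) D(2) b by (intro mult_left_mono sum_mono) auto
  finally show "(Fn (z ^ q * act (yw y) (v b)) x)^2 <= C * (SUM s:S. D s) * (QY z m v + ZN z v)"
   by (simp add: sum_distrib_right mult.assoc)
 qed (use S(3) D(1) in "auto intro!: sum_nonneg mult_nonneg_nonneg")
qed

end

lemma sq_sup_bound:
 assumes "bs z" shows "EX C>=0. ALL g B. (ALL x. Fn z x ~= 0 --> \<bar>Fn g x\<bar> <= B) --> sq (z * g) <= C * B^2"
proof (intro exI[of _ "sq z"] conjI allI impI)
 fix g B assume B: "ALL x. Fn z x ~= 0 --> \<bar>Fn g x\<bar> <= B"
 have "sq (z * g) <= (LINT x|lborel. Fn z x * Fn z x * B^2)"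
  unfolding sq_def ip_def
 proof (rule integral_mono)
  show "integrable lborel (%x. Fn (z * g) x * Fn (z * g) x)" by (rule integrable_ip) (use assms in simp)
  show "integrable lborel (%x. Fn z x * Fn z x * B^2)" by (rule integrable_mult_left, rule integrable_ip) (use assms in simp)
  fix x
  have "Fn z x = 0 \<or> (Fn g x)^2 <= B^2" using B[rule_format, of x] by (auto simp: abs_le_square_iff[symmetric] intro: order_trans[OF _ abs_ge_self])
  then show "Fn (z * g) x * Fn (z * g) x <= Fn z x * Fn z x * B^2"
  proof
   assume "(Fn g x)^2 <= B^2"
   from mult_left_mono[OF this, of "Fn z x * Fn z x"] show ?thesis by (simp add: power2_eq_square mult_ac)
  qed simp
 qed
 then show "sq (z * g) <= sq z * B^2" by (simp add: sq_def ip_def)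
qed simp

context maximal
begin

text \<open>The square norms on the right are replaced by suprema over the set where the cutoff is
  nonzero, because the mollifications and their rows are controlled in this form.\<close>

theorem sup_estimate:
 assumes z: "bs z"
 shows "EX q m. EX C>=0. ALL v B. B >= 0 --> (ALL b<N. ALL x. Fn z x ~= 0 --> \<bar>Fn (v b) x\<bar> <= B) -->
  (ALL d r y w x. (d, r) : rows --> length y <= m --> w : words (k - d) --> Fn z x ~= 0 --> \<bar>row_deriv w y r v x\<bar> <= B) -->
  (ALL b<N. ALL x. \<bar>Fn (z ^ q * act (yw y) (v b)) x\<bar> <= C * B)"
proof -
 obtain q m C where C: "C >= 0" "!!v b x. b < N ==> (Fn (z ^ q * act (yw y) (v b)) x)^2 <= C * (QY z m v + ZN z v)"
  using pointwise_estimate[OF z] by metis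
 obtain D where D: "D >= 0" "!!g B. (!!x. Fn z x ~= 0 ==> \<bar>Fn g x\<bar> <= B) ==> sq (z * g) <= D * B^2" using sq_sup_bound[OF z] by blast
 define T where "T = (SUM (d, r):rows. SUM y:{y :: 5 list. length y <= m}. SUM w:words (k - d). D)"
 have T: "T >= 0" unfolding T_def using D(1) by (auto intro!: sum_nonneg)
 show ?thesis
 proof (rule exI[of _ q], rule exI[of _ m], rule exI[of _ "sqrt (C * (T + N * D))"], intro conjI allI impI)
  show "0 <= sqrt (C * (T + N * D))" using C(1) T D(1) by simp
  fix v B b x assume B: "B >= 0" "ALL b<N. ALL x. Fn z x ~= 0 --> \<bar>Fn (v b) x\<bar> <= B"
   and R: "ALL d r y w x. (d, r) : rows --> length y <= m --> w : words (k - d) --> Fn z x ~= 0 --> \<bar>row_deriv w y r v x\<bar> <= B"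
   and b: "b < N"
  have "QY z m v <= (SUM (d, r):rows. SUM y:{y :: 5 list. length y <= m}. SUM w:words (k - d). D * B^2)"
   unfolding QY_def case_prod_unfold
  proof (intro sum_mono D(2))
   fix p :: "nat \<times> _" and y w x assume "p : rows" "y : {y :: 5 list. length y <= m}" "w : words (k - fst p)" "Fn z x ~= 0"
   then show "\<bar>row_deriv w y (snd p) v x\<bar> <= B" using R[rule_format, of "fst p" "snd p"] by simp
  qed
  also have "... = T * B^2" by (simp add: T_def sum_distrib_right case_prod_unfold mult.assoc)
  finally have 1: "QY z m v <= T * B^2" .
  have "ZN z v <= (SUM b<N. D * B^2)" unfolding ZN_def using B(2) by (intro sum_mono D(2)) auto
  then have 2: "ZN z v <= N * D * B^2" by simp
  have "(Fn (z ^ q * act (yw y) (v b)) x)^2 <= C * (T * B^2 + N * D * B^2)"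
   using C(2)[OF b, of v x] mult_left_mono[OF add_mono[OF 1 2] C(1)] by linarith
  also have "... = (C * (T + N * D)) * B^2" by (simp add: algebra_simps)
  finally have "sqrt ((Fn (z ^ q * act (yw y) (v b)) x)^2) <= sqrt ((C * (T + N * D)) * B^2)" by (rule real_sqrt_le_mono)
  then show "\<bar>Fn (z ^ q * act (yw y) (v b)) x\<bar> <= sqrt (C * (T + N * D)) * B"
   using B(1) by (simp add: real_sqrt_mult)
 qed
qed

end

section \<open>Operations on functionals of compact support\<close>

lemma iter_deriv_linear:
 assumes "smooth f" "smooth g"
 shows "iter_deriv vs (%x. f x + g x) = (%x. iter_deriv vs f x + iter_deriv vs g x)"
  and "iter_deriv vs (%x. c * f x) = (%x. c * iter_deriv vs f x)"
proof (induction vs)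
 case (Cons v vs)
 have "(iter_deriv vs f has_derivative fder (iter_deriv vs f) x) (at x)"
  "(iter_deriv vs g has_derivative fder (iter_deriv vs g) x) (at x)" for x
  using smooth_on_has_derivative[OF smooth_iter_deriv] assms by auto
 note d = this
 case 1 show ?case using fder_eqI[OF has_derivative_add[OF d]] by (simp add: Cons(1))
 case 2 show ?case using fder_eqI[OF has_derivative_mult_right[OF d(1)]] by (simp add: Cons(2))
qed simp_all

lemma iter_deriv_sum:
 assumes "finite I" "!!i. i : I ==> smooth (f i)"
 shows "iter_deriv vs (%x. SUM i:I. f i x) = (%x. SUM i:I. iter_deriv vs (f i) x)"
 using assms
proof (induction rule: finite_induct)
 case empty
 have "iter_deriv vs (%x. 0) = (%x. 0)" using iter_deriv_linear(2)[of "%x. 0" "%x. 0" vs 0] by simp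
 then show ?case by simp
next
 case (insert i I)
 have "smooth (%x. SUM i:I. f i x)" using insert.prems by (intro smooth_on_sum) auto
 then show ?case using insert by (simp add: iter_deriv_linear(1))
qed

text \<open>Splitting off the innermost derivative with \<open>a\<close> arbitrary replaces an
  explicit Leibniz formula: one term differentiates \<open>a\<close>, the other the test
  function.\<close>

lemma iter_deriv_mult_bound:
 fixes a :: "'a::euclidean_space => real"
 assumes "compact K" "vs : lists Basis" "smooth a"
 shows "EX C>=0. ALL \<phi> B. smooth \<phi> --> deriv_bound (length vs) K \<phi> B -->
  (ALL x:K. \<bar>iter_deriv vs (%x. a x * \<phi> x) x\<bar> <= C * B)"
 using assms(2,3)
proof (induction vs arbitrary: a rule: rev_induct)
 case Nil
 have "compact (a ` K)" using Nil smooth_on_continuous_on assms(1) by (intro compact_continuous_image) (auto intro: continuous_on_subset)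
 then obtain C where C: "C > 0" "!!x. x : K ==> \<bar>a x\<bar> <= C" using compact_imp_bounded bounded_pos by (metis imageI real_norm_def)
 show ?case
 proof (intro exI[of _ C] conjI allI impI ballI)
  fix \<phi> :: "'a => real" and B x assume "deriv_bound (length []) K \<phi> B" and x: "x : K"
  then have "\<bar>\<phi> x\<bar> <= B" by auto
  then show "\<bar>iter_deriv [] (%x. a x * \<phi> x) x\<bar> <= C * B" using C(1) C(2)[OF x] by (simp add: abs_mult mult_mono')
 qed (use C in auto)
next
 case (snoc b vs)
 let ?D = "%f x. fder f x b"
 have b: "b : Basis" and vs: "vs : lists Basis" using snoc.prems by auto
 have sa: "smooth (?D a)" using snoc.prems by (intro smooth_on_deriv) auto
 obtain C1 where C1: "C1 >= 0" "!!\<phi> B x. smooth \<phi> ==> deriv_bound (length vs) K \<phi> B ==>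
  x : K ==> \<bar>iter_deriv vs (%x. ?D a x * \<phi> x) x\<bar> <= C1 * B" using snoc.IH[OF vs sa] by metis
 obtain C2 where C2: "C2 >= 0" "!!\<phi> B x. smooth \<phi> ==> deriv_bound (length vs) K \<phi> B ==>
  x : K ==> \<bar>iter_deriv vs (%x. a x * \<phi> x) x\<bar> <= C2 * B" using snoc.IH[OF vs snoc.prems(2)] by metis
 show ?case
 proof (intro exI[of _ "C1 + C2"] conjI allI impI ballI)
  fix \<phi> :: "'a => real" and B x assume p: "smooth \<phi>" and B: "deriv_bound (length (vs @ [b])) K \<phi> B" and x: "x : K"
  have sp: "smooth (?D \<phi>)" using p by (intro smooth_on_deriv) auto
  have "?D (%x. a x * \<phi> x) = (%x. ?D a x * \<phi> x + a x * ?D \<phi> x)"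
  proof
   fix y
   show "?D (%x. a x * \<phi> x) y = ?D a y * \<phi> y + a y * ?D \<phi> y"
    using fder_eqI[OF has_derivative_mult[OF smooth_on_has_derivative[OF snoc.prems(2)] smooth_on_has_derivative[OF p]], of y] by simp
  qed
  then have "iter_deriv (vs @ [b]) (%x. a x * \<phi> x) x = iter_deriv vs (%x. ?D a x * \<phi> x) x + iter_deriv vs (%x. a x * ?D \<phi> x) x"
   unfolding iter_deriv_snoc using sa sp p snoc.prems(2) by (simp add: iter_deriv_linear smooth_on_mult)
  moreover have "\<bar>iter_deriv vs (%x. ?D a x * \<phi> x) x\<bar> <= C1 * B"
   using B by (intro C1(2) p x) auto
  moreover have "\<bar>iter_deriv vs (%x. a x * ?D \<phi> x) x\<bar> <= C2 * B"
  proof (intro C2(2) sp x ballI impI)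
   fix ws :: "'a list" and y assume "ws : lists Basis" "length ws <= length vs" "y : K"
   then show "\<bar>iter_deriv ws (?D \<phi>) y\<bar> <= B" using B[rule_format, of "ws @ [b]" y] b by (simp add: iter_deriv_snoc)
  qed
  ultimately show "\<bar>iter_deriv (vs @ [b]) (%x. a x * \<phi> x) x\<bar> <= (C1 + C2) * B" by (simp add: algebra_simps)
 qed (use C1 C2 in auto)
qed

lemma finite_lists_le: "finite {vs : lists (Basis :: 'a::euclidean_space set). length vs <= N}"
 using finite_lists_length_le[of "Basis :: 'a set" N] by (simp add: lists_eq_set)

lemma iter_deriv_mult_bound_le:
 fixes a :: "'a::euclidean_space => real"
 assumes "compact K" "smooth a"
 shows "EX C>=0. ALL \<phi> B. smooth \<phi> --> deriv_bound N K \<phi> B -->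
  deriv_bound N K (%x. a x * \<phi> x) (C * B)"
proof -
 define Q where "Q vs C \<longleftrightarrow> (ALL \<phi> B. smooth \<phi> --> deriv_bound (length vs) K \<phi> B -->
  (ALL x:K. \<bar>iter_deriv vs (%x. a x * \<phi> x) x\<bar> <= C * B))" for vs :: "'a list" and C :: real
 have "ALL vs:lists Basis. EX C. C >= 0 & Q vs C"
  unfolding Q_def using iter_deriv_mult_bound[OF assms(1) _ assms(2)] by (rule ballI)
 from bchoice[OF this] obtain C where CQ: "ALL vs:lists Basis. C vs >= 0 & Q vs (C vs)" ..
 then have C1: "!!vs. vs : lists Basis ==> C vs >= 0" and Q: "!!vs. vs : lists Basis ==> Q vs (C vs)" by auto
 have C2: "\<bar>iter_deriv vs (%x. a x * \<phi> x) x\<bar> <= C vs * B" if "vs : lists (Basis :: 'a set)" "smooth \<phi>"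
  "deriv_bound (length vs) K \<phi> B" "x : K"
  for vs :: "'a list" and \<phi> :: "'a => real" and B x
  by (rule Q[OF that(1), unfolded Q_def, THEN spec, THEN spec, THEN mp, THEN mp, THEN bspec]) (fact that)+
 let ?L = "{vs : lists (Basis :: 'a set). length vs <= N}"
 show ?thesis
 proof (intro exI[of _ "SUM vs:?L. C vs"] conjI allI impI ballI)
  fix \<phi> :: "'a => real" and B and vs :: "'a list" and x assume p: "smooth \<phi>" and B: "deriv_bound N K \<phi> B"
   and vs: "vs : lists Basis" "length vs <= N" and x: "x : K"
  have B0: "B >= 0" using B[rule_format, of "[]", OF _ _ x] by simp
  have "\<bar>iter_deriv vs (%x. a x * \<phi> x) x\<bar> <= C vs * B" using B vs by (intro C2 p x) auto
  also have "... <= (SUM vs:?L. C vs) * B"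
   using vs finite_lists_le[of N] C1 B0 by (intro mult_right_mono member_le_sum) auto
  finally show "\<bar>iter_deriv vs (%x. a x * \<phi> x) x\<bar> <= (SUM vs:?L. C vs) * B" .
 qed (rule sum_nonneg, rule C1, simp)
qed

lemma cdistr_mult:
 assumes S: "cdistr S" and a: "smooth a"
 shows "cdistr (%\<phi>. S (%x. a x * \<phi> x))"
proof -
 obtain K N C where K: "compact K" "C >= 0" "!!\<phi> B. smooth \<phi> ==>
   deriv_bound N K \<phi> B ==> \<bar>S \<phi>\<bar> <= C * B"
  using S unfolding cdistr_def by blast
 obtain D where "D >= 0 & (ALL \<phi> B. smooth \<phi> --> deriv_bound N K \<phi> B -->
  deriv_bound N K (%x. a x * \<phi> x) (D * B))"
  using iter_deriv_mult_bound_le[OF K(1) a, of N] ..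
 then have D: "D >= 0" and D2: "ALL \<phi> B. smooth \<phi> --> deriv_bound N K \<phi> B -->
  deriv_bound N K (%x. a x * \<phi> x) (D * B)" by (rule conjunct1, rule conjunct2)
 have "\<bar>S (%x. a x * \<phi> x)\<bar> <= C * D * B" if "smooth \<phi>" "deriv_bound N K \<phi> B" for \<phi> B
  unfolding mult.assoc by (rule K(3)[OF smooth_mult[OF a that(1)] D2[THEN spec, THEN spec, THEN mp, THEN mp, OF that]])
 then have bd: "EX K N C. compact K & 0 <= C & (ALL \<phi> B. smooth \<phi> -->
   deriv_bound N K \<phi> B --> \<bar>S (%x. a x * \<phi> x)\<bar> <= C * B)"
  by - (rule exI[of _ K], rule exI[of _ N], rule exI[of _ "C * D"], intro conjI K(1) mult_nonneg_nonneg K(2) D allI impI)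
 show ?thesis unfolding cdistr_def
  using bd cdistr_add[OF S] cdistr_cmult[OF S] a
  by (simp add: distrib_left smooth_on_mult mult.left_commute)
qed

lemma cdistr_deriv:
 fixes S :: "('a::euclidean_space => real) => real"
 assumes S: "cdistr S" and b: "b : Basis"
 shows "cdistr (%\<phi>. S (%x. fder \<phi> x b))"
proof -
 obtain K N C where K: "compact K" "C >= 0" "!!\<phi> B. smooth \<phi> ==>
   deriv_bound N K \<phi> B ==> \<bar>S \<phi>\<bar> <= C * B"
  using S unfolding cdistr_def by blast
 have bd: "EX K N C. compact K & 0 <= C & (ALL \<phi> B. smooth \<phi> -->
   deriv_bound N K \<phi> B --> \<bar>S (%x. fder \<phi> x b)\<bar> <= C * B)"
 proof (rule exI[of _ K], rule exI[of _ "Suc N"], rule exI[of _ C], intro conjI allI impI K(1,2))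
  fix \<phi> :: "'a => real" and B assume p: "smooth \<phi>" and B: "deriv_bound (Suc N) K \<phi> B"
  show "\<bar>S (%x. fder \<phi> x b)\<bar> <= C * B"
  proof (intro K(3) ballI impI)
   fix vs :: "'a list" and x assume "vs : lists Basis" "length vs <= N" "x : K"
   then show "\<bar>iter_deriv vs (%x. fder \<phi> x b) x\<bar> <= B"
    using B[rule_format, of "vs @ [b]" x] b by (simp add: iter_deriv_snoc)
  qed (use p in "auto intro: smooth_on_deriv")
 qed
 have 1: "(%x. fder (%x. \<phi> x + \<psi> x) x b) = (%x. fder \<phi> x b + fder \<psi> x b)"
  "(%x. fder (%x. c * \<phi> x) x b) = (%x. c * fder \<phi> x b)"
  if "smooth \<phi>" "smooth \<psi>" for \<phi> \<psi> :: "'a => real" and c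
  using iter_deriv_linear[OF that, of "[b]"] by simp_all
 show ?thesis unfolding cdistr_def
  using bd by (simp add: 1 cdistr_add[OF S] cdistr_cmult[OF S] smooth_on_deriv)
qed

lemma cdistr_plus:
 fixes S :: "('a::euclidean_space => real) => real"
 assumes S: "cdistr S" and T: "cdistr T"
 shows "cdistr (%\<phi>. S \<phi> + T \<phi>)"
proof -
 obtain K N C where K: "compact K" "C >= 0" "!!\<phi> B. smooth \<phi> ==>
   deriv_bound N K \<phi> B ==> \<bar>S \<phi>\<bar> <= C * B"
  using S unfolding cdistr_def by blast
 obtain K' N' C' where K': "compact K'" "C' >= 0" "!!\<phi> B. smooth \<phi> ==>
   deriv_bound N' K' \<phi> B ==> \<bar>T \<phi>\<bar> <= C' * B"
  using T unfolding cdistr_def by blast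
 have bd: "EX K N C. compact K & 0 <= C & (ALL \<phi> B. smooth \<phi> -->
   deriv_bound N K \<phi> B --> \<bar>S \<phi> + T \<phi>\<bar> <= C * B)"
 proof (rule exI[of _ "K \<union> K'"], rule exI[of _ "N + N'"], rule exI[of _ "C + C'"], intro conjI allI impI)
  fix \<phi> :: "'a => real" and B assume p: "smooth \<phi>" and B: "deriv_bound (N + N') (K \<union> K') \<phi> B"
  have "\<bar>S \<phi>\<bar> <= C * B" using B by (intro K(3) p) auto
  moreover have "\<bar>T \<phi>\<bar> <= C' * B" using B by (intro K'(3) p) auto
  ultimately show "\<bar>S \<phi> + T \<phi>\<bar> <= (C + C') * B" by (simp add: algebra_simps)
 qed (use K K' in auto)
 show ?thesis unfolding cdistr_def
  using bd cdistr_add[OF S] cdistr_cmult[OF S] cdistr_add[OF T] cdistr_cmult[OF T]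
  by (auto simp: algebra_simps)
qed

declare Fn_Sm [simp]

text \<open>Elements of \<open>dop\<close> are linear and local but carry no continuity bound; this
  property is therefore proved for multiplications and coordinate derivatives and propagated along
  sums and products.\<close>

definition op_closed :: "dop => bool" where
 "op_closed D \<longleftrightarrow> (ALL S. cdistr S --> cdistr (%\<phi>. S (Fn (act D (Sm \<phi>)))))"

lemma cdistr_cong:
 assumes "!!\<phi>. smooth \<phi> ==> S \<phi> = T \<phi>" "cdistr S"
 shows "cdistr T"
proof -
 have "smooth (%x. \<phi> x + \<psi> x)" "smooth (%x. c * \<phi> x)" if "smooth \<phi>" "smooth \<psi>" for \<phi> \<psi> :: "'a => real" and c
  using that by (auto intro: smooth_on_add smooth_on_cmult)
 then show ?thesis using assms(2) unfolding cdistr_def by (simp add: assms(1)[symmetric])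
qed

lemma op_closed_mu: "op_closed (mu a)"
 unfolding op_closed_def
proof (intro allI impI)
 fix S :: "(real^5 => real) => real" assume "cdistr S"
 from cdistr_mult[OF this, of "Fn a"] show "cdistr (%\<phi>. S (Fn (act (mu a) (Sm \<phi>))))"
  by (rule cdistr_cong[rotated]) (simp_all add: times_sm.rep_eq)
qed

lemma op_closed_Pd: "op_closed (Pd i)"
 unfolding op_closed_def
proof (intro allI impI)
 fix S :: "(real^5 => real) => real" assume "cdistr S"
 from cdistr_deriv[OF this, of "axis i 1"] show "cdistr (%\<phi>. S (Fn (act (Pd i) (Sm \<phi>))))"
  by (rule cdistr_cong[rotated]) (simp_all add: act_Pd Fn_dr[abs_def] axis_in_Basis_iff)
qed

lemma op_closed_add: "op_closed D ==> op_closed E ==> op_closed (D + E)"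
 unfolding op_closed_def
proof (intro allI impI)
 fix S :: "(real^5 => real) => real"
 assume D: "ALL S. cdistr S --> cdistr (%\<phi>. S (Fn (act D (Sm \<phi>))))"
  and E: "ALL S. cdistr S --> cdistr (%\<phi>. S (Fn (act E (Sm \<phi>))))" and S: "cdistr S"
 from cdistr_plus[OF D[rule_format, OF S] E[rule_format, OF S]]
 show "cdistr (%\<phi>. S (Fn (act (D + E) (Sm \<phi>))))"
  by (rule cdistr_cong[rotated]) (simp add: plus_sm.rep_eq cdistr_add[OF S])
qed

lemma op_closed_mult: "op_closed D ==> op_closed E ==> op_closed (D * E)"
 unfolding op_closed_def
proof (intro allI impI)
 fix S :: "(real^5 => real) => real"
 assume D: "ALL S. cdistr S --> cdistr (%\<phi>. S (Fn (act D (Sm \<phi>))))"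
  and E: "ALL S. cdistr S --> cdistr (%\<phi>. S (Fn (act E (Sm \<phi>))))" and S: "cdistr S"
 from E[rule_format, OF D[rule_format, OF S]]
 show "cdistr (%\<phi>. S (Fn (act (D * E) (Sm \<phi>))))"
  by (simp add: Fn_inverse)
qed

lemma op_closed_Xf: "op_closed (Xf i)"
 unfolding Xf_def by (auto intro!: op_closed_add op_closed_mult op_closed_Pd op_closed_mu)

section \<open>Interchange of functionals and integrals\<close>

lemma smooth_bounded_on_compact:
 assumes "smooth f" "compact K"
 shows "EX C>=0. ALL x:K. \<bar>f x\<bar> <= C"
proof -
 have "compact (f ` K)" using assms smooth_on_continuous_on by (intro compact_continuous_image) (auto intro: continuous_on_subset)
 then show ?thesis using compact_imp_bounded[of "f ` K"] bounded_pos[of "f ` K"] by (auto intro: less_imp_le)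
qed

text \<open>The tagged division enters only through its fineness, so one division serves
  simultaneously for all functions with a common modulus of continuity.\<close>

lemma riemann_sum_bound:
 fixes g :: "'a::euclidean_space => real"
 assumes "continuous_on (cbox a b) g" "p tagged_division_of cbox a b" "(%x. ball x d) fine p"
  and g: "!!x x'. x : cbox a b ==> x' : cbox a b ==> dist x x' < d ==> \<bar>g x - g x'\<bar> <= e" and e: "e >= 0"
 shows "\<bar>(SUM (x, k):p. measure lborel k * g x) - integral (cbox a b) g\<bar> <= e * measure lborel (cbox a b)"
proof -
 have gi: "g integrable_on cbox a b" by (rule integrable_continuous[OF assms(1)])
 have "integral (cbox a b) g = (SUM (x, k):p. integral k g)"
  by (rule integral_combine_tagged_division_topdown[OF gi assms(2)])
 then have "\<bar>(SUM (x, k):p. measure lborel k * g x) - integral (cbox a b) g\<bar> = \<bar>SUM (x, k):p. measure lborel k * g x - integral k g\<bar>"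
  by (simp add: sum_subtractf case_prod_unfold)
 also have "... <= (SUM (x, k):p. \<bar>measure lborel k * g x - integral k g\<bar>)" unfolding case_prod_unfold by (rule sum_abs)
 also have "... <= (SUM (x, k):p. e * measure lborel k)"
 proof (rule sum_mono, clarify)
  fix x k assume xk: "(x, k) : p"
  then obtain u v where k: "k = cbox u v" using assms(2) by (metis tagged_division_ofD(4))
  have sub: "k <= cbox a b" "x : k" using xk assms(2) by (auto dest: tagged_division_ofD)
  have kd: "k <= ball x d" using xk assms(3) by (auto simp: fine_def)
  have gk: "g integrable_on k" using integrable_on_subcbox[OF gi] sub(1) k by blast
  have hi: "((%y. g x - g y) has_integral (measure lborel k * g x - integral k g)) (cbox u v)"
   using has_integral_diff[OF has_integral_const[of "g x" u v] integrable_integral[OF gk, unfolded k]] by (simp add: k)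
  have "norm (measure lborel k * g x - integral k g) <= e * measure lborel (cbox u v)"
   by (rule has_integral_bound[OF e hi]) (use sub kd k g in "auto simp: subset_eq")
  then show "\<bar>measure lborel k * g x - integral k g\<bar> <= e * measure lborel k" by (simp add: k)
 qed
 also have "... = e * measure lborel (cbox a b)"
  using additive_content_tagged_division[OF assms(2)] by (simp add: sum_distrib_left case_prod_unfold flip: sum_distrib_left)
 finally show ?thesis .
qed

lemma lborel_integral_cbox:
 fixes f :: "'a::euclidean_space => real"
 assumes "continuous_on UNIV f" "!!x. x ~: cbox a b ==> f x = 0"
 shows "(LINT x|lborel. f x) = integral (cbox a b) f"
proof -
 obtain r where "!!x. x : cbox a b ==> norm x <= r" using bounded_cbox[of a b] bounded_iff by metis
 then have "bsupp f" using assms(2) by (intro bsuppI[of r]) (meson not_less)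
 from has_integral_integral_lborel[OF integrable_bsupp[OF assms(1) this]]
 have "((%x. if x : cbox a b then f x else 0) has_integral (LINT x|lborel. f x)) UNIV"
  by (rule has_integral_eq[rotated]) (use assms(2) in auto)
 then show ?thesis unfolding has_integral_restrict_UNIV by (simp add: integral_unique)
qed

lemma iter_deriv_zero: "iter_deriv vs (%x. 0) = (%x. 0)"
 using iter_deriv_linear(2)[of "%x. 0" "%x. 0" vs 0] by simp

lemma smooth_on_swap:
 fixes \<Phi> :: "'b::euclidean_space \<times> 'a::euclidean_space => real"
 assumes "smooth \<Phi>" shows "smooth (%z. \<Phi> (snd z, fst z))"
proof (rule smooth_on_compose[OF open_UNIV open_UNIV _ _ assms])
 fix c :: "'b \<times> 'a" assume c: "c : Basis"
 have "bounded_linear (%z. (snd z, fst z) \<bullet> c)" by (intro bounded_linear_inner_left_comp bounded_linear_Pair bounded_linear_fst bounded_linear_snd)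
 then show "smooth (%z. (snd z, fst z) \<bullet> c)" by (rule smooth_on_bounded_linear)
qed auto

lemma slice1:
 fixes \<Phi> :: "'b::euclidean_space \<times> 'a::euclidean_space => real"
 assumes "smooth \<Phi>"
 shows "smooth (%y. \<Phi> (x, y))" "smooth (%x. \<Phi> (x, y))"
 using smooth_on_slice[of UNIV \<Phi>] smooth_on_slice[of UNIV "%z. \<Phi> (snd z, fst z)"] smooth_on_swap[OF assms] assms by auto

lemma iter_deriv_integral:
 fixes \<Phi> :: "'b::euclidean_space \<times> 'a::euclidean_space => real"
 assumes "smooth \<Phi>" "!!x y. r < norm x ==> \<Phi> (x, y) = 0"
 shows "smooth (%y. LINT x|lborel. \<Phi> (x, y)) &
  iter_deriv vs (%y. LINT x|lborel. \<Phi> (x, y)) = (%y. LINT x|lborel. iter_deriv vs (%y. \<Phi> (x, y)) y)"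
proof -
 define R where "R = max r 1"
 define \<kappa> where "\<kappa> = bump (0 :: 'b) (2 * R)"
 have \<kappa>: "smooth \<kappa>" "bsupp \<kappa>" "!!x. norm x <= r ==> \<kappa> x = 1"
  unfolding \<kappa>_def using bump_props[of "2 * R", where ?x0.0 = "0 :: 'b"] by (auto simp: smooth_on_bump R_def bsupp_def intro!: exI[of _ "2 * R"])
 define I where "I \<phi> = (LINT x|lborel. \<kappa> x * \<phi> x)" for \<phi>
 have I: "cdistr I" unfolding I_def using \<kappa> by (intro cdistr_integral smooth_on_continuous_on)
 have IP: "(LINT x|lborel. \<Phi> (x, y)) = I (%x. \<Phi> (x, y))" if "!!x y. r < norm x ==> \<Phi> (x, y) = 0" for \<Phi> :: "'b \<times> 'a => real" and y
  unfolding I_def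
 proof (rule Bochner_Integration.integral_cong)
  fix x show "\<Phi> (x, y) = \<kappa> x * \<Phi> (x, y)" using that[of x y] \<kappa>(3)[of x] by (cases "norm x <= r") auto
 qed simp
 have d: "smooth (%y. LINT x|lborel. \<Phi> (x, y))"
  "fder (%y. LINT x|lborel. \<Phi> (x, y)) y b = (LINT x|lborel. fder \<Phi> (x, y) (0, b))"
  "smooth (%z. fder \<Phi> z (0, b))" "!!x y. r < norm x ==> fder \<Phi> (x, y) (0, b) = 0"
  if \<Phi>: "smooth \<Phi>" "!!x y. r < norm x ==> \<Phi> (x, y) = 0" for \<Phi> :: "'b \<times> 'a => real" and b y
 proof -
  define \<Psi> where "\<Psi> = (%z. \<Phi> (snd z, fst z))"
  have sm: "smooth \<Psi>" unfolding \<Psi>_def by (rule smooth_on_swap[OF \<Phi>(1)])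
  note cs = cdistr_smooth[OF I open_UNIV, of \<Psi>, unfolded UNIV_Times_UNIV, OF sm]
  have e: "(%y. LINT x|lborel. \<Phi> (x, y)) = (%y. I (%x. \<Psi> (y, x)))" unfolding \<Psi>_def fst_conv snd_conv by (rule ext, rule IP, rule \<Phi>(2))
  show "smooth (%y. LINT x|lborel. \<Phi> (x, y))" unfolding e by (rule cs(1))
  show "smooth (%z. fder \<Phi> z (0, b))" using \<Phi>(1) by (rule smooth_deriv)
  show z: "!!x y. r < norm x ==> fder \<Phi> (x, y) (0, b) = 0"
  proof -
   fix x :: 'b and y :: 'a assume "r < norm x"
   moreover have "open ({x :: 'b. r < norm x} \<times> (UNIV :: 'a set))" by (intro open_Times open_UNIV open_Collect_less continuous_intros)
   ultimately show "fder \<Phi> (x, y) (0, b) = 0" using \<Phi>(2) by (intro fder_zero_outside) auto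
  qed
  have sw: "fder \<Psi> (y, x) (b, 0) = fder \<Phi> (x, y) (0, b)" for x
  proof -
   have "((%z :: 'a \<times> 'b. (snd z, fst z)) has_derivative (%z. (snd z, fst z))) (at (y, x))" by (auto intro!: derivative_eq_intros)
   from diff_chain_at[OF this, of \<Phi> "fder \<Phi> (x, y)"] show ?thesis
    using smooth_on_has_derivative[OF \<Phi>(1)] by (simp add: \<Psi>_def o_def fder_eqI)
  qed
  show "fder (%y. LINT x|lborel. \<Phi> (x, y)) y b = (LINT x|lborel. fder \<Phi> (x, y) (0, b))"
   unfolding e cs(2)[OF UNIV_I] sw using IP[of "%z. fder \<Phi> z (0, b)" y, OF z] by simp
 qed
 have "iter_deriv vs (%y. LINT x|lborel. \<Phi> (x, y)) = (%y. LINT x|lborel. iter_deriv vs (%y. \<Phi> (x, y)) y)"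
  using assms
 proof (induction vs arbitrary: \<Phi> rule: rev_induct)
  case (snoc b vs)
  have sl: "(%y. fder (%y. \<Phi> (x, y)) y b) = (%y. fder \<Phi> (x, y) (0, b))" for x
   using fder_slice[of UNIV \<Phi> x] snoc.prems(1) by simp
  have "(%y. fder (%y. LINT x|lborel. \<Phi> (x, y)) y b) = (%y. LINT x|lborel. fder \<Phi> (x, y) (0, b))"
   by (rule ext, rule d(2)) (rule snoc.prems, assumption?)+
  then show ?case unfolding iter_deriv_snoc sl
   using snoc.IH[of "%z. fder \<Phi> z (0, b)", OF d(3,4)[OF snoc.prems]] by simp
 qed simp
 then show ?thesis using d(1)[OF assms] by simp
qed

text \<open>A Fubini theorem. Riemann sums of \<open>\<Phi>\<close> in x approximate the integral
  together with the derivatives in y that bound \<open>S\<close>, uniformly on \<open>K\<close>, and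
  \<open>S\<close> commutes with finite sums. Uniform continuity provides one fineness for all these
  derivatives and for the right-hand integrand.\<close>

lemma cdistr_integral_swap:
 fixes \<Phi> :: "'b::euclidean_space \<times> 'a::euclidean_space => real"
 assumes S: "cdistr S" and \<Phi>: "smooth \<Phi>" "!!x y. r < norm x ==> \<Phi> (x, y) = 0"
 shows "S (%y. LINT x|lborel. \<Phi> (x, y)) = (LINT x|lborel. S (%y. \<Phi> (x, y)))"
proof -
 let ?V = "%y. LINT x|lborel. \<Phi> (x, y)" and ?T = "%x. S (%y. \<Phi> (x, y))" and ?W = "%vs y x. iter_deriv vs (%y. \<Phi> (x, y)) y"
 obtain K N C where K: "compact K" "C >= 0" "!!\<phi> B. smooth \<phi> ==>
   deriv_bound N K \<phi> B ==> \<bar>S \<phi>\<bar> <= C * B"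
  using S unfolding cdistr_def by blast
 obtain a where a: "cball (0 :: 'b) r <= cbox (- a) a" using bounded_subset_cbox_symmetric[OF bounded_cball] by metis
 let ?Q = "cbox (- a) a"
 have out: "\<Phi> (x, y) = 0" if "x ~: ?Q" for x y using a that \<Phi>(2)[of x y] by (auto simp: subset_eq not_le[symmetric])
 have out0: "(%y. \<Phi> (x, y)) = (%y. 0)" if "x ~: ?Q" for x using out[OF that] by auto
 have sl: "smooth (%y. \<Phi> (x, y))" for x by (rule slice1[OF \<Phi>(1)])
 have G: "?W vs y x = iter_deriv (map (Pair 0) vs) \<Phi> (x, y)" for vs x y
  using iter_deriv_slice[of UNIV \<Phi> x vs] \<Phi>(1) by simp
 have cG: "continuous_on UNIV (%z. iter_deriv (map (Pair 0) vs) \<Phi> z)" for vs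
  by (intro smooth_on_continuous_on smooth_on_iter_deriv open_UNIV \<Phi>(1))
 have cGx: "continuous_on UNIV (?W vs y)" for vs y
  unfolding G by (rule continuous_on_compose2[OF cG]) (auto intro!: continuous_intros)
 have sS: "smooth ?T"
  using cdistr_smooth(1)[OF S open_UNIV, of \<Phi>] \<Phi>(1) by simp
 have cS: "continuous_on UNIV ?T" by (rule smooth_on_continuous_on[OF sS])
 have L: "(LINT x|lborel. ?T x) = integral ?Q ?T"
  by (rule lborel_integral_cbox[OF cS]) (simp add: out0 cdistr_zero[OF S])
 have ii: "smooth ?V &
  iter_deriv vs ?V = (%y. LINT x|lborel. ?W vs y x)" for vs
  by (rule iter_deriv_integral[OF \<Phi>(1), where r = r]) (rule \<Phi>(2))
 have L2: "iter_deriv vs ?V y = integral ?Q (?W vs y)" for vs y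
 proof -
  have "iter_deriv vs ?V y = (LINT x|lborel. ?W vs y x)" using ii[of vs] by simp
  also have "... = integral ?Q (?W vs y)"
   by (intro lborel_integral_cbox cGx) (simp add: out0 iter_deriv_zero)
  finally show ?thesis .
 qed
 have est: "\<bar>S ?V - (LINT x|lborel. ?T x)\<bar> <= ((C + 1) * measure lborel ?Q) * e" if e: "e > 0" for e
 proof -
  have "EX d>0. ALL x:?Q. ALL x':?Q. ALL y:K. dist x x' < d --> \<bar>?W vs y x - ?W vs y x'\<bar> <= e" for vs
  proof -
   have "uniformly_continuous_on (?Q \<times> K) (iter_deriv (map (Pair 0) vs) \<Phi>)"
    by (intro compact_uniformly_continuous compact_Times compact_cbox K(1) continuous_on_subset[OF cG]) auto
   then obtain d where d: "d > 0" "!!z z'. z : ?Q \<times> K ==> z' : ?Q \<times> K ==> dist z' z < d ==>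
    dist (iter_deriv (map (Pair 0) vs) \<Phi> z') (iter_deriv (map (Pair 0) vs) \<Phi> z) < e"
    using e unfolding uniformly_continuous_on_def by metis
   show ?thesis
   proof (intro exI[of _ d] conjI ballI impI d(1))
    fix x x' y assume "x : ?Q" "x' : ?Q" "y : K" "dist x x' < d"
    then show "\<bar>?W vs y x - ?W vs y x'\<bar> <= e"
     using d(2)[of "(x', y)" "(x, y)"] by (simp add: G dist_Pair_Pair dist_real_def)
   qed
  qed
  then obtain d where d: "!!vs. d vs > 0" "!!vs x x' y. x : ?Q ==> x' : ?Q ==> y : K ==> dist x x' < d vs ==>
   \<bar>?W vs y x - ?W vs y x'\<bar> <= e" by metis
  have "uniformly_continuous_on ?Q ?T"
   by (intro compact_uniformly_continuous compact_cbox continuous_on_subset[OF cS]) auto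
  then obtain d' where d': "d' > 0" "!!x x'. x : ?Q ==> x' : ?Q ==> dist x' x < d' ==> dist (?T x') (?T x) < e"
   using e unfolding uniformly_continuous_on_def by metis
  let ?L = "{vs : lists (Basis :: 'a set). length vs <= N}"
  define D where "D = Min (insert d' (d ` ?L))"
  have D: "D > 0" "D <= d'" "!!vs. vs : ?L ==> D <= d vs"
   unfolding D_def using finite_lists_le[of N, where 'a = 'a] d(1) d'(1) by auto
  obtain p where p: "p tagged_division_of ?Q" "(%x. ball x D) fine p"
   using fine_division_exists[OF gauge_ball[OF D(1)], of "- a" a] .
  have fp: "finite p" using p(1) by blast
  define \<psi> where "\<psi> y = (SUM q:p. measure lborel (snd q) * \<Phi> (fst q, y))" for y
  have smq: "smooth (%y. measure lborel (snd q) * \<Phi> (fst q, y))" for q :: "'b \<times> 'b set" by (intro smooth_cmult sl)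
  have sm: "smooth \<psi>" unfolding \<psi>_def using smq by (intro smooth_sum)
  have itp: "iter_deriv vs \<psi> y = (SUM q:p. measure lborel (snd q) * iter_deriv vs (%y. \<Phi> (fst q, y)) y)" for vs y
   unfolding \<psi>_def iter_deriv_sum[OF fp smq] by (simp add: iter_deriv_linear(2)[OF sl sl])
  have "S \<psi> = (SUM q:p. S (%y. measure lborel (snd q) * \<Phi> (fst q, y)))"
   unfolding \<psi>_def by (rule cdistr_sum[OF S fp smq])
  also have "... = (SUM (x, k):p. measure lborel k * ?T x)"
   by (simp add: cdistr_cmult[OF S sl] case_prod_unfold)
  finally have 1: "\<bar>S \<psi> - integral ?Q ?T\<bar> <= e * measure lborel ?Q"
   using riemann_sum_bound[OF continuous_on_subset[OF cS] p, of e] d'(2) D(2) e by (force simp: dist_real_def dist_commute)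
  have "\<bar>S \<psi> - S ?V\<bar> = \<bar>S (%y. \<psi> y - ?V y)\<bar>"
   using cdistr_diff[OF S sm] ii by simp
  also have "... <= C * (e * measure lborel ?Q)"
  proof (intro K(3) ballI impI smooth_on_diff open_UNIV sm conjunct1[OF ii])
   fix vs y assume vs: "vs : lists (Basis :: 'a set)" "length vs <= N" and y: "y : K"
   have "iter_deriv vs (%y. \<psi> y - ?V y) y = iter_deriv vs \<psi> y - iter_deriv vs ?V y"
    using iter_deriv_linear(1)[OF sm smooth_cmult[OF conjunct1[OF ii], of "-1"], of vs]
     iter_deriv_linear(2)[OF conjunct1[OF ii] conjunct1[OF ii], of vs "-1"] by simp
   moreover have "iter_deriv vs \<psi> y = (SUM (x, k):p. measure lborel k * ?W vs y x)"
    by (simp add: itp case_prod_unfold)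
   moreover have "\<bar>(SUM (x, k):p. measure lborel k * ?W vs y x) - integral ?Q (?W vs y)\<bar> <= e * measure lborel ?Q"
   proof (rule riemann_sum_bound[OF continuous_on_subset[OF cGx] p])
    fix x x' assume "x : ?Q" "x' : ?Q" "dist x x' < D"
    then show "\<bar>?W vs y x - ?W vs y x'\<bar> <= e"
     using d(2)[OF _ _ y] D(3)[of vs] vs by fastforce
   qed (use e in auto)
   ultimately show "\<bar>iter_deriv vs (%y. \<psi> y - ?V y) y\<bar> <= e * measure lborel ?Q" by (simp add: L2)
  qed
  finally show ?thesis using 1 by (simp add: L algebra_simps)
 qed
 define c where "c = (C + 1) * measure lborel ?Q"
 have "\<bar>S ?V - (LINT x|lborel. ?T x)\<bar> <= 0 + e" if "e > 0" for e
 proof -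
  have c: "c >= 0" using K(2) by (simp add: c_def)
  then have "c * (e / (c + 1)) <= e" using that by (simp add: field_simps)
  then show ?thesis using est[of "e / (c + 1)"] that c by (simp add: c_def[symmetric])
 qed
 then have "\<bar>S ?V - (LINT x|lborel. ?T x)\<bar> <= 0" by (rule field_le_epsilon)
 then show ?thesis by simp
qed

section \<open>Changes of variables\<close>

lemma integral_affine:
 fixes f :: "'a::euclidean_space => real"
 assumes "c ~= 0" "continuous_on UNIV f"
 shows "(LINT x|lborel. f x) = \<bar>c\<bar> ^ DIM('a) * (LINT x|lborel. f (t + c *R x))"
proof -
 have [measurable]: "f : borel_measurable borel" using assms(2) by (rule borel_measurable_continuous_onI)
 have m [measurable]: "(%x :: 'a. t + c *R x) : borel \<rightarrow>\<^sub>M borel" by (intro borel_measurable_continuous_onI continuous_intros)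
 have "(LINT x|lborel. f x) = (LINT x|density (distr lborel borel (%x. t + c *R x)) (%_. ennreal (\<bar>c\<bar> ^ DIM('a))). f x)"
  using lborel_affine[OF assms(1), of t] by simp
 also have "... = \<bar>c\<bar> ^ DIM('a) * (LINT x|lborel. f (t + c *R x))"
  by (subst integral_density) (simp_all add: integral_distr)
 finally show ?thesis .
qed

text \<open>The displacement points in the directions \<open>I\<close>, and along these directions
  it does not vary.\<close>

lemma shear_invariant:
 assumes p: "!!x b c. b : I ==> p (x + c *R b) = (p x :: 'a::euclidean_space)" "!!x b. b : Basis - I ==> p x \<bullet> b = 0" "I <= Basis"
 shows "p (x + t *R p x) = p x"
proof -
 have fI: "finite I" using p(3) finite_Basis finite_subset by blast
 have "p (x + (SUM b:A. f b *R b)) = p x" if "finite A" "A <= I" for A f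
  using that
 proof (induction A rule: finite_induct)
  case (insert b A)
  have "p (x + (SUM b:insert b A. f b *R b)) = p ((x + (SUM b:A. f b *R b)) + f b *R b)"
   using insert.hyps by (simp add: algebra_simps)
  then show ?case using insert p(1) by simp
 qed simp
 from this[OF fI order_refl, of "%b. t * (p x \<bullet> b)"]
 have "p (x + t *R (SUM b:I. (p x \<bullet> b) *R b)) = p x" by (simp add: scaleR_sum_right)
 also have "(SUM b:I. (p x \<bullet> b) *R b) = (SUM b:Basis. (p x \<bullet> b) *R b)"
  using p(2) by (intro sum.mono_neutral_left p(3)) auto
 finally show ?thesis by (simp only: euclidean_representation)
qed

text \<open>The shear is reached by the deformation x + t p(x). The derivative in t of the integrand
  is a divergence, so the integral is constant in t; no Jacobian determinant appears.\<close>

lemma integral_shear: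
 fixes f :: "'a::euclidean_space => real" and p :: "'a => 'a"
 assumes f: "smooth f" "bsupp f" and sp: "!!b. b : Basis ==> smooth (%x. p x \<bullet> b)"
  and p: "!!x b c. b : I ==> p (x + c *R b) = p x" "!!x b. b : Basis - I ==> p x \<bullet> b = 0" "I <= Basis"
 shows "(LINT x|lborel. f (x + p x)) = (LINT x|lborel. f x)"
  and "smooth (%x. f (x + p x))" and "bsupp (%x. f (x + p x))"
proof -
 note inv = shear_invariant[of I p, OF p]
 obtain r where r: "!!x. r < norm x ==> f x = 0" using f(2) by (auto simp: bsupp_def)
 have "continuous_on UNIV (%x. SUM b:Basis. (p x \<bullet> b) *R b)"
  by (intro continuous_intros smooth_on_continuous_on sp)
 then have cp: "continuous_on UNIV p" by (simp only: euclidean_representation)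
 then have "bounded (p ` cball 0 r)"
  by (intro compact_imp_bounded compact_continuous_image) (auto intro: continuous_on_subset)
 then obtain Q where Q: "Q > 0" "!!x. norm x <= r ==> norm (p x) <= Q" by (force simp: bounded_pos)
 \<comment> \<open>By invariance the displacement at x equals the one at the displaced point. If
   \<open>f\<close> does not vanish there, that point lies in the ball of radius r, where the
   displacement is at most Q.\<close>
 define R where "R = max 1 (r + 2 * Q)"
 have z: "f (x + t *R p x) = 0" if "R < norm x" "\<bar>t\<bar> <= 2" for x t
 proof (rule r, rule ccontr)
  assume "\<not> r < norm (x + t *R p x)"
  then have le: "norm (x + t *R p x) <= r" by simp
  then have "norm (p x) <= Q" using Q(2)[OF le] inv by simp
  then have "norm (t *R p x) <= 2 * Q" using that(2) by (simp add: mult_mono')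
  then have "norm x <= r + 2 * Q" using le norm_triangle_ineq4[of "x + t *R p x" "t *R p x"] by simp
  then show False using that(1) by (simp add: R_def)
 qed
 define \<kappa> where "\<kappa> = bump (0 :: 'a) (2 * R)"
 have \<kappa>: "smooth \<kappa>" "bsupp \<kappa>" "!!x. norm x <= R ==> \<kappa> x = 1"
  unfolding \<kappa>_def using bump_props[of "2 * R", where ?x0.0 = "0 :: 'a"] by (auto simp: smooth_on_bump R_def bsupp_def intro!: exI[of _ "2 * R"])
 define I' where "I' \<phi> = (LINT x|lborel. \<kappa> x * \<phi> x)" for \<phi>
 have cI: "cdistr I'" unfolding I'_def using \<kappa> by (intro cdistr_integral smooth_on_continuous_on)
 define \<sigma> where "\<sigma> = (%z :: real \<times> 'a. snd z + fst z *R p (snd z))"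
 have s\<sigma>: "smooth (%z. \<sigma> z \<bullet> b)" if b: "b : Basis" for b
 proof -
  have 1: "smooth (%z :: real \<times> 'a. snd z \<bullet> c)" for c
   by (intro smooth_on_bounded_linear bounded_linear_inner_left_comp bounded_linear_snd)
  have 2: "smooth (%z :: real \<times> 'a. fst z)" by (intro smooth_on_bounded_linear bounded_linear_fst)
  have 3: "smooth (%z :: real \<times> 'a. p (snd z) \<bullet> b)"
   by (rule smooth_on_compose[OF open_UNIV open_UNIV _ _ sp[OF b]]) (use 1 in auto)
  show ?thesis unfolding \<sigma>_def inner_add_left inner_scaleR_left by (intro smooth_add smooth_mult 1 2 3)
 qed
 define \<Phi> where "\<Phi> = (%z. f (\<sigma> z))"
 have s\<Phi>: "smooth \<Phi>" unfolding \<Phi>_def by (rule smooth_on_compose[OF open_UNIV open_UNIV _ s\<sigma> f(1)]) auto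
 have s\<Phi>t: "smooth (%x. \<Phi> (t, x))" for t by (rule slice1[OF s\<Phi>])
 have dp: "(p has_derivative fder p x) (at x)" for x
 proof -
  have "(%x. SUM b:Basis. (p x \<bullet> b) *R b) differentiable at x"
   by (intro differentiable_sum differentiable_scaleR differentiable_const finite_Basis ballI smooth_on_differentiable[OF sp]) auto
  then have "p differentiable at x" by (simp only: euclidean_representation)
  then show ?thesis by (simp add: frechet_derivative_works)
 qed
 have D: "fder \<Phi> (t, x) (v, w) = fder f (\<sigma> (t, x)) (w + v *R p x + t *R fder p x w)" for t x v w
 proof -
  have "(\<sigma> has_derivative (%h. snd h + (fst h *R p x + t *R fder p x (snd h)))) (at (t, x))"
  proof -
   have "((%z :: real \<times> 'a. p (snd z)) has_derivative (%h. fder p x (snd h))) (at (t, x))"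
    using diff_chain_at[OF has_derivative_snd[OF has_derivative_ident], of p _ "(t, x)"] dp by (simp add: o_def)
   then show ?thesis unfolding \<sigma>_def by (auto intro!: derivative_eq_intros simp: algebra_simps)
  qed
  from diff_chain_at[OF this smooth_on_has_derivative[OF f(1)]]
  show ?thesis unfolding \<Phi>_def by (simp add: o_def fder_eqI algebra_simps)
 qed
 have pb: "fder p x b = 0" if "b : I" for x b
 proof -
  have "((%c. p (x + c *R b)) has_derivative (%c. fder p x (c *R b))) (at (0::real))"
  proof -
   have "((%c::real. x + c *R b) has_derivative (%c. c *R b)) (at 0)" by (auto intro!: derivative_eq_intros)
   from diff_chain_at[OF this, of p] show ?thesis using dp[of x] by (simp add: o_def)
  qed
  then have "((%c::real. p x) has_derivative (%c. fder p x (c *R b))) (at 0)" using p(1)[OF that] by simp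
  then have "(%c::real. fder p x (c *R b)) = (%c. 0)"
   using has_derivative_unique has_derivative_const by blast
  from fun_cong[OF this, of 1] show ?thesis by simp
 qed
 \<comment> \<open>The components of the vector field whose divergence is the derivative in t: the
   coefficient along \<open>b\<close> is constant in the direction \<open>b\<close>, so only
   \<open>\<Phi>\<close> is differentiated.\<close>
 define g where "g t b x = (p x \<bullet> b) * \<Phi> (t, x)" for t b x
 have gz: "g t b x = 0" if "R < norm x" "\<bar>t\<bar> <= 2" for t b x using z[OF that] by (simp add: g_def \<Phi>_def \<sigma>_def)
 have sg: "smooth (g t b)" if "b : I" for t b unfolding g_def using that p(3) by (intro smooth_mult s\<Phi>t sp) auto
 have Dg: "fder (g t b) x b = (p x \<bullet> b) * fder f (\<sigma> (t, x)) b" if b: "b : I" for t b x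
 proof -
  have 1: "((%x. p x \<bullet> b) has_derivative (%h. fder p x h \<bullet> b)) (at x)"
   by (intro has_derivative_inner_left dp)
  have 2: "fder (%x. \<Phi> (t, x)) x b = fder f (\<sigma> (t, x)) b"
   using fder_slice[of UNIV \<Phi> t x b] s\<Phi> D[of t x 0 b] pb[OF b] by simp
  show ?thesis unfolding g_def
   using fder_eqI[OF has_derivative_mult[OF 1 smooth_on_has_derivative[OF s\<Phi>t UNIV_I]]] 2 pb[OF b] by simp
 qed
 have fI: "finite I" using p(3) finite_Basis finite_subset by blast
 have J: "((%t. I' (%x. \<Phi> (t, x))) has_derivative (%v. 0)) (at t)" if t: "t : {-2<..<2}" for t
 proof -
  have "I' (%x. fder \<Phi> (t, x) (v, 0)) = 0" for v
  proof -
   have e: "\<kappa> x * fder \<Phi> (t, x) (v, 0) = v * (SUM b:I. fder (g t b) x b)" for x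
   proof -
    have lin: "bounded_linear (fder f (\<sigma> (t, x)))" using smooth_on_has_derivative[OF f(1)] has_derivative_bounded_linear by blast
    have "p x = (SUM b:I. (p x \<bullet> b) *R b)"
    proof -
     have "(SUM b:I. (p x \<bullet> b) *R b) = (SUM b:Basis. (p x \<bullet> b) *R b)"
      using p(2) by (intro sum.mono_neutral_left p(3)) auto
     then show ?thesis by (simp only: euclidean_representation)
    qed
    then have "fder f (\<sigma> (t, x)) (p x) = (SUM b:I. (p x \<bullet> b) * fder f (\<sigma> (t, x)) b)"
     using linear_sum[OF bounded_linear.linear[OF lin], of "%b. (p x \<bullet> b) *R b" I] linear_cmul[OF bounded_linear.linear[OF lin]] by simp
    also have "... = (SUM b:I. fder (g t b) x b)" by (intro sum.cong refl) (simp add: Dg)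
    finally have 1: "fder \<Phi> (t, x) (v, 0) = v * (SUM b:I. fder (g t b) x b)"
     using D[of t x v 0] linear_0[OF bounded_linear.linear[OF has_derivative_bounded_linear[OF dp[of x]]]] linear_cmul[OF bounded_linear.linear[OF lin]] by simp
    show ?thesis
    proof (cases "norm x <= R")
     case False
     have "fder (g t b) x b = 0" for b
      by (rule fder_zero_outside[of "{x. R < norm x}"])
       (use False gz t in "auto intro!: open_Collect_less continuous_intros")
     then show ?thesis by (simp add: 1)
    qed (simp add: 1 \<kappa>(3))
   qed
   have bg: "bsupp (g t b)" for b using gz t by (intro bsuppI[of R]) auto
   have int: "integrable lborel (%x. fder (g t b) x b)" if "b : I" for b
    using bsupp_deriv[OF bg] continuous_on_deriv[OF open_UNIV sg[OF that]] by (intro integrable_bsupp)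
   show ?thesis unfolding I'_def e using int integral_deriv_zero[OF sg bg] by (simp add: Bochner_Integration.integral_sum)
  qed
  then show ?thesis using cdistr_has_derivative[OF cI open_UNIV, of \<Phi> t] s\<Phi> by simp
 qed
 have "I' (%x. \<Phi> (0, x)) = I' (%x. \<Phi> (1, x))"
 proof -
  have "EX c. ALL t:{-2<..<2}. I' (%x. \<Phi> (t, x)) = c"
   by (rule has_derivative_zero_constant) (auto intro!: has_derivative_at_withinI[OF J])
  then show ?thesis by auto
 qed
 moreover have "I' (%x. \<Phi> (t, x)) = (LINT x|lborel. f (x + t *R p x))" if "\<bar>t\<bar> <= 2" for t
  unfolding I'_def
 proof (rule Bochner_Integration.integral_cong)
  fix x show "\<kappa> x * \<Phi> (t, x) = f (x + t *R p x)"
   using z[OF _ that, of x] \<kappa>(3)[of x] by (cases "norm x <= R") (auto simp: \<Phi>_def \<sigma>_def)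
 qed simp
 ultimately show "(LINT x|lborel. f (x + p x)) = (LINT x|lborel. f x)" by simp
 show "smooth (%x. f (x + p x))" using s\<Phi>t[of 1] by (simp add: \<Phi>_def \<sigma>_def)
 show "bsupp (%x. f (x + p x))" using z[of _ 1] by (intro bsuppI[of R]) auto
qed

lemma integral_zero_imp_zero:
 fixes f :: "'a::euclidean_space => real"
 assumes f: "continuous_on UNIV f" "bsupp f" "!!y. f y >= 0" and "(LINT y|lborel. f y) = 0"
 shows "f x = 0"
proof -
 have *: "AE y in lborel. f y = 0"
  using integral_nonneg_eq_0_iff_AE[OF integrable_bsupp[OF f(1,2)]] f(3) assms(4) by simp
 define N where "N = {y. f y ~= 0}"
 have oN: "open N" unfolding N_def by (intro open_Collect_neq f continuous_intros)
 then have Ns: "N : sets lborel" by simp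
 have "AE y in lborel. y ~: N" using * by (simp add: N_def)
 then have "N : null_sets lborel" using AE_iff_null_sets[OF Ns] by blast
 then have "negligible N" using null_sets_completionI negligible_iff_null_sets by blast
 then have "N = {}" using open_not_negligible[OF oN] by blast
 then show ?thesis by (auto simp: N_def)
qed

text \<open>Tested against the difference times a bump function, the integrand is continuous and
  nonnegative with integral zero. The gluing of local densities relies on this uniqueness.\<close>

lemma smooth_unique:
 fixes f g :: "'a::euclidean_space => real" and x :: 'a
 assumes f: "smooth f" and g: "smooth g" and r: "r > 0"
  and eq: "!!\<phi> :: 'a => real. smooth \<phi> ==> (!!y. y ~: ball x r ==> (\<phi> :: 'a => real) y = 0) ==> (LINT y|lborel. f y * \<phi> y) = (LINT y|lborel. g y * \<phi> y)"
 shows "f x = g x"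
proof (rule ccontr)
 assume ne: "f x ~= g x"
 define h where "h y = f y - g y" for y
 have sh: "smooth h" unfolding h_def by (intro smooth_diff f g)
 define \<phi> where "\<phi> y = bump x r y * h y" for y
 have s\<phi>: "smooth \<phi>" unfolding \<phi>_def by (intro smooth_mult smooth_on_bump sh)
 have z: "\<phi> y = 0" if "y ~: ball x r" for y :: 'a using bump_props(4)[OF r that] by (simp add: \<phi>_def)
 have b: "bsupp \<phi>" by (rule bsupp_ball[OF z])
 have c: "continuous_on UNIV (%y. k y * \<phi> y)" if "smooth k" for k
  using that s\<phi> by (intro smooth_on_continuous_on smooth_mult)
 have int: "integrable lborel (%y. k y * \<phi> y)" if "smooth k" for k
  by (rule integrable_bsupp[OF c[OF that] bsupp_mult2[OF b]])
 have "(LINT y|lborel. h y * \<phi> y) = 0"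
  using eq[OF s\<phi> z] int[OF f] int[OF g] by (simp add: h_def left_diff_distrib)
 moreover have nn: "h y * \<phi> y >= 0" for y using bump_props(1)[OF r, of x y] by (simp add: \<phi>_def mult.left_commute[of "h y"] mult_nonneg_nonneg)
 ultimately have "h x * \<phi> x = 0"
  by (intro integral_zero_imp_zero[OF c[OF sh] bsupp_mult2[OF b]])
 moreover have "bump x r x > 0" using bump_props(3)[OF r, where ?x0.0 = x and x = x] r by simp
 ultimately show False using ne by (simp add: \<phi>_def h_def)
qed

section \<open>Mollification along the group\<close>

definition mk5 :: "real => real => real => real => real => real^5" where
 "mk5 a b c d e = (\<chi> i. if i = 1 then a else if i = 2 then b else if i = 3 then c else if i = 4 then d else e)"

lemma mk5_nth [simp]: "mk5 a b c d e $ 1 = a" "mk5 a b c d e $ 2 = b" "mk5 a b c d e $ 3 = c" "mk5 a b c d e $ 4 = d" "mk5 a b c d e $ 5 = e"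
 by (simp_all add: mk5_def)

lemma vec5_eq: "(x :: real^5) = y \<longleftrightarrow> x $ 1 = y $ 1 & x $ 2 = y $ 2 & x $ 3 = y $ 3 & x $ 4 = y $ 4 & x $ 5 = y $ 5"
 by (simp add: vec_eq_iff forall_5)

text \<open>The group law, and the quotients \<open>gdiv x y = x \<sqdot> y\<inverse>\<close> and \<open>ldiv h x = h\<inverse> \<sqdot> x\<close>.\<close>

definition gmul :: "real^5 => real^5 => real^5" where
 "gmul h y = mk5 (h$1 + y$1) (h$2 + y$2) (h$3 + y$3 + h$1 * y$2) (h$4 + y$4 + h$1 * y$3 + (h$1)^2 / 2 * y$2)
  (h$5 + y$5 + h$2 * y$3 + h$1 * h$2 * y$2 + h$1 * (y$2)^2 / 2)"

definition gdiv :: "real^5 => real^5 => real^5" where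
 "gdiv x y = mk5 (x$1 - y$1) (x$2 - y$2) (x$3 - y$3 - (x$1 - y$1) * y$2)
  (x$4 - y$4 - (x$1 - y$1) * y$3 - (x$1 - y$1)^2 / 2 * y$2)
  (x$5 - y$5 - (x$2 - y$2) * y$3 - (x$1 - y$1) * (x$2 - y$2) * y$2 - (x$1 - y$1) * (y$2)^2 / 2)"

definition ldiv :: "real^5 => real^5 => real^5" where
 "ldiv h x = (let y1 = x$1 - h$1; y2 = x$2 - h$2; y3 = x$3 - h$3 - h$1 * y2 in
  mk5 y1 y2 y3 (x$4 - h$4 - h$1 * y3 - (h$1)^2 / 2 * y2) (x$5 - h$5 - h$2 * y3 - h$1 * h$2 * y2 - h$1 * y2^2 / 2))"

lemma group_cancel:
 "gdiv (gmul h y) y = h" "gmul (gdiv x y) y = x" "gdiv x (ldiv h x) = h" "ldiv (gdiv x y) x = y" "ldiv 0 x = x" "gmul 0 x = x"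
 by (simp_all add: vec5_eq gmul_def gdiv_def ldiv_def Let_def)

lemma inner_Basis_5: "b : Basis ==> EX i. ALL x :: real^5. x \<bullet> b = x $ i"
 by (auto simp: Basis_vec_def inner_axis)

lemma smooth_vecI:
 fixes f :: "'a::euclidean_space => real^5"
 assumes "!!i. smooth_on S (%x. f x $ i)" "b : Basis"
 shows "smooth_on S (%x. f x \<bullet> b)"
 using assms(1) inner_Basis_5[OF assms(2)] by auto

lemma smooth_nth:
 assumes "bounded_linear f" shows "smooth_on S (%x. f x $ i)"
 by (intro smooth_on_bounded_linear bounded_linear_compose[OF bounded_linear_vec_nth] assms)

lemma smooth_coordinate: "smooth_on S (%x :: real^5. x $ i)"
 by (rule smooth_nth) (rule bounded_linear_ident)

lemma smooth_on_half: "open S ==> smooth_on S f ==> smooth_on S (%x. f x / 2)"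
 using smooth_on_cmult[of S f "1/2"] by simp

lemma smooth_on_vec_components:
 assumes "open S" "!!i. smooth_on S (%z. f z $ i)" "!!i. smooth_on S (%z. g z $ i)"
 shows "smooth_on S (%z. gmul (f z) (g z) $ i)" "smooth_on S (%z. gdiv (f z) (g z) $ i)" "smooth_on S (%z. ldiv (f z) (g z) $ i)"
proof -
 note sm = smooth_on_add[OF assms(1)] smooth_on_diff[OF assms(1)] smooth_on_mult[OF assms(1)] smooth_on_power[OF assms(1)] assms(2,3)
 note d = smooth_on_half[OF assms(1)]
 have "ALL i. smooth_on S (%z. gmul (f z) (g z) $ i)" unfolding forall_5 gmul_def mk5_nth by (intro conjI sm d)
 then show "smooth_on S (%z. gmul (f z) (g z) $ i)" ..
 have "ALL i. smooth_on S (%z. gdiv (f z) (g z) $ i)" unfolding forall_5 gdiv_def mk5_nth by (intro conjI sm d)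
 then show "smooth_on S (%z. gdiv (f z) (g z) $ i)" ..
 have "ALL i. smooth_on S (%z. ldiv (f z) (g z) $ i)" unfolding forall_5 ldiv_def mk5_nth Let_def by (intro conjI sm d)
 then show "smooth_on S (%z. ldiv (f z) (g z) $ i)" ..
qed

text \<open>The differential of \<open>gdiv\<close> at the point (x, y) in the direction (v,
  w).\<close>

definition dgdiv :: "real^5 => real^5 => real^5 => real^5 => real^5" where
 "dgdiv x y v w = mk5 (v$1 - w$1) (v$2 - w$2) (v$3 - w$3 - (v$1 - w$1) * y$2 - (x$1 - y$1) * w$2)
  (v$4 - w$4 - (v$1 - w$1) * y$3 - (x$1 - y$1) * w$3 - (x$1 - y$1) * (v$1 - w$1) * y$2 - (x$1 - y$1)^2 / 2 * w$2)
  (v$5 - w$5 - (v$2 - w$2) * y$3 - (x$2 - y$2) * w$3 - (v$1 - w$1) * (x$2 - y$2) * y$2 - (x$1 - y$1) * (v$2 - w$2) * y$2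
   - (x$1 - y$1) * (x$2 - y$2) * w$2 - (v$1 - w$1) * (y$2)^2 / 2 - (x$1 - y$1) * (y$2 * w$2))"

lemma has_derivative_vec5:
 fixes f :: "'a::real_normed_vector => real^5"
 assumes "!!i. ((%x. f x $ i) has_derivative (%h. f' h $ i)) (at x)"
 shows "(f has_derivative f') (at x)"
proof (rule has_derivative_componentwise_within[THEN iffD2, rule_format])
 fix b :: "real^5" assume "b : Basis"
 then obtain i where "!!x. (x :: real^5) \<bullet> b = x $ i" using inner_Basis_5 by blast
 then show "((%x. f x \<bullet> b) has_derivative (%h. f' h \<bullet> b)) (at x)" using assms[of i] by simp
qed

lemma has_derivative_gdiv:
 assumes "(f has_derivative f') (at z)" "(g has_derivative g') (at z)"
 shows "((%z. gdiv (f z) (g z)) has_derivative (%h. dgdiv (f z) (g z) (f' h) (g' h))) (at z)"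
proof (rule has_derivative_vec5)
 have [derivative_intros]: "((%z. f z $ i) has_derivative (%h. f' h $ i)) (at z)" "((%z. g z $ i) has_derivative (%h. g' h $ i)) (at z)" for i
  using assms by (auto intro: bounded_linear.has_derivative[OF bounded_linear_vec_nth])
 have "ALL i. ((%z. gdiv (f z) (g z) $ i) has_derivative (%h. dgdiv (f z) (g z) (f' h) (g' h) $ i)) (at z)"
  unfolding forall_5 gdiv_def dgdiv_def mk5_nth
  by (intro conjI; auto intro!: derivative_eq_intros simp: field_simps power2_eq_square)
 then show "((%z. gdiv (f z) (g z) $ i) has_derivative (%h. dgdiv (f z) (g z) (f' h) (g' h) $ i)) (at z)" for i ..
qed

definition yfield :: "5 => real^5 => real^5" where
 "yfield i x = (if i = 1 then mk5 1 0 (x$2) (x$3) ((x$2)^2 / 2) else if i = 2 then mk5 0 1 0 0 (x$3) else axis i 1)"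

lemma axis_nth5: "axis i (1::real) $ j = (if i = j then 1 else 0)" by (auto simp: axis_def)

lemma vfield_eq: "vfield i x = (if i = 1 then mk5 1 0 0 0 0 else if i = 2 then mk5 0 1 (x$1) ((x$1)^2 / 2) (x$1 * x$2)
 else if i = 3 then mk5 0 0 1 (x$1) (x$2) else if i = 4 then mk5 0 0 0 1 0 else mk5 0 0 0 0 1)"
 by (simp add: vfield_def vec5_eq axis_nth5)

text \<open>Left-invariant fields generate right translations, and the quotient of x g and y g is
  the quotient of x and y. Right-invariant fields generate left translations, which act on the
  quotient as they act on its first argument.\<close>

lemma dgdiv_fields: "dgdiv x y (vfield i x) (vfield i y) = 0" "dgdiv x y (yfield i x) 0 = yfield i (gdiv x y)"
proof -
 have "ALL i. dgdiv x y (vfield i x) (vfield i y) = 0"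
  unfolding forall_5 by (simp add: vfield_eq dgdiv_def vec5_eq field_simps power2_eq_square)
 then show "dgdiv x y (vfield i x) (vfield i y) = 0" ..
 have "ALL i. dgdiv x y (yfield i x) 0 = yfield i (gdiv x y)"
  unfolding forall_5 by (simp add: yfield_def dgdiv_def gdiv_def vec5_eq axis_nth5 field_simps power2_eq_square)
 then show "dgdiv x y (yfield i x) 0 = yfield i (gdiv x y)" ..
qed

lemma FD_sum:
 "fder (Fn f) x v = v$1 * Fn (dr 1 f) x + v$2 * Fn (dr 2 f) x + v$3 * Fn (dr 3 f) x + v$4 * Fn (dr 4 f) x + v$5 * Fn (dr 5 f) x"
proof -
 have lin: "linear (fder (Fn f) x)" using has_derivative_Fn has_derivative_linear by blast
 have e: "v = v$1 *R axis 1 1 + v$2 *R axis 2 1 + v$3 *R axis 3 1 + v$4 *R axis 4 1 + v$5 *R axis 5 1" for v :: "real^5"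
  by (simp add: vec5_eq axis_nth5)
 show ?thesis by (subst e[of v]) (simp add: linear_add[OF lin] linear_cmul[OF lin] Fn_dr)
qed

lemma act_Yf: "Fn (act (Yf i) f) x = fder (Fn f) x (yfield i x)"
proof -
 have "ALL i. Fn (act (Yf i) f) x = fder (Fn f) x (yfield i x)"
  unfolding forall_5 by (simp add: Yf_def yfield_def act_Pd axis_nth5 power2_eq_square FD_sum)
 then show ?thesis ..
qed

lemma smooth_fields: "smooth (%x. vfield i x $ j)" "smooth (%x. yfield i x $ j)"
proof -
 note sm = smooth_mult smooth_power smooth_coordinate smooth_on_const smooth_on_half[OF open_UNIV]
 have "ALL i j. smooth (%x. vfield i x $ j)" unfolding forall_5 by (simp add: vfield_eq sm)
 then show "smooth (%x. vfield i x $ j)" by blast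
 have "ALL i j. smooth (%x. yfield i x $ j)" unfolding forall_5 by (simp add: yfield_def axis_nth5 sm)
 then show "smooth (%x. yfield i x $ j)" by blast
qed

text \<open>Right translation is an ordinary translation composed with a shear of the last three
  coordinates by functions of the first two.\<close>

lemma integral_gmul:
 assumes f: "smooth f" "bsupp f"
 shows "(LINT h|lborel. f (gmul h y)) = (LINT x|lborel. f x)"
proof -
 define p where "p h = mk5 0 0 (h$1 * y$2) (h$1 * y$3 + (h$1)^2 / 2 * y$2) (h$2 * y$3 + h$1 * h$2 * y$2 + h$1 * (y$2)^2 / 2)" for h :: "real^5"
 define f' where "f' x = f (y + 1 *R x)" for x
 have f': "smooth f'"
 proof -
  have "smooth (%x. (y + 1 *R x) \<bullet> b)" for b by (simp add: inner_add_left) (intro smooth_add smooth_on_const smooth_on_inner)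
  then show ?thesis unfolding f'_def by (intro smooth_on_compose[OF open_UNIV open_UNIV _ _ f(1)]) auto
 qed
 have bf': "bsupp f'"
 proof -
  obtain r where r: "!!x. r < norm x ==> f x = 0" using f(2) by (auto simp: bsupp_def)
  show ?thesis unfolding f'_def
  proof (rule bsuppI[of "r + norm y"])
   fix x :: "real^5" assume "r + norm y < norm x"
   then have "r < norm (y + 1 *R x)" using norm_diff_ineq[of x y] by (simp add: add.commute)
   then show "f (y + 1 *R x) = 0" by (rule r)
  qed
 qed
 have sp: "smooth (%x. p x \<bullet> b)" if "b : Basis" for b
 proof (rule smooth_vecI[OF _ that])
  have "ALL i. smooth (%x. p x $ i)" unfolding forall_5 p_def mk5_nth
   by (intro conjI smooth_on_add smooth_on_mult smooth_on_power open_UNIV smooth_coordinate smooth_on_const smooth_on_half)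
  then show "smooth (%x. p x $ i)" for i ..
 qed
 have "(LINT x|lborel. f' (x + p x)) = (LINT x|lborel. f' x)"
 proof (rule integral_shear(1)[OF f' bf' sp, where I = "{axis 3 1, axis 4 1, axis 5 1}"])
  fix x b :: "real^5" and c assume "b : {axis 3 1, axis 4 1, axis 5 (1::real)}" then show "p (x + c *R b) = p x" by (auto simp: p_def axis_nth5)
 next
  fix x b :: "real^5" assume b: "b : Basis - {axis 3 1, axis 4 1, axis 5 (1::real)}"
  then obtain i where i: "b = axis i 1" by (auto simp: Basis_vec_def)
  have "ALL i. axis i 1 ~: {axis 3 1, axis 4 1, axis 5 (1::real)} --> p x $ i = 0" unfolding forall_5 by (simp add: p_def)
  then show "p x \<bullet> b = 0" using b by (auto simp: i inner_axis)
 qed (auto simp: axis_in_Basis_iff)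
 moreover have "f' (x + p x) = f (gmul x y)" for x unfolding f'_def by (rule arg_cong[of _ _ f]) (simp add: vec5_eq p_def gmul_def)
 ultimately show ?thesis
  using integral_affine[of 1 f y] smooth_on_continuous_on[OF f(1)] by (simp add: f'_def)
qed

text \<open>The map is the reflection u = x - h followed by two shears, first of coordinate 3 and
  then of coordinates 4 and 5. They cannot be merged into one, as the second displacement depends on
  the third coordinate.\<close>

lemma integral_ldiv:
 assumes f: "smooth f" "bsupp f"
 shows "(LINT h|lborel. f (ldiv h x)) = (LINT y|lborel. f y)"
proof -
 note sm = smooth_add smooth_diff smooth_minus smooth_mult smooth_power smooth_coordinate smooth_on_const smooth_on_half[OF open_UNIV]
 define p where "p u = mk5 0 0 (- ((x$1 - u$1) * u$2)) 0 0" for u :: "real^5"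
 define q where "q u = mk5 0 0 0 (- ((x$1 - u$1) * u$3) - (x$1 - u$1)^2 / 2 * u$2)
  (- ((x$2 - u$2) * u$3) - (x$1 - u$1) * (x$2 - u$2) * u$2 - (x$1 - u$1) * (u$2)^2 / 2)" for u :: "real^5"
 have sp: "smooth (%x. p x \<bullet> b)" if "b : Basis" for b
  by (rule smooth_vecI[OF spec[where P = "%i. smooth (%x. p x $ i)"] that]) (unfold forall_5 p_def mk5_nth, intro conjI sm)
 have sq: "smooth (%x. q x \<bullet> b)" if "b : Basis" for b
  by (rule smooth_vecI[OF spec[where P = "%i. smooth (%x. q x $ i)"] that]) (unfold forall_5 q_def mk5_nth, intro conjI sm)
 define f' where "f' u = f (u + q u)" for u
 have I: "b : {axis 4 1, axis 5 1} ==> q (u + c *R b) = q u" "b : Basis - {axis 4 1, axis 5 1} ==> q u \<bullet> b = 0" for u b c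
 proof -
  show "b : {axis 4 1, axis 5 1} ==> q (u + c *R b) = q u" by (auto simp: q_def axis_nth5)
  assume b: "b : Basis - {axis 4 1, axis 5 1}"
  then obtain i where i: "b = axis i 1" by (auto simp: Basis_vec_def)
  have "ALL i. axis i 1 ~: {axis 4 1, axis 5 (1::real)} --> q u $ i = 0" unfolding forall_5 by (simp add: q_def)
  then show "q u \<bullet> b = 0" using b by (auto simp: i inner_axis)
 qed
 have J: "b : {axis 3 1} ==> p (u + c *R b) = p u" "b : Basis - {axis 3 1} ==> p u \<bullet> b = 0" for u b c
 proof -
  show "b : {axis 3 1} ==> p (u + c *R b) = p u" by (auto simp: p_def axis_nth5)
  assume b: "b : Basis - {axis 3 1}"
  then obtain i where i: "b = axis i 1" by (auto simp: Basis_vec_def)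
  have "ALL i. axis i 1 ~: {axis 3 (1::real)} --> p u $ i = 0" unfolding forall_5 by (simp add: p_def)
  then show "p u \<bullet> b = 0" using b by (auto simp: i inner_axis)
 qed
 have Bs: "{axis 4 1, axis 5 1} <= (Basis :: (real^5) set)" "{axis 3 1} <= (Basis :: (real^5) set)" by (auto simp: axis_in_Basis_iff)
 note s1 = integral_shear[OF f sq, where I = "{axis 4 1, axis 5 1}", folded f'_def]
 have 1: "(LINT u|lborel. f' u) = (LINT u|lborel. f u)" and sf': "smooth f'" and bf': "bsupp f'" by (rule s1; (intro I Bs)?; assumption)+
 note s2 = integral_shear[OF sf' bf' sp, where I = "{axis 3 1}"]
 have 2: "(LINT u|lborel. f' (u + p u)) = (LINT u|lborel. f' u)" and sf2: "smooth (%u. f' (u + p u))" by (rule s2; (intro J Bs)?; assumption)+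
 have 3: "(LINT u|lborel. f' (u + p u)) = (LINT h|lborel. f' ((x + (-1) *R h) + p (x + (-1) *R h)))"
  using integral_affine[of "-1" "%u. f' (u + p u)" x] smooth_on_continuous_on[OF sf2] by simp
 have e: "f' ((x + (-1) *R h) + p (x + (-1) *R h)) = f (ldiv h x)" for h
  unfolding f'_def by (rule arg_cong[of _ _ f]) (simp add: vec5_eq p_def q_def ldiv_def Let_def algebra_simps)
 show ?thesis using 1 2 3 by (simp only: e)
qed

section \<open>The mollifier and its derivatives\<close>

definition ker :: "sm => bool" where "ker k \<longleftrightarrow> (ALL h. 1 <= norm h --> Fn k h = 0)"

lemma ker_mult: "ker k ==> ker (f * k)" by (simp add: ker_def)

lemma ker_bs: "ker k ==> bs k" unfolding ker_def bs_def by (rule bsuppI[of 1]) auto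

type_synonym kernel_arg = "(real \<times> (real^5)) \<times> (real^5)"

text \<open>The mollifier at scale \<open>\<epsilon> = s\<^sup>2\<close>; squaring makes the estimates below lose exactly one power of \<open>s\<close>
  at each step.\<close>

definition Psi :: "sm => kernel_arg => real" where
 "Psi k z = inverse (fst (fst z) ^ 10) * Fn k (inverse (fst (fst z) ^ 2) *R gdiv (snd (fst z)) (snd z))"

definition Psi_dom :: "kernel_arg set" where "Psi_dom = ({0<..} \<times> UNIV) \<times> UNIV"

lemma open_dom [simp]: "open Psi_dom" "open ({0::real<..} \<times> (UNIV :: (real^5) set))"
 by (auto simp: Psi_dom_def intro!: open_Times)

lemma in_dom [simp]: "((s, x), y) : Psi_dom \<longleftrightarrow> s > 0" by (simp add: Psi_dom_def)

lemma smooth_Psi: "smooth_on Psi_dom (Psi k)"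
proof -
 have s: "smooth_on Psi_dom (%z. fst (fst z))"
  by (rule smooth_on_bounded_linear) (intro bounded_linear_compose[OF bounded_linear_fst] bounded_linear_fst)
 have i: "smooth_on Psi_dom (%z. inverse (fst (fst z) ^ n))" for n
  by (rule smooth_on_inverse[OF open_dom(1) smooth_on_power[OF open_dom(1) s]]) (auto simp: Psi_dom_def)
 have x: "smooth_on Psi_dom (%z. snd (fst z) $ i)" "smooth_on Psi_dom (%z. snd z $ i)" for i
  by (rule smooth_nth, intro bounded_linear_compose[OF bounded_linear_snd] bounded_linear_fst, rule smooth_nth, rule bounded_linear_snd)
 have "smooth_on Psi_dom (%z. Fn k (inverse (fst (fst z) ^ 2) *R gdiv (snd (fst z)) (snd z)))"
 proof (rule smooth_on_compose[OF open_dom(1) open_UNIV _ _ smooth_Fn])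
  fix c :: "real^5" assume c: "c : Basis"
  show "smooth_on Psi_dom (%z. (inverse (fst (fst z) ^ 2) *R gdiv (snd (fst z)) (snd z)) \<bullet> c)"
   by (rule smooth_vecI[OF _ c]) (simp add: smooth_on_mult i smooth_on_vec_components x)
 qed auto
 then show ?thesis unfolding Psi_def by (intro smooth_on_mult open_dom i)
qed

lemma FD_linear: "fder (Fn f) x (v + w) = fder (Fn f) x v + fder (Fn f) x w"
 "fder (Fn f) x (c *R v) = c * fder (Fn f) x v"
 "fder (Fn f) x (v - w) = fder (Fn f) x v - fder (Fn f) x w"
 "fder (Fn f) x 0 = 0" "fder (Fn f) x (- v) = - fder (Fn f) x v"
 by (simp_all add: FD_sum algebra_simps)

lemma FD_Psi:
 assumes s: "s > 0"
 defines "h \<equiv> (%x y. inverse (s ^ 2) *R gdiv x y)"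
 shows "fder (Psi k) ((s, x), y) ((\<sigma>, v), w) =
  inverse (s ^ 12) * fder (Fn k) (h x y) (dgdiv x y v w)
  - \<sigma> * inverse (s ^ 11) * (10 * Fn k (h x y) + 2 * fder (Fn k) (h x y) (h x y))"
proof -
 have g: "((%z. gdiv (snd (fst z)) (snd z)) has_derivative (%z. dgdiv x y (snd (fst z)) (snd z))) (at ((s, x), y))"
  using has_derivative_gdiv[of "%z. snd (fst z)" "%z. snd (fst z)" "((s, x), y)" snd snd]
  by (simp add: bounded_linear_imp_has_derivative bounded_linear_snd bounded_linear_compose[OF bounded_linear_snd bounded_linear_fst, unfolded o_def])
 have i: "((%z :: kernel_arg. inverse (fst (fst z) ^ n)) has_derivative (%z. - real n * inverse (s ^ (n + 1)) * fst (fst z))) (at ((s, x), y))" for n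
 proof -
  have "((%t. inverse (t ^ n)) has_field_derivative (- real n * inverse (s ^ (n + 1)))) (at s)"
  proof (cases n)
   case (Suc m)
   have "((%t. inverse (t ^ n)) has_field_derivative (- (inverse (s ^ n) * (real n * s ^ (n - Suc 0)) * inverse (s ^ n)))) (at s)"
    using s by (intro DERIV_inverse' DERIV_pow) simp
   moreover have "inverse (s ^ n) * (real n * s ^ (n - Suc 0)) * inverse (s ^ n) = real n * inverse (s ^ (n + 1))"
    using s by (simp add: Suc field_simps)
   ultimately show ?thesis by simp
  qed simp
  then have "((%t. inverse (t ^ n)) has_derivative (*) (- real n * inverse (s ^ (n + 1)))) (at (fst (fst ((s, x), y))))"
   by (simp add: has_field_derivative_def)
  moreover have "((%z :: kernel_arg. fst (fst z)) has_derivative (%z. fst (fst z))) (at ((s, x), y))"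
   by (intro bounded_linear_imp_has_derivative bounded_linear_compose[OF bounded_linear_fst bounded_linear_fst])
  ultimately have "((%z :: kernel_arg. inverse (fst (fst z) ^ n)) has_derivative (%z. (- real n * inverse (s ^ (n + 1))) * fst (fst z))) (at ((s, x), y))"
   by (rule has_derivative_compose[rotated])
  then show ?thesis .
 qed
 have m: "((%z. inverse (fst (fst z) ^ 2) *R gdiv (snd (fst z)) (snd z)) has_derivative
  (%z. inverse (s ^ 2) *R dgdiv x y (snd (fst z)) (snd z) - (2 * inverse (s ^ 3) * fst (fst z)) *R gdiv x y)) (at ((s, x), y))"
  using has_derivative_scaleR[OF i[of 2] g] by simp
 have k: "((%z. Fn k (inverse (fst (fst z) ^ 2) *R gdiv (snd (fst z)) (snd z))) has_derivative
  (%z. fder (Fn k) (h x y) (inverse (s ^ 2) *R dgdiv x y (snd (fst z)) (snd z) - (2 * inverse (s ^ 3) * fst (fst z)) *R gdiv x y))) (at ((s, x), y))"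
  using diff_chain_at[OF m, of "Fn k"] has_derivative_Fn by (simp add: o_def h_def)
 have gd: "gdiv x y = s ^ 2 *R h x y" using s by (simp add: h_def)
 have "(Psi k has_derivative (%z. inverse (s ^ 10) * fder (Fn k) (h x y) (inverse (s ^ 2) *R dgdiv x y (snd (fst z)) (snd z) - (2 * inverse (s ^ 3) * fst (fst z)) *R gdiv x y)
  + (- 10 * inverse (s ^ 11) * fst (fst z)) * Fn k (h x y))) (at ((s, x), y))"
  unfolding Psi_def[abs_def] using has_derivative_mult[OF i[of 10] k] by (simp add: h_def)
 from fder_eqI[OF this]
 show ?thesis unfolding gd using s by (simp add: FD_linear field_simps eval_nat_numeral)
qed

lemma dgdiv_linear: "dgdiv x y (v + v') (w + w') = dgdiv x y v w + dgdiv x y v' w'"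
 by (simp add: vec5_eq dgdiv_def field_simps)

text \<open>The quotient does not change when both arguments move along the same left-invariant
  field. Hence left-invariant operators applied to a mollification pass to the functional.\<close>

lemma FD_Psi_vfield:
 assumes "s > 0"
 shows "fder (Psi k) ((s, x), y) ((0, vfield i x), 0) = - fder (Psi k) ((s, x), y) ((0, 0), vfield i y)"
proof -
 have "dgdiv x y (vfield i x) 0 + dgdiv x y 0 (vfield i y) = 0"
  using dgdiv_linear[of x y "vfield i x" 0 0 "vfield i y"] dgdiv_fields(1)[of x y i] by simp
 then have "dgdiv x y (vfield i x) 0 = (- 1) *R dgdiv x y 0 (vfield i y)" by (simp add: eq_neg_iff_add_eq_0)
 then show ?thesis by (simp add: FD_Psi[OF assms] FD_linear)
qed

text \<open>An entry \<open>(e, c, j, k')\<close> contributes \<open>- 2 c s\<^sup>1\<^sup>+\<^sup>e Y\<^sub>j\<close> applied to the mollifier with kernel \<open>k'\<close>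
  to the derivative in \<open>s\<close>: the generator of the scaling is a combination of right-invariant fields.\<close>

definition terms :: "sm => (nat \<times> real \<times> 5 \<times> sm) list" where
 "terms k = [(0, 1, 1, co 1 * k), (0, 1, 2, co 2 * k), (0, 1, 3, co 3 * k), (0, 1, 4, co 4 * k), (0, 1, 5, co 5 * k),
  (2, -1, 3, co 2 * (co 1 * k)), (2, -1, 4, co 3 * (co 1 * k)), (4, -1/2, 5, co 2 * (co 2 * (co 1 * k))), (2, -1, 5, co 3 * (co 2 * k))]"

text \<open>The factor 10 is twice the dimension, which makes the derivative -2 s^(-11) times the
  divergence of h k(h). Solving for the coordinate derivatives in terms of the right-invariant
  fields at the point \<open>s ^ 2 *R h\<close> produces the corrections with s^2 and s^4; their
  polynomial factors do not depend on the coordinates in which they are differentiated and can be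
  moved into the kernel.\<close>

lemma FD_Psi_scale:
 assumes s: "s > 0"
 shows "fder (Psi k) ((s, x), y) ((1, 0), 0) =
  (SUM (e, c, j, k')<-terms k. (- 2 * s * c * s ^ e) * fder (Psi k') ((s, x), y) ((0, yfield j x), 0))"
proof -
 define h where "h = inverse (s ^ 2) *R gdiv x y"
 have gd: "gdiv x y = s ^ 2 *R h" using s by (simp add: h_def)
 have z: "dgdiv x y 0 0 = 0" by (simp add: vec5_eq dgdiv_def)
 have yf: "yfield 1 (s ^ 2 *R h) = mk5 1 0 (s ^ 2 * h$2) (s ^ 2 * h$3) (s ^ 4 * (h$2)^2 / 2)" "yfield 2 (s ^ 2 *R h) = mk5 0 1 0 0 (s ^ 2 * h$3)"
  "yfield 3 x = mk5 0 0 1 0 0" "yfield 4 x = mk5 0 0 0 1 0" "yfield 5 x = mk5 0 0 0 0 1" for x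
  by (simp_all add: yfield_def vec5_eq axis_nth5 power_mult_distrib flip: power_mult)
 note d = FD_Psi[OF s, of _ x y, folded h_def]
 have Y: "fder (Psi k') ((s, x), y) ((0, yfield j x), 0) = inverse (s ^ 12) * fder (Fn k') h (yfield j (s ^ 2 *R h))" for j k'
  by (simp add: d dgdiv_fields(2) gd)
 have L: "fder (Psi k) ((s, x), y) ((1, 0), 0) = - inverse (s ^ 11) * (10 * Fn k h + 2 * fder (Fn k) h h)"
  by (simp add: d z FD_linear)
 have i: "inverse (s ^ 11) = s * inverse (s ^ 12)" using s by (simp add: field_simps eval_nat_numeral)
 define A where "A = inverse (s ^ 12)"
 show ?thesis unfolding terms_def L Y i A_def[symmetric]
  by (simp add: FD_sum yf dr_mult dr_co) (simp add: eval_nat_numeral algebra_simps)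
qed

definition Tm :: "((real^5 => real) => real) => sm => real => sm" where
 "Tm S k s = Sm (%x. S (%y. Psi k ((s, x), y)))"

definition Psm :: "sm => real => real^5 => sm" where "Psm k s x = Sm (%y. Psi k ((s, x), y))"

lemma Psi_slice: "s > 0 ==> smooth (%y. Psi k ((s, x), y))"
 by (rule smooth_on_slice[OF open_dom(2) smooth_Psi[unfolded Psi_dom_def]]) simp

lemma Fn_Psm: "s > 0 ==> Fn (Psm k s x) = (%y. Psi k ((s, x), y))"
 by (simp add: Psm_def Psi_slice)

lemma mollified_smooth:
 assumes S: "cdistr S"
 shows "smooth_on ({0<..} \<times> UNIV) (%p. S (%y. Psi k (p, y)))"
  and "s > 0 ==> fder (%p. S (%y. Psi k (p, y))) (s, x) v = S (%y. fder (Psi k) ((s, x), y) (v, 0))"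
 using cdistr_smooth[OF S open_dom(2) smooth_Psi[unfolded Psi_dom_def]] by auto

lemma Fn_Tm:
 assumes S: "cdistr S" and s: "s > 0"
 shows "Fn (Tm S k s) = (%x. S (%y. Psi k ((s, x), y)))"
proof -
 have "smooth (%x. (%p. S (%y. Psi k (p, y))) (s, x))"
  by (rule smooth_on_slice[OF _ mollified_smooth(1)[OF S]]) (use s in auto)
 then show ?thesis by (simp add: Tm_def)
qed

lemma FD_Tm:
 assumes S: "cdistr S" and s: "s > 0"
 shows "fder (Fn (Tm S k s)) x v = S (%y. fder (Psi k) ((s, x), y) ((0, v), 0))"
proof -
 have "fder (%x. (%p. S (%y. Psi k (p, y))) (s, x)) x v = fder (%p. S (%y. Psi k (p, y))) (s, x) (0, v)"
  by (rule fder_slice[OF _ mollified_smooth(1)[OF S]]) (use s in auto)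
 then show ?thesis using s by (simp add: Fn_Tm[OF S] mollified_smooth(2)[OF S])
qed

lemma smooth_FD_Psi: "s > 0 ==> smooth (%y. fder (Psi k) ((s, x), y) v)"
 by (rule smooth_on_slice[where U = "{0<..} \<times> UNIV" and \<Phi> = "%z. fder (Psi k) z v"])
  (use smooth_on_deriv[OF open_dom(1) smooth_Psi] in "auto simp: Psi_dom_def")

lemma cdistr_sum_list:
 assumes S: "cdistr S" and "!!i. i : set I ==> smooth (f i)"
 shows "S (%x. SUM i<-I. c i * f i x) = (SUM i<-I. c i * S (f i))"
proof -
 have "smooth (%x. SUM i<-I. c i * f i x) & S (%x. SUM i<-I. c i * f i x) = (SUM i<-I. c i * S (f i))"
  using assms(2)
  by (induction I) (auto simp: cdistr_zero[OF S] cdistr_add[OF S] cdistr_cmult[OF S] smooth_on_cmult smooth_on_add)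
 then show ?thesis ..
qed

lemma scale_derivative:
 assumes S: "cdistr S" and s: "s > 0"
 shows "fder (%p. S (%y. Psi k (p, y))) (s, x) (1, 0) =
  (SUM (e, c, j, k')<-terms k. (- 2 * s * c * s ^ e) * Fn (act (Yf j) (Tm S k' s)) x)"
 unfolding mollified_smooth(2)[OF S s] FD_Psi_scale[OF s] case_prod_unfold
 by (subst cdistr_sum_list[OF S]) (auto simp: smooth_FD_Psi[OF s] act_Yf FD_Tm[OF S s])

lemma op_closed_dual_wd: "op_closed (dual (wd w))"
proof (induction w)
 case Nil
 then show ?case using op_closed_mu[of 1] by (simp add: mu_ring)
next
 case (Cons i w)
 have "- Xf i = mu (- 1) * Xf i" by (simp add: mu_ring)
 then have "op_closed (- Xf i)" using op_closed_mult[OF op_closed_mu op_closed_Xf] by metis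
 then show ?case using Cons by (simp add: op_closed_mult del: mult_minus_right)
qed

text \<open>Applying a word to the mollification of \<open>S\<close> mollifies the transformed
  functional S'. The induction therefore runs with \<open>S\<close> arbitrary and uses that the
  adjoint words keep compact support and continuity.\<close>

lemma act_wd_Tm:
 assumes s: "s > 0"
 shows "cdistr S ==> Fn (act (wd w) (Tm S k s)) x = S (Fn (act (dual (wd w)) (Psm k s x)))"
proof (induction w arbitrary: S x)
 case Nil
 then show ?case by (simp add: Fn_Tm s Fn_Psm)
next
 case (Cons i w)
 define S' where "S' \<phi> = S (Fn (act (dual (wd w)) (Sm \<phi>)))" for \<phi>
 have S': "cdistr S'" unfolding S'_def using op_closed_dual_wd Cons.prems by (simp add: op_closed_def)
 have "act (wd w) (Tm S k s) = Tm S' k s"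
  using Cons.IH[OF Cons.prems] by (intro sm_eqI) (simp add: Fn_Tm[OF S' s], simp add: S'_def Psm_def)
 then have "Fn (act (wd (i # w)) (Tm S k s)) x = Fn (act (Xf i) (Tm S' k s)) x" by simp
 also have "... = S' (%y. fder (Psi k) ((s, x), y) ((0, vfield i x), 0))"
  by (simp add: act_Xf FD_Tm[OF S' s])
 also have "(%y. fder (Psi k) ((s, x), y) ((0, vfield i x), 0)) = Fn (act (dual (Xf i)) (Psm k s x))"
 proof
  fix y
  have "fder (%y. Psi k ((s, x), y)) y (vfield i y) = fder (Psi k) ((s, x), y) (0, vfield i y)"
   by (rule fder_slice[OF open_dom(2) smooth_Psi[unfolded Psi_dom_def]]) (use s in simp)
  then show "fder (Psi k) ((s, x), y) ((0, vfield i x), 0) = Fn (act (dual (Xf i)) (Psm k s x)) y"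
   by (simp add: FD_Psi_vfield[OF s] act_Xf Fn_Psm[OF s] zero_prod_def)
 qed
 finally show ?case by (simp only: S'_def Fn_inverse wd_simps dual_ring act_ring)
qed

lemma act_Hom_Tm:
 assumes s: "s > 0" and S: "cdistr S" and P: "P : Hom n"
 shows "Fn (act P (Tm S k s)) x = S (Fn (act (dual P) (Psm k s x)))"
proof (rule Hom_induct[OF P, where Q = "%P. Fn (act P (Tm S k s)) x = S (Fn (act (dual P) (Psm k s x)))"])
 have 1: "S (%x. Fn f x + Fn g x) = S (Fn f) + S (Fn g)" "S (%x. c * Fn f x) = c * S (Fn f)" for f g c
  using cdistr_add[OF S] cdistr_cmult[OF S] by simp_all
 have "S (Fn 0) = 0" using cdistr_zero[OF S] by (simp add: zero_sm.rep_eq)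
 then show "subspace {P. Fn (act P (Tm S k s)) x = S (Fn (act (dual P) (Psm k s x)))}"
  by (simp add: subspace_def 1 plus_sm.rep_eq scaleR_sm.rep_eq)
qed (rule act_wd_Tm[OF s S])

lemma bs_bounded: "bs q ==> EX C>=0. ALL x. \<bar>Fn q x\<bar> <= C"
proof -
 assume "bs q"
 then obtain r where r: "!!x. r < norm x ==> Fn q x = 0" by (auto simp: bs_def bsupp_def)
 obtain C where "C >= 0" "!!x. x : cball 0 r ==> \<bar>Fn q x\<bar> <= C" using smooth_bounded_on_compact[OF smooth_Fn compact_cball] by metis
 then show ?thesis using r by (intro exI[of _ C]) (metis abs_zero mem_cball_0 not_less)
qed

text \<open>Each derivative of the dilated kernel yields at most one factor \<open>\<sigma>\<close>;
  as \<open>\<sigma>\<close> is at least 1, lower powers are harmless. The coefficient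
  \<open>a\<close> closes the induction, because differentiating the quotient creates factors
  depending on x and y.\<close>

lemma growth:
 fixes a :: "(real^5) \<times> (real^5) => real"
 assumes K: "compact K1" "compact K2" and vs: "vs : lists Basis" and a: "smooth a" and q: "bs q"
 shows "EX C>=0. ALL \<sigma>>=1. ALL x:K1. ALL y:K2. \<bar>iter_deriv vs (%y. a (x, y) * Fn q (\<sigma> *R gdiv x y)) y\<bar> <= C * \<sigma> ^ length vs"
 using vs a q
proof (induction vs arbitrary: a q rule: rev_induct)
 case Nil
 obtain A where A: "A >= 0" "!!z. z : K1 \<times> K2 ==> \<bar>a z\<bar> <= A" using smooth_bounded_on_compact[OF Nil(2) compact_Times[OF K]] by blast
 obtain B where B: "B >= 0" "!!x. \<bar>Fn q x\<bar> <= B" using bs_bounded[OF Nil(3)] by blast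
 show ?case
  by (rule exI[of _ "A * B"], intro conjI allI impI ballI) (use A B in "auto simp: abs_mult intro!: mult_mono'")
next
 case (snoc b vs)
 have b: "b : Basis" and vs: "vs : lists Basis" using snoc.prems by auto
 define da where "da z = fder a z (0, b)" for z
 have da: "smooth da" unfolding da_def using snoc.prems(2) by (rule smooth_deriv)
 define ai where "ai i z = a z * dgdiv (fst z) (snd z) 0 b $ i" for i :: 5 and z
 have ai: "smooth (ai i)" for i
 proof -
  have g: "smooth (%z :: (real^5) \<times> (real^5). gdiv (fst z) (snd z) $ i)"
   by (intro smooth_on_vec_components open_UNIV smooth_nth bounded_linear_fst bounded_linear_snd)
  have "fder (%z. gdiv (fst z) (snd z) $ i) z (0, b) = dgdiv (fst z) (snd z) 0 b $ i" for z
   by (subst fder_eqI[OF bounded_linear.has_derivative[OF bounded_linear_vec_nth has_derivative_gdiv[OF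
    bounded_linear_imp_has_derivative[OF bounded_linear_fst] bounded_linear_imp_has_derivative[OF bounded_linear_snd]]]]) simp
  then show ?thesis unfolding ai_def using smooth_mult[OF snoc.prems(2) smooth_deriv[OF g, of "(0, b)"]] by simp
 qed
 define F where "F a q \<sigma> x y = a (x, y) * Fn q (\<sigma> *R gdiv x y)" for a :: "(real^5) \<times> (real^5) => real" and q \<sigma> x y
 have sF: "smooth (%y. F a q \<sigma> x y)" if a: "smooth a" for a q \<sigma> x
 proof -
  have 1: "smooth (%y. gdiv x y $ i)" for i
   by (rule smooth_on_vec_components(2)[OF open_UNIV]) (auto intro: smooth_coordinate)
  have "smooth (%y. Fn q (\<sigma> *R gdiv x y))"
   by (rule smooth_on_compose[OF open_UNIV open_UNIV _ _ smooth_Fn]) (auto intro!: smooth_vecI smooth_on_cmult 1)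
  then show ?thesis unfolding F_def by (intro smooth_on_mult open_UNIV slice1(1)[OF a])
 qed
 have dF: "fder (%y. F a q \<sigma> x y) y b = F da q \<sigma> x y + (SUM i:UNIV. \<sigma> * F (ai i) (dr i q) \<sigma> x y)" for \<sigma> x y
 proof -
  have 1: "((%y. a (x, y)) has_derivative fder (%y. a (x, y)) y) (at y)"
   by (rule smooth_on_has_derivative[OF slice1(1)[OF snoc.prems(2)] UNIV_I])
  have "((%y. \<sigma> *R gdiv x y) has_derivative (%w. \<sigma> *R dgdiv x y 0 w)) (at y)"
   using has_derivative_scaleR_right[OF has_derivative_gdiv[OF has_derivative_const[of x] has_derivative_ident]] by simp
  from has_derivative_compose[OF this has_derivative_Fn[of q]]
  have 2: "((%y. Fn q (\<sigma> *R gdiv x y)) has_derivative (%w. fder (Fn q) (\<sigma> *R gdiv x y) (\<sigma> *R dgdiv x y 0 w))) (at y)" .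
  have 3: "fder (%y. a (x, y)) y b = da (x, y)"
   using fder_slice[of UNIV a x y b] snoc.prems(2) by (simp add: da_def)
  have s5: "(SUM i:(UNIV :: 5 set). f i) = f 1 + f 2 + f 3 + f 4 + f 5" for f :: "5 => real" unfolding UNIV_5 by simp
  show ?thesis unfolding F_def
   using fder_eqI[OF has_derivative_mult[OF 1 2]] 3 by (simp add: FD_linear, simp add: FD_sum s5 ai_def algebra_simps)
 qed
 have IH: "EX C>=0. ALL \<sigma>>=1. ALL x:K1. ALL y:K2. \<bar>iter_deriv vs (%y. F a q \<sigma> x y) y\<bar> <= C * \<sigma> ^ length vs" if "smooth a" "bs q" for a q
  unfolding F_def by (rule snoc.IH[OF vs that])
 obtain C where C: "C >= 0" "!!\<sigma> x y. \<sigma> >= 1 ==> x : K1 ==> y : K2 ==> \<bar>iter_deriv vs (%y. F da q \<sigma> x y) y\<bar> <= C * \<sigma> ^ length vs"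
  using IH[OF da snoc.prems(3)] by blast
 have "bs (dr i q)" for i using bs_act[OF snoc.prems(3), of "Pd i"] by (simp add: act_Pd)
 from IH[OF ai this] have "ALL i. EX C>=0. ALL \<sigma>>=1. ALL x:K1. ALL y:K2. \<bar>iter_deriv vs (%y. F (ai i) (dr i q) \<sigma> x y) y\<bar> <= C * \<sigma> ^ length vs" by blast
 then obtain D where D: "!!i. D i >= 0" "!!i \<sigma> x y. \<sigma> >= 1 ==> x : K1 ==> y : K2 ==> \<bar>iter_deriv vs (%y. F (ai i) (dr i q) \<sigma> x y) y\<bar> <= D i * \<sigma> ^ length vs"
  by metis
 show ?case
 proof (rule exI[of _ "C + (SUM i:UNIV. D i)"], intro conjI allI impI ballI)
  show "0 <= C + (SUM i:UNIV. D i)" using C(1) D(1) by (simp add: sum_nonneg)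
  fix \<sigma> :: real and x y assume h: "1 <= \<sigma>" "x : K1" "y : K2"
  have "iter_deriv (vs @ [b]) (%y. F a q \<sigma> x y) y = iter_deriv vs (%y. F da q \<sigma> x y) y + (SUM i:UNIV. \<sigma> * iter_deriv vs (%y. F (ai i) (dr i q) \<sigma> x y) y)"
   unfolding iter_deriv_snoc dF
   by (subst iter_deriv_linear(1)[OF sF[OF da] smooth_sum[OF smooth_cmult[OF sF[OF ai]]]],
    subst iter_deriv_sum[OF finite smooth_cmult[OF sF[OF ai]]], simp add: iter_deriv_linear(2)[OF sF[OF ai] sF[OF ai]])
  also have "\<bar>...\<bar> <= C * \<sigma> ^ Suc (length vs) + (SUM i:UNIV. D i * \<sigma> ^ Suc (length vs))"
  proof (rule order_trans[OF abs_triangle_ineq add_mono[OF _ order_trans[OF sum_abs sum_mono]]])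
   show "\<bar>iter_deriv vs (%y. F da q \<sigma> x y) y\<bar> <= C * \<sigma> ^ Suc (length vs)"
    using C(2)[OF h] mult_left_mono[OF power_increasing[of "length vs" "Suc (length vs)", OF _ h(1)] C(1)] by linarith
   fix i
   have "\<bar>\<sigma> * iter_deriv vs (%y. F (ai i) (dr i q) \<sigma> x y) y\<bar> <= \<sigma> * (D i * \<sigma> ^ length vs)"
    using mult_left_mono[OF D(2)[OF h, of i], of \<sigma>] h(1) by (simp add: abs_mult)
   also have "... = D i * \<sigma> ^ Suc (length vs)" by simp
   finally show "\<bar>\<sigma> * iter_deriv vs (%y. F (ai i) (dr i q) \<sigma> x y) y\<bar> <= D i * \<sigma> ^ Suc (length vs)" .
  qed
  finally show "\<bar>iter_deriv (vs @ [b]) (%y. a (x, y) * Fn q (\<sigma> *R gdiv x y)) y\<bar> <= (C + (SUM i:UNIV. D i)) * \<sigma> ^ length (vs @ [b])"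
   by (simp add: F_def distrib_right sum_distrib_right del: power_Suc)
 qed
qed

text \<open>The exponent is 10 from the normalization plus 2 for each of the N derivatives in the
  bound of \<open>S\<close>. It is chosen before the kernel, since the scale derivative passes from
  one kernel to others.\<close>

lemma Tm_growth:
 assumes S: "cdistr S" and K: "compact K1"
 shows "EX n. ALL k. bs k --> (EX C>=0. ALL s x. 0 < s --> s <= 1 --> x : K1 --> \<bar>Fn (Tm S k s) x\<bar> <= C * inverse s ^ n)"
proof -
 obtain K N C where K2: "compact K" "C >= 0" "!!\<phi> B. smooth \<phi> ==>
   deriv_bound N K \<phi> B ==> \<bar>S \<phi>\<bar> <= C * B"
  using S unfolding cdistr_def by blast
 show ?thesis
 proof (rule exI[of _ "10 + 2 * N"], intro allI impI)
 fix k assume k: "bs k"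
 have "ALL vs:lists Basis. EX C>=0. ALL \<sigma>>=1. ALL x:K1. ALL y:K. \<bar>iter_deriv vs (%y. 1 * Fn k (\<sigma> *R gdiv x y)) y\<bar> <= C * \<sigma> ^ length vs"
  using growth[OF K K2(1) _ smooth_on_const[of UNIV 1] k] by blast
 then obtain D where D: "!!vs. vs : lists Basis ==> D vs >= 0" "!!vs \<sigma> x y. vs : lists Basis ==> \<sigma> >= 1 ==> x : K1 ==> y : K ==>
  \<bar>iter_deriv vs (%y. 1 * Fn k (\<sigma> *R gdiv x y)) y\<bar> <= D vs * \<sigma> ^ length vs" by metis
 let ?L = "{vs : lists (Basis :: (real^5) set). length vs <= N}"
 have fin: "finite ?L" by (rule finite_lists_le)
 define E where "E = (SUM vs:?L. D vs)"
 have E: "E >= 0" unfolding E_def by (rule sum_nonneg) (use D(1) in simp)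
 have "\<bar>Fn (Tm S k s) x\<bar> <= (C * E) * inverse s ^ (10 + 2 * N)" if s: "0 < s" "s <= 1" and x: "x : K1" for s x
 proof -
  define \<sigma> where "\<sigma> = inverse (s ^ 2)"
  have \<sigma>: "\<sigma> >= 1" using s by (simp add: \<sigma>_def one_le_inverse power_le_one)
  define \<phi> where "\<phi> y = 1 * Fn k (\<sigma> *R gdiv x y)" for y
  have P: "(%y. Psi k ((s, x), y)) = (%y. inverse (s ^ 10) * \<phi> y)" by (simp add: Psi_def \<phi>_def \<sigma>_def)
  have "s ^ 10 * Psi k ((s, x), y) = \<phi> y" for y using fun_cong[OF P, of y] s by simp
  then have "\<phi> = (%y. s ^ 10 * Psi k ((s, x), y))" by simp
  then have sm: "smooth \<phi>" using Psi_slice[OF s(1)] by (simp add: smooth_on_cmult)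
  have "\<bar>S \<phi>\<bar> <= C * (E * \<sigma> ^ N)"
  proof (intro K2(3) sm ballI impI)
   fix vs y assume vs: "vs : lists (Basis :: (real^5) set)" "length vs <= N" and y: "y : K"
   have "\<bar>iter_deriv vs \<phi> y\<bar> <= D vs * \<sigma> ^ length vs" unfolding \<phi>_def by (rule D(2)[OF vs(1) \<sigma> x y])
   also have "... <= E * \<sigma> ^ N"
   proof (intro mult_mono power_increasing \<sigma>)
    show "D vs <= E" unfolding E_def using vs D(1) by (intro member_le_sum fin) auto
    show "length vs <= N" by (rule vs(2))
   qed (use E \<sigma> in auto)
   finally show "\<bar>iter_deriv vs \<phi> y\<bar> <= E * \<sigma> ^ N" .
  qed
  then have "inverse (s ^ 10) * \<bar>S \<phi>\<bar> <= inverse (s ^ 10) * (C * (E * \<sigma> ^ N))" using s by (intro mult_left_mono) auto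
  also have "... = (C * E) * inverse s ^ (10 + 2 * N)" by (simp add: \<sigma>_def power_add power_inverse mult_ac flip: power_mult)
  finally show ?thesis using s by (simp add: Fn_Tm[OF S] P cdistr_cmult[OF S sm] abs_mult)
 qed
 then show "EX C>=0. ALL s x. 0 < s --> s <= 1 --> x : K1 --> \<bar>Fn (Tm S k s) x\<bar> <= C * inverse s ^ (10 + 2 * N)"
  using K2(2) E by (intro exI[of _ "C * E"] conjI) auto
 qed
qed

section \<open>Smooth dependence on the scale\<close>

lemma lipschitz_in_parameter:
 fixes f :: "real \<times> 'b::euclidean_space => real"
 assumes W: "smooth_on W f" and M: "!!t. t : closed_segment s s' ==> (t, x) : W & \<bar>fder f (t, x) (1, 0)\<bar> <= M"
 shows "\<bar>f (s, x) - f (s', x)\<bar> <= M * \<bar>s - s'\<bar>"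
proof -
 have d: "((%t. f (t, x)) has_field_derivative fder f (t, x) (1, 0)) (at t within closed_segment s s')"
  if "t : closed_segment s s'" for t
 proof -
  have F: "(f has_derivative fder f (t, x)) (at (t, x))" using smooth_on_has_derivative[OF W] M[OF that] by blast
  have "((%t. (t, x)) has_derivative (%h. (h, 0))) (at t)" by (auto intro!: derivative_eq_intros)
  from has_derivative_compose[OF this F] have 1: "((%t. f (t, x)) has_derivative (%h. fder f (t, x) (h, 0))) (at t)" .
  have "(%h. fder f (t, x) (h, 0)) = (*) (fder f (t, x) (1, 0))"
  proof
   fix h
   show "fder f (t, x) (h, 0) = fder f (t, x) (1, 0) * h"
    using linear_cmul[OF has_derivative_linear[OF F], of h "(1, 0)"] by (simp add: mult.commute)
  qed
  from 1[unfolded this] show ?thesis unfolding has_field_derivative_def by (rule has_derivative_at_withinI)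
 qed
 have "norm (f (s, x) - f (s', x)) <= M * norm (s - s')"
  by (rule field_differentiable_bound[OF _ d]) (use M in auto)
 then show ?thesis by simp
qed

lemma smooth_family_bounds:
 fixes G :: "real \<times> (real^5) => real"
 assumes G: "smooth G"
 shows "EX C>=0. ALL s:{0..1}. ALL s':{0..1}. ALL x:cball x0 r. \<bar>G (s, x)\<bar> <= C & \<bar>G (s, x) - G (s', x)\<bar> <= C * \<bar>s - s'\<bar>"
proof -
 have K: "compact ({0..1::real} \<times> cball x0 r)" by (intro compact_Times) auto
 obtain A where A: "A >= 0" "!!z. z : {0..1} \<times> cball x0 r ==> \<bar>G z\<bar> <= A" using smooth_bounded_on_compact[OF G K] by blast
 obtain B where B: "B >= 0" "!!z. z : {0..1} \<times> cball x0 r ==> \<bar>fder G z (1, 0)\<bar> <= B"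
  using smooth_bounded_on_compact[OF smooth_deriv[OF G] K] by blast
 show ?thesis
 proof (intro exI[of _ "A + B"] conjI ballI)
  fix s s' x assume h: "s : {0..1::real}" "s' : {0..1::real}" "x : cball x0 r"
  show "\<bar>G (s, x)\<bar> <= A + B" using A(2)[of "(s, x)"] h B(1) by auto
  have "closed_segment s s' <= {0..1}" using h by (intro closed_segment_subset) auto
  then have "\<bar>G (s, x) - G (s', x)\<bar> <= B * \<bar>s - s'\<bar>"
   by (intro lipschitz_in_parameter[OF G]) (use B(2) h(3) in auto)
  also have "... <= (A + B) * \<bar>s - s'\<bar>" using A(1) by (intro mult_right_mono) auto
  finally show "\<bar>G (s, x) - G (s', x)\<bar> <= (A + B) * \<bar>s - s'\<bar>" .
 qed (use A B in auto)
qed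

text \<open>Here D differentiates in the point only; joint smoothness in scale and point is what
  yields Lipschitz bounds in the scale, uniform down to zero.\<close>

definition family_op :: "dop => bool" where
 "family_op D \<longleftrightarrow> (ALL G :: real \<times> (real^5) => real. smooth G --> smooth (%p. Fn (act D (Sm (%x. G (fst p, x)))) (snd p)))"

lemma family_op_mult: "family_op D ==> family_op E ==> family_op (D * E)"
 unfolding family_op_def
proof (intro allI impI)
 fix G :: "real \<times> (real^5) => real"
 assume D: "ALL G :: real \<times> (real^5) => real. smooth G --> smooth (%p. Fn (act D (Sm (%x. G (fst p, x)))) (snd p))"
  and E: "ALL G :: real \<times> (real^5) => real. smooth G --> smooth (%p. Fn (act E (Sm (%x. G (fst p, x)))) (snd p))" and G: "smooth G"
 show "smooth (%p. Fn (act (D * E) (Sm (%x. G (fst p, x)))) (snd p))"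
  using D[rule_format, OF E[rule_format, OF G]] by (simp add: Fn_inverse)
qed

lemma family_op_field:
 assumes "!!f x. Fn (act D f) x = fder (Fn f) x (v x)" "!!i. smooth (%x. v x $ i)"
 shows "family_op D"
 unfolding family_op_def
proof (intro allI impI)
 fix G :: "real \<times> (real^5) => real" assume G: "smooth G"
 have "Fn (act D (Sm (%x. G (fst p, x)))) (snd p) = fder G p (0, v (snd p))" for p
  using fder_slice[of UNIV G "fst p" "snd p"] G slice1(1)[OF G] by (simp add: assms(1))
 moreover have "smooth (%p. fder G p (0, v (snd p)))"
 proof (rule smooth_on_deriv_field[OF open_UNIV G])
  fix b :: "real \<times> (real^5)" assume b: "b : Basis"
  have "smooth (%p :: real \<times> (real^5). v (snd p) $ i)" for i
   by (rule smooth_on_compose[OF open_UNIV open_UNIV _ _ assms(2)])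
    (auto intro!: smooth_on_bounded_linear bounded_linear_inner_left_comp bounded_linear_snd)
  then show "smooth (%p :: real \<times> (real^5). (0, v (snd p)) \<bullet> b)"
   by (intro smooth_on_Pair_components b) (auto intro: smooth_vecI)
 qed
 ultimately show "smooth (%p. Fn (act D (Sm (%x. G (fst p, x)))) (snd p))" by simp
qed

lemma family_op_words: "family_op (wd w * yw y)"
proof -
 have 1: "family_op 1" by (simp add: family_op_def slice1)
 have x: "family_op (Xf i)" for i by (rule family_op_field[OF act_Xf smooth_fields(1)])
 have y: "family_op (Yf i)" for i by (rule family_op_field[OF act_Yf smooth_fields(2)])
 have "family_op (wd w)" by (induction w) (simp_all add: 1 x family_op_mult)
 moreover have "family_op (yw y)" by (induction y) (simp_all add: 1 y family_op_mult)
 ultimately show ?thesis by (rule family_op_mult)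
qed

text \<open>Written in the variable of the unscaled kernel, the mollification of a smooth function
  is smooth in the scale on the whole line, in particular across zero. The case \<open>ldiv\<close>
  serves the right-hand sides of the system, the case \<open>gmul\<close> the transposed
  mollification of test functions.\<close>

lemma smooth_average:
 assumes k: "ker k" and \<mu>: "\<mu> = ldiv \<or> \<mu> = gmul"
 shows "smooth (%p. LINT h|lborel. Fn k h * Fn f (\<mu> (fst p ^ 2 *R h) (snd p)))"
proof -
 have I: "cdistr (%\<phi>. LINT h|lborel. Fn k h * \<phi> h)"
  using ker_bs[OF k] by (intro cdistr_integral cont_Fn) (simp add: bs_def)
 have s: "smooth (%z :: kernel_arg. fst (fst z))"
  by (rule smooth_on_bounded_linear) (intro bounded_linear_compose[OF bounded_linear_fst] bounded_linear_fst)
 have x: "smooth (%z :: kernel_arg. snd (fst z) $ i)" "smooth (%z :: kernel_arg. snd z $ i)" for i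
  by (rule smooth_nth, intro bounded_linear_compose[OF bounded_linear_snd] bounded_linear_fst, rule smooth_nth, rule bounded_linear_snd)
 have c: "smooth (%z :: kernel_arg. (fst (fst z) ^ 2 *R snd z) $ i)" for i
  by (simp add: smooth_on_mult smooth_on_power s x)
 have "smooth (%z :: kernel_arg. \<mu> (fst (fst z) ^ 2 *R snd z) (snd (fst z)) $ i)" for i
  using \<mu> smooth_on_vec_components(1,3)[OF open_UNIV c x(1)] by auto
 then have "smooth (%z :: kernel_arg. Fn f (\<mu> (fst (fst z) ^ 2 *R snd z) (snd (fst z))))"
  by (intro smooth_on_compose[OF open_UNIV open_UNIV _ _ smooth_Fn]) (auto intro: smooth_vecI)
 from cdistr_smooth(1)[OF I open_UNIV, unfolded UNIV_Times_UNIV, OF this] show ?thesis by simp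
qed

lemma finite_bound:
 assumes "finite I" "!!i. i : I ==> EX C>=0. Q i (C :: real)" "!!i C C'. Q i C ==> C <= C' ==> Q i C'"
 shows "EX C>=0. ALL i:I. Q i C"
 using assms(1,2)
proof (induction I rule: finite_induct)
 case (insert i I)
 obtain C where "C >= 0" "ALL i:I. Q i C" using insert by auto
 moreover obtain D where "D >= 0" "Q i D" using insert.prems(1)[of i] by auto
 ultimately show ?case using assms(3) by (intro exI[of _ "max C D"]) (auto intro: max.cobounded1 max.cobounded2)
qed auto

text \<open>The power 10 is the Jacobian of the isotropic dilation by s^2 in five
  coordinates.\<close>

lemma integral_scaled:
 fixes g :: "real^5 => real"
 assumes "s > 0" "continuous_on UNIV g"
 shows "(LINT h|lborel. g h) = s ^ 10 * (LINT h|lborel. g (s^2 *R h))"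
 using integral_affine[of "s^2" g 0] assms by (simp add: power_mult[symmetric])

abbreviation smooth_near :: "(('a::euclidean_space => real) => real) => 'a => bool" where
 "smooth_near T x \<equiv> EX \<rho>>0. EX g. smooth g & (ALL \<phi>. smooth \<phi> --> (ALL y. y ~: ball x \<rho> --> \<phi> y = 0) --> T \<phi> = (LINT x|lborel. g x * \<phi> x))"

text \<open>The assumption \<open>eqn\<close> says that near \<open>x0\<close> each row \<open>r\<close> of the system maps \<open>S\<close> to the smooth function \<open>F r\<close>.\<close>

locale mollified = maximal +
 fixes S :: "nat => (real^5 => real) => real" and x0 :: "real^5" and R s0 :: real and F :: "(nat => dop) => sm"
 assumes S: "b < N ==> cdistr (S b)" and R: "R > 0" and s0: "0 < s0" "s0 <= 1"
  and supp: "0 < s ==> s <= s0 ==> dist x0 x <= R / 2 ==> y ~: ball x0 R ==> 1 <= norm (inverse (s^2) *R gdiv x y)"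
  and eqn: "(d, r) : rows ==> (!!y. y ~: ball x0 R ==> Fn \<phi> y = 0) ==> (SUM b<N. S b (Fn (act (dual (r b)) \<phi>))) = ip (F r) \<phi>"
begin

abbreviation Tv :: "sm => real => nat => sm" where "Tv \<kappa> s \<equiv> (%b. Tm (S b) \<kappa> s)"

abbreviation dTv :: "sm => nat => real => real^5 => real" where
 "dTv \<kappa> b s x \<equiv> fder (%p. S b (%y. Psi \<kappa> (p, y))) (s, x) (1, 0)"

text \<open>A row commutes with the mollification, and by \<open>supp\<close> the scaled kernel at x
  lives in the ball where the equation holds. The substitution of \<open>ldiv h x\<close> for y,
  followed by scaling, turns the result into an average of the smooth right-hand side.\<close>

lemma rowact_Tv:
 assumes dr: "(d, r) : rows" and k: "ker \<kappa>" and s: "0 < s" "s <= s0" and x: "dist x0 x <= R / 2"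
 shows "Fn (rowact N r (Tv \<kappa> s)) x = (LINT h|lborel. Fn \<kappa> h * Fn (F r) (ldiv (s^2 *R h) x))"
proof -
 have z: "Fn (Psm \<kappa> s x) y = 0" if "y ~: ball x0 R" for y
  using supp[OF s x that] k by (simp add: Fn_Psm[OF s(1)] Psi_def ker_def)
 have "Fn (rowact N r (Tv \<kappa> s)) x = (SUM b<N. S b (Fn (act (dual (r b)) (Psm \<kappa> s x))))"
  unfolding rowact_def using act_Hom_Tm[OF s(1) S row_Hom[OF dr]] by simp
 also have "... = ip (F r) (Psm \<kappa> s x)" using eqn[OF dr] z by blast
 also have "... = (LINT y|lborel. Fn (F r * Psm \<kappa> s x) y)" by (simp add: ip_def)
 also have "... = (LINT h|lborel. Fn (F r * Psm \<kappa> s x) (ldiv h x))"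
 proof (rule integral_ldiv[symmetric])
  show "bsupp (Fn (F r * Psm \<kappa> s x))" by (rule bsupp_ball[of x0 R]) (use z in simp)
 qed (rule smooth_Fn)
 also have "... = s ^ 10 * (LINT h|lborel. Fn (F r * Psm \<kappa> s x) (ldiv (s^2 *R h) x))"
 proof (rule integral_scaled[OF s(1) smooth_on_continuous_on])
  have "smooth (%h. ldiv h x $ i)" for i
   by (rule smooth_on_vec_components(3)[OF open_UNIV]) (auto intro: smooth_coordinate)
  then show "smooth (%h. Fn (F r * Psm \<kappa> s x) (ldiv h x))"
   by (intro smooth_on_compose[OF open_UNIV open_UNIV _ _ smooth_Fn]) (auto intro: smooth_vecI)
 qed
 also have "... = (LINT h|lborel. Fn \<kappa> h * Fn (F r) (ldiv (s^2 *R h) x))"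
 proof -
  have c: "s ^ 10 * (inverse (s ^ 10) * X) = X" for X using s(1) by simp
  show ?thesis using s(1)
   by (subst Bochner_Integration.integral_mult_right_zero[symmetric]) (simp add: Fn_Psm[OF s(1)] Psi_def group_cancel c mult_ac)
 qed
 finally show ?thesis .
qed

text \<open>On the smaller ball the row of the mollification is the restriction to s > 0 of a
  function smooth in (s, x) on the whole space; compactness of [0, 1] times the closed ball gives
  both bounds.\<close>

lemma row_bounds:
 assumes dr: "(d, r) : rows" and k: "ker \<kappa>"
 shows "EX C>=0. ALL s s' x. 0 < s --> s <= s0 --> 0 < s' --> s' <= s0 --> dist x0 x < R / 2 -->
  \<bar>row_deriv w y r (Tv \<kappa> s) x\<bar> <= C &
  \<bar>row_deriv w y r (Tv \<kappa> s) x - row_deriv w y r (Tv \<kappa> s') x\<bar> <= C * \<bar>s - s'\<bar>"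
proof -
 define G where "G p = (LINT h|lborel. Fn \<kappa> h * Fn (F r) (ldiv (fst p ^ 2 *R h) (snd p)))" for p :: "real \<times> (real^5)"
 have sG: "smooth G" unfolding G_def by (rule smooth_average[OF k]) simp
 define G' where "G' p = Fn (act (wd w * yw y) (Sm (%x. G (fst p, x)))) (snd p)" for p
 have sG': "smooth G'" unfolding G'_def using family_op_words sG by (auto simp: family_op_def)
 obtain C where C: "C >= 0" "!!s s' x. s : {0..1} ==> s' : {0..1} ==> x : cball x0 (R / 2) ==> \<bar>G' (s, x)\<bar> <= C & \<bar>G' (s, x) - G' (s', x)\<bar> <= C * \<bar>s - s'\<bar>"
  using smooth_family_bounds[OF sG', of x0 "R / 2"] by blast
 have e: "row_deriv w y r (Tv \<kappa> s) x = G' (s, x)" if s: "0 < s" "s <= s0" and x: "dist x0 x < R / 2" for s x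
 proof -
  have "Fn (act (wd w * yw y) (rowact N r (Tv \<kappa> s))) x = Fn (act (wd w * yw y) (Sm (%x. G (s, x)))) x"
  proof (rule act_cong_on[OF open_ball])
   fix x' assume "x' : ball x0 (R / 2)"
   then show "Fn (rowact N r (Tv \<kappa> s)) x' = Fn (Sm (%x. G (s, x))) x'"
    using rowact_Tv[OF dr k s, of x'] slice1(1)[OF sG] by (simp add: G_def)
  qed (use x in simp)
  then show ?thesis by (simp add: G'_def)
 qed
 show ?thesis
 proof (intro exI[of _ C] conjI allI impI C(1))
  fix s s' x assume h: "0 < s" "s <= s0" "0 < s'" "s' <= s0" "dist x0 x < R / 2"
  have "s : {0..1}" "s' : {0..1}" "x : cball x0 (R / 2)" using h s0(2) by auto
  note C' = C(2)[OF this]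
  show "\<bar>row_deriv w y r (Tv \<kappa> s) x\<bar> <= C"
   "\<bar>row_deriv w y r (Tv \<kappa> s) x - row_deriv w y r (Tv \<kappa> s') x\<bar> <= C * \<bar>s - s'\<bar>"
   using C' e[OF h(1,2,5)] e[OF h(3,4,5)] by auto
 qed
qed

lemma row_bounds_uniform:
 assumes k: "ker \<kappa>"
 shows "EX C>=0. ALL d r y w s s' x. (d, r) : rows --> length y <= m --> w : words (k - d) --> 0 < s --> s <= s0 --> 0 < s' --> s' <= s0 --> dist x0 x < R / 2 -->
  \<bar>row_deriv w y r (Tv \<kappa> s) x\<bar> <= C &
  \<bar>row_deriv w y r (Tv \<kappa> s) x - row_deriv w y r (Tv \<kappa> s') x\<bar> <= C * \<bar>s - s'\<bar>"
proof -
 define I where "I = rows \<times> {y :: 5 list. length y <= m} \<times> (\<Union>j\<le>k. words j)"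
 have fin: "finite I" unfolding I_def using finite_rows finite_lists5 by auto
 define Q where "Q i C \<longleftrightarrow> (ALL s s' x. 0 < s --> s <= s0 --> 0 < s' --> s' <= s0 --> dist x0 x < R / 2 -->
  \<bar>row_deriv (snd (snd i)) (fst (snd i)) (snd (fst i)) (Tv \<kappa> s) x\<bar> <= C &
  \<bar>row_deriv (snd (snd i)) (fst (snd i)) (snd (fst i)) (Tv \<kappa> s) x
  - row_deriv (snd (snd i)) (fst (snd i)) (snd (fst i)) (Tv \<kappa> s') x\<bar> <= C * \<bar>s - s'\<bar>)"
  for i :: "(nat \<times> (nat => dop)) \<times> 5 list \<times> 5 list" and C
 have "EX C>=0. ALL i:I. Q i C"
 proof (rule finite_bound[OF fin])
  fix i assume "i : I"
  then have "(fst (fst i), snd (fst i)) : rows" by (auto simp: I_def)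
  from row_bounds[OF this k] show "EX C>=0. Q i C" unfolding Q_def .
 next
  fix i C C' assume q: "Q i C" and c: "C <= C'"
  show "Q i C'" unfolding Q_def
  proof (intro allI impI conjI)
   fix s s' x assume "0 < s" "s <= s0" "0 < s'" "s' <= s0" "dist x0 x < R / 2"
   note q[unfolded Q_def, rule_format, OF this]
   moreover have "C * \<bar>s - s'\<bar> <= C' * \<bar>s - s'\<bar>" using c by (intro mult_right_mono) auto
   ultimately show "\<bar>row_deriv (snd (snd i)) (fst (snd i)) (snd (fst i)) (Tv \<kappa> s) x\<bar> <= C'"
    "\<bar>row_deriv (snd (snd i)) (fst (snd i)) (snd (fst i)) (Tv \<kappa> s) x
    - row_deriv (snd (snd i)) (fst (snd i)) (snd (fst i)) (Tv \<kappa> s') x\<bar> <= C' * \<bar>s - s'\<bar>"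
    using c by linarith+
  qed
 qed
 then obtain C where C: "C >= 0" "!!i. i : I ==> Q i C" by blast
 show ?thesis
 proof (rule exI[of _ C], intro conjI[OF C(1)], intro allI impI)
  fix d r y w s s' x assume "(d, r) : rows" "length (y :: 5 list) <= m" "w : words (k - d)" and h: "0 < s" "s <= s0" "0 < s'" "s' <= s0" "dist x0 x < R / 2"
  then have "((d, r), y, w) : I" by (auto simp: I_def)
  from C(2)[OF this, unfolded Q_def, rule_format, OF h]
  show "\<bar>row_deriv w y r (Tv \<kappa> s) x\<bar> <= C &
  \<bar>row_deriv w y r (Tv \<kappa> s) x - row_deriv w y r (Tv \<kappa> s') x\<bar> <= C * \<bar>s - s'\<bar>" by simp
 qed
qed

end

section \<open>Improvement of the growth exponent\<close>

lemma rowact_diff: "rowact N r (%b. u b - v b) = rowact N r u - rowact N r v"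
 by (simp add: rowact_def sum_subtractf)

context mollified
begin

text \<open>All kernels supported in the unit ball are included at once, because the scale
  derivative of one mollification involves mollifications with the kernels in
  \<open>terms\<close>.\<close>

definition Good :: "nat => real => bool" where
 "Good n \<rho> \<longleftrightarrow> (ALL \<kappa>. ker \<kappa> --> (EX C>=0. ALL b<N. ALL s x. 0 < s --> s <= s0 --> dist x0 x < \<rho> --> \<bar>Fn (Tv \<kappa> s b) x\<bar> <= C * inverse s ^ n))"

lemma estimate_on_ball:
 assumes \<rho>: "0 < \<rho>"
 shows "EX m. EX C>=0. ALL v B. B >= 0 --> (ALL b<N. ALL x. dist x0 x < \<rho> --> \<bar>Fn (v b) x\<bar> <= B) -->
  (ALL d r y w x. (d, r) : rows --> length y <= m --> w : words (k - d) --> dist x0 x < \<rho> --> \<bar>row_deriv w y r v x\<bar> <= B) -->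
  (ALL b<N. ALL x. dist x0 x < \<rho> / 2 --> \<bar>Fn (act (yw y) (v b)) x\<bar> <= C * B)"
proof -
 define z where "z = Sm (bump x0 \<rho>)"
 have Fz: "Fn z = bump x0 \<rho>" by (simp add: z_def smooth_on_bump)
 have z0: "dist x0 x < \<rho>" if "Fn z x ~= 0" for x using bump_props(4)[OF \<rho>, of x x0] that by (auto simp: Fz)
 have z1: "Fn z x = 1" if "dist x0 x < \<rho> / 2" for x using bump_props(5)[OF \<rho>, of x0 x] that by (simp add: Fz)
 have bz: "bs z" unfolding bs_def by (rule bsupp_ball[of x0 \<rho>]) (use z0 in force)
 obtain q m C where C0: "C >= 0" and C: "ALL v B. B >= 0 --> (ALL b<N. ALL x. Fn z x ~= 0 --> \<bar>Fn (v b) x\<bar> <= B) -->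
  (ALL d r y w x. (d, r) : rows --> length y <= m --> w : words (k - d) --> Fn z x ~= 0 --> \<bar>row_deriv w y r v x\<bar> <= B) -->
  (ALL b<N. ALL x. \<bar>Fn (z ^ q * act (yw y) (v b)) x\<bar> <= C * B)"
  using sup_estimate[OF bz, of y] by (elim exE conjE) (rule that)
 show ?thesis
 proof (rule exI[of _ m], rule exI[of _ C], intro conjI C0 allI impI)
  fix v B b x assume B: "B >= 0" "ALL b<N. ALL x. dist x0 x < \<rho> --> \<bar>Fn (v b) x\<bar> <= B"
   "ALL d r y w x. (d, r) : rows --> length y <= m --> w : words (k - d) --> dist x0 x < \<rho> --> \<bar>row_deriv w y r v x\<bar> <= B"
   and b: "b < N" and x: "dist x0 x < \<rho> / 2"
  have "\<bar>Fn (z ^ q * act (yw y) (v b)) x\<bar> <= C * B"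
   by (rule C[THEN spec, THEN spec, THEN mp, THEN mp, THEN mp, THEN spec, THEN mp, THEN spec]) (use B b z0 in simp_all)
  then show "\<bar>Fn (act (yw y) (v b)) x\<bar> <= C * B" by (simp add: z1[OF x])
 qed
qed

text \<open>Right-invariant derivatives obey the same power of 1 / s: the rows are bounded
  independently of s, and the remaining data of the estimate are suprema of the mollifications
  themselves.\<close>

lemma Y_bound:
 assumes G: "Good n \<rho>" and \<rho>: "0 < \<rho>" "\<rho> <= R / 2" and \<kappa>: "ker \<kappa>"
 shows "EX C>=0. ALL b<N. ALL s x. 0 < s --> s <= s0 --> dist x0 x < \<rho> / 2 --> \<bar>Fn (act (yw y) (Tv \<kappa> s b)) x\<bar> <= C * inverse s ^ n"
proof -
 obtain A where A0: "A >= 0" and A: "ALL b<N. ALL s x. 0 < s --> s <= s0 --> dist x0 x < \<rho> --> \<bar>Fn (Tv \<kappa> s b) x\<bar> <= A * inverse s ^ n"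
  using G \<kappa> unfolding Good_def by blast
 obtain m C where C0: "C >= 0" and C: "ALL v B. B >= 0 --> (ALL b<N. ALL x. dist x0 x < \<rho> --> \<bar>Fn (v b) x\<bar> <= B) -->
  (ALL d r y w x. (d, r) : rows --> length y <= m --> w : words (k - d) --> dist x0 x < \<rho> --> \<bar>row_deriv w y r v x\<bar> <= B) -->
  (ALL b<N. ALL x. dist x0 x < \<rho> / 2 --> \<bar>Fn (act (yw y) (v b)) x\<bar> <= C * B)"
  using estimate_on_ball[OF \<rho>(1), of y] by (elim exE conjE) (rule that)
 obtain D where D0: "D >= 0" and D: "ALL d r y w s s' x. (d, r) : rows --> length y <= m --> w : words (k - d) --> 0 < s --> s <= s0 --> 0 < s' --> s' <= s0 --> dist x0 x < R / 2 -->
  \<bar>row_deriv w y r (Tv \<kappa> s) x\<bar> <= D &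
  \<bar>row_deriv w y r (Tv \<kappa> s) x - row_deriv w y r (Tv \<kappa> s') x\<bar> <= D * \<bar>s - s'\<bar>"
  using row_bounds_uniform[OF \<kappa>, of m] by (elim exE conjE) (rule that)
 show ?thesis
 proof (rule exI[of _ "C * (A + D)"], intro conjI allI impI)
  show "0 <= C * (A + D)" using A0 C0 D0 by simp
  fix b s x assume b: "b < N" and s: "0 < s" "s <= s0" and x: "dist x0 x < \<rho> / 2"
  have i1: "1 <= inverse s ^ n" using s s0(2) by (simp add: one_le_power one_le_inverse)
  have "\<bar>Fn (act (yw y) (Tv \<kappa> s b)) x\<bar> <= C * ((A + D) * inverse s ^ n)"
  proof (rule C[THEN spec, THEN spec, THEN mp, THEN mp, THEN mp, THEN spec, THEN mp, THEN spec, THEN mp, OF _ _ _ b x])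
   show "0 <= (A + D) * inverse s ^ n" using A0 D0 s by simp
   show "ALL b<N. ALL x. dist x0 x < \<rho> --> \<bar>Fn (Tv \<kappa> s b) x\<bar> <= (A + D) * inverse s ^ n"
   proof (intro allI impI)
    fix b x assume "b < N" "dist x0 x < \<rho>"
    then have "\<bar>Fn (Tv \<kappa> s b) x\<bar> <= A * inverse s ^ n" using A s by blast
    also have "... <= (A + D) * inverse s ^ n" using D0 s by (intro mult_right_mono) auto
    finally show "\<bar>Fn (Tv \<kappa> s b) x\<bar> <= (A + D) * inverse s ^ n" .
   qed
   show "ALL d r y w x. (d, r) : rows --> length y <= m --> w : words (k - d) --> dist x0 x < \<rho> -->
    \<bar>row_deriv w y r (Tv \<kappa> s) x\<bar> <= (A + D) * inverse s ^ n"
   proof (intro allI impI)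
    fix d r y w x assume "(d, r) : rows" "length (y :: 5 list) <= m" "w : words (k - d)" "dist x0 x < \<rho>"
    then have "\<bar>row_deriv w y r (Tv \<kappa> s) x\<bar> <= D" using D s \<rho>(2) by auto
    also have "... <= (A + D) * inverse s ^ n" using mult_mono[of D "A + D" 1 "inverse s ^ n"] A0 D0 i1 by simp
    finally show "\<bar>row_deriv w y r (Tv \<kappa> s) x\<bar> <= (A + D) * inverse s ^ n" .
   qed
  qed
  then show "\<bar>Fn (act (yw y) (Tv \<kappa> s b)) x\<bar> <= C * (A + D) * inverse s ^ n" by (simp add: mult.assoc)
 qed
qed

lemma terms_ker: "ker \<kappa> ==> (e, c, j, \<kappa>') : set (terms \<kappa>) ==> ker \<kappa>'"
 by (auto simp: terms_def ker_mult)

text \<open>Every summand of the scale derivative has an explicit factor s, a nonnegative further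
  power of s, and one right-invariant derivative of a mollification with an admissible
  kernel.\<close>

lemma scale_derivative_bound:
 assumes G: "Good n \<rho>" and \<rho>: "0 < \<rho>" "\<rho> <= R / 2" and \<kappa>: "ker \<kappa>"
 shows "EX C>=0. ALL b<N. ALL s x. 0 < s --> s <= s0 --> dist x0 x < \<rho> / 2 -->
  \<bar>dTv \<kappa> b s x\<bar> <= C * (s * inverse s ^ n)"
proof -
 define Q where "Q t C \<longleftrightarrow> (ALL b<N. ALL s x. 0 < s --> s <= s0 --> dist x0 x < \<rho> / 2 -->
  \<bar>Fn (act (Yf (fst (snd (snd t)))) (Tv (snd (snd (snd t))) s b)) x\<bar> <= C * inverse s ^ n)" for t :: "nat \<times> real \<times> 5 \<times> sm" and C
 have "ALL t:set (terms \<kappa>). EX C. C >= 0 & Q t C"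
 proof
  fix t assume "t : set (terms \<kappa>)"
  then have "ker (snd (snd (snd t)))" using terms_ker[OF \<kappa>, of "fst t" "fst (snd t)" "fst (snd (snd t))" "snd (snd (snd t))"] by simp
  from Y_bound[OF G \<rho> this, of "[fst (snd (snd t))]"] show "EX C. C >= 0 & Q t C" unfolding Q_def by simp
 qed
 from bchoice[OF this] obtain C where C: "ALL t:set (terms \<kappa>). C t >= 0 & Q t (C t)" ..
 define D where "D = (SUM t<-terms \<kappa>. 2 * \<bar>fst (snd t)\<bar> * C t)"
 have D0: "D >= 0" unfolding D_def using C by (intro sum_list_nonneg) auto
 have "\<bar>dTv \<kappa> b s x\<bar> <= D * (s * inverse s ^ n)"
  if b: "b < N" and s: "0 < s" "s <= s0" and x: "dist x0 x < \<rho> / 2" for b s x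
 proof -
  let ?Y = "%t. Fn (act (Yf (fst (snd (snd t)))) (Tm (S b) (snd (snd (snd t))) s)) x"
  let ?U = "%t. (- 2 * s * fst (snd t) * s ^ fst t) * ?Y t"
  have "\<bar>dTv \<kappa> b s x\<bar>
   = \<bar>SUM t<-terms \<kappa>. ?U t\<bar>"
   unfolding scale_derivative[OF S[OF b] s(1)] case_prod_unfold by simp
  also have "... <= (SUM t<-terms \<kappa>. \<bar>?U t\<bar>)"
   using sum_list_abs[of "map ?U (terms \<kappa>)"] by (simp add: o_def)
  also have "... <= (SUM t<-terms \<kappa>. (2 * \<bar>fst (snd t)\<bar> * C t) * (s * inverse s ^ n))"
  proof (rule sum_list_mono)
   fix t assume t: "t : set (terms \<kappa>)"
   have "\<bar>?Y t\<bar> <= C t * inverse s ^ n"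
    using C t b s x unfolding Q_def by blast
   moreover have "s ^ fst t <= 1" using s s0(2) by (simp add: power_le_one)
   ultimately have "s ^ fst t * \<bar>?Y t\<bar> <= 1 * (C t * inverse s ^ n)"
    using s by (intro mult_mono) auto
   then have "(2 * s * \<bar>fst (snd t)\<bar>) * (s ^ fst t * \<bar>?Y t\<bar>) <= (2 * s * \<bar>fst (snd t)\<bar>) * (1 * (C t * inverse s ^ n))"
    using s by (intro mult_left_mono) auto
   then show "\<bar>?U t\<bar> <= (2 * \<bar>fst (snd t)\<bar> * C t) * (s * inverse s ^ n)"
    using s by (simp add: abs_mult mult_ac)
  qed
  also have "... = D * (s * inverse s ^ n)" by (simp add: D_def sum_list_mult_const)
  finally show ?thesis .
 qed
 then show ?thesis using D0 by blast
qed

lemma Tv_lipschitz: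
 assumes b: "b < N" and s: "0 < s" "0 < s'"
  and M: "!!t. t : closed_segment s s' ==> \<bar>dTv \<kappa> b t x\<bar> <= M"
 shows "\<bar>Fn (Tv \<kappa> s b) x - Fn (Tv \<kappa> s' b) x\<bar> <= M * \<bar>s - s'\<bar>"
proof -
 have "\<bar>(%p. S b (%y. Psi \<kappa> (p, y))) (s, x) - (%p. S b (%y. Psi \<kappa> (p, y))) (s', x)\<bar> <= M * \<bar>s - s'\<bar>"
 proof (rule lipschitz_in_parameter[OF mollified_smooth(1)[OF S[OF b]]])
  fix t assume t: "t : closed_segment s s'"
  then have "t > 0" using s by (auto simp: closed_segment_eq_real_ivl split: if_splits)
  then show "(t, x) : {0<..} \<times> UNIV & \<bar>dTv \<kappa> b t x\<bar> <= M" using M[OF t] by simp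
 qed
 then show ?thesis using s by (simp add: Fn_Tm[OF S[OF b]])
qed

text \<open>On the segment from s to s0 the scale derivative is at most C t t^(-(n+1)) = C t^(-n),
  hence at most C s^(-n), and the segment has length at most 1. At the fixed scale s0 the
  mollification is bounded on a compact ball.\<close>

lemma Good_step:
 assumes G: "Good (Suc n) \<rho>" and \<rho>: "0 < \<rho>" "\<rho> <= R / 2"
 shows "Good n (\<rho> / 2)"
 unfolding Good_def
proof (intro allI impI)
 fix \<kappa> assume \<kappa>: "ker \<kappa>"
 obtain C where C0: "C >= 0" and C: "ALL b<N. ALL s x. 0 < s --> s <= s0 --> dist x0 x < \<rho> / 2 -->
  \<bar>dTv \<kappa> b s x\<bar> <= C * (s * inverse s ^ Suc n)"
  using scale_derivative_bound[OF G \<rho> \<kappa>] by blast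
 have "EX A>=0. ALL b:{..<N}. ALL x:cball x0 (\<rho> / 2). \<bar>Fn (Tv \<kappa> s0 b) x\<bar> <= A"
  by (rule finite_bound[where Q = "%b A. ALL x:cball x0 (\<rho> / 2). \<bar>Fn (Tv \<kappa> s0 b) x\<bar> <= A"])
   (use smooth_bounded_on_compact[OF smooth_Fn compact_cball] in "auto intro: order_trans")
 then obtain A where A: "A >= 0" "!!b x. b < N ==> dist x0 x <= \<rho> / 2 ==> \<bar>Fn (Tv \<kappa> s0 b) x\<bar> <= A" by auto
 show "EX C>=0. ALL b<N. ALL s x. 0 < s --> s <= s0 --> dist x0 x < \<rho> / 2 --> \<bar>Fn (Tv \<kappa> s b) x\<bar> <= C * inverse s ^ n"
 proof (rule exI[of _ "A + C"], intro conjI allI impI)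
  show "0 <= A + C" using A(1) C0 by simp
  fix b s x assume b: "b < N" and s: "0 < s" "s <= s0" and x: "dist x0 x < \<rho> / 2"
  have "\<bar>Fn (Tv \<kappa> s b) x - Fn (Tv \<kappa> s0 b) x\<bar> <= (C * inverse s ^ n) * \<bar>s - s0\<bar>"
  proof (rule Tv_lipschitz[OF b s(1) s0(1)])
   fix t assume "t : closed_segment s s0"
   then have t: "s <= t" "t <= s0" using s by (auto simp: closed_segment_eq_real_ivl)
   then have "\<bar>dTv \<kappa> b t x\<bar> <= C * (t * inverse t ^ Suc n)"
    using C b x s by auto
   also have "t * inverse t ^ Suc n = inverse t ^ n" using t s by simp
   also have "C * inverse t ^ n <= C * inverse s ^ n" using t s C0 by (intro mult_left_mono power_mono) auto
   finally show "\<bar>dTv \<kappa> b t x\<bar> <= C * inverse s ^ n" .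
  qed
  also have "... <= (C * inverse s ^ n) * 1" using s s0(2) C0 by (intro mult_left_mono) auto
  finally have 1: "\<bar>Fn (Tv \<kappa> s b) x - Fn (Tv \<kappa> s0 b) x\<bar> <= C * inverse s ^ n" by simp
  have "1 <= inverse s ^ n" using s s0(2) by (simp add: one_le_power one_le_inverse)
  then have "A * 1 <= A * inverse s ^ n" using A(1) by (intro mult_left_mono) auto
  moreover have "\<bar>Fn (Tv \<kappa> s0 b) x\<bar> <= A" using A(2)[OF b] x by simp
  ultimately show "\<bar>Fn (Tv \<kappa> s b) x\<bar> <= (A + C) * inverse s ^ n" using 1 by (simp add: algebra_simps)
 qed
qed

lemma Good_start: "EX n. Good n (R / 2)"
proof -
 have "ALL b:{..<N}. EX n. ALL \<kappa>. bs \<kappa> --> (EX C>=0. ALL s x. 0 < s --> s <= 1 --> x : cball x0 (R / 2) --> \<bar>Fn (Tm (S b) \<kappa> s) x\<bar> <= C * inverse s ^ n)"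
  using Tm_growth[OF S compact_cball] by blast
 from bchoice[OF this] obtain n where n: "ALL b:{..<N}. ALL \<kappa>. bs \<kappa> --> (EX C>=0. ALL s x. 0 < s --> s <= 1 --> x : cball x0 (R / 2) -->
  \<bar>Fn (Tm (S b) \<kappa> s) x\<bar> <= C * inverse s ^ n b)" ..
 define M where "M = (SUM b<N. n b)"
 have "Good M (R / 2)" unfolding Good_def
 proof (intro allI impI)
  fix \<kappa> assume k: "ker \<kappa>"
  define Q where "Q b C \<longleftrightarrow> (ALL s x. 0 < s --> s <= s0 --> dist x0 x < R / 2 --> \<bar>Fn (Tv \<kappa> s b) x\<bar> <= C * inverse s ^ M)" for b C
  have "EX C>=0. ALL b:{..<N}. Q b C"
  proof (rule finite_bound)
   fix b assume b: "b : {..<N}"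
   obtain C where C0: "C >= 0" and C: "ALL s x. 0 < s --> s <= 1 --> x : cball x0 (R / 2) --> \<bar>Fn (Tm (S b) \<kappa> s) x\<bar> <= C * inverse s ^ n b"
    using n[THEN bspec, OF b, THEN spec, THEN mp, OF ker_bs[OF k]] by (elim exE conjE) (rule that)
   have "n b <= M" unfolding M_def using b by (intro member_le_sum) auto
   then have i: "C * inverse s ^ n b <= C * inverse s ^ M" if "0 < s" "s <= s0" for s
    using that s0(2) C0 by (intro mult_left_mono power_increasing) (auto simp: one_le_inverse)
   have "Q b C" unfolding Q_def
   proof (intro allI impI)
    fix s x assume h: "0 < s" "s <= s0" "dist x0 x < R / 2"
    have "\<bar>Fn (Tv \<kappa> s b) x\<bar> <= C * inverse s ^ n b" using C h s0(2) by simp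
    then show "\<bar>Fn (Tv \<kappa> s b) x\<bar> <= C * inverse s ^ M" using i[OF h(1,2)] by linarith
   qed
   then show "EX C>=0. Q b C" using C0 by blast
  next
   fix b C C' assume Q: "Q b C" and c: "C <= (C' :: real)"
   show "Q b C'" unfolding Q_def
   proof (intro allI impI)
    fix s x assume h: "0 < s" "s <= s0" "dist x0 x < R / 2"
    have "C * inverse s ^ M <= C' * inverse s ^ M" using c h by (intro mult_right_mono) auto
    then show "\<bar>Fn (Tv \<kappa> s b) x\<bar> <= C' * inverse s ^ M" using Q[unfolded Q_def, rule_format, OF h] by linarith
   qed
  qed simp
  then show "EX C>=0. ALL b<N. ALL s x. 0 < s --> s <= s0 --> dist x0 x < R / 2 --> \<bar>Fn (Tv \<kappa> s b) x\<bar> <= C * inverse s ^ M"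
   unfolding Q_def by blast
 qed
 then show ?thesis ..
qed

lemma Good_zero: "EX \<rho>>0. \<rho> <= R / 2 & Good 0 \<rho>"
proof -
 have "Good n \<rho> ==> 0 < \<rho> ==> \<rho> <= R / 2 ==> EX \<rho>>0. \<rho> <= R / 2 & Good 0 \<rho>" for n \<rho>
 proof (induction n arbitrary: \<rho>)
  case (Suc n)
  then show ?case using Good_step[OF Suc.prems] by simp
 qed auto
 then show ?thesis using Good_start R by force
qed

text \<open>Once the mollifications are bounded, their scale derivatives are too, so they are
  Lipschitz in s; so are the rows. By linearity the local estimate applies to the difference of two
  mollifications and passes this on to right-invariant derivatives.\<close>

lemma Y_lipschitz:
 assumes G: "Good 0 \<rho>" and \<rho>: "0 < \<rho>" "\<rho> <= R / 2" and \<kappa>: "ker \<kappa>"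
 shows "EX C>=0. ALL b<N. ALL s s' x. 0 < s --> s <= s0 --> 0 < s' --> s' <= s0 --> dist x0 x < \<rho> / 4 -->
  \<bar>Fn (act (yw y) (Tv \<kappa> s b)) x - Fn (act (yw y) (Tv \<kappa> s' b)) x\<bar> <= C * \<bar>s - s'\<bar>"
proof -
 obtain A where A0: "A >= 0" and A: "ALL b<N. ALL s x. 0 < s --> s <= s0 --> dist x0 x < \<rho> / 2 -->
  \<bar>dTv \<kappa> b s x\<bar> <= A * (s * inverse s ^ 0)"
  using scale_derivative_bound[OF G \<rho> \<kappa>] by blast
 obtain m C where C0: "C >= 0" and C: "ALL v B. B >= 0 --> (ALL b<N. ALL x. dist x0 x < \<rho> / 2 --> \<bar>Fn (v b) x\<bar> <= B) -->
  (ALL d r y w x. (d, r) : rows --> length y <= m --> w : words (k - d) --> dist x0 x < \<rho> / 2 --> \<bar>row_deriv w y r v x\<bar> <= B) -->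
  (ALL b<N. ALL x. dist x0 x < \<rho> / 2 / 2 --> \<bar>Fn (act (yw y) (v b)) x\<bar> <= C * B)"
  using estimate_on_ball[OF half_gt_zero[OF \<rho>(1)], of y] by (elim exE conjE) (rule that)
 obtain D where D0: "D >= 0" and D: "ALL d r y w s s' x. (d, r) : rows --> length y <= m --> w : words (k - d) --> 0 < s --> s <= s0 --> 0 < s' --> s' <= s0 --> dist x0 x < R / 2 -->
  \<bar>row_deriv w y r (Tv \<kappa> s) x\<bar> <= D &
  \<bar>row_deriv w y r (Tv \<kappa> s) x - row_deriv w y r (Tv \<kappa> s') x\<bar> <= D * \<bar>s - s'\<bar>"
  using row_bounds_uniform[OF \<kappa>, of m] by (elim exE conjE) (rule that)
 show ?thesis
 proof (rule exI[of _ "C * (A + D)"], intro conjI allI impI)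
  show "0 <= C * (A + D)" using A0 C0 D0 by simp
  fix b s s' x assume b: "b < N" and s: "0 < s" "s <= s0" "0 < s'" "s' <= s0" and x: "dist x0 x < \<rho> / 4"
  have x': "dist x0 x < \<rho> / 2 / 2" using x by simp
  define v where "v b = Tv \<kappa> s b - Tv \<kappa> s' b" for b
  have "\<bar>Fn (act (yw y) (v b)) x\<bar> <= C * ((A + D) * \<bar>s - s'\<bar>)"
  proof (rule C[THEN spec, THEN spec, THEN mp, THEN mp, THEN mp, THEN spec, THEN mp, THEN spec, THEN mp, OF _ _ _ b x'])
   show "0 <= (A + D) * \<bar>s - s'\<bar>" using A0 D0 by simp
   show "ALL b<N. ALL x. dist x0 x < \<rho> / 2 --> \<bar>Fn (v b) x\<bar> <= (A + D) * \<bar>s - s'\<bar>"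
   proof (intro allI impI)
    fix b x assume b: "b < N" and x: "dist x0 x < \<rho> / 2"
    have "\<bar>Fn (Tv \<kappa> s b) x - Fn (Tv \<kappa> s' b) x\<bar> <= A * \<bar>s - s'\<bar>"
    proof (rule Tv_lipschitz[OF b s(1,3)])
     fix t assume "t : closed_segment s s'"
     then have t: "0 < t" "t <= s0" using s by (auto simp: closed_segment_eq_real_ivl split: if_splits)
     then have "\<bar>dTv \<kappa> b t x\<bar> <= A * (t * inverse t ^ 0)"
      using A b x by blast
     also have "... <= A * 1" using A0 t s0(2) by (intro mult_left_mono) auto
     finally show "\<bar>dTv \<kappa> b t x\<bar> <= A" by simp
    qed
    also have "... <= (A + D) * \<bar>s - s'\<bar>" using D0 by (intro mult_right_mono) auto
    finally show "\<bar>Fn (v b) x\<bar> <= (A + D) * \<bar>s - s'\<bar>" by (simp add: v_def)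
   qed
   show "ALL d r y w x. (d, r) : rows --> length y <= m --> w : words (k - d) --> dist x0 x < \<rho> / 2 -->
    \<bar>row_deriv w y r v x\<bar> <= (A + D) * \<bar>s - s'\<bar>"
   proof (intro allI impI)
    fix d r y w x assume "(d, r) : rows" "length (y :: 5 list) <= m" "w : words (k - d)" "dist x0 x < \<rho> / 2"
    then have "\<bar>row_deriv w y r (Tv \<kappa> s) x - row_deriv w y r (Tv \<kappa> s') x\<bar> <= D * \<bar>s - s'\<bar>"
     using D s \<rho> by auto
    also have "... <= (A + D) * \<bar>s - s'\<bar>" using A0 by (intro mult_right_mono) auto
    finally show "\<bar>row_deriv w y r v x\<bar> <= (A + D) * \<bar>s - s'\<bar>"
     unfolding v_def rowact_diff by simp
   qed
  qed
  then show "\<bar>Fn (act (yw y) (Tv \<kappa> s b)) x - Fn (act (yw y) (Tv \<kappa> s' b)) x\<bar> <= C * (A + D) * \<bar>s - s'\<bar>" by (simp add: v_def mult.assoc)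
 qed
qed

end

section \<open>From distributions to smooth functions\<close>

lemma Cauchy_uniform_limit:
 fixes f :: "nat => 'a => real"
 assumes C: "C >= 0" and f: "!!m n x. x : U ==> \<bar>f n x - f m x\<bar> <= C * \<bar>\<sigma> n - \<sigma> m\<bar>" and \<sigma>: "\<sigma> \<longlonglongrightarrow> (0::real)" and x: "x : U"
 shows "(%n. f n x) \<longlonglongrightarrow> lim (%n. f n x)" "\<bar>f n x - lim (%n. f n x)\<bar> <= C * \<bar>\<sigma> n\<bar>"
proof -
 have cs: "Cauchy \<sigma>" using \<sigma> by (rule LIMSEQ_imp_Cauchy)
 have "Cauchy (%n. f n x)"
 proof (rule metric_CauchyI)
  fix e :: real assume e: "e > 0"
  then have "e / (C + 1) > 0" using C by simp
  then obtain M where M: "!!m n. m >= M ==> n >= M ==> dist (\<sigma> m) (\<sigma> n) < e / (C + 1)"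
   using metric_CauchyD[OF cs] by blast
  have "dist (f m x) (f n x) < e" if "m >= M" "n >= M" for m n
  proof -
   have "dist (f m x) (f n x) <= C * dist (\<sigma> m) (\<sigma> n)" using f[OF x] by (simp add: dist_real_def)
   also have "... <= C * (e / (C + 1))" using M[OF that] C by (intro mult_left_mono) auto
   also have "... < e" using C e by (simp add: field_simps)
   finally show ?thesis .
  qed
  then show "EX M. ALL m>=M. ALL n>=M. dist (f m x) (f n x) < e" by blast
 qed
 then show l: "(%n. f n x) \<longlonglongrightarrow> lim (%n. f n x)" using Cauchy_convergent convergent_LIMSEQ_iff by blast
 have "(%m. \<bar>f n x - f m x\<bar>) \<longlonglongrightarrow> \<bar>f n x - lim (%n. f n x)\<bar>" by (intro tendsto_intros l)
 moreover have "(%m. C * \<bar>\<sigma> n - \<sigma> m\<bar>) \<longlonglongrightarrow> C * \<bar>\<sigma> n - 0\<bar>" by (intro tendsto_intros \<sigma>)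
 ultimately show "\<bar>f n x - lim (%n. f n x)\<bar> <= C * \<bar>\<sigma> n\<bar>" using f[OF x] by (auto intro: LIMSEQ_le)
qed

text \<open>Coordinate derivatives are combinations of right-invariant ones with smooth
  coefficients. So the limits \<open>g y\<close>, indexed by words, form a family closed under
  differentiation, and uniform convergence of the derivatives identifies those of the
  limits.\<close>

lemma smooth_limit:
 assumes U: "U = ball x0 \<tau>" "\<tau> > 0" and \<sigma>: "\<sigma> \<longlonglongrightarrow> 0"
  and C: "!!y. EX C>=0. ALL m n. ALL x:U. \<bar>Fn (act (yw y) (u n)) x - Fn (act (yw y) (u m)) x\<bar> <= C * \<bar>\<sigma> n - \<sigma> m\<bar>"
 shows "smooth_on U (%x. lim (%n. Fn (u n) x))"
proof -
 define f where "f y n = Fn (act (yw y) (u n))" for y n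
 obtain C where C0: "!!y. C y >= 0" and C: "!!y m n x. x : U ==> \<bar>f y n x - f y m x\<bar> <= C y * \<bar>\<sigma> n - \<sigma> m\<bar>"
  using C unfolding f_def by metis
 define g where "g y x = lim (%n. f y n x)" for y x
 have lim: "(%n. f y n x) \<longlonglongrightarrow> g y x" "\<bar>f y n x - g y x\<bar> <= C y * \<bar>\<sigma> n\<bar>" if "x : U" for y n x
  unfolding g_def using Cauchy_uniform_limit[OF C0 C \<sigma> that] by auto
 obtain c where c: "!!i. Pd i = (SUM l:UNIV. mu (c i l) * Yf l)" using Pd_Yf by metis
 define L where "L G x h = (SUM i:UNIV. h $ i * (SUM l:UNIV. Fn (c i l) x * G l x))" for G :: "5 => real^5 => real" and x h
 have df: "(f y n has_derivative L (%l. f (l # y) n) x) (at x)" for y n x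
 proof -
  have "fder (f y n) x h = L (%l. f (l # y) n) x h" for h
  proof -
   have "Fn (dr i (act (yw y) (u n))) x = (SUM l:UNIV. Fn (c i l) x * f (l # y) n x)" for i
    by (simp only: act_Pd[symmetric]) (simp add: c f_def)
   then show ?thesis unfolding L_def f_def FD_sum UNIV_5 by (simp add: f_def)
  qed
  then have "fder (f y n) x = L (%l. f (l # y) n) x" by auto
  then show ?thesis using has_derivative_Fn[of "act (yw y) (u n)" x] unfolding f_def by simp
 qed
 obtain A where A: "A >= 0" "!!i l x. x : U ==> \<bar>Fn (c i l) x\<bar> <= A"
 proof -
  have "EX A>=0. ALL p:(UNIV :: (5 \<times> 5) set). ALL x:U. \<bar>Fn (c (fst p) (snd p)) x\<bar> <= A"
  proof (rule finite_bound[where Q = "%p A. ALL x:U. \<bar>Fn (c (fst p) (snd p)) x\<bar> <= A"])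
   fix p :: "5 \<times> 5"
   obtain A where "A >= 0" "ALL x:cball x0 \<tau>. \<bar>Fn (c (fst p) (snd p)) x\<bar> <= A" using smooth_bounded_on_compact[OF smooth_Fn compact_cball] by blast
   then show "EX A>=0. ALL x:U. \<bar>Fn (c (fst p) (snd p)) x\<bar> <= A" by (intro exI[of _ A]) (auto simp: U)
  qed (auto intro: order_trans)
  then show thesis using that by auto
 qed
 have dg: "(g y has_derivative L (%l. g (l # y)) x) (at x)" if x: "x : U" for y x
 proof -
  define E where "E = (SUM i:(UNIV :: 5 set). SUM l:UNIV. A * C (l # y))"
  have E0: "E >= 0" unfolding E_def using A C0 by (intro sum_nonneg) auto
  have est: "norm (L (%l. f (l # y) n) x h - L (%l. g (l # y)) x h) <= (E * \<bar>\<sigma> n\<bar>) * norm h" if x: "x : U" for n x h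
  proof -
   have "L (%l. f (l # y) n) x h - L (%l. g (l # y)) x h = (SUM i:UNIV. h $ i * (SUM l:UNIV. Fn (c i l) x * (f (l # y) n x - g (l # y) x)))"
    by (simp add: L_def sum_subtractf right_diff_distrib)
   also have "\<bar>...\<bar> <= (SUM i:(UNIV :: 5 set). norm h * (SUM l:UNIV. A * (C (l # y) * \<bar>\<sigma> n\<bar>)))"
   proof (rule order_trans[OF sum_abs], rule sum_mono)
    fix i :: 5
    have "\<bar>SUM l:UNIV. Fn (c i l) x * (f (l # y) n x - g (l # y) x)\<bar> <= (SUM l:UNIV. A * (C (l # y) * \<bar>\<sigma> n\<bar>))"
     by (rule order_trans[OF sum_abs], rule sum_mono) (use A lim(2) x in "auto simp: abs_mult intro!: mult_mono")
    then show "\<bar>h $ i * (SUM l:UNIV. Fn (c i l) x * (f (l # y) n x - g (l # y) x))\<bar> <= norm h * (SUM l:UNIV. A * (C (l # y) * \<bar>\<sigma> n\<bar>))"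
     unfolding abs_mult by (intro mult_mono component_le_norm_cart) auto
   qed
   also have "... = (E * \<bar>\<sigma> n\<bar>) * norm h" by (simp add: E_def sum_distrib_left sum_distrib_right mult_ac)
   finally show ?thesis by simp
  qed
  have "EX g'. ALL x:U. (%n. f y n x) \<longlonglongrightarrow> g' x & (g' has_derivative L (%l. g (l # y)) x) (at x within U)"
  proof (rule has_derivative_sequence)
   show "convex U" by (simp add: U)
   show "(f y n has_derivative L (%l. f (l # y) n) x) (at x within U)" for n x using df by (rule has_derivative_at_withinI)
   fix e :: real assume e: "e > 0"
   have "(%n. E * \<bar>\<sigma> n\<bar>) \<longlonglongrightarrow> E * \<bar>0\<bar>" by (intro tendsto_intros \<sigma>)
   then have "\<forall>\<^sub>F n in sequentially. E * \<bar>\<sigma> n\<bar> < e" using e by (intro order_tendstoD) auto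
   then show "\<forall>\<^sub>F n in sequentially. ALL x:U. ALL h. norm (L (%l. f (l # y) n) x h - L (%l. g (l # y)) x h) <= e * norm h"
   proof (rule eventually_mono)
    fix n assume n: "E * \<bar>\<sigma> n\<bar> < e"
    show "ALL x:U. ALL h. norm (L (%l. f (l # y) n) x h - L (%l. g (l # y)) x h) <= e * norm h"
    proof (intro ballI allI)
     fix x h assume "x : U"
     then have "norm (L (%l. f (l # y) n) x h - L (%l. g (l # y)) x h) <= (E * \<bar>\<sigma> n\<bar>) * norm h" by (rule est)
     also have "... <= e * norm h" using n by (intro mult_right_mono) auto
     finally show "norm (L (%l. f (l # y) n) x h - L (%l. g (l # y)) x h) <= e * norm h" .
    qed
   qed
  qed (rule x, rule lim(1)[OF x])
  then obtain g' where g': "!!x. x : U ==> (%n. f y n x) \<longlonglongrightarrow> g' x" "!!x. x : U ==> (g' has_derivative L (%l. g (l # y)) x) (at x within U)"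
   by blast
  have oU: "open U" by (simp add: U)
  have "(g' has_derivative L (%l. g (l # y)) x) (at x)" using g'(2)[OF x] at_within_open[OF x oU] by simp
  then show ?thesis
   by (rule has_derivative_transform_within_open[OF _ oU x]) (use LIMSEQ_unique[OF g'(1) lim(1)] in auto)
 qed
 have oU: "open U" by (simp add: U)
 have "diffn n U (g y)" for n y
 proof (induction n arbitrary: y)
  case 0
  then show ?case using dg by (auto simp: differentiable_def)
 next
  case (Suc n)
  have "diffn n U (%x. fder (g y) x b)" for b
  proof (rule diffn_cong[OF oU])
   have "diffn n U (Fn (c i l))" for i l using smooth_on_subset[OF smooth_Fn, of U] by (simp add: smooth_on_iff_diffn)
   then show "diffn n U (%x. SUM i:UNIV. b $ i * (SUM l:UNIV. Fn (c i l) x * g (l # y) x))"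
    by (intro diffn_sum diffn_mult oU diffn_const Suc.IH)
  qed (simp add: fder_eqI[OF dg] L_def)
  then show ?case using dg by (auto simp: differentiable_def)
 qed
 then have "smooth_on U (g [])" by (simp add: smooth_on_iff_diffn)
 then show ?thesis by (simp add: g_def[abs_def] f_def)
qed

section \<open>Convergence of the mollifications\<close>

context mollified
begin

text \<open>Moves the mollification to the test function: the integral is taken inside
  \<open>S\<close>, and then x is replaced by \<open>gmul (s^2 *R h) y\<close>.\<close>

lemma mollified_pairing:
 assumes b: "b < N" and \<kappa>: "ker \<kappa>" and \<phi>: "smooth \<phi>" "bsupp \<phi>" and s: "s > 0"
 shows "(LINT x|lborel. \<phi> x * Fn (Tv \<kappa> s b) x) = S b (%y. LINT h|lborel. Fn \<kappa> h * \<phi> (gmul (s^2 *R h) y))"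
proof -
 define \<Phi> where "\<Phi> z = \<phi> (fst z) * Psi \<kappa> ((s, fst z), snd z)" for z
 have s\<Phi>: "smooth \<Phi>"
 proof -
  have c: "smooth (%z :: (real^5) \<times> (real^5). fst z \<bullet> c)" "smooth (%z :: (real^5) \<times> (real^5). snd z \<bullet> c)" for c
   by (intro smooth_on_bounded_linear bounded_linear_inner_left_comp bounded_linear_fst bounded_linear_snd)+
  have "smooth (%z :: (real^5) \<times> (real^5). ((s, fst z), snd z) \<bullet> i)" if "i : Basis" for i
   using that by (intro smooth_on_Pair_components) (auto intro!: smooth_on_Pair_components c)
  then have "smooth (%z :: (real^5) \<times> (real^5). Psi \<kappa> ((s, fst z), snd z))"
   by (intro smooth_on_compose[OF open_UNIV open_dom(1) _ _ smooth_Psi]) (use s in auto)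
  moreover have "smooth (%z :: (real^5) \<times> (real^5). \<phi> (fst z))"
   by (rule smooth_on_compose[OF open_UNIV open_UNIV _ _ \<phi>(1)]) (use c in auto)
  ultimately show ?thesis unfolding \<Phi>_def by (intro smooth_mult)
 qed
 obtain r where r: "!!x. r < norm x ==> \<phi> x = 0" using \<phi>(2) by (auto simp: bsupp_def)
 have "(LINT x|lborel. \<phi> x * Fn (Tv \<kappa> s b) x) = (LINT x|lborel. S b (%y. \<Phi> (x, y)))"
  using cdistr_cmult[OF S[OF b] Psi_slice[OF s]] by (simp add: Fn_Tm[OF S[OF b] s] \<Phi>_def)
 also have "... = S b (%y. LINT x|lborel. \<Phi> (x, y))"
  by (rule cdistr_integral_swap[OF S[OF b] s\<Phi>, symmetric]) (use r in "auto simp: \<Phi>_def")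
 also have "(%y. LINT x|lborel. \<Phi> (x, y)) = (%y. LINT h|lborel. Fn \<kappa> h * \<phi> (gmul (s^2 *R h) y))"
 proof
  fix y
  have sm: "smooth (%x. \<Phi> (x, y))" by (rule slice1(2)[OF s\<Phi>])
  have "(LINT x|lborel. \<Phi> (x, y)) = (LINT h|lborel. \<Phi> (gmul h y, y))"
   by (rule integral_gmul[OF sm, symmetric]) (use r in "auto simp: \<Phi>_def intro!: bsuppI[of r]")
  also have "... = s ^ 10 * (LINT h|lborel. \<Phi> (gmul (s^2 *R h) y, y))"
  proof (rule integral_scaled[OF s smooth_on_continuous_on])
   have "smooth (%h. gmul h y $ i)" for i
    by (rule smooth_on_vec_components(1)[OF open_UNIV]) (auto intro: smooth_coordinate)
   then show "smooth (%h. \<Phi> (gmul h y, y))"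
    by (intro smooth_on_compose[OF open_UNIV open_UNIV _ _ sm]) (auto intro: smooth_vecI)
  qed
  also have "... = (LINT h|lborel. Fn \<kappa> h * \<phi> (gmul (s^2 *R h) y))"
  proof -
   have c: "s ^ 10 * (inverse (s ^ 10) * X) = X" for X using s by simp
   show ?thesis using s
    by (subst Bochner_Integration.integral_mult_right_zero[symmetric]) (simp add: \<Phi>_def Psi_def group_cancel c mult_ac)
  qed
  finally show "(LINT x|lborel. \<Phi> (x, y)) = (LINT h|lborel. Fn \<kappa> h * \<phi> (gmul (s^2 *R h) y))" .
 qed
 finally show ?thesis .
qed

theorem locally_smooth:
 assumes b: "b < N"
 shows "smooth_near (S b) x0"
proof -
 obtain \<rho> where \<rho>: "\<rho> > 0" "\<rho> <= R / 2" and G: "Good 0 \<rho>" using Good_zero by blast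
 define \<tau> where "\<tau> = \<rho> / 4"
 have \<tau>: "\<tau> > 0" using \<rho> by (simp add: \<tau>_def)
 define \<kappa> where "\<kappa> = Sm (bump (0 :: real^5) 1)"
 have F\<kappa>: "Fn \<kappa> = bump 0 1" by (simp add: \<kappa>_def smooth_on_bump)
 have \<kappa>: "ker \<kappa>" unfolding ker_def F\<kappa> using bump_props(4)[of 1, where ?x0.0 = "0 :: real^5"] by auto
 \<comment> \<open>The mass of the kernel, which is not normalized: the mollifications tend to c
   times the functional, and c is divided out at the end.\<close>
 define c where "c = (LINT h|lborel. Fn \<kappa> h)"
 have c: "c ~= 0"
 proof
  assume "c = 0"
  then have "Fn \<kappa> 0 = 0"
   unfolding c_def using ker_bs[OF \<kappa>] by (intro integral_zero_imp_zero[OF cont_Fn]) (auto simp: bs_def F\<kappa> bump_props)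
  then show False using bump_props(3)[of 1 "0 :: real^5" 0] by (simp add: F\<kappa>)
 qed
 define \<sigma> where "\<sigma> n = s0 * inverse (real (Suc n))" for n
 have \<sigma>: "0 < \<sigma> n" "\<sigma> n <= s0" for n using s0 by (auto simp: \<sigma>_def field_simps)
 have \<sigma>0: "\<sigma> \<longlonglongrightarrow> 0" unfolding \<sigma>_def using tendsto_mult_right_zero[OF LIMSEQ_inverse_real_of_nat] .
 have L: "EX C>=0. ALL m n. ALL x:ball x0 \<tau>. \<bar>Fn (act (yw y) (Tv \<kappa> (\<sigma> n) b)) x - Fn (act (yw y) (Tv \<kappa> (\<sigma> m) b)) x\<bar> <= C * \<bar>\<sigma> n - \<sigma> m\<bar>" for y
 proof -
  obtain C where C0: "C >= 0" and C: "ALL b<N. ALL s s' x. 0 < s --> s <= s0 --> 0 < s' --> s' <= s0 --> dist x0 x < \<rho> / 4 -->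
   \<bar>Fn (act (yw y) (Tv \<kappa> s b)) x - Fn (act (yw y) (Tv \<kappa> s' b)) x\<bar> <= C * \<bar>s - s'\<bar>"
   using Y_lipschitz[OF G \<rho> \<kappa>, of y] by (elim exE conjE) (rule that)
  show ?thesis by (rule exI[of _ C], intro conjI C0 allI ballI, rule C[rule_format, OF b \<sigma> \<sigma>]) (simp add: \<tau>_def)
 qed
 define g where "g x = lim (%n. Fn (Tv \<kappa> (\<sigma> n) b) x)" for x
 have sg: "smooth_on (ball x0 \<tau>) g" unfolding g_def by (rule smooth_limit[OF refl \<tau> \<sigma>0 L])
 obtain C where C0: "C >= 0" and C: "!!m n x. x : ball x0 \<tau> ==> \<bar>Fn (Tv \<kappa> (\<sigma> n) b) x - Fn (Tv \<kappa> (\<sigma> m) b) x\<bar> <= C * \<bar>\<sigma> n - \<sigma> m\<bar>"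
  using L[of "[]"] by auto
 have lim: "\<bar>Fn (Tv \<kappa> (\<sigma> n) b) x - g x\<bar> <= C * \<bar>\<sigma> n\<bar>" if "x : ball x0 \<tau>" for n x
  unfolding g_def by (rule Cauchy_uniform_limit(2)[OF C0 C \<sigma>0 that])
 \<comment> \<open>A globally smooth function is required, while the limit is smooth only on the
   ball; the two agree on the ball of radius \<open>\<tau> / 4\<close>.\<close>
 define g' where "g' x = bump x0 (\<tau> / 2) x * g x" for x
 have t2: "\<tau> / 2 > 0" using \<tau> by simp
 have sg': "smooth g'"
 proof (rule smooth_zero_extension[OF open_ball _ closed_cball[of x0 "\<tau> / 2"]])
  show "smooth_on (ball x0 \<tau>) g'" unfolding g'_def
   by (intro smooth_on_mult open_ball sg smooth_on_subset[OF smooth_on_bump]) auto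
 qed (use \<tau> in "auto simp: g'_def bump_props(4)[OF t2]")
 have eq: "g' x = g x" if "x : ball x0 (\<tau> / 4)" for x
  using bump_props(5)[OF t2, of x0 x] that by (simp add: g'_def)
 have "c * S b \<phi> = (LINT x|lborel. g' x * \<phi> x)" if \<phi>: "smooth \<phi>" "!!y. y ~: ball x0 (\<tau> / 4) ==> \<phi> y = 0" for \<phi>
 proof -
  have b\<phi>: "bsupp \<phi>" by (rule bsupp_ball[OF \<phi>(2)])
  have int: "integrable lborel (%x. \<phi> x * u x)" if "smooth u" for u
   by (intro integrable_bsupp smooth_on_continuous_on smooth_mult \<phi> that bsupp_mult1 b\<phi>)
  \<comment> \<open>The transposed mollification of the test function. It is smooth across scale 0,
    where it equals c times the test function, so continuity of \<open>S\<close> applied to it gives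
    the limit.\<close>
  define H where "H p = (LINT h|lborel. Fn \<kappa> h * \<phi> (gmul (fst p ^ 2 *R h) (snd p)))" for p :: "real \<times> (real^5)"
  have sH: "smooth H"
   using smooth_average[OF \<kappa>, of gmul "Sm \<phi>"] \<phi>(1) by (simp add: H_def[abs_def])
  have "smooth (%s. S b (%y. H (s, y)))"
   using cdistr_smooth(1)[OF S[OF b] open_UNIV, of H] sH by simp
  then have "isCont (%s. S b (%y. H (s, y))) 0" by (rule smooth_on_isCont) simp
  then have "(%n. S b (%y. H (\<sigma> n, y))) \<longlonglongrightarrow> S b (%y. H (0, y))" using \<sigma>0 by (rule isCont_tendsto_compose)
  moreover have "S b (%y. H (0, y)) = c * S b \<phi>"
   using cdistr_cmult[OF S[OF b] \<phi>(1), of c] by (simp add: H_def c_def group_cancel)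
  moreover have "S b (%y. H (\<sigma> n, y)) = (LINT x|lborel. \<phi> x * Fn (Tv \<kappa> (\<sigma> n) b) x)" for n
   using mollified_pairing[OF b \<kappa> \<phi>(1) b\<phi> \<sigma>(1)] by (simp add: H_def)
  ultimately have l1: "(%n. LINT x|lborel. \<phi> x * Fn (Tv \<kappa> (\<sigma> n) b) x) \<longlonglongrightarrow> c * S b \<phi>" by simp
  define P where "P = (LINT x|lborel. \<bar>\<phi> x\<bar>)"
  have iP: "integrable lborel (%x. \<bar>\<phi> x\<bar>)" using integrable_bsupp[OF smooth_on_continuous_on[OF \<phi>(1)] b\<phi>] by (rule integrable_abs)
  have est: "\<bar>(LINT x|lborel. \<phi> x * Fn (Tv \<kappa> (\<sigma> n) b) x) - (LINT x|lborel. \<phi> x * g' x)\<bar> <= C * \<bar>\<sigma> n\<bar> * P" for n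
  proof -
   have "(LINT x|lborel. \<phi> x * Fn (Tv \<kappa> (\<sigma> n) b) x) - (LINT x|lborel. \<phi> x * g' x) = (LINT x|lborel. \<phi> x * Fn (Tv \<kappa> (\<sigma> n) b) x - \<phi> x * g' x)"
    using int[OF smooth_Fn] int[OF sg'] by simp
   also have "\<bar>...\<bar> <= (LINT x|lborel. C * \<bar>\<sigma> n\<bar> * \<bar>\<phi> x\<bar>)"
   proof (rule order_trans[OF integral_abs_bound integral_mono])
    show "integrable lborel (%x. \<bar>\<phi> x * Fn (Tv \<kappa> (\<sigma> n) b) x - \<phi> x * g' x\<bar>)"
     using int[OF smooth_Fn] int[OF sg'] by (intro integrable_abs Bochner_Integration.integrable_diff)
    show "integrable lborel (%x. C * \<bar>\<sigma> n\<bar> * \<bar>\<phi> x\<bar>)" using iP by simp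
    fix x
    show "\<bar>\<phi> x * Fn (Tv \<kappa> (\<sigma> n) b) x - \<phi> x * g' x\<bar> <= C * \<bar>\<sigma> n\<bar> * \<bar>\<phi> x\<bar>"
    proof (cases "x : ball x0 (\<tau> / 4)")
     case True
     then have "\<bar>Fn (Tv \<kappa> (\<sigma> n) b) x - g' x\<bar> <= C * \<bar>\<sigma> n\<bar>" using lim[of x n] eq[OF True] \<tau> by simp
     from mult_left_mono[OF this, of "\<bar>\<phi> x\<bar>"]
     have "\<bar>\<phi> x * (Fn (Tv \<kappa> (\<sigma> n) b) x - g' x)\<bar> <= \<bar>\<phi> x\<bar> * (C * \<bar>\<sigma> n\<bar>)" by (simp add: abs_mult)
     then show ?thesis by (simp only: right_diff_distrib mult.commute)
    qed (simp add: \<phi>(2))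
   qed
   finally show ?thesis by (simp add: P_def)
  qed
  have "(%n. C * \<bar>\<sigma> n\<bar> * P) \<longlonglongrightarrow> C * \<bar>0\<bar> * P" by (intro tendsto_intros \<sigma>0)
  then have l2: "(%n. C * \<bar>\<sigma> n\<bar> * P) \<longlonglongrightarrow> 0" by simp
  have "(%n. (LINT x|lborel. \<phi> x * Fn (Tv \<kappa> (\<sigma> n) b) x) - (LINT x|lborel. \<phi> x * g' x)) \<longlonglongrightarrow> 0"
   by (rule Lim_null_comparison[OF always_eventually l2]) (simp only: real_norm_def est simp_thms)
  then have "(%n. LINT x|lborel. \<phi> x * Fn (Tv \<kappa> (\<sigma> n) b) x) \<longlonglongrightarrow> (LINT x|lborel. \<phi> x * g' x)" by (simp add: LIM_zero_iff)
  from LIMSEQ_unique[OF l1 this] show ?thesis by (simp add: mult.commute)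
 qed
 then have "S b \<phi> = (LINT x|lborel. (1 / c * g' x) * \<phi> x)" if "smooth \<phi>" "!!y. y ~: ball x0 (\<tau> / 4) ==> \<phi> y = 0" for \<phi>
  using that c by (simp add: field_simps)
 moreover have "smooth (%x. 1 / c * g' x)" by (intro smooth_cmult sg')
 ultimately show ?thesis using \<tau> by (intro exI[of _ "\<tau> / 4"]) auto
qed

end

section \<open>Localization and gluing of distributions\<close>

definition vanish :: "real^5 => real => sm => bool" where
 "vanish x \<rho> \<phi> \<longleftrightarrow> (ALL y. y ~: ball x \<rho> --> Fn \<phi> y = 0)"

lemma vanish_mono: "vanish x \<rho> \<phi> ==> \<rho> <= \<rho>' ==> vanish x \<rho>' \<phi>"
 by (auto simp: vanish_def)

lemma vanish_bs: "vanish x \<rho> \<phi> ==> bs \<phi>"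
 unfolding bs_def vanish_def by (rule bsupp_ball) blast

lemma vanish_act:
 assumes "vanish x \<rho> \<phi>" shows "y ~: cball x \<rho> ==> Fn (act D \<phi>) y = 0" "\<rho> < \<rho>' ==> vanish x \<rho>' (act D \<phi>)"
proof -
 show 1: "Fn (act D \<phi>) y = 0" if "y ~: cball x \<rho>" for y
  by (rule act_zero_on[of "- cball x \<rho>"]) (use assms that in "auto simp: vanish_def")
 show "\<rho> < \<rho>' ==> vanish x \<rho>' (act D \<phi>)" using 1 by (auto simp: vanish_def)
qed

lemma test_functionsI:
 assumes "smooth \<phi>" "!!y. y ~: K ==> \<phi> y = 0" "compact K" "K <= \<Omega>"
 shows "\<phi> : test_functions \<Omega>"
proof -
 have "supp \<phi> <= K" unfolding supp_def using assms(2) by (intro closure_minimal compact_imp_closed assms(3)) auto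
 moreover from this have "K \<inter> supp \<phi> = supp \<phi>" by blast
 then have "compact (supp \<phi>)" using compact_Int_closed[OF assms(3), of "supp \<phi>"] by (simp add: supp_def)
 ultimately show ?thesis using assms(1,4) by (simp add: test_functions_def)
qed

lemma test_functionsD:
 fixes \<phi> :: "'a::euclidean_space => real"
 assumes "\<phi> : test_functions \<Omega>"
 shows "smooth \<phi>" "compact (supp \<phi>)" "supp \<phi> <= \<Omega>" "y ~: supp \<phi> ==> \<phi> y = 0" "bsupp \<phi>"
proof -
 show 1: "smooth \<phi>" "compact (supp \<phi>)" "supp \<phi> <= \<Omega>" using assms by (auto simp: test_functions_def)
 show 2: "y ~: supp \<phi> ==> \<phi> y = 0" for y
  using subsetD[OF closure_subset[of "{x. \<phi> x ~= 0}"], of y] unfolding supp_def by auto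
 obtain r where r: "ALL y:supp \<phi>. norm y <= r" using compact_imp_bounded[OF 1(2)] unfolding bounded_iff ..
 show "bsupp \<phi>"
 proof (rule bsuppI)
  fix y :: 'a assume "r < norm y"
  then have "y ~: supp \<phi>" using r by auto
  then show "\<phi> y = 0" by (rule 2)
 qed
qed

lemma test_functions_vanish:
 assumes "vanish x \<rho> \<phi>" "cball x \<rho> <= \<Omega>" shows "Fn (act D \<phi>) : test_functions \<Omega>"
 by (rule test_functionsI[OF smooth_Fn vanish_act(1)[OF assms(1)] compact_cball assms(2)])

lemma iter_deriv_zero_outside:
 assumes "open U" "!!x. x : U ==> f x = 0" "x : U" shows "iter_deriv vs f x = 0"
 using assms(3)
proof (induction vs arbitrary: x)
 case (Cons v vs)
 then show ?case using fder_zero_outside[OF assms(1), of "iter_deriv vs f" x v] by simp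
qed (simp add: assms(2))

text \<open>Multiplication by a test function extends the distribution to all smooth functions. The
  supremum norms in \<open>C_norm\<close> are dominated by derivatives on the support of that test
  function, outside of which all derivatives of the product vanish.\<close>

lemma distribution_cdistr:
 fixes T :: "'a::euclidean_space functional"
 assumes T: "distribution_on \<Omega> T" and \<kappa>: "\<kappa> : test_functions \<Omega>"
 shows "cdistr (%\<phi>. T (%x. \<kappa> x * \<phi> x))"
proof -
 note \<kappa>D = test_functionsD[OF \<kappa>]
 have mem: "(%x. \<kappa> x * \<phi> x) : test_functions \<Omega>" if "smooth \<phi>" for \<phi>
  by (rule test_functionsI[OF smooth_mult[OF \<kappa>D(1) that] _ \<kappa>D(2,3)]) (simp add: \<kappa>D(4))
 have lin: "T (%x. \<phi> x + \<psi> x) = T \<phi> + T \<psi>" "T (%x. c * \<phi> x) = c * T \<phi>" if "\<phi> : test_functions \<Omega>" "\<psi> : test_functions \<Omega>" for \<phi> \<psi> c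
  using T that unfolding distribution_on_def by auto
 obtain C N where C: "ALL \<phi>:test_functions \<Omega>. supp \<phi> <= supp \<kappa> --> \<bar>T \<phi>\<bar> <= C * C_norm N \<phi>"
  using T \<kappa>D(2,3) unfolding distribution_on_def by blast
 let ?L = "{vs. vs : lists (Basis :: 'a set) & length vs <= N}"
 \<comment> \<open>The point 0 makes the compact set nonempty, so that every admissible bound is
   nonnegative.\<close>
 define K where "K = insert 0 (supp \<kappa>)"
 have K: "compact K" using \<kappa>D(2) by (simp add: K_def)
 obtain D where "D >= 0 & (ALL \<phi> B. smooth \<phi> --> deriv_bound N K \<phi> B -->
  deriv_bound N K (%x. \<kappa> x * \<phi> x) (D * B))"
  using iter_deriv_mult_bound_le[OF K \<kappa>D(1), of N] ..
 then have D: "D >= 0" and D2: "ALL \<phi> B. smooth \<phi> --> deriv_bound N K \<phi> B -->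
  deriv_bound N K (%x. \<kappa> x * \<phi> x) (D * B)" by (rule conjunct1, rule conjunct2)
 have bd: "\<bar>T (%x. \<kappa> x * \<phi> x)\<bar> <= (\<bar>C\<bar> * (card ?L * D)) * B"
  if \<phi>: "smooth \<phi>" and B: "deriv_bound N K \<phi> B" for \<phi> :: "'a => real" and B
 proof -
  have B0: "B >= 0" using B[rule_format, of "[]" 0] by (simp add: K_def)
  have le: "\<bar>iter_deriv vs (%x. \<kappa> x * \<phi> x) x\<bar> <= D * B" if vs: "vs : ?L" for vs x
  proof (cases "x : supp \<kappa>")
   case True
   then show ?thesis using D2[THEN spec, THEN spec, THEN mp, THEN mp, OF \<phi> B] vs by (simp add: K_def)
  next
   case False
   have "iter_deriv vs (%x. \<kappa> x * \<phi> x) x = 0"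
    by (rule iter_deriv_zero_outside[of "- supp \<kappa>"]) (use False \<kappa>D(2,4) in "auto intro: compact_imp_closed")
   then show ?thesis using D B0 by simp
  qed
  have sub: "supp (%x. \<kappa> x * \<phi> x) <= supp \<kappa>" unfolding supp_def by (rule closure_mono) auto
  have nn: "0 <= C_norm N (%x. \<kappa> x * \<phi> x)" unfolding C_norm_def
  proof (rule sum_nonneg)
   fix vs assume vs: "vs : ?L"
   have "bdd_above (range (%x. \<bar>iter_deriv vs (%x. \<kappa> x * \<phi> x) x\<bar>))" using le[OF vs] by (intro bdd_aboveI2[where M = "D * B"])
   from cSUP_upper[OF UNIV_I this, of 0] show "0 <= (SUP x. \<bar>iter_deriv vs (%x. \<kappa> x * \<phi> x) x\<bar>)" by linarith
  qed
  have "\<bar>T (%x. \<kappa> x * \<phi> x)\<bar> <= C * C_norm N (%x. \<kappa> x * \<phi> x)" using C mem[OF \<phi>] sub by blast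
  also have "... <= \<bar>C\<bar> * C_norm N (%x. \<kappa> x * \<phi> x)" using nn by (intro mult_right_mono) auto
  also have "... <= \<bar>C\<bar> * (SUM vs:?L. D * B)"
   unfolding C_norm_def using le by (intro mult_left_mono sum_mono cSUP_least) auto
  finally show ?thesis by (simp add: mult.assoc)
 qed
 have "EX K N C. compact K & 0 <= C & (ALL \<phi> B. smooth \<phi> -->
   deriv_bound N K \<phi> B --> \<bar>T (%x. \<kappa> x * \<phi> x)\<bar> <= C * B)"
  by (rule exI[of _ K], rule exI[of _ N], rule exI[of _ "\<bar>C\<bar> * (card ?L * D)"], intro conjI K allI impI bd) (use D in auto)
 then show ?thesis unfolding cdistr_def using lin(1) lin(2)[OF mem mem] mem
  by (simp add: distrib_left mult.left_commute)
qed

text \<open>Gluing: the error functional \<open>\<phi> \<mapsto> T \<phi> - \<integral> g \<phi>\<close> does not change when \<open>\<phi>\<close> is multiplied by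
  \<open>\<Prod> (1 - b\<^sub>i)\<close>, and finitely many bump functions \<open>b\<^sub>i\<close> make this product vanish on the support of \<open>\<phi>\<close>.\<close>

lemma smooth_distribution_glue:
 fixes T :: "'a::euclidean_space functional"
 assumes oS: "open \<Omega>" and T: "distribution_on \<Omega> T"
  and loc: "!!x. x : \<Omega> ==> smooth_near T x"
 shows "smooth_distribution_on \<Omega> T"
proof -
 define Q where "Q x \<rho> g \<longleftrightarrow> \<rho> > 0 & smooth g & (ALL \<phi>. smooth \<phi> --> (ALL y. y ~: ball x \<rho> --> \<phi> y = 0) --> T \<phi> = (LINT x|lborel. g x * \<phi> x))" for x \<rho> g
 have "ALL x:\<Omega>. EX p. Q x (fst p) (snd p)" using loc unfolding Q_def by force
 from bchoice[OF this] obtain p where p: "ALL x:\<Omega>. Q x (fst (p x)) (snd (p x))" ..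
 define \<rho> where "\<rho> x = fst (p x)" for x
 define G where "G x = snd (p x)" for x
 have \<rho>: "\<rho> x > 0" and sG: "smooth (G x)" if "x : \<Omega>" for x
  using p that by (auto simp: Q_def \<rho>_def G_def)
 have TG: "T \<phi> = (LINT y|lborel. G x y * \<phi> y)" if "x : \<Omega>" "smooth \<phi>" "!!y. y ~: ball x (\<rho> x) ==> \<phi> y = 0" for x \<phi>
  using p that by (auto simp: Q_def \<rho>_def G_def)
 \<comment> \<open>The value at x of the local density centred at x. By uniqueness it agrees with
   each local density on its ball within the open set.\<close>
 define g where "g x = G x x" for x
 have gG: "g y = G x y" if x: "x : \<Omega>" and y: "y : \<Omega>" "y : ball x (\<rho> x)" for x y
 proof -
  have "open (ball x (\<rho> x) \<inter> ball y (\<rho> y))" "y : ball x (\<rho> x) \<inter> ball y (\<rho> y)" using y \<rho>[OF y(1)] by auto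
  then obtain r where r: "r > 0" "ball y r <= ball x (\<rho> x) \<inter> ball y (\<rho> y)" unfolding open_contains_ball by blast
  show ?thesis unfolding g_def
  proof (rule smooth_unique[OF sG[OF y(1)] sG[OF x] r(1)])
   fix \<phi> :: "'a => real" assume \<phi>: "smooth \<phi>" "!!z. z ~: ball y r ==> \<phi> z = 0"
   have z: "\<phi> z = 0" if "z ~: ball x (\<rho> x) \<or> z ~: ball y (\<rho> y)" for z
    using that r(2) by (intro \<phi>(2)) blast
   have "T \<phi> = (LINT z|lborel. G y z * \<phi> z)" using z by (intro TG[OF y(1) \<phi>(1)]) blast
   moreover have "T \<phi> = (LINT z|lborel. G x z * \<phi> z)" using z by (intro TG[OF x \<phi>(1)]) blast
   ultimately show "(LINT z|lborel. G y z * \<phi> z) = (LINT z|lborel. G x z * \<phi> z)" by simp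
  qed
 qed
 have sg: "smooth_on \<Omega> g"
 proof (rule smooth_on_Union)
  fix x assume x: "x : \<Omega>"
  have "smooth_on (\<Omega> \<inter> ball x (\<rho> x)) g"
   by (rule smooth_on_cong[of _ "G x"]) (use oS gG[OF x] smooth_on_subset[OF sG[OF x]] in auto)
  then show "EX U. x : U & smooth_on U g" using x \<rho>[OF x] by (intro exI[of _ "\<Omega> \<inter> ball x (\<rho> x)"]) auto
 qed
 have lin: "T (%x. \<phi> x + \<psi> x) = T \<phi> + T \<psi>" "T (%x. c * \<phi> x) = c * T \<phi>" if "\<phi> : test_functions \<Omega>" "\<psi> : test_functions \<Omega>" for \<phi> \<psi> c
  using T that unfolding distribution_on_def by auto
 define g0 where "g0 x = indicator \<Omega> x * g x" for x
 define E where "E \<phi> = T \<phi> - (LINT x|lborel. g0 x * \<phi> x)" for \<phi>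
 have int: "integrable lborel (%x. g0 x * \<phi> x)" if "\<phi> : test_functions \<Omega>" for \<phi>
 proof (rule integrable_bsupp[OF _ bsupp_mult2[OF test_functionsD(5)[OF that]]])
  note \<phi>D = test_functionsD[OF that]
  have "smooth_on \<Omega> (%x. g0 x * \<phi> x)"
   by (rule smooth_on_cong[OF oS, of "%x. g x * \<phi> x"]) (auto simp: g0_def intro!: smooth_on_mult oS sg smooth_on_subset[OF \<phi>D(1)])
  then show "continuous_on UNIV (%x. g0 x * \<phi> x)"
   by (intro smooth_on_continuous_on smooth_zero_extension[OF oS, of _ "supp \<phi>"]) (use \<phi>D(2-4) in "auto intro: compact_imp_closed")
 qed
 have E_diff: "E (%x. \<phi> x - \<psi> x) = E \<phi> - E \<psi>" if "\<phi> : test_functions \<Omega>" "\<psi> : test_functions \<Omega>" for \<phi> \<psi>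
 proof -
  have m: "(%x. - 1 * \<psi> x) : test_functions \<Omega>"
   using test_functionsD[OF that(2)] by (intro test_functionsI[of _ "supp \<psi>"] smooth_on_cmult) auto
  have "T (%x. \<phi> x - \<psi> x) = T \<phi> - T \<psi>" using lin(1)[OF that(1) m] lin(2)[OF that(2,2), of "-1"] by simp
  moreover have "(LINT x|lborel. g0 x * (\<phi> x - \<psi> x)) = (LINT x|lborel. g0 x * \<phi> x) - (LINT x|lborel. g0 x * \<psi> x)"
   using int[OF that(1)] int[OF that(2)] by (simp add: right_diff_distrib)
  ultimately show ?thesis by (simp add: E_def)
 qed
 have E0: "E \<phi> = 0" if x: "x : \<Omega>" and \<phi>: "\<phi> : test_functions \<Omega>" "!!y. y ~: ball x (\<rho> x) ==> \<phi> y = 0" for x \<phi>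
 proof -
  have "g0 y * \<phi> y = G x y * \<phi> y" for y
  proof (cases "y : \<Omega> \<inter> ball x (\<rho> x)")
   case True
   then show ?thesis using gG[OF x, of y] by (simp add: g0_def)
  next
   case False
   then have "\<phi> y = 0" using \<phi>(2)[of y] test_functionsD(3,4)[OF \<phi>(1)] by auto
   then show ?thesis by simp
  qed
  then have "(%y. g0 y * \<phi> y) = (%y. G x y * \<phi> y)" by (rule ext)
  moreover have "T \<phi> = (LINT y|lborel. G x y * \<phi> y)" by (rule TG[OF x test_functionsD(1)[OF \<phi>(1)] \<phi>(2)])
  ultimately show ?thesis by (simp add: E_def)
 qed
 have "T \<phi> = (LINT x:\<Omega>|lborel. g x * \<phi> x)" if \<phi>: "\<phi> : test_functions \<Omega>" for \<phi>
 proof -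
  note \<phi>D = test_functionsD[OF \<phi>]
  have "supp \<phi> <= (\<Union>x\<in>supp \<phi>. ball x (\<rho> x / 2))" using \<phi>D(3) \<rho> by force
  then obtain I where I: "I <= supp \<phi>" "finite I" "supp \<phi> <= (\<Union>x\<in>I. ball x (\<rho> x / 2))"
   using compactE_image[OF \<phi>D(2), of "supp \<phi>" "%x. ball x (\<rho> x / 2)"] by auto
  define w where "w J y = \<phi> y * (\<Prod>x\<in>J. 1 - bump x (\<rho> x) y)" for J y
  have w: "w J : test_functions \<Omega>" for J
   unfolding w_def
   by (rule test_functionsI[OF smooth_mult[OF \<phi>D(1) smooth_on_prod[OF open_UNIV smooth_diff]] _ \<phi>D(2,3)])
    (auto simp: \<phi>D(4) smooth_on_bump)
  have "E (w J) = E \<phi>" if "finite J" "J <= \<Omega>" for J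
   using that
  proof (induction J rule: finite_induct)
   case empty
   show ?case by (simp add: w_def[abs_def])
  next
   case (insert x J)
   have b: "(%y. w J y * bump x (\<rho> x) y) : test_functions \<Omega>"
    using test_functionsD[OF w[of J]] by (intro test_functionsI[of _ "supp (w J)"] smooth_on_mult smooth_on_bump) auto
   have "w (insert x J) = (%y. w J y - w J y * bump x (\<rho> x) y)" using insert.hyps by (auto simp: w_def algebra_simps)
   then have "E (w (insert x J)) = E (w J) - E (%y. w J y * bump x (\<rho> x) y)" using E_diff[OF w b] by simp
   moreover have "E (%y. w J y * bump x (\<rho> x) y) = 0"
    using insert.prems \<rho> by (intro E0[of x] b) (auto simp: bump_props(4))
   ultimately show ?case using insert by simp
  qed
  then have "E \<phi> = E (w I)" using I(1,2) \<phi>D(3) by simp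
  also have "w I = (%y. 0)"
  proof
   fix y
   show "w I y = 0"
   proof (cases "y : supp \<phi>")
    case True
    then obtain x where x: "x : I" "y : ball x (\<rho> x / 2)" using I(3) by blast
    then have "bump x (\<rho> x) y = 1" using I(1) \<phi>D(3) \<rho> by (intro bump_props(5)) auto
    then show ?thesis using x(1) I(2) by (auto simp: w_def)
   qed (simp add: w_def \<phi>D(4))
  qed
  also have "E (%y. 0) = 0"
   using lin(2)[OF \<phi> \<phi>, of 0] by (simp add: E_def)
  finally show ?thesis by (simp add: E_def g0_def set_lebesgue_integral_def mult.assoc)
 qed
 then show ?thesis using sg unfolding smooth_distribution_on_def by blast
qed

text \<open>The operators generated by the left-invariant fields. For these, unlike for arbitrary
  members of \<open>dop\<close>, the continuity property \<open>op_closed\<close> is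
  available.\<close>

definition alg :: "dop set" where "alg = range opd"

lemma alg_simps [simp]: "0 : alg" "1 : alg" "P : alg ==> Q : alg ==> P + Q : alg" "P : alg ==> - P : alg"
 "P : alg ==> Q : alg ==> P - Q : alg" "P : alg ==> Q : alg ==> P * Q : alg" "P : alg ==> c *R P : alg" "Xf i : alg"
 "P : alg ==> dual P : alg" "opd D : alg"
proof -
 show 1: "0 : alg" "1 : alg" "P : alg ==> Q : alg ==> P + Q : alg" "P : alg ==> - P : alg" for P Q
  unfolding alg_def by (auto simp flip: opd.simps)
 show "P : alg ==> Q : alg ==> P - Q : alg" using 1(3)[of P "- Q"] 1(4)[of Q] by simp
 show "P : alg ==> Q : alg ==> P * Q : alg" "P : alg ==> c *R P : alg" "Xf i : alg" "P : alg ==> dual P : alg" "opd D : alg"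
  unfolding alg_def by (auto simp flip: opd.simps opd_adj)
qed

lemma alg_sum [simp]: "(!!i. i : I ==> P i : alg) ==> (SUM i:I. P i) : alg"
 by (induction I rule: infinite_finite_induct) auto

lemma Hom_alg: "P : Hom n ==> P : alg"
proof (rule Hom_induct[where Q = "%P. P : alg"])
 show "wd w : alg" for w by (induction w) auto
qed (auto simp: subspace_def)

lemma op_closed_alg: "D : alg ==> op_closed D"
proof -
 have s: "op_closed (c *R D)" if "op_closed D" for c D
 proof -
  have "c *R D = mu (c *R 1) * D" by (simp add: mu_ring)
  then show ?thesis using op_closed_mult[OF op_closed_mu that] by metis
 qed
 have "op_closed (opd E)" for E
 proof (induction E)
  case Null
  then show ?case using op_closed_mu[of 0] by (simp add: mu_ring)
 next
  case Ident
  then show ?case using op_closed_mu[of 1] by (simp add: mu_ring)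
 next
  case (Neg E)
  then show ?case using s[of "opd E" "-1"] by simp
 qed (auto simp: op_closed_Xf op_closed_add op_closed_mult s)
 then show "D : alg ==> op_closed D" by (auto simp: alg_def)
qed

lemma cdistr_finite_sum:
 "finite I ==> (!!i. i : I ==> cdistr (S i)) ==> cdistr (%\<phi>. SUM i:I. S i \<phi>)"
proof (induction I rule: finite_induct)
 case empty
 show ?case unfolding cdistr_def by (auto intro!: exI[of _ "{}"] exI[of _ 0])
qed (simp add: cdistr_plus)

text \<open>Uniform continuity of the left quotient near h = 0: if the quotient h of x and y is
  short, then \<open>y = ldiv h x\<close> lies within R / 2 of x, hence inside the ball of radius R.
  Squaring the scale only shrinks h, as s is at most 1.\<close>

lemma mollifier_support:
 assumes R: "R > 0"
 shows "EX s0. 0 < s0 & s0 <= 1 & (ALL s x y. 0 < s --> s <= s0 --> dist x0 x <= R / 2 --> y ~: ball x0 R --> 1 <= norm (inverse (s^2) *R gdiv x y))"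
proof -
 define f where "f z = ldiv (fst z) (snd z)" for z
 have sc: "smooth (%z. f z $ i)" for i
  unfolding f_def by (intro smooth_on_vec_components open_UNIV smooth_nth bounded_linear_fst bounded_linear_snd)
 have "continuous_on UNIV (%z. SUM b:Basis. (f z \<bullet> b) *R b)"
  by (intro continuous_intros smooth_on_continuous_on smooth_vecI sc)
 then have cf: "continuous_on UNIV f" by (simp only: euclidean_representation)
 have "uniformly_continuous_on (cball 0 1 \<times> cball x0 (R / 2)) f"
  by (intro compact_uniformly_continuous compact_Times compact_cball continuous_on_subset[OF cf]) auto
 then obtain d where d: "d > 0" "!!z z'. z : cball 0 1 \<times> cball x0 (R / 2) ==> z' : cball 0 1 \<times> cball x0 (R / 2) ==> dist z' z < d ==> dist (f z') (f z) < R / 2"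
  using R unfolding uniformly_continuous_on_def by (metis half_gt_zero)
 define s0 where "s0 = min 1 (d / 2)"
 have s0: "0 < s0" "s0 <= 1" "s0 < d" using d(1) by (auto simp: s0_def)
 have "1 <= norm (inverse (s^2) *R gdiv x y)" if s: "0 < s" "s <= s0" and x: "dist x0 x <= R / 2" and y: "y ~: ball x0 R" for s x y
 proof (rule ccontr)
  define h where "h = gdiv x y"
  assume "\<not> 1 <= norm (inverse (s^2) *R gdiv x y)"
  then have "inverse (s^2) * norm h < 1" by (simp add: h_def)
  then have "norm h < s^2" using s(1) by (simp add: field_simps)
  also have "s^2 <= s * 1" unfolding power2_eq_square using s s0 by (intro mult_left_mono) auto
  finally have h: "norm h < s0" using s by simp
  have "dist (f (h, x)) (f (0, x)) < R / 2" using h s0 x by (intro d(2)) (auto simp: dist_Pair_Pair)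
  then have "dist y x < R / 2" by (simp add: f_def h_def group_cancel)
  then have "dist x0 y < R" using x dist_triangle[of x0 y x] by (simp add: dist_commute)
  then show False using y by simp
 qed
 then show ?thesis using s0 by blast
qed

section \<open>Operator combinations of the components of a distribution\<close>

locale distributions =
 fixes \<Omega> :: "(real^5) set" and u :: "nat => (real^5) functional" and N :: nat
 assumes open_dom: "open \<Omega>" and distr: "j < N ==> distribution_on \<Omega> (u j)"
begin

definition L :: "(nat => dop) => sm => real" where "L p \<phi> = (SUM j<N. u j (Fn (act (dual (p j)) \<phi>)))"

text \<open>\<open>L p\<close> is the distribution \<open>\<Sum>j<N. p j (u j)\<close>, and \<open>lsm p\<close> says that it is locally a smooth function.\<close>

abbreviation lsm_at :: "(nat => dop) => real^5 => bool" where
 "lsm_at p x \<equiv> EX \<rho>>0. EX g. cball x \<rho> <= \<Omega> & (ALL \<phi>. vanish x \<rho> \<phi> --> L p \<phi> = ip g \<phi>)"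

definition lsm :: "(nat => dop) => bool" where
 "lsm p \<longleftrightarrow> (ALL j<N. p j : alg) & (ALL x:\<Omega>. lsm_at p x)"

lemma lsmD: "lsm p ==> x : \<Omega> ==> lsm_at p x"
 by (simp add: lsm_def)

lemma u_linear:
 assumes "j < N" "Fn f : test_functions \<Omega>" "Fn g : test_functions \<Omega>"
 shows "u j (Fn (f + g)) = u j (Fn f) + u j (Fn g)" "u j (Fn (c *R f)) = c * u j (Fn f)" "u j (Fn 0) = 0"
proof -
 show 1: "u j (Fn (f + g)) = u j (Fn f) + u j (Fn g)" "u j (Fn (c *R f)) = c * u j (Fn f)" for c
  using distr[OF assms(1)] assms(2,3) by (simp_all add: distribution_on_def plus_sm.rep_eq scaleR_sm.rep_eq)
 show "u j (Fn 0) = 0" using 1(2)[of 0] by simp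
qed

lemma L_add:
 assumes "vanish x \<rho> \<phi>" "cball x \<rho> <= \<Omega>" shows "L (%j. p j + q j) \<phi> = L p \<phi> + L q \<phi>"
 using test_functions_vanish[OF assms] by (simp add: L_def u_linear(1) sum.distrib del: Fn_simps)

lemma L_mult: "L (%j. D * p j) \<phi> = L p (act (dual D) \<phi>)" by (simp add: L_def)

lemma lsm_add:
 assumes "lsm p" "lsm q" shows "lsm (%j. p j + q j)"
 unfolding lsm_def
proof (intro conjI ballI allI impI)
 fix x assume x: "x : \<Omega>"
 obtain \<rho> g where p: "\<rho> > 0" "cball x \<rho> <= \<Omega>" "!!\<phi>. vanish x \<rho> \<phi> ==> L p \<phi> = ip g \<phi>" using lsmD[OF assms(1) x] by blast
 obtain \<rho>' g' where q: "\<rho>' > 0" "cball x \<rho>' <= \<Omega>" "!!\<phi>. vanish x \<rho>' \<phi> ==> L q \<phi> = ip g' \<phi>" using lsmD[OF assms(2) x] by blast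
 define r where "r = min \<rho> \<rho>'"
 have sub: "cball x r <= \<Omega>" using p(2) by (auto simp: r_def)
 have "L (%j. p j + q j) \<phi> = ip (g + g') \<phi>" if v: "vanish x r \<phi>" for \<phi>
  using p(3)[of \<phi>] q(3)[of \<phi>] vanish_mono[OF v, of \<rho>] vanish_mono[OF v, of \<rho>'] vanish_bs[OF v] L_add[OF v sub]
  by (simp add: r_def ip_add_left)
 then show "lsm_at (%j. p j + q j) x"
  using p(1) q(1) sub by (intro exI[of _ r] conjI exI[of _ "g + g'"]) (auto simp: r_def)
qed (use assms in "auto simp: lsm_def")

lemma lsm_mult:
 assumes D: "D : alg" and p: "lsm p" shows "lsm (%j. D * p j)"
 unfolding lsm_def
proof (intro conjI ballI allI impI)
 fix x assume x: "x : \<Omega>"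
 obtain \<rho> g where p: "\<rho> > 0" "cball x \<rho> <= \<Omega>" "!!\<phi>. vanish x \<rho> \<phi> ==> L p \<phi> = ip g \<phi>" using lsmD[OF p x] by blast
 have "L (%j. D * p j) \<phi> = ip (act D g) \<phi>" if v: "vanish x (\<rho> / 2) \<phi>" for \<phi>
 proof -
  have "L (%j. D * p j) \<phi> = ip g (act (dual D) \<phi>)"
   unfolding L_mult using p(1) by (intro p(3) vanish_act(2)[OF v]) simp
  also have "... = ip (act D g) \<phi>" using ip_act[of g \<phi> "dual D"] vanish_bs[OF v] by simp
  finally show ?thesis .
 qed
 moreover have "cball x (\<rho> / 2) <= \<Omega>" using p(1,2) by (auto simp: subset_eq)
 ultimately show "lsm_at (%j. D * p j) x"
  using p(1) by (intro exI[of _ "\<rho> / 2"] conjI exI[of _ "act D g"]) auto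
qed (use assms in "auto simp: lsm_def")

lemma lsm_scale: "lsm p ==> lsm (%j. c *R p j)"
 using lsm_mult[of "c *R 1" p] by simp

lemma lsm_minus: "lsm p ==> lsm (%j. - p j)"
 using lsm_scale[of p "-1"] by simp

lemma lsm_diff: "lsm p ==> lsm q ==> lsm (%j. p j - q j)"
 using lsm_add[OF _ lsm_minus, of p q] by simp

lemma lsm_zero: "lsm (%j. 0)"
 unfolding lsm_def
proof (intro conjI ballI allI impI)
 fix x assume x: "x : \<Omega>"
 obtain \<rho> where \<rho>: "\<rho> > 0" "cball x \<rho> <= \<Omega>" using open_dom x open_contains_cball by blast
 have "L (%j. 0) \<phi> = ip 0 \<phi>" if "vanish x \<rho> \<phi>" for \<phi>
  using u_linear(3)[OF _ test_functions_vanish[OF that \<rho>(2)] test_functions_vanish[OF that \<rho>(2)]] by (simp add: L_def)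
 then show "lsm_at (%j. 0) x" using \<rho> by blast
qed simp

lemma lsm_sum: "finite I ==> (!!i. i : I ==> lsm (p i)) ==> lsm (%j. SUM i:I. p i j)"
 by (induction I rule: finite_induct) (auto simp: lsm_zero lsm_add)

lemma lsmI_smooth_distribution:
 assumes "!!j. j < N ==> p j : alg" "smooth_distribution_on \<Omega> V" "!!\<phi>. Fn \<phi> : test_functions \<Omega> ==> V (Fn \<phi>) = L p \<phi>"
 shows "lsm p"
 unfolding lsm_def
proof (intro conjI ballI allI impI)
 fix x assume x: "x : \<Omega>"
 obtain f where f: "smooth_on \<Omega> f" "!!\<phi>. \<phi> : test_functions \<Omega> ==> V \<phi> = (LINT x:\<Omega>|lborel. f x * \<phi> x)"
  using assms(2) unfolding smooth_distribution_on_def by blast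
 obtain r where r: "r > 0" "cball x r <= \<Omega>" using open_dom x open_contains_cball by blast
 define g where "g y = bump x r y * f y" for y
 have sg: "smooth g"
 proof (rule smooth_zero_extension[OF open_dom _ closed_cball r(2)])
  show "smooth_on \<Omega> g" unfolding g_def by (intro smooth_on_mult open_dom f smooth_on_subset[OF smooth_on_bump]) auto
 qed (auto simp: g_def bump_props(4)[OF r(1)])
 have sub: "cball x (r / 2) <= \<Omega>" using r by (auto simp: subset_eq)
 have "L p \<phi> = ip (Sm g) \<phi>" if v: "vanish x (r / 2) \<phi>" for \<phi>
 proof -
  have t: "Fn \<phi> : test_functions \<Omega>" using test_functions_vanish[OF v sub, of 1] by simp
  have "L p \<phi> = (LINT y:\<Omega>|lborel. f y * Fn \<phi> y)" using assms(3)[OF t] f(2)[OF t] by simp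
  also have "... = (LINT y|lborel. g y * Fn \<phi> y)"
   unfolding set_lebesgue_integral_def
  proof (rule Bochner_Integration.integral_cong[OF refl])
   fix y
   show "indicator \<Omega> y *R (f y * Fn \<phi> y) = g y * Fn \<phi> y"
   proof (cases "y : ball x (r / 2)")
    case True
    then have "y : \<Omega>" "bump x r y = 1" using sub bump_props(5)[OF r(1), of x y] by (auto simp: subset_eq)
    then show ?thesis by (simp add: g_def)
   qed (use v in "simp add: vanish_def")
  qed
  finally show ?thesis using sg by (simp add: ip_def)
 qed
 then show "lsm_at p x"
  using r(1) sub by (intro exI[of _ "r / 2"] conjI exI[of _ "Sm g"]) auto
qed (rule assms(1))

lemma smooth_distribution_lsm:
 assumes b: "b < N" and l: "lsm (%j. if j = b then 1 else 0)"
 shows "smooth_distribution_on \<Omega> (u b)"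
proof (rule smooth_distribution_glue[OF open_dom distr[OF b]])
 fix x assume x: "x : \<Omega>"
 obtain \<rho> g where p: "\<rho> > 0" "cball x \<rho> <= \<Omega>" "!!\<phi>. vanish x \<rho> \<phi> ==> L (%j. if j = b then 1 else 0) \<phi> = ip g \<phi>" using lsmD[OF l x] by blast
 have "u b \<phi> = (LINT x|lborel. Fn g x * \<phi> x)" if \<phi>: "smooth \<phi>" "!!y. y ~: ball x \<rho> ==> \<phi> y = 0" for \<phi>
 proof -
  have v: "vanish x \<rho> (Sm \<phi>)" using \<phi> by (simp add: vanish_def)
  have t: "Fn (Sm \<phi>) : test_functions \<Omega>" using test_functions_vanish[OF v p(2), of 1] by simp
  have "L (%j. if j = b then 1 else 0) (Sm \<phi>) = (SUM j<N. if j = b then u b \<phi> else 0)"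
   unfolding L_def by (intro sum.cong refl) (use u_linear(3)[OF _ t t] \<phi>(1) in auto)
  also have "... = u b \<phi>" using b by simp
  finally show ?thesis using p(3)[OF v] \<phi>(1) by (simp add: ip_def)
 qed
 then show "smooth_near (u b) x"
  using p(1) by (intro exI[of _ \<rho>] conjI exI[of _ "Fn g"]) auto
qed

text \<open>The inner cutoff localizes the argument; the outer one, equal to 1 on the support of the
  inner, turns \<open>u j\<close> into a functional of compact support without changing the
  value.\<close>

lemma cdistr_cutoff:
 assumes "j < N" "D : alg" "e > 0" "cball x (4 * e) <= \<Omega>"
 shows "cdistr (%\<phi>. u j (Fn (act D (Sm (bump x (2 * e)) * Sm \<phi>))))"
proof -
 have e: "2 * e > 0" "4 * e > 0" using assms(3) by auto
 define b where "b = bump x (4 * e)"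
 have "b : test_functions \<Omega>"
  by (rule test_functionsI[OF _ _ compact_cball assms(4)]) (auto simp: b_def smooth_on_bump bump_props(4)[OF e(2)])
 from distribution_cdistr[OF distr[OF assms(1)] this]
 have 1: "cdistr (%\<phi>. u j (%y. b y * \<phi> y))" .
 have "op_closed (D * mu (Sm (bump x (2 * e))))" using op_closed_mult[OF op_closed_alg[OF assms(2)] op_closed_mu] .
 then have "cdistr (%\<phi>. u j (%y. b y * Fn (act (D * mu (Sm (bump x (2 * e)))) (Sm \<phi>)) y))"
  using 1 unfolding op_closed_def by blast
 then show ?thesis
 proof (rule cdistr_cong[rotated])
  fix \<phi> :: "real^5 => real"
  have v: "vanish x (2 * e) (Sm (bump x (2 * e)) * Sm \<phi>)" by (simp add: vanish_def smooth_on_bump bump_props(4)[OF e(1)])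
  have "b y * Fn (act D (Sm (bump x (2 * e)) * Sm \<phi>)) y = Fn (act D (Sm (bump x (2 * e)) * Sm \<phi>)) y" for y
  proof (cases "y : cball x (2 * e)")
   case True
   then show ?thesis using bump_props(5)[OF e(2), of x y] by (simp add: b_def)
  qed (simp add: vanish_act(1)[OF v])
  then have "(%y. b y * Fn (act D (Sm (bump x (2 * e)) * Sm \<phi>)) y) = Fn (act D (Sm (bump x (2 * e)) * Sm \<phi>))" by (rule ext)
  then show "u j (%y. b y * Fn (act (D * mu (Sm (bump x (2 * e)))) (Sm \<phi>)) y) = u j (Fn (act D (Sm (bump x (2 * e)) * Sm \<phi>)))" by (simp only: act_ring act_mu)
 qed
qed

text \<open>Transfers \<open>locally_smooth\<close> to distributions: near a point each combination
  is replaced by its cut-off version, which agrees with it on functions supported in a small ball,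
  and the system holds there.\<close>

theorem lsm_system:
 assumes max: "maximal k n sys" and v: "!!b j. b < n ==> j < N ==> v b j : alg"
  and rows: "!!d r. (d, r) : sys ==> lsm (%j. SUM b<n. r b * v b j)" and b: "b < n"
 shows "lsm (v b)"
 unfolding lsm_def
proof (intro conjI ballI allI impI v b)
 fix x assume x: "x : \<Omega>"
 interpret maximal k n sys by (rule max)
 define Q where "Q r p \<longleftrightarrow> fst p > 0 & (ALL \<phi>. vanish x (fst p) \<phi> --> L (%j. SUM b<n. r b * v b j) \<phi> = ip (snd p) \<phi>)" for r :: "nat => dop" and p :: "real \<times> sm"
 have "ALL r:snd ` sys. EX p. Q r p"
 proof
  fix r assume "r : snd ` sys"
  then obtain d where "(d, r) : sys" by auto
  from lsmD[OF rows[OF this] x] show "EX p. Q r p" unfolding Q_def by force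
 qed
 from bchoice[OF this] obtain p where p: "ALL r:snd ` sys. Q r (p r)" ..
 obtain r0 where r0: "r0 > 0" "cball x r0 <= \<Omega>" using open_dom x open_contains_cball by blast
 \<comment> \<open>Small enough for the local densities of all the finitely many rows; the quarter
   leaves room for the nested cutoffs of radii 2e and 4e inside the open set.\<close>
 define e where "e = Min (insert (r0 / 4) ((%r. fst (p r)) ` snd ` sys))"
 have fin: "finite (insert (r0 / 4) ((%r. fst (p r)) ` snd ` sys))" using finite_rows by simp
 have e: "e > 0" "e <= r0 / 4" "!!d r. (d, r) : sys ==> e <= fst (p r)"
 proof -
  show "e > 0" unfolding e_def using fin r0(1) p by (subst Min_gr_iff) (auto simp: Q_def)
  show "e <= r0 / 4" unfolding e_def using fin by (intro Min_le) auto
  show "e <= fst (p r)" if "(d, r) : sys" for d r unfolding e_def using fin that by (intro Min_le) force+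
 qed
 have sub: "cball x (4 * e) <= \<Omega>" using r0(2) e(2) by (auto simp: subset_eq)
 have e2: "2 * e > 0" using e(1) by simp
 define \<kappa> where "\<kappa> = Sm (bump x (2 * e))"
 have \<kappa>: "\<kappa> * f = f" if "!!y. y ~: cball x e ==> Fn f y = 0" for f
 proof (rule sm_eqI)
  fix y show "Fn (\<kappa> * f) y = Fn f y"
   using that[of y] bump_props(5)[OF e2, of x y] by (cases "y : cball x e") (auto simp: \<kappa>_def smooth_on_bump)
 qed
 define S where "S b \<phi> = L (v b) (\<kappa> * Sm \<phi>)" for b \<phi>
 have cS: "cdistr (S b)" if b: "b < n" for b
  unfolding S_def L_def \<kappa>_def
  by (rule cdistr_finite_sum) (auto intro!: cdistr_cutoff e(1) sub v[OF b] alg_simps)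
 have LS: "L (v b) \<phi> = S b (Fn \<phi>)" if "!!y. y ~: cball x e ==> Fn \<phi> y = 0" for b \<phi>
  unfolding S_def Fn_inverse by (rule arg_cong[where f = "L (v b)"], rule \<kappa>[OF that, symmetric])
 obtain s0 where s0: "0 < s0" "s0 <= 1" "!!s x' y. 0 < s ==> s <= s0 ==> dist x x' <= e / 2 ==> y ~: ball x e ==> 1 <= norm (inverse (s^2) *R gdiv x' y)"
  using mollifier_support[OF e(1), of x] by blast
 interpret mollified k n sys S x e s0 "%r. snd (p r)"
 proof
  fix d r \<phi> assume dr: "(d, r) : sys" and \<phi>: "!!y. y ~: ball x e ==> Fn \<phi> y = 0"
  have ve: "vanish x e \<phi>" using \<phi> by (simp add: vanish_def)
  have cb: "cball x (2 * e) <= \<Omega>" using sub e(1) by (auto simp: subset_eq)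
  have "(SUM b<n. S b (Fn (act (dual (r b)) \<phi>))) = (SUM b<n. L (%j. r b * v b j) \<phi>)"
   unfolding L_mult by (intro sum.cong refl LS[symmetric] vanish_act(1)[OF ve])
  also have "... = L (%j. SUM b<n. r b * v b j) \<phi>"
  proof -
   have z: "L (%j. 0) \<phi> = 0"
    using u_linear(3)[OF _ test_functions_vanish[OF vanish_mono[OF ve] cb] test_functions_vanish[OF vanish_mono[OF ve] cb]] e(1) by (simp add: L_def)
   have "(SUM b:B. L (%j. r b * v b j) \<phi>) = L (%j. SUM b:B. r b * v b j) \<phi>" if "finite B" for B
    using that
   proof (induction B rule: finite_induct)
    case (insert b B)
    then show ?case using L_add[OF vanish_mono[OF ve] cb, of "%j. r b * v b j" "%j. SUM b:B. r b * v b j"] e(1) by simp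
   qed (simp add: z)
   then show ?thesis by simp
  qed
  also have "... = ip (snd (p r)) \<phi>"
  proof -
   have "Q r (p r)" using p dr by force
   then show ?thesis unfolding Q_def using vanish_mono[OF ve e(3)[OF dr]] by blast
  qed
  finally show "(SUM b<n. S b (Fn (act (dual (r b)) \<phi>))) = ip (snd (p r)) \<phi>" .
 qed (use cS e(1) s0 in auto)
 obtain \<rho> g where \<rho>: "\<rho> > 0" and g: "smooth g" "!!\<phi>. smooth \<phi> ==> (!!y. y ~: ball x \<rho> ==> \<phi> y = 0) ==> S b \<phi> = (LINT x|lborel. g x * \<phi> x)"
  using locally_smooth[OF b] by blast
 define r where "r = min \<rho> e"
 have "L (v b) \<phi> = ip (Sm g) \<phi>" if vr: "vanish x r \<phi>" for \<phi>
 proof -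
  have "L (v b) \<phi> = S b (Fn \<phi>)" using vr e(1) by (intro LS) (auto simp: vanish_def r_def)
  also have "... = (LINT x|lborel. g x * Fn \<phi> x)" using vr by (intro g(2)) (auto simp: vanish_def r_def)
  finally show ?thesis using g(1) by (simp add: ip_def)
 qed
 moreover have "cball x r <= \<Omega>" using sub e(1) by (auto simp: subset_eq r_def)
 ultimately show "lsm_at (v b) x"
  using \<rho> e(1) by (intro exI[of _ r] conjI exI[of _ "Sm g"]) (auto simp: r_def)
qed

end

section \<open>The Rumin complex and Hodge duality\<close>

definition rk :: "nat => nat" where "rk h = (if h = 0 \<or> h = 5 then 1 else if h = 1 \<or> h = 4 then 2 else 3)"

lemma rk_simps [simp]: "rk 0 = 1" "rk 1 = 2" "rk (Suc 0) = 2" "rk 2 = 3" "rk 3 = 3" "rk 4 = 2" "rk 5 = 1" "rk (Suc (Suc 0)) = 3" "rk (Suc (Suc (Suc 0))) = 3"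
 by (simp_all add: rk_def)

definition D :: "nat => nat => nat => dop" where "D h i j = opd (dc_matrix h ! i ! j)"

definition cD :: "nat => nat => nat => dop" where "cD h i j = dual (D h j i)"

lemma opd_ops [simp]: "opd (P + Q) = opd P + opd Q" "opd (- P) = - opd P" "opd (P - Q) = opd P - opd Q" "opd (P * Q) = opd P * opd Q" "opd 0 = 0" "opd 1 = 1"
 "opd (P ^ n) = opd P ^ n"
proof -
 show 1: "opd (P + Q) = opd P + opd Q" "opd (- P) = - opd P" "opd (P - Q) = opd P - opd Q" "opd 0 = 0"
  by (simp_all add: plus_diffop_def uminus_diffop_def minus_diffop_def zero_diffop_def)
 show 2: "opd (P * Q) = opd P * opd Q" "opd 1 = 1" for P Q by (simp_all add: times_diffop_def one_diffop_def)
 show "opd (P ^ n) = opd P ^ n" by (induction n) (simp_all add: 2)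
qed

text \<open>The lengths of the rescaled middle basis vectors. One factor per basis element is enough
  to remove every square root, as \<open>D_dmat\<close> confirms.\<close>

definition rho :: "nat => nat => real" where
 "rho h i = (if i = 1 & h = 2 then sqrt 2 else if i = 1 & h = 3 then 1 / sqrt 2 else 1)"

lemma rho_pos [simp]: "rho h i > 0" "rho h i ~= 0" by (auto simp: rho_def)

lemma less_cases: "(ALL i<rk h. P i) \<longleftrightarrow> (if h = 0 \<or> h = 5 then P 0 else if h = 1 \<or> h = 4 then P 0 & P 1 else P 0 & P 1 & P (2::nat))"
 by (simp only: rk_def all_less_numerals split: if_split) auto

lemma D_entries:
 "D 0 0 0 = Xf 1" "D 0 1 0 = Xf 2"
 "D 1 0 0 = - (Xf 1 * Xf 1 * Xf 2) - Xf 1 * Xf 3 - Xf 4" "D 1 0 1 = Xf 1 * Xf 1 * Xf 1"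
 "D 1 1 0 = - (sqrt 2 *R (Xf 1 * (Xf 2 * Xf 2) + Xf 5))" "D 1 1 1 = sqrt 2 *R (Xf 2 * (Xf 1 * Xf 1) - Xf 4)"
 "D 1 2 0 = - (Xf 2 * Xf 2 * Xf 2)" "D 1 2 1 = Xf 2 * Xf 2 * Xf 1 - Xf 2 * Xf 3 - Xf 5"
 "D 2 0 0 = - (Xf 1 * Xf 2) - Xf 3" "D 2 0 1 = (1 / sqrt 2) *R (Xf 1 * Xf 1)" "D 2 0 2 = 0"
 "D 2 1 0 = - ((1 / sqrt 2) *R (Xf 2 * Xf 2))" "D 2 1 1 = - ((3 / 2) *R Xf 3)" "D 2 1 2 = (1 / sqrt 2) *R (Xf 1 * Xf 1)"
 "D 2 2 0 = 0" "D 2 2 1 = - ((1 / sqrt 2) *R (Xf 2 * Xf 2))" "D 2 2 2 = Xf 2 * Xf 1 - Xf 3"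
 "D 3 0 0 = (Xf 1 * Xf 2 + Xf 3) * Xf 2 - Xf 5" "D 3 0 1 = sqrt 2 *R (- (Xf 1 * Xf 1 * Xf 2) + Xf 4)" "D 3 0 2 = Xf 1 * Xf 1 * Xf 1"
 "D 3 1 0 = Xf 2 * Xf 2 * Xf 2" "D 3 1 1 = - (sqrt 2 *R (Xf 2 * Xf 2 * Xf 1 + Xf 5))" "D 3 1 2 = Xf 2 * (Xf 1 * Xf 1) - Xf 3 * Xf 1 + Xf 4"
 "D 4 0 0 = - Xf 2" "D 4 0 1 = Xf 1"
 by (simp_all add: D_def dc_matrix_def power2_eq_square power3_eq_cube numeral_2_eq_2)

lemma D_dmat:
 assumes "h : {0, 1, 2, 3}" "i < rk (h + 1)" "j < rk h"
 shows "D h i j = (rho (h + 1) i / rho h j) *R dmat h i j"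
proof -
 have "ALL i<rk (h + 1). ALL j<rk h. D h i j = (rho (h + 1) i / rho h j) *R dmat h i j"
  using assms(1) unfolding less_cases
  by (elim insertE emptyE; simp del: One_nat_def add: D_entries; simp add: dmat_def ent_def rho_def mult.assoc numeral_2_eq_2 scaleR_right_distrib scaleR_right_diff_distrib)
 then show ?thesis using assms by blast
qed

text \<open>A computation in normal form with \<open>dmat\<close>; the scale factors of the
  intermediate degree cancel.\<close>

lemma D_square:
 assumes "h : {0, 1, 2}" "c < rk (h + 2)" "a < rk h"
 shows "(SUM b<rk (h + 1). D (h + 1) c b * D h b a) = 0"
proof -
 have "ALL c<rk (h + 2). ALL a<rk h. (SUM b<rk (h + 1). dmat (h + 1) c b * dmat h b a) = 0"
  using assms(1) unfolding less_cases
  by (elim insertE emptyE; simp del: One_nat_def add: sum_less_numerals; simp add: dmat_def ent_def numeral_2_eq_2 algebra_simps scaleR_3 Xf_sort Xf_assoc)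
 then have z: "(SUM b<rk (h + 1). dmat (h + 1) c b * dmat h b a) = 0" using assms by blast
 have "D (h + 1) c b * D h b a = (rho (h + 2) c / rho h a) *R (dmat (h + 1) c b * dmat h b a)" if "b < rk (h + 1)" for b
  using D_dmat[of h b a] D_dmat[of "h + 1" c b] assms that by (auto simp: numeral_2_eq_2 numeral_3_eq_3)
 then have "(SUM b<rk (h + 1). D (h + 1) c b * D h b a) = (rho (h + 2) c / rho h a) *R (SUM b<rk (h + 1). dmat (h + 1) c b * dmat h b a)"
  unfolding scaleR_sum_right by (intro sum.cong) auto
 then show ?thesis using z by simp
qed

text \<open>In the given bases the Hodge star reverses the order of the basis elements, up to these signs.\<close>

definition hodge_sign :: "nat => nat => real" where
 "hodge_sign h i = (if h = 1 & i = 0 \<or> h = 2 & i ~= 1 \<or> h = 3 & i = 1 then - 1 else 1)"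

lemma hodge_D:
 assumes "h : {0, 1, 2}" "a < rk (h + 1)" "b < rk h"
 shows "D h a b = (hodge_sign (h + 1) a * hodge_sign h b) *R cD (4 - h) (rk (h + 1) - 1 - a) (rk h - 1 - b)"
proof -
 have "ALL a<rk (h + 1). ALL b<rk h. D h a b = (hodge_sign (h + 1) a * hodge_sign h b) *R cD (4 - h) (rk (h + 1) - 1 - a) (rk h - 1 - b)"
  using assms(1) unfolding less_cases
  by (elim insertE emptyE; simp del: One_nat_def add: D_entries cD_def hodge_sign_def; simp add: D_entries[unfolded One_nat_def] algebra_simps Xf_sort Xf_assoc scaleR_right_diff_distrib)
 then show ?thesis using assms by blast
qed

text \<open>An entry \<open>t b j\<close> is the operator with which the original component j enters
  component b of a form. A form depending on the unknown distributions is thus a matrix of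
  operators, and the unknown itself is the identity matrix.\<close>

definition app :: "nat => (nat => nat => dop) => (nat => nat => dop) => nat => nat => dop" where
 "app n M t a j = (SUM b<n. M a b * t b j)"

lemma app_app: "app n M (app m K t) a j = (SUM b<m. (SUM c<n. M a c * K c b) * t b j)"
proof -
 have "app n M (app m K t) a j = (SUM c<n. SUM b<m. M a c * K c b * t b j)" by (simp add: app_def sum_distrib_left mult.assoc)
 also have "... = (SUM b<m. SUM c<n. M a c * K c b * t b j)" by (rule sum.swap)
 finally show ?thesis by (simp add: sum_distrib_right)
qed

lemma app_linear: "app n M (%a j. s a j + t a j) = (%a j. app n M s a j + app n M t a j)" "app n M (%a j. 0) = (%a j. 0)"
 by (auto simp: app_def distrib_left sum.distrib fun_eq_iff)

lemma app_cong: "(!!b. b < n ==> s b = t b) ==> app n M s = app n M t" by (auto simp: app_def fun_eq_iff)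

lemma D_D: "h : {0, 1, 2} ==> c < rk (h + 2) ==> app (rk (h + 1)) (D (h + 1)) (app (rk h) (D h) t) c = (%j. 0)"
 unfolding fun_eq_iff app_app using D_square[of h c] by (auto intro: sum.neutral)

lemma cD_cD: "h : {0, 1, 2} ==> c < rk h ==> app (rk (h + 1)) (cD h) (app (rk (h + 2)) (cD (h + 1)) t) c = (%j. 0)"
proof -
 assume h: "h : {0, 1, 2}" "c < rk h"
 have "(SUM b<rk (h + 1). cD h c b * cD (h + 1) b a) = 0" if "a < rk (h + 2)" for a
  using D_square[OF h(1) that h(2), THEN arg_cong[where f = dual]] by (simp add: cD_def)
 then show ?thesis unfolding fun_eq_iff app_app by (auto intro: sum.neutral)
qed

lemma D_alg [simp]: "D h i j : alg" "cD h i j : alg" by (simp_all add: D_def cD_def)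

lemma maximal_homotopy_system:
 assumes "homotopy_system N nl nh ol oh p k wt dl dh"
  and "homotopy N nl nh ol oh dl dh {} 4 1" "homotopy N nl nh ol oh dl dh {4} 5 1"
  "homotopy N nl nh ol oh dl dh {4, 5} 3 2" "homotopy N nl nh ol oh dl dh {3, 4, 5} 1 3"
  "homotopy N nl nh ol oh dl dh {1, 3, 4, 5} 2 3"
 shows "maximal k N (hrows wt p nl nh ol oh dl dh)"
proof -
 interpret homotopy_system N nl nh ol oh p k wt dl dh by (rule assms(1))
 show ?thesis
 proof (unfold_locales)
  show "EX C>=0. ALL u. tv u --> Nk u <= C * Rk u" by (rule system_estimate) (rule assms)+
  show "k >= 3" using k by simp
 qed
qed

lemma dmat_Hom:
 "ALL i<2. ALL j<1. dmat 0 i j : Hom 1" "ALL i<3. ALL j<2. dmat 1 i j : Hom 3" "ALL i<3. ALL j<3. dmat 2 i j : Hom 2" "ALL i<2. ALL j<3. dmat 3 i j : Hom 3"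
 unfolding all_less_numerals by (simp_all add: homotopy_simps)

text \<open>Degree 3 carries the factor \<open>Bp 1\<close>, because the operator in degree 2 gives
  control of the codifferential of A d t rather than of d t.\<close>

abbreviation rumin_rows :: "nat => nat => nat => (nat \<times> (nat => dop)) set" where
 "rumin_rows h ol oh \<equiv> hrows (%a. (rho h a)^2) (if h = 3 then 1 else 0) (rk (h - 1)) (rk (h + 1)) ol oh (dmat (h - 1)) (dmat h)"

lemma rumin_maximal:
 assumes "h : {1, 2, 3}"
 shows "EX k ol oh. maximal k (rk h) (rumin_rows h ol oh)"
proof -
 have wt: "(rho h a)^2 > 0" for a by simp
 consider "h = 1" | "h = 2" | "h = 3" using assms by auto
 then show ?thesis
 proof cases
  case 1
  have "maximal 6 2 (hrows (%a. (rho h a)^2) 0 1 3 1 3 (dmat 0) (dmat 1))"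
   by (rule maximal_homotopy_system[OF _ homotopy_1_4 homotopy_1_5 homotopy_1_3 homotopy_1_1 homotopy_1_2], unfold_locales)
    (use dmat_Hom in auto)
  then show ?thesis unfolding 1 by auto
 next
  case 2
  have "maximal 6 3 (hrows (%a. (rho h a)^2) 0 2 3 3 2 (dmat 1) (dmat 2))"
   by (rule maximal_homotopy_system[OF _ homotopy_2_4 homotopy_2_5 homotopy_2_3 homotopy_2_1 homotopy_2_2], unfold_locales)
    (use dmat_Hom in auto)
  then show ?thesis unfolding 2 by auto
 next
  case 3
  have "maximal 7 3 (hrows (%a. (rho h a)^2) 1 3 2 2 3 (dmat 2) (dmat 3))"
   by (rule maximal_homotopy_system[OF _ homotopy_3_4 homotopy_3_5 homotopy_3_3 homotopy_3_1 homotopy_3_2], unfold_locales)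
    (use dmat_Hom in auto)
  then show ?thesis unfolding 3 by auto
 qed
qed

text \<open>For functions the estimate is an identity: every word of length 3 ends in one of the two
  letters, and the last letter is the operator applied first.\<close>

lemma gradient_maximal: "maximal 3 1 {(1, %_. Xf 1), (1, %_. Xf 2)}"
proof -
 interpret estimate 3 1 "{(1, %_. Xf 1), (1, %_. Xf 2)}"
  by unfold_locales (auto simp: Hom_Xf)
 show ?thesis
 proof (unfold_locales, intro exI[of _ 1] conjI allI impI)
  fix u :: "nat => sm"
  \<comment> \<open>The rows form a set; the two must be distinct for the sum over rows to have two
    summands.\<close>
  have ne: "(%_ :: nat. Xf 1) ~= (%_. Xf 2)"
  proof
   assume "(%_ :: nat. Xf 1) = (%_. Xf 2)"
   then have "Xf 1 = Xf 2" by metis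
   then have "Fn (act (Xf 1) (co 1)) 0 = Fn (act (Xf 2) (co 1)) 0" by simp
   then show False by (simp add: Xf_def act_Pd dr_co)
  qed
  have "words 3 = (%w. w @ [1]) ` words 2 \<union> (%w. w @ [2]) ` words 2"
  proof (intro equalityI subsetI)
   fix w :: "5 list" assume w: "w : words 3"
   then have "w ~= []" by (auto simp: words_def)
   then have e: "w = butlast w @ [last w]" "last w : set w" "set (butlast w) <= set w" by (auto dest: in_set_butlastD)
   have "butlast w : words 2" "last w : {1, 2}" using w e by (auto simp: words_def)
   have "w : (%v. v @ [last w]) ` words 2" using e(1) \<open>butlast w : words 2\<close> by (rule image_eqI)
   then show "w : (%w. w @ [1]) ` words 2 \<union> (%w. w @ [2]) ` words 2" using \<open>last w : {1, 2}\<close> by auto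
  qed (auto simp: words_def)
  moreover have "(%w :: 5 list. w @ [1]) ` words 2 \<inter> (%w. w @ [2]) ` words 2 = {}" by auto
  ultimately have "hnorm 3 (u 0) = hnorm 2 (act (Xf 1) (u 0)) + hnorm 2 (act (Xf 2) (u 0))"
   by (simp add: hnorm_def sum.union_disjoint sum.reindex inj_on_def)
  then show "Nk u <= 1 * Rk u" using ne unfolding Nk_def Rk_def by (simp add: rowact_def)
 qed simp_all
qed

lemma Bp_0: "Bp 0 = 1" by (simp add: Bp_def)

section \<open>Hypoellipticity in degrees 0, 1 and 2\<close>

context distributions
begin

definition vec :: "nat => (nat => nat => dop) => bool" where "vec n t \<longleftrightarrow> (ALL b<n. ALL j<N. t b j : alg)"
definition smv :: "nat => (nat => nat => dop) => bool" where "smv n t \<longleftrightarrow> (ALL b<n. lsm (t b))"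

lemma vec_app: "vec n t ==> (!!a b. M a b : alg) ==> vec m (app n M t)"
 by (auto simp: vec_def app_def intro!: alg_sum alg_simps)

lemma smv_app: "smv n t ==> (!!a b. M a b : alg) ==> smv m (app n M t)"
 unfolding smv_def app_def by (auto intro!: lsm_sum lsm_mult)

lemma smv_diff: "smv n s ==> smv n t ==> smv n (%b j. s b j - t b j)"
 by (simp add: smv_def lsm_diff)

lemma smv_zero: "(!!b. b < n ==> t b = (%j. 0)) ==> smv n t"
 by (simp add: smv_def lsm_zero)

lemma rumin_system:
 assumes h: "h : {1, 2, 3}" and t: "vec (rk h) t"
  and low: "smv (rk (h - 1)) (app (rk h) (cD (h - 1)) (%b j. Bp (if h = 3 then 1 else 0) * t b j))"
  and high: "smv (rk (h + 1)) (app (rk h) (D h) t)"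
 shows "smv (rk h) t"
proof -
 obtain k ol oh where max: "maximal k (rk h) (rumin_rows h ol oh)"
  using rumin_maximal[OF h] by blast
 define p :: nat where "p = (if h = 3 then 1 else 0)"
 \<comment> \<open>The estimates are formulated for \<open>dmat\<close>, that is, for components in
   the rescaled basis.\<close>
 define v where "v b j = (1 / rho h b) *R t b j" for b j
 have "lsm (v b)" if b: "b < rk h" for b
 proof (rule lsm_system[OF max _ _ b])
  fix b j assume "b < rk h" "j < N" then show "v b j : alg" using t by (simp add: v_def vec_def)
 next
  fix d r assume "(d, r) : rumin_rows h ol oh"
  then consider c where "c < rk (h - 1)" "r = lrow (%a. (rho h a)^2) p (dmat (h - 1)) c" | c where "c < rk (h + 1)" "r = dmat h c"
   unfolding hrows_def p_def by auto
  then show "lsm (%j. SUM b<rk h. r b * v b j)"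
  proof cases
   case 1
   have "r b * v b j = rho (h - 1) c *R (cD (h - 1) c b * (Bp p * t b j))" if "b < rk h" for b j
   proof -
    have e: "h - 1 + 1 = h" "h - 1 : {0, 1, 2, 3}" using h by auto
    show ?thesis using D_dmat[of "h - 1" b c, unfolded e] e(2) that 1
     by (simp add: lrow_def v_def cD_def power2_eq_square mult.assoc)
   qed
   then have "(%j. SUM b<rk h. r b * v b j) = (%j. rho (h - 1) c *R app (rk h) (cD (h - 1)) (%b j. Bp p * t b j) c j)"
    unfolding app_def scaleR_sum_right by (intro ext sum.cong) auto
   then show ?thesis using low 1(1) by (simp add: smv_def lsm_scale p_def)
  next
   case 2
   have "r b * v b j = (1 / rho (h + 1) c) *R (D h c b * t b j)" if "b < rk h" for b j
    using D_dmat[of h c b] that 2 h by (simp add: v_def)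
   then have "(%j. SUM b<rk h. r b * v b j) = (%j. (1 / rho (h + 1) c) *R app (rk h) (D h) t c j)"
    unfolding app_def scaleR_sum_right by (intro ext sum.cong) auto
   then show ?thesis using high 2(1) by (simp add: smv_def lsm_scale)
  qed
 qed
 then have "lsm (%j. rho h b *R v b j)" if "b < rk h" for b using that by (intro lsm_scale)
 then show ?thesis by (simp add: smv_def v_def)
qed

text \<open>An exact form is closed, so its upper rows vanish and only the weighted codifferential
  has to be smooth.\<close>

lemma exact_system:
 assumes h: "h : {0, 1, 2}" and s: "vec (rk h) s"
  and "smv (rk h) (app (rk (h + 1)) (cD h) (%b j. Bp (if h = 2 then 1 else 0) * app (rk h) (D h) s b j))"
 shows "smv (rk (h + 1)) (app (rk h) (D h) s)"
proof (rule rumin_system)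
 show "vec (rk (h + 1)) (app (rk h) (D h) s)" using s by (intro vec_app) auto
 show "smv (rk (h + 1 + 1)) (app (rk (h + 1)) (D (h + 1)) (app (rk h) (D h) s))"
  by (rule smv_zero) (use D_D[OF h(1)] in simp)
qed (use h assms(3) in auto)

lemma gradient_system:
 assumes t: "vec 1 t" and "smv 2 (app 1 (D 0) t)" shows "smv 1 t"
 unfolding smv_def
proof (intro allI impI)
 fix b :: nat assume b: "b < 1"
 show "lsm (t b)"
 proof (rule lsm_system[OF gradient_maximal _ _ b])
  fix d r assume "(d, r) : {(1 :: nat, %_ :: nat. Xf 1), (1, %_. Xf 2)}"
  moreover have "app 1 (D 0) t 0 = (%j. Xf 1 * t 0 j)" "app 1 (D 0) t 1 = (%j. Xf 2 * t 0 j)"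
   by (simp_all add: fun_eq_iff app_def D_entries D_entries[unfolded One_nat_def])
  ultimately show "lsm (%j. SUM b<1. r b * t b j)"
   using assms(2) unfolding smv_def all_less_numerals by auto
 qed (use t in "auto simp: vec_def")
qed

text \<open>The differential of t is exact with smooth codifferential, hence smooth; then the
  gradient estimate applies to t.\<close>

lemma hypoelliptic_0:
 assumes t: "vec 1 t" and P: "smv 1 (app 2 (cD 0) (app 1 (D 0) t))"
 shows "smv 1 t"
proof (rule gradient_system[OF t])
 have "smv (rk (0 + 1)) (app (rk 0) (D 0) t)"
  by (rule exact_system) (use t P in "simp_all add: Bp_0")
 then show "smv 2 (app 1 (D 0) t)" by simp
qed

text \<open>Applying the codifferential removes the second summand and leaves the cube of the degree
  0 operator on the codifferential s of t, so s is smooth by three uses of degree 0. Subtracting the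
  first summand shows that the codifferential of d t is smooth, hence d t, and finally t from s and
  d t.\<close>

lemma hypoelliptic_1:
 assumes t: "vec 2 t"
  and P: "smv 2 (%a j. app 1 (D 0) (app 2 (cD 0) (app 1 (D 0) (app 2 (cD 0) (app 1 (D 0) (app 2 (cD 0) t))))) a j + app 3 (cD 1) (app 2 (D 1) t) a j)"
 shows "smv 2 t"
proof -
 define s where "s = app 2 (cD 0) t"
 define \<Delta> where "\<Delta> = (%s. app 2 (cD 0) (app 1 (D 0) s))"
 have vs: "vec 1 s" unfolding s_def by (intro vec_app t) simp
 have v\<Delta>: "vec 1 s ==> vec 1 (\<Delta> s)" for s unfolding \<Delta>_def by (intro vec_app) auto
 have "smv 1 (app 2 (cD 0) (%a j. app 1 (D 0) (\<Delta> (\<Delta> s)) a j + app 3 (cD 1) (app 2 (D 1) t) a j))"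
  using P unfolding s_def \<Delta>_def by (intro smv_app) auto
 then have "smv 1 (%a j. \<Delta> (\<Delta> (\<Delta> s)) a j + app 2 (cD 0) (app 3 (cD 1) (app 2 (D 1) t)) a j)"
  unfolding app_linear \<Delta>_def .
 moreover have "app 2 (cD 0) (app 3 (cD 1) (app 2 (D 1) t)) 0 = (%j. 0)"
  using cD_cD[of 0 0 "app 2 (D 1) t"] by (simp add: numeral_2_eq_2)
 ultimately have "smv 1 (\<Delta> (\<Delta> (\<Delta> s)))" by (simp add: smv_def)
 then have d2: "smv 1 (\<Delta> (\<Delta> s))" using hypoelliptic_0[OF v\<Delta>[OF v\<Delta>[OF vs]]] by (simp add: \<Delta>_def)
 then have "smv 1 (\<Delta> s)" using hypoelliptic_0[OF v\<Delta>[OF vs]] by (simp add: \<Delta>_def)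
 then have ss: "smv 1 s" using hypoelliptic_0[OF vs] by (simp add: \<Delta>_def)
 have "smv 2 (app 1 (D 0) (\<Delta> (\<Delta> s)))" by (rule smv_app[OF d2]) simp
 from smv_diff[OF P[folded s_def] this] have sd: "smv 2 (app 3 (cD 1) (app 2 (D 1) t))" by (simp add: \<Delta>_def)
 have y: "smv (rk (1 + 1)) (app (rk 1) (D 1) t)"
  by (rule exact_system) (use t sd in "simp_all add: Bp_0 numeral_2_eq_2")
 have "smv (rk 1) t"
  by (rule rumin_system) (use t ss y in "simp_all add: Bp_0 s_def numeral_2_eq_2")
 then show ?thesis by simp
qed

text \<open>Let w be the codifferential of t. Applying the codifferential to the equation leaves
  that of d w; thus d w is smooth, and w, whose own codifferential vanishes, is smooth. What remains
  is the weighted codifferential of d t, and the degree 3 system with weight gives d t, then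
  t.\<close>

lemma hypoelliptic_2:
 assumes t: "vec 3 t"
  and P: "smv 3 (%a j. app 2 (D 1) (app 3 (cD 1) t) a j + app 3 (cD 2) (%b j. Bp 1 * app 3 (D 2) t b j) a j)"
 shows "smv 3 t"
proof -
 define w where "w = app 3 (cD 1) t"
 define z where "z = app 3 (cD 2) (%b j. Bp 1 * app 3 (D 2) t b j)"
 have vw: "vec 2 w" unfolding w_def by (intro vec_app t) simp
 have "smv 2 (app 3 (cD 1) (%a j. app 2 (D 1) w a j + z a j))"
  using P unfolding w_def z_def by (intro smv_app) auto
 then have "smv 2 (%a j. app 3 (cD 1) (app 2 (D 1) w) a j + app 3 (cD 1) z a j)" unfolding app_linear .
 moreover have "app 3 (cD 1) z a = (%j. 0)" if "a < 2" for a
  using cD_cD[of 1 a] that by (simp add: z_def numeral_2_eq_2 numeral_3_eq_3)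
 ultimately have sd: "smv 2 (app 3 (cD 1) (app 2 (D 1) w))" by (simp add: smv_def)
 have y: "smv (rk (1 + 1)) (app (rk 1) (D 1) w)"
  by (rule exact_system) (use vw sd in "simp_all add: Bp_0 numeral_2_eq_2")
 have sw: "smv (rk 1) w"
 proof (rule rumin_system)
  have "app 2 (cD 0) w 0 = (%j. 0)" using cD_cD[of 0 0 t] by (simp add: w_def numeral_2_eq_2)
  then show "smv (rk (1 - 1)) (app (rk 1) (cD (1 - 1)) (%b j. Bp (if 1 = (3::nat) then 1 else 0) * w b j))"
   by (intro smv_zero) (simp add: Bp_0)
 qed (use vw y in "simp_all add: numeral_2_eq_2")
 have sz: "smv 3 z" using smv_diff[OF P[folded w_def, folded z_def], of "app 2 (D 1) w"] y by simp
 have y': "smv (rk (2 + 1)) (app (rk 2) (D 2) t)"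
  by (rule exact_system) (use t sz in "simp_all add: z_def")
 have "smv (rk 2) t"
  by (rule rumin_system) (use t sw y' in "simp_all add: Bp_0 w_def")
 then show ?thesis by simp
qed

end

section \<open>Transfer to degrees 3, 4 and 5 by Hodge duality\<close>

definition hodge :: "nat => (nat => nat => dop) => nat => nat => dop" where
 "hodge h t a j = hodge_sign h a *R t (rk h - 1 - a) j"

lemma hodge_sign_square [simp]: "hodge_sign h a * hodge_sign h a = 1" by (auto simp: hodge_sign_def)

lemma app_reverse:
 fixes m :: nat and M K :: "nat => dop"
 assumes "!!b. b < m ==> M b = (\<sigma> * \<tau> b) *R K (m - 1 - b)" "!!b. \<tau> b * \<tau> b = (1::real)"
 shows "(SUM b<m. M b * (\<tau> b *R t (m - 1 - b))) = \<sigma> *R (SUM b<m. K b * (t b :: dop))"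
proof -
 have "(SUM b<m. M b * (\<tau> b *R t (m - 1 - b))) = (SUM b<m. \<sigma> *R (K (m - Suc b) * t (m - Suc b)))"
 proof (rule sum.cong[OF refl])
  fix b assume "b : {..<m}"
  moreover have "\<sigma> * \<tau> b * \<tau> b = \<sigma>" using assms(2)[of b] by (simp add: mult.assoc)
  ultimately show "M b * (\<tau> b *R t (m - 1 - b)) = \<sigma> *R (K (m - Suc b) * t (m - Suc b))" by (simp add: assms(1) mult.commute)
 qed
 also have "... = (SUM b<m. \<sigma> *R (K b * t b))" by (rule sum.nat_diff_reindex)
 finally show ?thesis by (simp add: scaleR_sum_right)
qed

lemma hodge_app_D:
 assumes h: "h : {0, 1, 2}" and a: "a < rk (h + 1)"
 shows "app (rk h) (D h) (hodge h t) a = hodge (h + 1) (app (rk h) (cD (4 - h)) t) a"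
proof
 fix j
 show "app (rk h) (D h) (hodge h t) a j = hodge (h + 1) (app (rk h) (cD (4 - h)) t) a j"
  unfolding app_def hodge_def by (rule app_reverse) (simp_all add: hodge_D[OF h a])
qed

lemma hodge_app_cD:
 assumes h: "h : {0, 1, 2}" and a: "a < rk h"
 shows "app (rk (h + 1)) (cD h) (hodge (h + 1) t) a = hodge h (app (rk (h + 1)) (D (4 - h)) t) a"
proof
 fix j
 show "app (rk (h + 1)) (cD h) (hodge (h + 1) t) a j = hodge h (app (rk (h + 1)) (D (4 - h)) t) a j"
  unfolding app_def hodge_def
 proof (rule app_reverse)
  fix b assume "b < rk (h + 1)"
  then show "cD h a b = (hodge_sign h a * hodge_sign (h + 1) b) *R D (4 - h) (rk h - 1 - a) (rk (h + 1) - 1 - b)"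
   using hodge_D[OF h _ a, of b] by (simp add: cD_def mult.commute)
 qed simp
qed

lemma dc_matrix_dims:
 assumes "h < 5"
 shows "length (dc_matrix h) = rk (h + 1)" "i < rk (h + 1) ==> length (dc_matrix h ! i) = rk h"
  "length (deltac_matrix (h + 1)) = rk h" "j < rk h ==> length (deltac_matrix (h + 1) ! j) = rk (h + 1)"
  "j < rk h ==> i < rk (h + 1) ==> opd (deltac_matrix (h + 1) ! j ! i) = cD h j i"
proof -
 have h: "h = 0 \<or> h = 1 \<or> h = 2 \<or> h = 3 \<or> h = 4" using assms by auto
 have "length (dc_matrix h) = rk (h + 1) & length (deltac_matrix (h + 1)) = rk h & (ALL i<rk (h + 1). length (dc_matrix h ! i) = rk h)
  & (ALL j<rk h. length (deltac_matrix (h + 1) ! j) = rk (h + 1)) &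
  (ALL j<rk h. ALL i<rk (h + 1). opd (deltac_matrix (h + 1) ! j ! i) = cD h j i)"
  using h unfolding less_cases
  by (elim disjE; simp add: dc_matrix_def deltac_matrix_def numeral_2_eq_2 cD_def D_def opd_adj)
 then show "length (dc_matrix h) = rk (h + 1)" "i < rk (h + 1) ==> length (dc_matrix h ! i) = rk h"
  "length (deltac_matrix (h + 1)) = rk h" "j < rk h ==> length (deltac_matrix (h + 1) ! j) = rk (h + 1)"
  "j < rk h ==> i < rk (h + 1) ==> opd (deltac_matrix (h + 1) ! j ! i) = cD h j i" by blast+
qed

text \<open>Identifies the weight of the degree 3 system with the diagonal entry of
  \<open>A_Delta\<close>.\<close>

lemma Bp_1: "Bp 1 = - (Xf 1 * Xf 1 + Xf 2 * Xf 2)"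
 by (simp add: Bp_def words_1)

lemma test_functions_act:
 assumes "Fn \<phi> : test_functions \<Omega>" shows "Fn (act P \<phi>) : test_functions \<Omega>"
proof (rule test_functionsI[OF smooth_Fn])
 note T = test_functionsD[OF assms]
 show "Fn (act P \<phi>) y = 0" if "y ~: supp (Fn \<phi>)" for y
  by (rule act_zero_on[of "- supp (Fn \<phi>)"]) (use that T in "auto intro: compact_imp_closed")
qed (use test_functionsD[OF assms] in auto)

context distributions
begin

lemma smv_hodge: "smv (rk h) t ==> smv (rk h) (hodge h t)"
 unfolding smv_def hodge_def by (auto intro!: lsm_scale)

lemma smv_hodge_cancel:
 assumes "smv (rk h) (hodge h t)" shows "smv (rk h) t"
 unfolding smv_def
proof (intro allI impI)
 fix a assume a: "a < rk h"
 then have "lsm (%j. hodge_sign h (rk h - 1 - a) *R hodge h t (rk h - 1 - a) j)" using assms by (intro lsm_scale) (simp add: smv_def)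
 moreover have "hodge_sign h (rk h - 1 - a) *R hodge h t (rk h - 1 - a) j = t a j" for j using a by (simp add: hodge_def)
 ultimately show "lsm (t a)" by simp
qed

lemma vec_hodge: "vec (rk h) t ==> vec (rk h) (hodge h t)"
 by (auto simp: vec_def hodge_def)

lemma smv_eqI: "smv n t ==> (!!a. a < n ==> s a = t a) ==> smv n s" by (simp add: smv_def)

text \<open>The scheme for this and the next two results: the star turns D into the codifferential
  of complementary degree and conversely, so the equation for t becomes the equation in degree 5 - h
  for the reversed and signed tuple \<open>hodge (5 - h) t\<close>. The signs square to 1, so
  smoothness returns to t.\<close>

lemma hypoelliptic_5:
 assumes t: "vec 1 t" and P: "smv 1 (app 2 (D 4) (app 1 (cD 4) t))"
 shows "smv 1 t"
proof -
 have "app 1 (D 0) (hodge 0 t) a = hodge 1 (app 1 (cD 4) t) a" if "a < 2" for a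
  using hodge_app_D[of 0 a t] that by simp
 then have "app 2 (cD 0) (app 1 (D 0) (hodge 0 t)) = app 2 (cD 0) (hodge 1 (app 1 (cD 4) t))" by (rule app_cong)
 moreover have "app 2 (cD 0) (hodge 1 s) a = hodge 0 (app 2 (D 4) s) a" if "a < 1" for a s
  using hodge_app_cD[of 0 a s] that by simp
 ultimately have eq: "app 2 (cD 0) (app 1 (D 0) (hodge 0 t)) a = hodge 0 (app 2 (D 4) (app 1 (cD 4) t)) a" if "a < 1" for a
  using that by simp
 have "smv 1 (hodge 0 (app 2 (D 4) (app 1 (cD 4) t)))" using smv_hodge[of 0, unfolded rk_simps] P .
 then have "smv 1 (app 2 (cD 0) (app 1 (D 0) (hodge 0 t)))" by (rule smv_eqI) (rule eq)
 then have "smv 1 (hodge 0 t)" using vec_hodge[of 0 t, unfolded rk_simps, OF t] by (rule hypoelliptic_0[rotated])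
 then show ?thesis using smv_hodge_cancel[of 0 t] by simp
qed

lemma hypoelliptic_4:
 assumes t: "vec 2 t"
  and P: "smv 2 (%a j. app 3 (D 3) (app 2 (cD 3) t) a j + app 1 (cD 4) (app 2 (D 4) (app 1 (cD 4) (app 2 (D 4) (app 1 (cD 4) (app 2 (D 4) t))))) a j)"
 shows "smv 2 t"
proof -
 have c0: "app 2 (cD 0) (hodge 1 s) a = hodge 0 (app 2 (D 4) s) a" if "a < 1" for a s
  using hodge_app_cD[of 0 a s] that by simp
 have d0: "app 1 (D 0) (hodge 0 s) a = hodge 1 (app 1 (cD 4) s) a" if "a < 2" for a s
  using hodge_app_D[of 0 a s] that by simp
 have c1: "app 3 (cD 1) (hodge 2 s) a = hodge 1 (app 3 (D 3) s) a" if "a < 2" for a s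
  using hodge_app_cD[of 1 a s] that by (simp add: numeral_2_eq_2)
 have d1: "app 2 (D 1) (hodge 1 s) a = hodge 2 (app 2 (cD 3) s) a" if "a < 3" for a s
  using hodge_app_D[of 1 a s] that by (simp add: numeral_2_eq_2)
 have 1: "app 1 (D 0) (app 2 (cD 0) (hodge 1 s)) a = hodge 1 (app 1 (cD 4) (app 2 (D 4) s)) a" if "a < 2" for a s
  using app_cong[of 1 "app 2 (cD 0) (hodge 1 s)", OF c0] d0[OF that] by simp
 have 2: "app 2 (cD 0) s = app 2 (cD 0) s'" if "!!a. a < 2 ==> s a = s' a" for s s' using app_cong[of 2] that by blast
 let ?G = "%s. app 1 (D 0) (app 2 (cD 0) s)" and ?H = "%s. app 1 (cD 4) (app 2 (D 4) s)"
 have G: "?G (?G (?G (hodge 1 t))) a = hodge 1 (?H (?H (?H t))) a" if "a < 2" for a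
 proof -
  have "app 2 (cD 0) (?G (hodge 1 t)) = app 2 (cD 0) (hodge 1 (?H t))" by (rule 2) (rule 1)
  then have "?G (?G (hodge 1 t)) b = hodge 1 (?H (?H t)) b" if "b < 2" for b using 1[OF that] by simp
  then have "app 2 (cD 0) (?G (?G (hodge 1 t))) = app 2 (cD 0) (hodge 1 (?H (?H t)))" by (rule 2)
  then show ?thesis using 1[OF that] by simp
 qed
 have S: "app 3 (cD 1) (app 2 (D 1) (hodge 1 t)) a = hodge 1 (app 3 (D 3) (app 2 (cD 3) t)) a" if "a < 2" for a
  using app_cong[of 3 "app 2 (D 1) (hodge 1 t)", OF d1] c1[OF that] by simp
 have "smv 2 (hodge 1 (%a j. app 3 (D 3) (app 2 (cD 3) t) a j + ?H (?H (?H t)) a j))"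
  using smv_hodge[of 1] P by simp
 then have "smv 2 (%a j. ?G (?G (?G (hodge 1 t))) a j + app 3 (cD 1) (app 2 (D 1) (hodge 1 t)) a j)"
  by (rule smv_eqI) (simp only: G S, simp add: hodge_def fun_eq_iff scaleR_add_right add.commute)
 then have "smv 2 (hodge 1 t)" using vec_hodge[of 1 t, unfolded rk_simps, OF t] by (rule hypoelliptic_1[rotated])
 then show ?thesis using smv_hodge_cancel[of 1 t] by simp
qed

lemma hypoelliptic_3:
 assumes t: "vec 3 t"
  and P: "smv 3 (%a j. app 3 (D 2) (%b j. Bp 1 * app 3 (cD 2) t b j) a j + app 2 (cD 3) (app 3 (D 3) t) a j)"
 shows "smv 3 t"
proof -
 have c1: "app 3 (cD 1) (hodge 2 s) a = hodge 1 (app 3 (D 3) s) a" if "a < 2" for a s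
  using hodge_app_cD[of 1 a s] that by (simp add: numeral_2_eq_2)
 have d1: "app 2 (D 1) (hodge 1 s) a = hodge 2 (app 2 (cD 3) s) a" if "a < 3" for a s
  using hodge_app_D[of 1 a s] that by (simp add: numeral_2_eq_2)
 have c2: "app 3 (cD 2) (hodge 3 s) a = hodge 2 (app 3 (D 2) s) a" if "a < 3" for a s
  using hodge_app_cD[of 2 a s] that by (simp add: numeral_2_eq_2 numeral_3_eq_3)
 have d2: "app 3 (D 2) (hodge 2 s) a = hodge 3 (app 3 (cD 2) s) a" if "a < 3" for a s
  using hodge_app_D[of 2 a s] that by (simp add: numeral_2_eq_2 numeral_3_eq_3)
 have S: "app 2 (D 1) (app 3 (cD 1) (hodge 2 t)) a = hodge 2 (app 2 (cD 3) (app 3 (D 3) t)) a" if "a < 3" for a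
  using app_cong[of 2 "app 3 (cD 1) (hodge 2 t)", OF c1] d1[OF that] by simp
 have "(%j. Bp 1 * app 3 (D 2) (hodge 2 t) b j) = hodge 3 (%b j. Bp 1 * app 3 (cD 2) t b j) b" if "b < 3" for b
  unfolding d2[OF that] by (simp add: hodge_def fun_eq_iff)
 then have "app 3 (cD 2) (%b j. Bp 1 * app 3 (D 2) (hodge 2 t) b j) = app 3 (cD 2) (hodge 3 (%b j. Bp 1 * app 3 (cD 2) t b j))"
  by (rule app_cong)
 then have G: "app 3 (cD 2) (%b j. Bp 1 * app 3 (D 2) (hodge 2 t) b j) a = hodge 2 (app 3 (D 2) (%b j. Bp 1 * app 3 (cD 2) t b j)) a" if "a < 3" for a
  using c2[OF that] by simp
 have "smv 3 (hodge 2 (%a j. app 3 (D 2) (%b j. Bp 1 * app 3 (cD 2) t b j) a j + app 2 (cD 3) (app 3 (D 3) t) a j))"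
  using smv_hodge[of 2] P by simp
 then have "smv 3 (%a j. app 2 (D 1) (app 3 (cD 1) (hodge 2 t)) a j + app 3 (cD 2) (%b j. Bp 1 * app 3 (D 2) (hodge 2 t) b j) a j)"
  by (rule smv_eqI) (simp only: G S, simp add: hodge_def fun_eq_iff scaleR_add_right add.commute)
 then have "smv 3 (hodge 2 t)" using vec_hodge[of 2 t, unfolded rk_simps, OF t] by (rule hypoelliptic_2[rotated])
 then show ?thesis using smv_hodge_cancel[of 2 t] by simp
qed

text \<open>Connects the functionals of the statement with the operator tuples. Agreement is asked
  on test functions only, since elsewhere the functionals are arbitrary.\<close>

definition repr :: "nat => (real^5) vec_functional => (nat => nat => dop) => bool" where
 "repr n V t \<longleftrightarrow> (ALL i<n. ALL \<phi>. Fn \<phi> : test_functions \<Omega> --> V i (Fn \<phi>) = L (t i) \<phi>)"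

lemma L_add_test: "Fn \<phi> : test_functions \<Omega> ==> L (%j. p j + q j) \<phi> = L p \<phi> + L q \<phi>"
 using test_functions_act[of \<phi> \<Omega>] by (simp add: L_def u_linear(1) sum.distrib del: Fn_simps)

lemma L_sum_test:
 assumes "Fn \<phi> : test_functions \<Omega>" shows "L (%j. SUM i<n. p i j) \<phi> = (SUM i<(n :: nat). L (p i) \<phi>)"
proof (induction n)
 case 0
 show ?case using u_linear(3)[OF _ assms assms] by (simp add: L_def)
next
 case (Suc n)
 then show ?case using L_add_test[OF assms, of "%j. SUM i<n. p i j" "p n"] by simp
qed

lemma repr_apply_matrix:
 assumes V: "repr m V t" and M: "length M = n" "!!i. i < n ==> length (M ! i) = m" "!!i j. i < n ==> j < m ==> opd (M ! i ! j) = K i j"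
 shows "repr n (apply_matrix M V) (app m K t)"
 unfolding repr_def
proof (intro allI impI)
 fix i \<phi> assume i: "i < n" and \<phi>: "Fn \<phi> : test_functions \<Omega>"
 have "apply_matrix M V i (Fn \<phi>) = (SUM j<m. L (%l. K i j * t j l) \<phi>)"
  unfolding apply_matrix_def
 proof (simp add: M i, rule sum.cong[OF refl])
  fix j assume "j : {..<m}"
  then have j: "j < m" by simp
  have "apply_distr (M ! i ! j) (V j) (Fn \<phi>) = V j (Fn (act (dual (K i j)) \<phi>))"
   by (simp add: apply_distr_def Fn_act_opd[symmetric] opd_adj M(3)[OF i j])
  also have "... = L (%l. K i j * t j l) \<phi>"
   using V j test_functions_act[OF \<phi>] by (simp add: repr_def L_mult)
  finally show "apply_distr (M ! i ! j) (V j) (Fn \<phi>) = L (%l. K i j * t j l) \<phi>" .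
 qed
 then show "apply_matrix M V i (Fn \<phi>) = L (app m K t i) \<phi>"
  using L_sum_test[OF \<phi>, where n = m and p = "%j l. K i j * t j l"] by (simp add: app_def[abs_def])
qed

lemma repr_dc: "h < 5 ==> repr (rk h) V t ==> repr (rk (h + 1)) (dc h V) (app (rk h) (D h) t)"
 unfolding dc_def by (rule repr_apply_matrix) (simp_all add: dc_matrix_dims[simplified] D_def)

lemma repr_deltac: "h < 5 ==> repr (rk (h + 1)) V t ==> repr (rk h) (deltac (h + 1) V) (app (rk (h + 1)) (cD h) t)"
 unfolding deltac_def by (rule repr_apply_matrix) (simp_all add: dc_matrix_dims[simplified])

lemma repr_A_Delta: "repr 3 V t ==> repr 3 (A_Delta V) (%b j. Bp 1 * t b j)"
proof -
 assume V: "repr 3 V t"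
 define K :: "nat => nat => dop" where "K i j = (if i = j then Bp 1 else 0)" for i j
 let ?L = "- ((X 1)^2 + (X 2)^2)"
 have "opd ?L = Bp 1" unfolding Bp_1 by (simp add: power2_eq_square)
 then have e: "ALL i<3. ALL j<3. opd ([[?L, 0, 0], [0, ?L, 0], [0, 0, ?L]] ! i ! j) = K i j"
  unfolding all_less_numerals by (simp add: K_def numeral_2_eq_2)
 have l: "ALL i<3. length ([[?L, 0, 0], [0, ?L, 0], [0, 0, ?L]] ! i) = 3"
  unfolding all_less_numerals by (simp add: numeral_2_eq_2)
 have "repr 3 (A_Delta V) (app 3 K t)"
  unfolding A_Delta_def Let_def by (rule repr_apply_matrix[OF V]) (use e l in auto)
 moreover have "app 3 K t b = (%j. Bp 1 * t b j)" if "b < 3" for b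
  using that by (auto simp: app_def K_def fun_eq_iff if_distrib[of "%x. x * _"] cong: if_cong)
 ultimately show ?thesis by (simp add: repr_def)
qed

lemma repr_add: "repr n V s ==> repr n W t ==> repr n (%i \<phi>. V i \<phi> + W i \<phi>) (%a j. s a j + t a j)"
 by (simp add: repr_def L_add_test)

lemma repr_u: "repr N u (%b j. if j = b then 1 else 0)"
 unfolding repr_def
proof (intro allI impI)
 fix b \<phi> assume b: "b < N" and \<phi>: "Fn \<phi> : test_functions \<Omega>"
 have "L (%j. if j = b then 1 else 0) \<phi> = (SUM j<N. if j = b then u b (Fn \<phi>) else 0)"
  unfolding L_def by (intro sum.cong refl) (use u_linear(3)[OF _ \<phi> \<phi>] in auto)
 then show "u b (Fn \<phi>) = L (%j. if j = b then 1 else 0) \<phi>" using b by simp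
qed

lemma smooth_if:
 assumes "repr N P t" "vec N t" "ALL i<N. smooth_distribution_on \<Omega> (P i)"
  and "vec N (%b j. if j = b then 1 else 0) ==> smv N t ==> smv N (%b j. if j = b then 1 else 0)" and b: "b < N"
 shows "smooth_distribution_on \<Omega> (u b)"
proof -
 have "smv N t" unfolding smv_def
 proof (intro allI impI)
  fix i assume i: "i < N"
  show "lsm (t i)" using assms(1-3) i by (intro lsmI_smooth_distribution[of _ "P i"]) (auto simp: vec_def repr_def)
 qed
 then have "smv N (%b j. if j = b then 1 else 0)" by (intro assms(4)) (auto simp: vec_def)
 then show ?thesis using b by (intro smooth_distribution_lsm) (auto simp: smv_def)
qed

end

section \<open>The operators of the statement in each degree\<close>

lemma apply_matrix_zero: "apply_matrix M (%i \<phi>. 0) = (%i \<phi>. 0)"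
 by (simp add: apply_matrix_def apply_distr_def fun_eq_iff)

text \<open>At the two ends of the complex one summand of the operator drops out: in degree 0 the
  codifferential is the empty matrix, and in degree 5 the same holds for the one following the
  differential.\<close>

lemma deltac_trivial: "deltac 0 V = (%i \<phi>. 0)" "deltac 6 V = (%i \<phi>. 0)"
 by (simp_all add: deltac_def deltac_matrix_def dc_matrix_def apply_matrix_def)

theorem proposition4p14:
  fixes h :: nat
  assumes "h \<le> 5"
  shows "hypoelliptic (rumin_rank h) (rumin_laplacian h)"
 unfolding hypoelliptic_def
proof (intro allI impI)
 have rank: "rumin_rank h = rk h" using assms by (auto simp: rumin_rank_def rumin_basis_def rk_def)
 fix \<Omega> u j
 assume hyp: "open \<Omega> & (ALL j<rumin_rank h. distribution_on \<Omega> (u j)) & (ALL i<rumin_rank h. smooth_distribution_on \<Omega> (rumin_laplacian h u i))"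
  and j: "j < rumin_rank h"
 interpret distributions \<Omega> u "rk h" by unfold_locales (use hyp rank in auto)
 \<comment> \<open>The identity tuple, which represents the unknown \<open>u\<close>; applying the
   operator to it gives the tuple to which the result for the degree applies.\<close>
 define e :: "nat => nat => dop" where "e = (%b j. if j = b then 1 else 0)"
 have re: "repr (rk h) u e" unfolding e_def by (rule repr_u)
 have ve: "vec n e" for n by (auto simp: vec_def e_def)
 have sm: "ALL i<rk h. smooth_distribution_on \<Omega> (rumin_laplacian h u i)" using hyp rank by simp
 have fin: "smooth_distribution_on \<Omega> (u j)" if "repr (rk h) (rumin_laplacian h u) t" "vec (rk h) t" "smv (rk h) t ==> smv (rk h) e" for t
  using smooth_if[OF that(1,2) sm, folded e_def, OF that(3)] j rank by simp
 have va: "vec m (app n (D i) t)" "vec m (app n (cD i) t)" if "vec n t" for m n i t using that by (auto intro: vec_app)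
 have vadd: "vec n (%a j. s a j + t a j)" if "vec n s" "vec n t" for n s t using that by (simp add: vec_def)
 have vA: "vec n (%a j. Bp 1 * t a j)" if "vec n t" for n t using that Hom_alg[OF Bp_Hom[of 1]] by (simp add: vec_def)
 have rc: "repr (rk h) V t" if "repr n V t" "rk h = n" for n V t using that by simp
 \<comment> \<open>The case numbers run one ahead of the degree.\<close>
 consider "h = 0" | "h = 1" | "h = 2" | "h = 3" | "h = 4" | "h = 5" using assms by linarith
 then show "smooth_distribution_on \<Omega> (u j)"
 proof cases
  case 1
  have "repr 1 (deltac 1 (dc 0 u)) (app 2 (cD 0) (app 1 (D 0) e))"
   using repr_deltac[of 0, OF _ repr_dc[of 0]] re by (simp add: 1)
  moreover have "rumin_laplacian h u = deltac 1 (dc 0 u)"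
   by (simp add: 1 fun_eq_iff rumin_laplacian_def numeral_3_eq_3 deltac_trivial dc_def apply_matrix_zero)
  ultimately have "repr 1 (rumin_laplacian 0 u) (app 2 (cD 0) (app 1 (D 0) e))" using 1 by simp
  then have "repr (rk h) (rumin_laplacian h u) (app 2 (cD 0) (app 1 (D 0) e))" by (simp only: 1 rk_simps)
  from fin[OF this va(2)[OF va(1)[OF ve]]] show ?thesis using hypoelliptic_0[OF ve] by (simp only: 1 rk_simps)
 next
  case 2
  have G: "repr 2 (dc 0 (deltac 1 V)) (app 1 (D 0) (app 2 (cD 0) t))" if "repr 2 V t" for V t
   using repr_dc[of 0, OF _ repr_deltac[of 0]] that by simp
  have H: "repr 2 (deltac 2 (dc 1 V)) (app 3 (cD 1) (app 2 (D 1) t))" if "repr 2 V t" for V t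
   using repr_deltac[of 1, OF _ repr_dc[of 1]] that by (simp add: numeral_2_eq_2)
  have "rumin_laplacian h u = (%i \<phi>. dc 0 (deltac 1 (dc 0 (deltac 1 (dc 0 (deltac 1 u))))) i \<phi> + deltac 2 (dc 1 u) i \<phi>)"
   by (simp add: 2 fun_eq_iff rumin_laplacian_def numeral_3_eq_3 numeral_2_eq_2)
  note lap = this
  have r: "repr 2 u e" using re by (simp only: 2 rk_simps)
  have eq: "rk h = 2" by (simp add: 2)
  show ?thesis
   by (rule fin[OF rc[OF repr_add[OF G[OF G[OF G[OF r]]] H[OF r], folded lap] eq] vadd[OF va(1)[OF va(2)[OF va(1)[OF va(2)[OF va(1)[OF va(2)[OF ve]]]]]] va(2)[OF va(1)[OF ve]]]])
    (use hypoelliptic_1[OF ve] in "simp only: 2 rk_simps")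
 next
  case 3
  have G: "repr 3 (dc 1 (deltac 2 V)) (app 2 (D 1) (app 3 (cD 1) t))" if "repr 3 V t" for V t
   using repr_dc[of 1, OF _ repr_deltac[of 1]] that by (simp add: numeral_2_eq_2)
  have H: "repr 3 (deltac 3 (A_Delta (dc 2 V))) (app 3 (cD 2) (%b j. Bp 1 * app 3 (D 2) t b j))" if "repr 3 V t" for V t
  proof -
   have "repr 3 (dc 2 V) (app 3 (D 2) t)" using repr_dc[of 2 V t] that by simp
   from repr_A_Delta[OF this] show ?thesis using repr_deltac[of 2 "A_Delta (dc 2 V)" "%b j. Bp 1 * app 3 (D 2) t b j"] by simp
  qed
  have "rumin_laplacian h u = (%i \<phi>. dc 1 (deltac 2 u) i \<phi> + deltac 3 (A_Delta (dc 2 u)) i \<phi>)"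
   by (simp add: 3 fun_eq_iff rumin_laplacian_def)
  note lap = this
  have r: "repr 3 u e" using re by (simp only: 3 rk_simps)
  have eq: "rk h = 3" by (simp add: 3)
  show ?thesis
   by (rule fin[OF rc[OF repr_add[OF G[OF r] H[OF r], folded lap] eq] vadd[OF va(1)[OF va(2)[OF ve]] va(2)[OF vA[OF va(1)[OF ve]]]]])
    (use hypoelliptic_2[OF ve] in "simp only: 3 rk_simps")
 next
  case 4
  have G: "repr 3 (dc 2 (A_Delta (deltac 3 V))) (app 3 (D 2) (%b j. Bp 1 * app 3 (cD 2) t b j))" if "repr 3 V t" for V t
  proof -
   have "repr 3 (deltac 3 V) (app 3 (cD 2) t)" using repr_deltac[of 2 V t] that by simp
   from repr_A_Delta[OF this] show ?thesis using repr_dc[of 2 "A_Delta (deltac 3 V)" "%b j. Bp 1 * app 3 (cD 2) t b j"] by simp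
  qed
  have H: "repr 3 (deltac 4 (dc 3 V)) (app 2 (cD 3) (app 3 (D 3) t))" if "repr 3 V t" for V t
   using repr_deltac[of 3, OF _ repr_dc[of 3]] that by simp
  have "rumin_laplacian h u = (%i \<phi>. dc 2 (A_Delta (deltac 3 u)) i \<phi> + deltac 4 (dc 3 u) i \<phi>)"
   by (simp add: 4 fun_eq_iff rumin_laplacian_def)
  note lap = this
  have r: "repr 3 u e" using re by (simp only: 4 rk_simps)
  have eq: "rk h = 3" by (simp add: 4)
  show ?thesis
   by (rule fin[OF rc[OF repr_add[OF G[OF r] H[OF r], folded lap] eq] vadd[OF va(1)[OF vA[OF va(2)[OF ve]]] va(2)[OF va(1)[OF ve]]]])
    (use hypoelliptic_3[OF ve] in "simp only: 4 rk_simps")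
 next
  case 5
  have G: "repr 2 (dc 3 (deltac 4 V)) (app 3 (D 3) (app 2 (cD 3) t))" if "repr 2 V t" for V t
   using repr_dc[of 3, OF _ repr_deltac[of 3]] that by simp
  have H: "repr 2 (deltac 5 (dc 4 V)) (app 1 (cD 4) (app 2 (D 4) t))" if "repr 2 V t" for V t
   using repr_deltac[of 4, OF _ repr_dc[of 4]] that by simp
  have "rumin_laplacian h u = (%i \<phi>. dc 3 (deltac 4 u) i \<phi> + deltac 5 (dc 4 (deltac 5 (dc 4 (deltac 5 (dc 4 u))))) i \<phi>)"
   by (simp add: 5 fun_eq_iff rumin_laplacian_def numeral_3_eq_3)
  note lap = this
  have r: "repr 2 u e" using re by (simp only: 5 rk_simps)
  have eq: "rk h = 2" by (simp add: 5)
  show ?thesis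
   by (rule fin[OF rc[OF repr_add[OF G[OF r] H[OF H[OF H[OF r]]], folded lap] eq] vadd[OF va(1)[OF va(2)[OF ve]] va(2)[OF va(1)[OF va(2)[OF va(1)[OF va(2)[OF va(1)[OF ve]]]]]]]])
    (use hypoelliptic_4[OF ve] in "simp only: 5 rk_simps")
 next
  case 6
  have "repr 1 (dc 4 (deltac 5 u)) (app 2 (D 4) (app 1 (cD 4) e))"
   using repr_dc[of 4, OF _ repr_deltac[of 4]] re by (simp add: 6)
  moreover have "rumin_laplacian h u = dc 4 (deltac 5 u)"
   by (simp add: 6 fun_eq_iff rumin_laplacian_def numeral_3_eq_3 deltac_trivial)
  ultimately have "repr 1 (rumin_laplacian 5 u) (app 2 (D 4) (app 1 (cD 4) e))" using 6 by simp
  then have "repr (rk h) (rumin_laplacian h u) (app 2 (D 4) (app 1 (cD 4) e))" by (simp only: 6 rk_simps)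
  from fin[OF this va(1)[OF va(2)[OF ve]]] show ?thesis using hypoelliptic_5[OF ve] by (simp only: 6 rk_simps)
 qed
qed

end
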